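(* Fix $0<\beta_-\le\beta_+<S$, $M>0$, $0<c\le 1\le C<\infty$, and $0<\alpha,\alpha'<1$. The following conclusions hold uniformly over the full design class $\mathcal G(c,C)$, without any positive Besov smoothness assumption on the design density. (i) If $\beta_+\le 2\beta_-$, there are random sets $C_n$ (based on the $n$ observations) and a constant $K<\infty$ such that $$\liminf_{n\to\infty}\ \inf_{\beta\in[\beta_-,\beta_+],\ f\in\mathcal F_\beta(M),\ g\in\mathcal G(c,C)}\mathbb P_{f,g}(f\in C_n)\ \ge\ 1-\alpha,$$ and, for every $\beta\in[\beta_-,\beta_+]$, $$\limsup_{n\to\infty}\ \sup_{f\in\mathcal F_\beta(M),\ g\in\mathcal G(c,C)}\mathbb P_{f,g}\{\operatorname{diam}_2(C_n)>K\varepsilon_n(\beta)\}\ \le\ \alpha'.$$ (ii) If $\beta_+>2\beta_-$, there exist random sets $C_n$ (based on the $n$ observations) and constants $L_0,K<\infty$ such that, for every $L\ge L_0$, $$\liminf_{n\to\infty}\ \inf_{f\in\mathcal F_n^{\mathrm{sep}}(L),\ g\in\mathcal G(c,C)}\mathbb P_{f,g}(f\in C_n)\ \ge\ 1-\alpha,$$ and, for every $\beta\in[\beta_-,\beta_+]$, $$\limsup_{n\to\infty}\ \sup_{f\in\mathcal F_n^{\mathrm{sep}}(L)\cap\mathcal F_\beta(M),\ g\in\mathcal G(c,C)}\mathbb P_{f,g}\{\operatorname{diam}_2(C_n)>K\varepsilon_n(\beta)\}\ \le\ \alpha'.$$ (All constants may depend only on the displayed fixed parameters, $d$, and the chosen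 wavelet basis.) Moreover, when $c<1<C$, the class $\mathcal G(c,C)$ contains a density $g$ such that $$g\notin B^\gamma_{2,\infty}([0,1]^d)\qquad\text{for every }\gamma>0.$$
   Context: **Model.** Fix an integer $d\ge1$ and $\mathcal X=[0,1]^d$. For each $n$ one observes independent pairs $(X_i,Y_i)_{i=1}^n$ with $X_i\sim g$ (density on $\mathcal X$) and $Y_i\mid X_i=x\sim\mathrm{Bernoulli}(f(x))$; the law is $\mathbb P_{f,g}$. Both $f$ and $g$ are unknown; $M,c,C,\beta_-,\beta_+$ are known. The design class is $$\mathcal G(c,C)=\Big\{g:\int_{\mathcal X}g(x)\,dx=1,\ c\le g\le C\text{ almost everywhere}\Big\}.$$ Write $\|h\|_2^2=\int_{\mathcal X}h(x)^2dx$, and for nonempty $C\subset L^2(dx)$ let $\operatorname{diam}_2(C)=\sup_{u,v\in C}\|u-v\|_2$, with $\operatorname{diam}_2(\varnothing)=0$. For a set $\mathcal A\subset L^2(dx)$, $\operatorname{dist}_2(f,\mathcal A)=\inf_{h\in\mathcal A}\|f-h\|_2$. Random (confidence) sets $C_n$ are Effros-measurable random closed subsets of $L^2(dx)$ (for every open $O$ the event $\{C_n\cap O\ne\varnothing\}$ is measurable), determined by the $n$ observations; they may depend on the known fixed parameters but not on $f,g,\beta$. **Wavelets.** Fix $S>\beta_+$ and a compactly supported, tensor-product, boundary-corrected orthonormal wavelet basis of Cohen–Daubechies–Vial type on $[0,1]^d$, built from a compactly supported orthonormal Daubechies system on $\mathbb R$ (scaling function $\varphi$, wavelet $\psi$)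 with Hölder–Zygmund regularity $R_{\mathrm w}>S$ and an integer number $N_{\mathrm w}>S$ of vanishing moments. Thus for an integer $J_0\ge0$ and every $j\ge J_0$ there are orthonormal families $(\varphi^I_{j,k})_{k\in\mathcal I_j}$, $(\psi^I_{j,k})_{k\in\mathcal I_j}$ in $L^2([0,1])$, $|\mathcal I_j|=2^j$, each consisting of the ordinary functions $2^{j/2}\varphi(2^jx-k)$ (resp. $2^{j/2}\psi(2^jx-k)$) with support in $(0,1)$ together with a number, independent of $j$, of boundary functions that are $L^2$-normalized level-$j$ dilates of fixed compactly supported prototypes; $J_0$ is large enough that left- and right-boundary functions have disjoint supports at every level $j\ge J_0$. The spans $V^I_j,W^I_j$ satisfy $V^I_{j+1}=V^I_j\oplus W^I_j$ (orthogonal), $L^2([0,1])=V^I_{J_0}\oplus\bigoplus_{j\ge J_0}W^I_j$, and $V^I_j$ contains all polynomials of degree at most $N_{\mathrm w}-1$. On $[0,1]^d$ put $\Lambda_j=\mathcal I_j^d$, $\varphi_{j,\lambda}(x)=\prod_{\ell=1}^d\varphi^I_{j,k_\ell}(x_\ell)$ for $\lambda=(k_1,\dots,k_d)$, $V_j=\operatorname{span}\{\varphi_{j,\lambda}:\lambda\in\Lambda_j\}$; $P_J$ is the $L^2(dx)$-orthogonal projection onto $V_J$ and $Q_j=P_{j+1}-P_j$. **Function classes.** For $s\ge0$, $$\|h\|_{\mathbb B^s_{2,\infty}}=2^{J_0s}\|P_{J_0}h\|_2+\sup_{j\ge J_0}2^{js}\|Q_jh\|_2,$$ $\mathcal B_s(M)=\{h\in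 L^2(dx):\|h\|_{\mathbb B^s_{2,\infty}}\le M\}$, and $\mathcal F_s(M)=\{f\in\mathcal B_s(M):0\le f\le1\text{ a.e.}\}$. For $\gamma>0$, $B^\gamma_{2,\infty}([0,1]^d)$ denotes the standard Besov space, defined using any boundary-wavelet basis of regularity larger than $\gamma$. **Rates and separated classes.** $\varepsilon_n(s)=n^{-s/(2s+d)}$ and $\rho_n(s)=n^{-2s/(4s+d)}$. When $\beta_+>2\beta_-$, put $N=\lceil\log_2(\beta_+/\beta_-)\rceil$, $s_j=2^{j-1}\beta_-$ for $j=1,\dots,N$, and for $L>0$ $$\mathcal F_n^{\mathrm{sep}}(L)=\mathcal F_{s_N}(M)\cup\bigcup_{j=1}^{N-1}\big\{f\in\mathcal F_{s_j}(M):\operatorname{dist}_2(f,\mathcal F_{s_{j+1}}(M))\ge L\rho_n(s_j)\big\}.$$ *)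

theory Defs
  imports "HOL-Probability.Probability"
begin

section \<open>Square-integrable functions\<close>

text \<open>
  Elements of \<open>L\<^sup>2(M)\<close> are represented by measurable functions, not by equivalence classes.
  All sets of functions below that matter (spans, closed sets, open sets, smoothness classes) are
  invariant under almost-everywhere equality, so this is the same as working in the quotient.
\<close>

definition L2 :: "'a measure \<Rightarrow> ('a \<Rightarrow> real) set" where
  "L2 M = {h \<in> borel_measurable M. integrable M (\<lambda>x. (h x)\<^sup>2)}"

definition l2_inner :: "'a measure \<Rightarrow> ('a \<Rightarrow> real) \<Rightarrow> ('a \<Rightarrow> real) \<Rightarrow> real" where
  "l2_inner M u v = (\<integral>x. u x * v x \<partial>M)"

definition l2_norm :: "'a measure \<Rightarrow> ('a \<Rightarrow> real) \<Rightarrow> real" where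
  "l2_norm M h = sqrt (\<integral>x. (h x)\<^sup>2 \<partial>M)"

definition l2_dist :: "'a measure \<Rightarrow> ('a \<Rightarrow> real) \<Rightarrow> ('a \<Rightarrow> real) \<Rightarrow> real" where
  "l2_dist M u v = l2_norm M (\<lambda>x. u x - v x)"

definition l2_topology :: "'a measure \<Rightarrow> ('a \<Rightarrow> real) topology" where
  "l2_topology M = topology (\<lambda>U. U \<subseteq> L2 M \<and>
     (\<forall>u\<in>U. \<exists>e>0. \<forall>v\<in>L2 M. l2_dist M u v < e \<longrightarrow> v \<in> U))"

lemma openin_l2_topology:
  "openin (l2_topology M) U \<longleftrightarrow>
     U \<subseteq> L2 M \<and> (\<forall>u\<in>U. \<exists>e>0. \<forall>v\<in>L2 M. l2_dist M u v < e \<longrightarrow> v \<in> U)"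
proof -
  let ?P = "\<lambda>U. U \<subseteq> L2 M \<and> (\<forall>u\<in>U. \<exists>e>0. \<forall>v\<in>L2 M. l2_dist M u v < e \<longrightarrow> v \<in> U)"
  have "istopology ?P"
    unfolding istopology_def
  proof (intro conjI allI impI)
    fix U V assume UV: "?P U" "?P V"
    show "U \<inter> V \<subseteq> L2 M" using UV by blast
    show "\<forall>u\<in>U \<inter> V. \<exists>e>0. \<forall>v\<in>L2 M. l2_dist M u v < e \<longrightarrow> v \<in> U \<inter> V"
    proof
      fix u assume u: "u \<in> U \<inter> V"
      obtain d where d: "d > 0" "\<forall>v\<in>L2 M. l2_dist M u v < d \<longrightarrow> v \<in> U"
        using UV(1) u by blast
      obtain e where e: "e > 0" "\<forall>v\<in>L2 M. l2_dist M u v < e \<longrightarrow> v \<in> V"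
        using UV(2) u by blast
      show "\<exists>e>0. \<forall>v\<in>L2 M. l2_dist M u v < e \<longrightarrow> v \<in> U \<inter> V"
        using d e by (intro exI[of _ "min d e"]) auto
    qed
  next
    fix \<K> assume K: "\<forall>U\<in>\<K>. ?P U"
    show "\<Union>\<K> \<subseteq> L2 M" using K by blast
    show "\<forall>u\<in>\<Union>\<K>. \<exists>e>0. \<forall>v\<in>L2 M. l2_dist M u v < e \<longrightarrow> v \<in> \<Union>\<K>"
    proof
      fix u assume "u \<in> \<Union>\<K>"
      then obtain U where U: "U \<in> \<K>" "u \<in> U" by blast
      then obtain e where "e > 0" "\<forall>v\<in>L2 M. l2_dist M u v < e \<longrightarrow> v \<in> U"
        using K by blast
      then show "\<exists>e>0. \<forall>v\<in>L2 M. l2_dist M u v < e \<longrightarrow> v \<in> \<Union>\<K>"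
        using U by blast
    qed
  qed
  then show ?thesis
    by (simp add: l2_topology_def topology_inverse')
qed

text \<open>In \<^typ>\<open>ennreal\<close> the supremum of the empty set is \<open>0\<close>, as required for \<open>diam\<^sub>2(\<emptyset>)\<close>.\<close>

definition l2_diam :: "'a measure \<Rightarrow> ('a \<Rightarrow> real) set \<Rightarrow> ennreal" where
  "l2_diam M A = (SUP u\<in>A. SUP v\<in>A. ennreal (l2_dist M u v))"

definition l2_setdist :: "'a measure \<Rightarrow> ('a \<Rightarrow> real) \<Rightarrow> ('a \<Rightarrow> real) set \<Rightarrow> ennreal" where
  "l2_setdist M u A = (INF v\<in>A. ennreal (l2_dist M u v))"

definition l2_orthonormal :: "'a measure \<Rightarrow> 'i set \<Rightarrow> ('i \<Rightarrow> 'a \<Rightarrow> real) \<Rightarrow> bool" where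
  "l2_orthonormal M I e \<longleftrightarrow> (\<forall>i\<in>I. e i \<in> L2 M) \<and>
     (\<forall>i\<in>I. \<forall>k\<in>I. l2_inner M (e i) (e k) = (if i = k then 1 else 0))"

definition l2_span :: "'a measure \<Rightarrow> 'i set \<Rightarrow> ('i \<Rightarrow> 'a \<Rightarrow> real) \<Rightarrow> ('a \<Rightarrow> real) set" where
  "l2_span M I e = {h \<in> L2 M. \<exists>A a. finite A \<and> A \<subseteq> I \<and> (AE x in M. h x = (\<Sum>i\<in>A. a i * e i x))}"

definition l2_proj :: "'a measure \<Rightarrow> ('a \<Rightarrow> real) set \<Rightarrow> ('a \<Rightarrow> real) \<Rightarrow> 'a \<Rightarrow> real" where
  "l2_proj M V h = (SOME p. p \<in> V \<and> (\<forall>v\<in>V. l2_inner M (\<lambda>x. h x - p x) v = 0))"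

definition unit_interval :: "real measure" where
  "unit_interval = restrict_space lborel {0..1}"

definition unit_cube :: "(real ^ 'd) measure" where
  "unit_cube = restrict_space lborel {x. \<forall>i. 0 \<le> x $ i \<and> x $ i \<le> 1}"


section \<open>Compactly supported orthonormal wavelets on the line\<close>

text \<open>
  The Hoelder--Zygmund space of order \<open>R > 0\<close>: write \<open>R = m + \<sigma>\<close> with \<open>m\<close> a natural number and
  \<open>0 < \<sigma> \<le> 1\<close>; bounded continuous derivatives up to order \<open>m\<close>, the second difference of the
  \<open>m\<close>-th one being \<open>O(\<bar>t\<bar> powr \<sigma>)\<close>.  For \<open>\<sigma> < 1\<close> this is the Hoelder condition, for \<open>\<sigma> = 1\<close> the
  Zygmund condition.
\<close>

definition hoelder_zygmund :: "real \<Rightarrow> (real \<Rightarrow> real) \<Rightarrow> bool" where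
  "hoelder_zygmund R f \<longleftrightarrow> R > 0 \<and>
     (let m = nat (\<lceil>R\<rceil> - 1) in
      \<exists>D :: nat \<Rightarrow> real \<Rightarrow> real. D 0 = f \<and>
        (\<forall>i<m. \<forall>x. (D i has_real_derivative D (Suc i) x) (at x)) \<and>
        (\<forall>i\<le>m. continuous_on UNIV (D i) \<and> bounded (range (D i))) \<and>
        (\<exists>B. \<forall>x t. \<bar>D m (x + t) - 2 * D m x + D m (x - t)\<bar> \<le> B * \<bar>t\<bar> powr (R - real m)))"

definition dilate :: "(real \<Rightarrow> real) \<Rightarrow> nat \<Rightarrow> int \<Rightarrow> real \<Rightarrow> real" where
  "dilate f j k x = 2 powr (real j / 2) * f (2 ^ j * x - of_int k)"

definition line_family :: "(real \<Rightarrow> real) \<Rightarrow> (real \<Rightarrow> real) \<Rightarrow> int + nat \<times> int \<Rightarrow> real \<Rightarrow> real" where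
  "line_family \<phi> \<psi> i = (case i of Inl k \<Rightarrow> dilate \<phi> 0 k | Inr (j, k) \<Rightarrow> dilate \<psi> j k)"

text \<open>
  A compactly supported orthonormal wavelet system with finite filters \<open>a\<close> and \<open>b\<close>, regularity \<open>R\<close>
  and (at least) \<open>N\<close> vanishing moments.  Minimality of the filter length is not imposed, so the
  extremal-phase and the least-asymmetric Daubechies systems and Coiflets are all covered.
\<close>

definition daubechies_system :: "(real \<Rightarrow> real) \<Rightarrow> (real \<Rightarrow> real) \<Rightarrow> real \<Rightarrow> nat \<Rightarrow> bool" where
  "daubechies_system \<phi> \<psi> R N \<longleftrightarrow>
     bounded {x. \<phi> x \<noteq> 0} \<and> bounded {x. \<psi> x \<noteq> 0} \<and>
     hoelder_zygmund R \<phi> \<and> hoelder_zygmund R \<psi> \<and>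
     (\<exists>A a. finite A \<and> (\<forall>x. \<phi> x = (\<Sum>k\<in>A. a k * dilate \<phi> 1 k x))) \<and>
     (\<exists>A b. finite A \<and> (\<forall>x. \<psi> x = (\<Sum>k\<in>A. b k * dilate \<phi> 1 k x))) \<and>
     l2_orthonormal lborel UNIV (line_family \<phi> \<psi>) \<and>
     (\<forall>h\<in>L2 lborel. (\<forall>i. l2_inner lborel h (line_family \<phi> \<psi> i) = 0) \<longrightarrow> (AE x in lborel. h x = 0)) \<and>
     (\<forall>l<N. (\<integral>x. x ^ l * \<psi> x \<partial>lborel) = 0)"


section \<open>Boundary-corrected wavelets on the interval\<close>

record boundary_wavelets =
  father :: "real \<Rightarrow> real"
  mother :: "real \<Rightarrow> real"
  father_left :: "(real \<Rightarrow> real) list"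
  father_right :: "(real \<Rightarrow> real) list"
  mother_left :: "(real \<Rightarrow> real) list"
  mother_right :: "(real \<Rightarrow> real) list"
  coarse_level :: nat

text \<open>
  A family on \<open>[0,1]\<close> at level \<open>j\<close> consists of the dilates \<open>2\<^sup>j\<^sup>/\<^sup>2 f(2\<^sup>j x - k)\<close> supported in the open
  interval and of dilates of left and right prototypes.  All prototypes live on the half-line
  \<open>[0,\<infinity>)\<close>; a right prototype is evaluated at the rescaled distance \<open>2\<^sup>j (1 - x)\<close> to the
  endpoint \<open>1\<close>.
\<close>

datatype widx = Inner int | Left_Edge nat | Right_Edge nat

fun interval_family ::
  "(real \<Rightarrow> real) \<Rightarrow> (real \<Rightarrow> real) list \<Rightarrow> (real \<Rightarrow> real) list \<Rightarrow> nat \<Rightarrow> widx \<Rightarrow> real \<Rightarrow> real" where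
  "interval_family f ls rs j (Inner k) x = dilate f j k x"
| "interval_family f ls rs j (Left_Edge i) x = 2 powr (real j / 2) * (ls ! i) (2 ^ j * x)"
| "interval_family f ls rs j (Right_Edge i) x = 2 powr (real j / 2) * (rs ! i) (2 ^ j * (1 - x))"

definition interval_index ::
  "(real \<Rightarrow> real) \<Rightarrow> (real \<Rightarrow> real) list \<Rightarrow> (real \<Rightarrow> real) list \<Rightarrow> nat \<Rightarrow> widx set" where
  "interval_index f ls rs j =
     Inner ` {k. closure {x. dilate f j k x \<noteq> 0} \<subseteq> {0<..<1}} \<union>
     Left_Edge ` {..<length ls} \<union> Right_Edge ` {..<length rs}"

definition phi_idx :: "boundary_wavelets \<Rightarrow> nat \<Rightarrow> widx set" where
  "phi_idx W = interval_index (father W) (father_left W) (father_right W)"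

definition psi_idx :: "boundary_wavelets \<Rightarrow> nat \<Rightarrow> widx set" where
  "psi_idx W = interval_index (mother W) (mother_left W) (mother_right W)"

definition phi_I :: "boundary_wavelets \<Rightarrow> nat \<Rightarrow> widx \<Rightarrow> real \<Rightarrow> real" where
  "phi_I W = interval_family (father W) (father_left W) (father_right W)"

definition psi_I :: "boundary_wavelets \<Rightarrow> nat \<Rightarrow> widx \<Rightarrow> real \<Rightarrow> real" where
  "psi_I W = interval_family (mother W) (mother_left W) (mother_right W)"

definition V_I :: "boundary_wavelets \<Rightarrow> nat \<Rightarrow> (real \<Rightarrow> real) set" where
  "V_I W j = l2_span unit_interval (phi_idx W j) (phi_I W j)"

definition W_I :: "boundary_wavelets \<Rightarrow> nat \<Rightarrow> (real \<Rightarrow> real) set" where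
  "W_I W j = l2_span unit_interval (psi_idx W j) (psi_I W j)"

text \<open>
  In the Cohen--Daubechies--Vial construction the edge functions are finite linear combinations of
  translates of \<open>\<phi>(\<plusminus>\<cdot>)\<close> (edge scaling functions) or \<open>\<phi>(\<plusminus>2\<cdot>)\<close> (edge wavelets), cut off at the
  endpoint.  In particular they are bounded and compactly supported.
\<close>

definition edge_combination :: "(real \<Rightarrow> real) \<Rightarrow> real \<Rightarrow> (real \<Rightarrow> real) \<Rightarrow> bool" where
  "edge_combination \<phi> r p \<longleftrightarrow> (\<exists>(A :: int set) a. finite A \<and>
     p = (\<lambda>x. indicator {0..} x * (\<Sum>k\<in>A. a k * \<phi> (r * x - of_int k))))"

text \<open>
  The density clause is the Hilbert sum decomposition of \<open>L\<^sup>2([0,1])\<close>: by the preceding clauses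
  \<open>V_I W j\<close> is the orthogonal sum of \<open>V_I W J\<^sub>0\<close> and \<open>W_I W i\<close> for \<open>J\<^sub>0 \<le> i < j\<close>.
\<close>

definition cdv_wavelets :: "boundary_wavelets \<Rightarrow> real \<Rightarrow> nat \<Rightarrow> bool" where
  "cdv_wavelets W R N \<longleftrightarrow>
     daubechies_system (father W) (mother W) R N \<and>
     (\<forall>p\<in>set (father_left W). edge_combination (father W) 1 p) \<and>
     (\<forall>p\<in>set (father_right W). edge_combination (father W) (- 1) p) \<and>
     (\<forall>p\<in>set (mother_left W). edge_combination (father W) 2 p) \<and>
     (\<forall>p\<in>set (mother_right W). edge_combination (father W) (- 2) p) \<and>
     (\<forall>j\<ge>coarse_level W.
        card (phi_idx W j) = 2 ^ j \<and> card (psi_idx W j) = 2 ^ j \<and>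
        l2_orthonormal unit_interval (phi_idx W j) (phi_I W j) \<and>
        l2_orthonormal unit_interval (psi_idx W j) (psi_I W j) \<and>
        (\<forall>u\<in>V_I W j. \<forall>w\<in>W_I W j. l2_inner unit_interval u w = 0) \<and>
        V_I W (Suc j) = {\<lambda>x. u x + w x | u w. u \<in> V_I W j \<and> w \<in> W_I W j} \<and>
        (\<forall>l<N. (\<lambda>x. x ^ l) \<in> V_I W j) \<and>
        (\<forall>p\<in>set (father_left W @ mother_left W). \<forall>q\<in>set (father_right W @ mother_right W).
           closure {x\<in>{0..1}. p (2 ^ j * x) \<noteq> 0} \<inter> closure {x\<in>{0..1}. q (2 ^ j * (1 - x)) \<noteq> 0} = {})) \<and>
     (\<forall>h\<in>L2 unit_interval. \<forall>e>0. \<exists>j\<ge>coarse_level W. \<exists>u\<in>V_I W j. l2_dist unit_interval h u < e)"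


section \<open>Tensor-product spaces and Besov classes on the cube\<close>

definition phi_cube :: "boundary_wavelets \<Rightarrow> nat \<Rightarrow> ('d \<Rightarrow> widx) \<Rightarrow> real ^ 'd \<Rightarrow> real" where
  "phi_cube W j l x = (\<Prod>i\<in>UNIV. phi_I W j (l i) (x $ i))"

definition V_cube :: "boundary_wavelets \<Rightarrow> nat \<Rightarrow> (real ^ 'd \<Rightarrow> real) set" where
  "V_cube W j = l2_span unit_cube {l. \<forall>i. l i \<in> phi_idx W j} (phi_cube W j)"

definition P_cube :: "boundary_wavelets \<Rightarrow> nat \<Rightarrow> (real ^ 'd \<Rightarrow> real) \<Rightarrow> real ^ 'd \<Rightarrow> real" where
  "P_cube W j = l2_proj unit_cube (V_cube W j)"

definition Q_cube :: "boundary_wavelets \<Rightarrow> nat \<Rightarrow> (real ^ 'd \<Rightarrow> real) \<Rightarrow> real ^ 'd \<Rightarrow> real" where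
  "Q_cube W j h x = P_cube W (Suc j) h x - P_cube W j h x"

definition besov_norm :: "boundary_wavelets \<Rightarrow> real \<Rightarrow> (real ^ 'd \<Rightarrow> real) \<Rightarrow> ennreal" where
  "besov_norm W s h =
     ennreal (2 powr (real (coarse_level W) * s) * l2_norm unit_cube (P_cube W (coarse_level W) h)) +
     (SUP j\<in>{coarse_level W..}. ennreal (2 powr (real j * s) * l2_norm unit_cube (Q_cube W j h)))"

definition besov_ball :: "boundary_wavelets \<Rightarrow> real \<Rightarrow> real \<Rightarrow> (real ^ 'd \<Rightarrow> real) set" where
  "besov_ball W s B = {h \<in> L2 unit_cube. besov_norm W s h \<le> ennreal B}"

definition regression_class :: "boundary_wavelets \<Rightarrow> real \<Rightarrow> real \<Rightarrow> (real ^ 'd \<Rightarrow> real) set" where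
  "regression_class W s B = {f \<in> besov_ball W s B. AE x in unit_cube. 0 \<le> f x \<and> f x \<le> 1}"

text \<open>
  The standard Besov space of order \<open>\<gamma> > 0\<close>, which does not depend on the boundary-wavelet basis
  of regularity larger than \<open>\<gamma>\<close> used to define it.  With the existential quantifier,
  non-membership says that the wavelet norm is infinite in every such basis.
\<close>

definition besov_space :: "real \<Rightarrow> (real ^ 'd \<Rightarrow> real) set" where
  "besov_space \<gamma> = {h \<in> L2 unit_cube.
     \<exists>W R N. cdv_wavelets W R N \<and> \<gamma> < R \<and> \<gamma> < real N \<and> besov_norm W \<gamma> h < \<infinity>}"


section \<open>The regression model and confidence sets\<close>

definition design_class :: "real \<Rightarrow> real \<Rightarrow> (real ^ 'd \<Rightarrow> real) set" where
  "design_class c C = {g \<in> borel_measurable unit_cube.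
     (\<integral>x. g x \<partial>unit_cube) = 1 \<and> (AE x in unit_cube. c \<le> g x \<and> g x \<le> C)}"

text \<open>Joint law of one pair \<open>(X, Y)\<close>, by its density with respect to \<open>dx\<close> times counting measure.\<close>

definition pair_law :: "(real ^ 'd \<Rightarrow> real) \<Rightarrow> (real ^ 'd \<Rightarrow> real) \<Rightarrow> ((real ^ 'd) \<times> bool) measure" where
  "pair_law f g = density (unit_cube \<Otimes>\<^sub>M count_space UNIV)
     (\<lambda>(x, y). ennreal (g x * pmf (bernoulli_pmf (f x)) y))"

definition sample_law ::
  "(real ^ 'd \<Rightarrow> real) \<Rightarrow> (real ^ 'd \<Rightarrow> real) \<Rightarrow> nat \<Rightarrow> (nat \<Rightarrow> (real ^ 'd) \<times> bool) measure" where
  "sample_law f g n = (\<Pi>\<^sub>M i\<in>{..<n}. pair_law f g)"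

text \<open>Only the \<open>\<sigma>\<close>-algebra of this measure is used: it is the one of the \<open>n\<close> observations.\<close>

definition sample_space :: "nat \<Rightarrow> (nat \<Rightarrow> (real ^ 'd) \<times> bool) measure" where
  "sample_space n = (\<Pi>\<^sub>M i\<in>{..<n}. unit_cube \<Otimes>\<^sub>M count_space UNIV)"

text \<open>Effros-measurable random closed subsets of \<open>L\<^sup>2(dx)\<close>, functions of the observations.\<close>

definition random_closed_sets ::
  "(nat \<Rightarrow> (nat \<Rightarrow> (real ^ 'd) \<times> bool) \<Rightarrow> (real ^ 'd \<Rightarrow> real) set) \<Rightarrow> bool" where
  "random_closed_sets Cn \<longleftrightarrow> (\<forall>n.
     (\<forall>\<omega>\<in>space (sample_space n). closedin (l2_topology unit_cube) (Cn n \<omega>)) \<and>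
     (\<forall>U. openin (l2_topology unit_cube) U \<longrightarrow>
        {\<omega> \<in> space (sample_space n). Cn n \<omega> \<inter> U \<noteq> {}} \<in> sets (sample_space n)))"

definition eps_rate :: "nat \<Rightarrow> nat \<Rightarrow> real \<Rightarrow> real" where
  "eps_rate d n s = real n powr (- (s / (2 * s + real d)))"

definition rho_rate :: "nat \<Rightarrow> nat \<Rightarrow> real \<Rightarrow> real" where
  "rho_rate d n s = real n powr (- (2 * s / (4 * s + real d)))"

definition num_levels :: "real \<Rightarrow> real \<Rightarrow> nat" where
  "num_levels \<beta>m \<beta>p = nat \<lceil>log 2 (\<beta>p / \<beta>m)\<rceil>"

definition smooth_level :: "real \<Rightarrow> nat \<Rightarrow> real" where
  "smooth_level \<beta>m j = 2 ^ (j - 1) * \<beta>m"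

definition separated_class ::
  "boundary_wavelets \<Rightarrow> real \<Rightarrow> real \<Rightarrow> real \<Rightarrow> real \<Rightarrow> nat \<Rightarrow> (real ^ 'd \<Rightarrow> real) set" where
  "separated_class W B \<beta>m \<beta>p L n =
     regression_class W (smooth_level \<beta>m (num_levels \<beta>m \<beta>p)) B \<union>
     (\<Union>j\<in>{1..<num_levels \<beta>m \<beta>p}.
        {f \<in> regression_class W (smooth_level \<beta>m j) B.
           l2_setdist unit_cube f (regression_class W (smooth_level \<beta>m (Suc j)) B)
             \<ge> ennreal (L * rho_rate CARD('d) n (smooth_level \<beta>m j))})"

end

theory Submission
  imports Defs
begin

text \<open>
  Adaptation over a range \<open>[\<beta>, 2 \<beta>]\<close> is possible because the rate \<open>\<rho>\<^sub>n(s)\<close> at which the distance of \<open>f\<close> from a candidate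
  can be estimated is the rate \<open>\<epsilon>\<^sub>n(2 s)\<close> of function estimation at twice the smoothness: a ball around an adaptive
  estimator, whose radius is an estimate of its own loss, has a diameter of the order \<open>\<epsilon>\<^sub>n(\<beta>) + \<rho>\<^sub>n(s)\<close>, and the second
  summand is harmless as long as \<open>\<beta> \<le> 2 s\<close>.  For a larger range one first decides, by a chain of tests, in which of
  the intervals \<open>[s\<^sub>j, 2 s\<^sub>j]\<close> the smoothness lies; on the separated classes the tests are right with high probability.
  Both regimes are treated at once (\<open>adaptive_confidence_sets\<close>), the first being the case of a single level without any test.

  The unknown design density \<open>g\<close> enters through the loss.  The coefficients of \<open>g (f - u)\<close> can be estimated without bias and
  without knowledge of \<open>g\<close>, since they are the expectations of \<open>(Y - u(X)) \<phi>\<^sub>\<lambda>(X)\<close>.  If \<open>g\<close> is rough, then \<open>g (f - u)\<close> is rough as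
  well, and its projection \<open>P\<^sub>J\<close> need not be close to it.  But only the norm of the projection is of interest, and
  testing \<open>g (f - u)\<close> against an element \<open>w\<close> of \<open>V\<^sub>J\<close> close to \<open>f - u\<close> gives
  \<open>c \<parallel>w\<parallel>\<^sup>2 \<le> \<langle>g w, w\<rangle> \<le> \<parallel>P\<^sub>J(g (f - u))\<parallel> \<parallel>w\<parallel> + C \<parallel>f - u - w\<parallel> \<parallel>w\<parallel>\<close>.  Hence \<open>\<parallel>P\<^sub>J(g (f - u))\<parallel>\<close> is equivalent to \<open>\<parallel>f - u\<parallel>\<close> up to the
  bias of \<open>f - u\<close>, for which the smoothness of \<open>f\<close> and \<open>u\<close> is enough (\<open>theta_le\<close>, \<open>dist_le_theta\<close>).  The squared norm
  is estimated by a bilinear statistic from two independent blocks, with error \<open>\<surd>(dim V\<^sub>J) / n\<close> up to a multiplicative factor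
  (\<open>quad_stat_deviation\<close>); the balance with the bias is \<open>\<rho>\<^sub>n(s)\<^sup>2\<close>.

  The estimator is a penalised least squares estimator on a third block.  Its candidates are members of the class
  near the points of a lattice of coefficients, over all resolution levels.  The exponential moment of a difference of
  two least squares criteria is Gaussian in the distance of the two candidates (\<open>ls_comparison\<close>), and Gaussian sums over a
  lattice are exponential in the dimension, uniformly in the centre (\<open>lattice_gaussian_sum\<close>, \<open>lattice_net_sum\<close>); a union bound
  then gives the oracle inequality \<open>estimator_risk\<close>.  Since the candidates belong to the class, the difference
  of \<open>f\<close> and the estimator has the smoothness that the quadratic statistic requires.  The net is finite and
  the radius is rounded to integer multiples, so the confidence set is a function of a discrete random variable, from which its
  measurability is immediate (\<open>Cn_sets\<close>).

  The rough design density is a lacunary cosine series (\<open>exists_rough_density\<close>).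
\<close>


section \<open>Square-integrable functions\<close>

lemma L2_D: "h \<in> L2 M \<Longrightarrow> h \<in> borel_measurable M" "h \<in> L2 M \<Longrightarrow> integrable M (\<lambda>x. (h x)\<^sup>2)"
  by (auto simp: L2_def)

lemma L2_mult_integrable:
  assumes "u \<in> L2 M" "v \<in> L2 M" shows "integrable M (\<lambda>x. u x * v x)"
proof (rule Bochner_Integration.integrable_bound)
  show "integrable M (\<lambda>x. (u x)\<^sup>2 + (v x)\<^sup>2)" using assms by (simp add: L2_D(2))
  show "(\<lambda>x. u x * v x) \<in> borel_measurable M"
    using L2_D(1)[OF assms(1)] L2_D(1)[OF assms(2)] by simp
  show "AE x in M. norm (u x * v x) \<le> norm ((u x)\<^sup>2 + (v x)\<^sup>2)"
  proof (rule AE_I2)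
    fix x
    have "2 * (\<bar>u x\<bar> * \<bar>v x\<bar>) \<le> (u x)\<^sup>2 + (v x)\<^sup>2"
      using sum_squares_bound[of "\<bar>u x\<bar>" "\<bar>v x\<bar>"] by (simp add: power2_eq_square mult.assoc)
    moreover have "0 \<le> \<bar>u x\<bar> * \<bar>v x\<bar>" by simp
    ultimately have "\<bar>u x\<bar> * \<bar>v x\<bar> \<le> (u x)\<^sup>2 + (v x)\<^sup>2" by linarith
    then show "norm (u x * v x) \<le> norm ((u x)\<^sup>2 + (v x)\<^sup>2)"
      by (simp add: abs_mult)
  qed
qed

lemma L2_zero [simp]: "(\<lambda>x. 0) \<in> L2 M" by (simp add: L2_def)

lemma L2_scale [intro]: "u \<in> L2 M \<Longrightarrow> (\<lambda>x. a * u x) \<in> L2 M" for a :: real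
  by (auto simp: L2_def power_mult_distrib)

lemma L2_uminus [intro]: "u \<in> L2 M \<Longrightarrow> (\<lambda>x. - u x) \<in> L2 M"
  by (auto simp: L2_def)

lemma L2_add [intro]:
  assumes "u \<in> L2 M" "v \<in> L2 M" shows "(\<lambda>x. u x + v x) \<in> L2 M"
proof -
  have "integrable M (\<lambda>x. (u x)\<^sup>2 + (v x)\<^sup>2 + 2 * (u x * v x))"
    using assms L2_mult_integrable[OF assms]
    by (intro Bochner_Integration.integrable_add) (simp_all add: L2_D(2))
  moreover have "(u x + v x)\<^sup>2 = (u x)\<^sup>2 + (v x)\<^sup>2 + 2 * (u x * v x)" for x
    by (simp add: power2_sum)
  ultimately show ?thesis using assms by (auto simp: L2_def)
qed

lemma L2_diff [intro]:
  assumes "u \<in> L2 M" "v \<in> L2 M" shows "(\<lambda>x. u x - v x) \<in> L2 M"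
  using L2_add[OF assms(1) L2_uminus[OF assms(2)]] by simp

lemma L2_sum [intro]: "(\<And>i. i \<in> A \<Longrightarrow> u i \<in> L2 M) \<Longrightarrow> (\<lambda>x. \<Sum>i\<in>A. u i x) \<in> L2 M"
  by (induction A rule: infinite_finite_induct) (auto intro: L2_add)

lemma l2_inner_commute: "l2_inner M u v = l2_inner M v u"
  by (simp add: l2_inner_def mult.commute)

lemma l2_inner_add_left:
  "u \<in> L2 M \<Longrightarrow> v \<in> L2 M \<Longrightarrow> w \<in> L2 M \<Longrightarrow>
    l2_inner M (\<lambda>x. u x + v x) w = l2_inner M u w + l2_inner M v w"
  by (simp add: l2_inner_def distrib_right L2_mult_integrable)

lemma l2_inner_diff_left:
  "u \<in> L2 M \<Longrightarrow> v \<in> L2 M \<Longrightarrow> w \<in> L2 M \<Longrightarrow>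
    l2_inner M (\<lambda>x. u x - v x) w = l2_inner M u w - l2_inner M v w"
  by (simp add: l2_inner_def left_diff_distrib L2_mult_integrable)

lemma l2_inner_scale_left: "l2_inner M (\<lambda>x. a * u x) w = a * l2_inner M u w"
  by (simp add: l2_inner_def mult.assoc)

lemma l2_inner_sum_left:
  "(\<And>i. i \<in> A \<Longrightarrow> u i \<in> L2 M) \<Longrightarrow> w \<in> L2 M \<Longrightarrow>
    l2_inner M (\<lambda>x. \<Sum>i\<in>A. u i x) w = (\<Sum>i\<in>A. l2_inner M (u i) w)"
  by (simp add: l2_inner_def sum_distrib_right L2_mult_integrable)

lemma l2_norm_nonneg [simp]: "0 \<le> l2_norm M h"
  by (simp add: l2_norm_def)

lemma l2_norm_sq: "(l2_norm M h)\<^sup>2 = l2_inner M h h"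
  by (simp add: l2_norm_def l2_inner_def power2_eq_square)

lemma l2_norm_sq_int: "(l2_norm M h)\<^sup>2 = (\<integral>x. (h x)\<^sup>2 \<partial>M)"
  by (simp add: l2_norm_def)

lemma l2_norm_cong_AE:
  assumes "u \<in> borel_measurable M" "v \<in> borel_measurable M" "AE x in M. u x = v x"
  shows "l2_norm M u = l2_norm M v"
  unfolding l2_norm_def using assms
  by (intro arg_cong[where f=sqrt] integral_cong_AE) auto

lemma l2_inner_cong_AE:
  assumes "u \<in> borel_measurable M" "v \<in> borel_measurable M" "w \<in> borel_measurable M"
    "AE x in M. u x = v x"
  shows "l2_inner M u w = l2_inner M v w"
  unfolding l2_inner_def using assms by (intro integral_cong_AE) auto

lemma l2_Cauchy_Schwarz:
  assumes u: "u \<in> L2 M" and v: "v \<in> L2 M"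
  shows "\<bar>l2_inner M u v\<bar> \<le> l2_norm M u * l2_norm M v"
proof -
  let ?a = "l2_inner M u u" and ?b = "l2_inner M u v" and ?c = "l2_inner M v v"
  have q: "0 \<le> ?a - 2 * t * ?b + t\<^sup>2 * ?c" for t
  proof -
    have w: "(\<lambda>x. u x - t * v x) \<in> L2 M" using u v by auto
    have "0 \<le> l2_inner M (\<lambda>x. u x - t * v x) (\<lambda>x. u x - t * v x)"
      by (metis l2_norm_sq zero_le_power2)
    also have "\<dots> = l2_inner M u (\<lambda>x. u x - t * v x) - t * l2_inner M v (\<lambda>x. u x - t * v x)"
      using w u v by (subst l2_inner_diff_left) (auto simp: l2_inner_scale_left)
    also have "l2_inner M u (\<lambda>x. u x - t * v x) = ?a - t * ?b"
      using u v by (subst l2_inner_commute, subst l2_inner_diff_left)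
        (auto simp: l2_inner_scale_left l2_inner_commute)
    also have "l2_inner M v (\<lambda>x. u x - t * v x) = ?b - t * ?c"
      using u v by (subst l2_inner_commute, subst l2_inner_diff_left)
        (auto simp: l2_inner_scale_left l2_inner_commute)
    finally show ?thesis by (simp add: algebra_simps power2_eq_square)
  qed
  have c0: "0 \<le> ?c" and a0: "0 \<le> ?a" by (metis l2_norm_sq zero_le_power2)+
  have "?b\<^sup>2 \<le> ?a * ?c"
  proof (cases "?c = 0")
    case True
    have "?b = 0"
    proof (rule ccontr)
      assume "?b \<noteq> 0"
      then show False using q[of "(?a + 1) / (2 * ?b)"] True by (simp add: field_simps)
    qed
    then show ?thesis using True by simp
  next
    case False
    then have "0 < ?c" using c0 by simp
    then show ?thesis using q[of "?b / ?c"] by (simp add: field_simps power2_eq_square)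
  qed
  then have "\<bar>?b\<bar>\<^sup>2 \<le> (l2_norm M u * l2_norm M v)\<^sup>2"
    by (simp add: power_mult_distrib l2_norm_sq)
  then show ?thesis by (rule power2_le_imp_le) simp
qed

lemma l2_norm_triangle:
  assumes u: "u \<in> L2 M" and v: "v \<in> L2 M"
  shows "l2_norm M (\<lambda>x. u x + v x) \<le> l2_norm M u + l2_norm M v"
proof (rule power2_le_imp_le)
  have "(l2_norm M (\<lambda>x. u x + v x))\<^sup>2 = l2_inner M u (\<lambda>x. u x + v x) + l2_inner M v (\<lambda>x. u x + v x)"
    unfolding l2_norm_sq using u v by (subst l2_inner_add_left) auto
  also have "l2_inner M u (\<lambda>x. u x + v x) = l2_inner M u u + l2_inner M u v"
    using u v by (subst l2_inner_commute, subst l2_inner_add_left) (auto simp: l2_inner_commute)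
  also have "l2_inner M v (\<lambda>x. u x + v x) = l2_inner M u v + l2_inner M v v"
    using u v by (subst l2_inner_commute, subst l2_inner_add_left) (auto simp: l2_inner_commute)
  also have "l2_inner M u u + l2_inner M u v + (l2_inner M u v + l2_inner M v v)
      \<le> (l2_norm M u + l2_norm M v)\<^sup>2"
    using l2_Cauchy_Schwarz[OF u v] by (simp add: power2_sum l2_norm_sq)
  finally show "(l2_norm M (\<lambda>x. u x + v x))\<^sup>2 \<le> (l2_norm M u + l2_norm M v)\<^sup>2" .
qed simp

lemma l2_norm_scale: "l2_norm M (\<lambda>x. a * u x) = \<bar>a\<bar> * l2_norm M u"
  by (simp add: l2_norm_def power_mult_distrib real_sqrt_mult)

lemma l2_norm_uminus: "l2_norm M (\<lambda>x. - u x) = l2_norm M u"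
  by (simp add: l2_norm_def)

lemma l2_dist_nonneg [simp]: "0 \<le> l2_dist M u v"
  by (simp add: l2_dist_def)

lemma l2_dist_commute: "l2_dist M u v = l2_dist M v u"
  unfolding l2_dist_def using l2_norm_uminus[of M "\<lambda>x. u x - v x"] by simp

lemma l2_dist_triangle:
  assumes "u \<in> L2 M" "v \<in> L2 M" "w \<in> L2 M"
  shows "l2_dist M u w \<le> l2_dist M u v + l2_dist M v w"
  using l2_norm_triangle[of "\<lambda>x. u x - v x" M "\<lambda>x. v x - w x"] assms by (auto simp: l2_dist_def)

lemma l2_norm_le_dist:
  assumes "u \<in> L2 M" "v \<in> L2 M" shows "l2_norm M u \<le> l2_norm M v + l2_dist M u v"
  using l2_norm_triangle[of v M "\<lambda>x. u x - v x"] assms by (auto simp: l2_dist_def)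

lemma l2_dist_cong_AE:
  assumes "u \<in> borel_measurable M" "v \<in> borel_measurable M" "w \<in> borel_measurable M"
    "AE x in M. u x = v x"
  shows "l2_dist M u w = l2_dist M v w"
  unfolding l2_dist_def using assms by (intro l2_norm_cong_AE) auto

lemma l2_span_subset_L2: "l2_span M I e \<subseteq> L2 M"
  by (auto simp: l2_span_def)

text \<open>A span records finite subsums with coefficients up to null sets.  Over a finite index set one may always sum
  over all of it, which turns the linear-space properties below into statements about coefficient vectors.\<close>

lemma l2_span_finite_iff:
  assumes "finite I"
  shows "h \<in> l2_span M I e \<longleftrightarrow> h \<in> L2 M \<and> (\<exists>a. AE x in M. h x = (\<Sum>i\<in>I. a i * e i x))"
proof -
  have "AE x in M. h x = (\<Sum>i\<in>I. (if i \<in> A then a i else 0) * e i x)"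
    if "A \<subseteq> I" "AE x in M. h x = (\<Sum>i\<in>A. a i * e i x)" for A and a :: "_ \<Rightarrow> real"
  proof -
    have "(\<Sum>i\<in>I. (if i \<in> A then a i else 0) * e i x) = (\<Sum>i\<in>A. a i * e i x)" for x
      using that(1) assms by (intro sum.mono_neutral_cong_right) auto
    then show ?thesis using that(2) by simp
  qed
  then have "\<exists>a. AE x in M. h x = (\<Sum>i\<in>I. a i * e i x)"
    if "A \<subseteq> I" "AE x in M. h x = (\<Sum>i\<in>A. a i * e i x)" for A and a :: "_ \<Rightarrow> real"
    using that by metis
  then show ?thesis using assms unfolding l2_span_def
    by (auto intro!: exI[of _ I])
qed

lemma l2_span_add:
  assumes "finite I" "u \<in> l2_span M I e" "v \<in> l2_span M I e"
  shows "(\<lambda>x. u x + v x) \<in> l2_span M I e"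
proof -
  obtain a b where ab: "AE x in M. u x = (\<Sum>i\<in>I. a i * e i x)" "AE x in M. v x = (\<Sum>i\<in>I. b i * e i x)"
    and L: "u \<in> L2 M" "v \<in> L2 M"
    using assms by (auto simp: l2_span_finite_iff)
  have "AE x in M. u x + v x = (\<Sum>i\<in>I. (a i + b i) * e i x)"
    using ab by eventually_elim (simp add: distrib_right sum.distrib)
  then show ?thesis using L assms(1)
    by (subst l2_span_finite_iff) (auto intro!: exI[of _ "\<lambda>i. a i + b i"])
qed

lemma l2_span_scale:
  assumes "finite I" "u \<in> l2_span M I e"
  shows "(\<lambda>x. c * u x) \<in> l2_span M I e"
proof -
  obtain a where ab: "AE x in M. u x = (\<Sum>i\<in>I. a i * e i x)"
    and L: "u \<in> L2 M"
    using assms by (auto simp: l2_span_finite_iff)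
  have "AE x in M. c * u x = (\<Sum>i\<in>I. (c * a i) * e i x)"
    using ab by eventually_elim (simp add: sum_distrib_left mult.assoc)
  then show ?thesis using L assms(1)
    by (subst l2_span_finite_iff) (auto intro!: exI[of _ "\<lambda>i. c * a i"])
qed

lemma l2_span_sum:
  assumes "finite I" "\<And>k. k \<in> A \<Longrightarrow> u k \<in> l2_span M I e"
  shows "(\<lambda>x. \<Sum>k\<in>A. u k x) \<in> l2_span M I e"
  using assms(2)
proof (induction A rule: infinite_finite_induct)
  case (insert k A)
  then show ?case by (auto intro!: l2_span_add[OF assms(1)])
qed (auto simp: l2_span_finite_iff[OF assms(1)] intro!: exI[of _ "\<lambda>i. 0"])

lemma l2_span_base:
  assumes "finite I" "k \<in> I" "e k \<in> L2 M" shows "e k \<in> l2_span M I e"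
proof -
  have "AE x in M. e k x = (\<Sum>i\<in>I. (if i = k then 1 else 0) * e i x)"
    using assms by (simp add: if_distrib[of "\<lambda>c. c * _"] sum.delta cong: if_cong)
  then show ?thesis using assms by (subst l2_span_finite_iff) auto
qed

locale l2_onb =
  fixes M :: "'a measure" and I :: "'i set" and e :: "'i \<Rightarrow> 'a \<Rightarrow> real"
  assumes fin: "finite I" and orth: "l2_orthonormal M I e"
begin

lemma e_L2: "i \<in> I \<Longrightarrow> e i \<in> L2 M"
  using orth by (auto simp: l2_orthonormal_def)

lemma e_inner: "i \<in> I \<Longrightarrow> k \<in> I \<Longrightarrow> l2_inner M (e i) (e k) = (if i = k then 1 else 0)"
  using orth by (auto simp: l2_orthonormal_def)

lemma comb_L2: "(\<lambda>x. \<Sum>i\<in>I. a i * e i x) \<in> L2 M"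
  by (intro L2_sum L2_scale e_L2)

lemma comb_span: "(\<lambda>x. \<Sum>i\<in>I. a i * e i x) \<in> l2_span M I e"
  using comb_L2 fin by (subst l2_span_finite_iff) auto

lemma inner_comb_left:
  assumes "w \<in> L2 M"
  shows "l2_inner M (\<lambda>x. \<Sum>i\<in>I. a i * e i x) w = (\<Sum>i\<in>I. a i * l2_inner M (e i) w)"
  using assms e_L2 by (subst l2_inner_sum_left) (auto simp: l2_inner_scale_left)

lemma inner_comb_e:
  assumes "k \<in> I"
  shows "l2_inner M (\<lambda>x. \<Sum>i\<in>I. a i * e i x) (e k) = a k"
  using assms e_L2 fin by (subst inner_comb_left) (auto simp: e_inner if_distrib cong: if_cong)

lemma inner_comb_comb:
  "l2_inner M (\<lambda>x. \<Sum>i\<in>I. a i * e i x) (\<lambda>x. \<Sum>i\<in>I. b i * e i x) = (\<Sum>i\<in>I. a i * b i)"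
  using comb_L2 by (subst inner_comb_left) (auto simp: l2_inner_commute[of M "e _"] inner_comb_e)

lemma norm_comb: "(l2_norm M (\<lambda>x. \<Sum>i\<in>I. a i * e i x))\<^sup>2 = (\<Sum>i\<in>I. (a i)\<^sup>2)"
  unfolding l2_norm_sq inner_comb_comb by (simp add: power2_eq_square)

text \<open>Orthogonality of the residual determines the projection only up to null sets; the
  Fourier sum is one admissible value, so the choice in \<^const>\<open>l2_proj\<close> is never vacuous.\<close>

lemma proj_props:
  assumes h: "h \<in> L2 M"
  shows proj_span: "l2_proj M (l2_span M I e) h \<in> l2_span M I e"
    and proj_orth: "v \<in> l2_span M I e \<Longrightarrow> l2_inner M (\<lambda>x. h x - l2_proj M (l2_span M I e) h x) v = 0"
proof -
  define p where "p = (\<lambda>x. \<Sum>i\<in>I. l2_inner M h (e i) * e i x)"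
  have p: "p \<in> L2 M" unfolding p_def by (rule comb_L2)
  have "l2_inner M (\<lambda>x. h x - p x) v = 0" if v: "v \<in> l2_span M I e" for v
  proof -
    obtain a where a: "AE x in M. v x = (\<Sum>i\<in>I. a i * e i x)" and vL: "v \<in> L2 M"
      using v fin by (auto simp: l2_span_finite_iff)
    have hp: "(\<lambda>x. h x - p x) \<in> L2 M" using h p by auto
    have "l2_inner M (\<lambda>x. h x - p x) v = l2_inner M (\<lambda>x. \<Sum>i\<in>I. a i * e i x) (\<lambda>x. h x - p x)"
      unfolding l2_inner_commute[of M "\<lambda>x. h x - p x"]
      by (intro l2_inner_cong_AE L2_D a vL comb_L2 hp)
    also have "\<dots> = (\<Sum>i\<in>I. a i * (l2_inner M h (e i) - l2_inner M p (e i)))"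
      using hp h p e_L2 by (simp add: inner_comb_left l2_inner_commute[of M "e _"] l2_inner_diff_left)
    also have "\<dots> = 0" by (simp add: p_def inner_comb_e)
    finally show ?thesis .
  qed
  moreover have "p \<in> l2_span M I e" unfolding p_def by (rule comb_span)
  ultimately have "p \<in> l2_span M I e \<and> (\<forall>v\<in>l2_span M I e. l2_inner M (\<lambda>x. h x - p x) v = 0)"
    by blast
  then have "l2_proj M (l2_span M I e) h \<in> l2_span M I e \<and>
    (\<forall>v\<in>l2_span M I e. l2_inner M (\<lambda>x. h x - l2_proj M (l2_span M I e) h x) v = 0)"
    unfolding l2_proj_def
    by (rule someI[of "\<lambda>p. p \<in> l2_span M I e \<and> (\<forall>v\<in>l2_span M I e. l2_inner M (\<lambda>x. h x - p x) v = 0)"])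
  then show "l2_proj M (l2_span M I e) h \<in> l2_span M I e"
    "v \<in> l2_span M I e \<Longrightarrow> l2_inner M (\<lambda>x. h x - l2_proj M (l2_span M I e) h x) v = 0" by blast+
qed

lemma proj_L2: "h \<in> L2 M \<Longrightarrow> l2_proj M (l2_span M I e) h \<in> L2 M"
  using proj_span l2_span_subset_L2 by blast

lemma pythagoras:
  assumes h: "h \<in> L2 M" and v: "v \<in> l2_span M I e"
  shows "(l2_dist M h v)\<^sup>2 = (l2_dist M h (l2_proj M (l2_span M I e) h))\<^sup>2 +
    (l2_dist M (l2_proj M (l2_span M I e) h) v)\<^sup>2"
proof -
  let ?p = "l2_proj M (l2_span M I e) h"
  have L: "?p \<in> L2 M" "v \<in> L2 M" using proj_L2[OF h] v l2_span_subset_L2 by auto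
  have "(\<lambda>x. ?p x + (-1) * v x) \<in> l2_span M I e"
    by (intro l2_span_add l2_span_scale proj_span fin h v)
  then have o: "l2_inner M (\<lambda>x. h x - ?p x) (\<lambda>x. ?p x - v x) = 0"
    using proj_orth[OF h] by simp
  have i: "integrable M (\<lambda>x. (h x - ?p x)\<^sup>2)" "integrable M (\<lambda>x. (?p x - v x)\<^sup>2)"
    "integrable M (\<lambda>x. (h x - ?p x) * (?p x - v x))"
    using L2_D(2)[OF L2_diff[OF h L(1)]] L2_D(2)[OF L2_diff[OF L]]
      L2_mult_integrable[OF L2_diff[OF h L(1)] L2_diff[OF L]] by auto
  have "(h x - v x)\<^sup>2 = (h x - ?p x)\<^sup>2 + (?p x - v x)\<^sup>2 + 2 * ((h x - ?p x) * (?p x - v x))" for x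
    by (simp add: power2_eq_square algebra_simps)
  then show ?thesis
    using o i by (simp add: l2_dist_def l2_norm_sq_int l2_inner_def)
qed

lemma proj_best:
  assumes h: "h \<in> L2 M" and v: "v \<in> l2_span M I e"
  shows "l2_dist M h (l2_proj M (l2_span M I e) h) \<le> l2_dist M h v"
  by (rule power2_le_imp_le) (use pythagoras[OF assms] in auto)

lemma norm_proj_le:
  assumes h: "h \<in> L2 M"
  shows "l2_norm M (l2_proj M (l2_span M I e) h) \<le> l2_norm M h"
proof (rule power2_le_imp_le)
  have 0: "(\<lambda>x. 0) \<in> l2_span M I e" using comb_span[of "\<lambda>_. 0"] by simp
  show "(l2_norm M (l2_proj M (l2_span M I e) h))\<^sup>2 \<le> (l2_norm M h)\<^sup>2"
    using pythagoras[OF h 0] by (simp add: l2_dist_def)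
qed simp

lemma bessel:
  assumes h: "h \<in> L2 M"
  shows "(\<Sum>i\<in>I. (l2_inner M h (e i))\<^sup>2) \<le> (l2_norm M h)\<^sup>2"
proof -
  let ?p = "\<lambda>x. \<Sum>i\<in>I. l2_inner M h (e i) * e i x"
  have p: "?p \<in> L2 M" by (rule comb_L2)
  have "0 \<le> (l2_norm M (\<lambda>x. h x - ?p x))\<^sup>2" by simp
  also have "\<dots> = l2_inner M h (\<lambda>x. h x - ?p x) - l2_inner M ?p (\<lambda>x. h x - ?p x)"
    unfolding l2_norm_sq using h p by (subst l2_inner_diff_left) auto
  also have "l2_inner M h (\<lambda>x. h x - ?p x) = l2_inner M h h - l2_inner M ?p h"
    using h p by (subst l2_inner_commute, subst l2_inner_diff_left) auto
  also have "l2_inner M ?p (\<lambda>x. h x - ?p x) = l2_inner M ?p h - l2_inner M ?p ?p"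
    using h p by (subst l2_inner_commute, subst l2_inner_diff_left) (auto simp: l2_inner_commute)
  also have "l2_inner M ?p h = (\<Sum>i\<in>I. (l2_inner M h (e i))\<^sup>2)"
    using h by (subst inner_comb_left) (auto simp: power2_eq_square l2_inner_commute)
  also have "l2_inner M ?p ?p = (\<Sum>i\<in>I. (l2_inner M h (e i))\<^sup>2)"
    by (simp add: inner_comb_comb power2_eq_square)
  finally show ?thesis by (simp add: l2_norm_sq)
qed

end

text \<open>The confidence sets constructed below are closed balls, so topology and diameter enter only through balls.\<close>

lemma topspace_l2_topology: "topspace (l2_topology M) = L2 M"
proof -
  have "openin (l2_topology M) (L2 M)"
    by (auto simp: openin_l2_topology intro!: exI[of _ 1])
  then show ?thesis
    by (metis openin_l2_topology openin_subset openin_topspace subset_antisym)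
qed

lemma closedin_l2_cball:
  assumes u: "u \<in> L2 M"
  shows "closedin (l2_topology M) {v \<in> L2 M. l2_dist M u v \<le> r}"
proof -
  have "openin (l2_topology M) (L2 M - {v \<in> L2 M. l2_dist M u v \<le> r})"
    unfolding openin_l2_topology
  proof (intro conjI ballI)
    fix v assume v: "v \<in> L2 M - {v \<in> L2 M. l2_dist M u v \<le> r}"
    show "\<exists>e>0. \<forall>w\<in>L2 M. l2_dist M v w < e \<longrightarrow> w \<in> L2 M - {v \<in> L2 M. l2_dist M u v \<le> r}"
    proof (intro exI[of _ "l2_dist M u v - r"] conjI ballI impI)
      fix w assume w: "w \<in> L2 M" "l2_dist M v w < l2_dist M u v - r"
      then show "w \<in> L2 M - {v \<in> L2 M. l2_dist M u v \<le> r}"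
        using l2_dist_triangle[of u M w v] u v by (auto simp: l2_dist_commute)
    qed (use v in auto)
  qed auto
  then show ?thesis by (simp add: closedin_def topspace_l2_topology)
qed

lemma l2_diam_cball:
  assumes u: "u \<in> L2 M" and r: "0 \<le> r"
  shows "l2_diam M {v \<in> L2 M. l2_dist M u v \<le> r} \<le> ennreal (2 * r)"
  unfolding l2_diam_def
proof (intro SUP_least ennreal_leI)
  fix v w assume "v \<in> {v \<in> L2 M. l2_dist M u v \<le> r}" "w \<in> {v \<in> L2 M. l2_dist M u v \<le> r}"
  then show "l2_dist M v w \<le> 2 * r"
    using l2_dist_triangle[of v M u w] u by (auto simp: l2_dist_commute)
qed


section \<open>The unit cube as a product of intervals\<close>

lemma space_unit_interval [simp]: "space unit_interval = {0..1}"
  by (simp add: unit_interval_def space_restrict_space)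

lemma nth_borel_measurable [measurable]: "(\<lambda>x :: real ^ 'd. x $ i) \<in> borel_measurable borel"
  by (intro borel_measurable_continuous_onI continuous_intros)

lemma vec_lambda_borel_measurable [measurable]:
  "(\<lambda>f. \<chi> i. f i) \<in> borel_measurable (\<Pi>\<^sub>M i\<in>(UNIV :: 'd :: finite set). (lborel :: real measure))"
proof -
  have "(\<lambda>f. \<chi> i. f i) = (\<lambda>f. \<Sum>i\<in>(UNIV :: 'd set). f i *\<^sub>R (axis i 1 :: real ^ 'd))"
    by (auto simp: vec_eq_iff axis_def if_distrib cong: if_cong)
  then show ?thesis by simp
qed

text \<open>The basis of the cube consists of products over the coordinates.  Integrals of such products factor because
  Lebesgue measure on vectors is the image of the product of the Lebesgue measures on the line.\<close>

lemma lborel_vec_eq_distr: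
  "(lborel :: (real ^ 'd) measure) = distr (\<Pi>\<^sub>M i\<in>(UNIV :: 'd set). lborel) borel (\<lambda>f. \<chi> i. f i)"
proof (rule lborel_eqI)
  interpret product_sigma_finite "\<lambda>_ :: 'd. lborel :: real measure" ..
  fix l u :: "real ^ 'd" assume le: "\<And>b. b \<in> Basis \<Longrightarrow> l \<bullet> b \<le> u \<bullet> b"
  have le': "l $ i \<le> u $ i" for i
    using le[of "axis i 1"] by (simp add: inner_axis axis_in_Basis_iff)
  have "emeasure (distr (\<Pi>\<^sub>M i\<in>(UNIV :: 'd set). lborel) borel (\<lambda>f. \<chi> i. f i)) (box l u) =
      emeasure (\<Pi>\<^sub>M i\<in>(UNIV :: 'd set). lborel) (\<Pi>\<^sub>E i\<in>UNIV. {l $ i <..< u $ i})"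
    by (subst emeasure_distr)
      (auto intro!: arg_cong2[where f=emeasure] simp: mem_box_cart space_PiM PiE_def Pi_iff)
  also have "\<dots> = (\<Prod>i\<in>UNIV. ennreal (u $ i - l $ i))"
    by (subst emeasure_PiM) (auto simp: le')
  also have "\<dots> = ennreal (\<Prod>i\<in>UNIV. (u $ i - l $ i))"
    using le' by (simp add: prod_ennreal)
  also have "(\<Prod>i\<in>UNIV. (u $ i - l $ i)) = (\<Prod>b\<in>Basis. (u - l) \<bullet> b)"
    by (rule prod.reindex_bij_witness[where j="\<lambda>i. axis i 1" and i="\<lambda>b. axis_index b"])
      (auto simp: Basis_vec_def axis_index_axis inner_axis)
  finally show "emeasure (distr (\<Pi>\<^sub>M i\<in>(UNIV :: 'd set). lborel) borel (\<lambda>f. \<chi> i. f i)) (box l u) =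
    ennreal (\<Prod>b\<in>Basis. (u - l) \<bullet> b)" .
qed simp

lemma cube_prod_integral:
  fixes h :: "'d :: finite \<Rightarrow> real \<Rightarrow> real"
  assumes h: "\<And>i. integrable unit_interval (h i)"
  shows cube_prod_integrable: "integrable unit_cube (\<lambda>x. \<Prod>i\<in>UNIV. h i (x $ i))"
    and cube_prod_integral_eq: "(\<integral>x. (\<Prod>i\<in>UNIV. h i (x $ i)) \<partial>unit_cube) = (\<Prod>i\<in>UNIV. \<integral>t. h i t \<partial>unit_interval)"
proof -
  interpret product_sigma_finite "\<lambda>_ :: 'd. lborel :: real measure" ..
  let ?Q = "{x :: real ^ 'd. \<forall>i. 0 \<le> x $ i \<and> x $ i \<le> 1}"
  let ?h = "\<lambda>i x. indicator {0..1} x *\<^sub>R h i x"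
  have i: "integrable lborel (?h i)" for i
    using h[of i] unfolding unit_interval_def by (subst (asm) integrable_restrict_space) auto
  have eq: "indicator ?Q x *\<^sub>R (\<Prod>i\<in>UNIV. h i (x $ i)) = (\<Prod>i\<in>UNIV. ?h i (x $ i))" for x :: "real ^ 'd"
  proof (cases "x \<in> ?Q")
    case False
    then obtain i where "x $ i \<notin> {0..1}" by auto
    then have "(\<Prod>i\<in>UNIV. ?h i (x $ i)) = 0" by (intro prod_zero) (use \<open>x $ i \<notin> {0..1}\<close> in \<open>auto simp: indicator_def intro!: exI[of _ i]\<close>)
    then show ?thesis using False by simp
  qed (auto intro!: prod.cong)
  have ip: "integrable (\<Pi>\<^sub>M i\<in>(UNIV :: 'd set). lborel) (\<lambda>f. \<Prod>i\<in>UNIV. ?h i (f i))"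
    by (intro product_integrable_prod i) auto
  have m: "?h i \<in> borel_measurable borel" for i using i[of i] by simp
  have mp[measurable]: "(\<lambda>x :: real ^ 'd. \<Prod>i\<in>UNIV. ?h i (x $ i)) \<in> borel_measurable borel"
    by (intro borel_measurable_prod measurable_compose[OF nth_borel_measurable m])
  have il: "integrable lborel (\<lambda>x :: real ^ 'd. \<Prod>i\<in>UNIV. ?h i (x $ i))"
    by (subst lborel_vec_eq_distr, subst integrable_distr_eq) (use ip mp in auto)
  show "integrable unit_cube (\<lambda>x. \<Prod>i\<in>UNIV. h i (x $ i))"
    unfolding unit_cube_def by (subst integrable_restrict_space) (use il eq in auto)
  have "(\<integral>x. (\<Prod>i\<in>UNIV. h i (x $ i)) \<partial>unit_cube) = (\<integral>x. (\<Prod>i\<in>UNIV. ?h i (x $ i)) \<partial>lborel)"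
    unfolding unit_cube_def by (subst integral_restrict_space) (use eq in auto)
  also have "\<dots> = (\<integral>f. (\<Prod>i\<in>UNIV. ?h i (f i)) \<partial>(\<Pi>\<^sub>M i\<in>(UNIV :: 'd set). lborel))"
    by (subst lborel_vec_eq_distr, subst integral_distr) (use mp in auto)
  also have "\<dots> = (\<Prod>i\<in>UNIV. \<integral>t. ?h i t \<partial>lborel)"
    by (intro product_integral_prod i) auto
  also have "\<dots> = (\<Prod>i\<in>UNIV. \<integral>t. h i t \<partial>unit_interval)"
    unfolding unit_interval_def by (subst integral_restrict_space) auto
  finally show "(\<integral>x. (\<Prod>i\<in>UNIV. h i (x $ i)) \<partial>unit_cube) = (\<Prod>i\<in>UNIV. \<integral>t. h i t \<partial>unit_interval)" .
qed

lemma prob_space_unit_interval: "prob_space unit_interval"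
  unfolding unit_interval_def by (rule prob_spaceI) (simp add: emeasure_restrict_space space_restrict_space)

interpretation unit_interval: prob_space unit_interval by (rule prob_space_unit_interval)

lemma prob_space_unit_cube: "prob_space (unit_cube :: (real ^ 'd) measure)"
proof (rule prob_spaceI)
  let ?M = "unit_cube :: (real ^ 'd) measure"
  have "measure ?M (space ?M) = 1"
    using cube_prod_integral_eq[of "\<lambda>_ :: 'd. \<lambda>_. 1 :: real"] unit_interval.prob_space by simp
  then show "emeasure ?M (space ?M) = 1"
    by (cases "emeasure ?M (space ?M)") (auto simp: measure_def)
qed

interpretation unit_cube: prob_space "unit_cube :: (real ^ 'd) measure"
  by (rule prob_space_unit_cube)

lemma measurable_coord [measurable]: "(\<lambda>x. x $ i) \<in> unit_cube \<rightarrow>\<^sub>M unit_interval"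
  unfolding unit_cube_def unit_interval_def
  by (intro measurable_restrict_space3) auto

lemma distr_coord: "distr unit_cube unit_interval (\<lambda>x :: real ^ 'd. x $ i) = unit_interval"
proof (rule measure_eqI)
  fix A assume "A \<in> sets (distr unit_cube unit_interval (\<lambda>x :: real ^ 'd. x $ i))"
  then have A[measurable]: "A \<in> sets unit_interval" by simp
  let ?h = "\<lambda>j :: 'd. \<lambda>t. if j = i then indicator A t else (1 :: real)"
  have h: "integrable unit_interval (?h j)" for j
    using A by (cases "j = i") (auto intro!: integrable_real_indicator simp: less_top[symmetric])
  have "measure (distr unit_cube unit_interval (\<lambda>x :: real ^ 'd. x $ i)) A =
      (\<integral>x. indicator A (x $ i) \<partial>(unit_cube :: (real ^ 'd) measure))"
    using A sets.sets_into_space[OF A]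
    by (subst integral_distr[symmetric, where N=unit_interval and f="indicator A"]) (auto simp: Int_absorb2)
  also have "\<dots> = (\<integral>x. (\<Prod>j\<in>UNIV. ?h j (x $ j)) \<partial>(unit_cube :: (real ^ 'd) measure))"
    by (intro Bochner_Integration.integral_cong refl) (simp add: prod.delta)
  also have "\<dots> = (\<Prod>j\<in>UNIV. \<integral>t. ?h j t \<partial>unit_interval)"
    by (rule cube_prod_integral_eq[OF h])
  also have "\<dots> = (\<Prod>j\<in>UNIV. if j = i then measure unit_interval A else 1)"
    using unit_interval.prob_space A sets.sets_into_space[OF A]
    by (intro prod.cong refl) (auto simp: Int_absorb2)
  also have "\<dots> = measure unit_interval A" by (simp add: prod.delta)
  finally show "emeasure (distr unit_cube unit_interval (\<lambda>x :: real ^ 'd. x $ i)) A = emeasure unit_interval A"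
    by (simp add: unit_interval.emeasure_eq_measure
        finite_measure.emeasure_eq_measure[OF prob_space.finite_measure, OF unit_cube.prob_space_distr])
qed simp

text \<open>Expansions in one coordinate hold outside null sets of the interval.  A null set of the interval stays null when
  it is pulled back to the cube, so that such expansions may be substituted into products.\<close>

lemma AE_coord:
  assumes "AE t in unit_interval. P t"
  shows "AE x in (unit_cube :: (real ^ 'd) measure). P (x $ i)"
proof (rule AE_distrD[OF measurable_coord])
  show "AE t in distr (unit_cube :: (real ^ 'd) measure) unit_interval (\<lambda>x. x $ i). P t"
    using assms unfolding distr_coord .
qed


section \<open>The multiresolution analysis on the cube\<close>

lemma l2_span_cong_AE:
  assumes "u \<in> l2_span M I e" "h \<in> L2 M" "AE x in M. h x = u x"
  shows "h \<in> l2_span M I e"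
proof -
  obtain A a where "finite A" "A \<subseteq> I" "AE x in M. u x = (\<Sum>i\<in>A. a i * e i x)"
    using assms(1) by (auto simp: l2_span_def)
  moreover from this(3) assms(3) have "AE x in M. h x = (\<Sum>i\<in>A. a i * e i x)"
    by eventually_elim simp
  ultimately show ?thesis using assms(2) unfolding l2_span_def by blast
qed

lemma tensor_measurable:
  fixes u :: "'d :: finite \<Rightarrow> real \<Rightarrow> real"
  assumes "\<And>i. u i \<in> borel_measurable unit_interval"
  shows "(\<lambda>x :: real ^ 'd. \<Prod>i\<in>UNIV. u i (x $ i)) \<in> borel_measurable unit_cube"
  by (intro borel_measurable_prod measurable_compose[OF measurable_coord assms])

lemma tensor_L2:
  fixes u :: "'d :: finite \<Rightarrow> real \<Rightarrow> real"
  assumes u: "\<And>i. u i \<in> L2 unit_interval"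
  shows "(\<lambda>x :: real ^ 'd. \<Prod>i\<in>UNIV. u i (x $ i)) \<in> L2 unit_cube"
proof -
  have "integrable unit_cube (\<lambda>x :: real ^ 'd. \<Prod>i\<in>UNIV. (u i (x $ i))\<^sup>2)"
    using L2_D(2)[OF u] by (intro cube_prod_integrable[of "\<lambda>i t. (u i t)\<^sup>2"])
  then show ?thesis
    using tensor_measurable[of u, OF L2_D(1)[OF u]] by (simp add: L2_def prod_power_distrib)
qed

lemma tensor_inner:
  assumes u: "\<And>i. u i \<in> L2 unit_interval" and v: "\<And>i. v i \<in> L2 unit_interval"
  shows "l2_inner unit_cube (\<lambda>x :: real ^ 'd. \<Prod>i\<in>UNIV. u i (x $ i)) (\<lambda>x. \<Prod>i\<in>UNIV. v i (x $ i)) =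
    (\<Prod>i\<in>UNIV. l2_inner unit_interval (u i) (v i))"
  using cube_prod_integral_eq[of "\<lambda>i t. u i t * v i t"] L2_mult_integrable[OF u v]
  by (simp add: l2_inner_def prod.distrib)

lemma bounded_L2:
  assumes "finite_measure M" "h \<in> borel_measurable M" "\<And>x. x \<in> space M \<Longrightarrow> \<bar>h x\<bar> \<le> B"
  shows "h \<in> L2 M"
proof -
  have "norm ((h x)\<^sup>2) \<le> B\<^sup>2" if "x \<in> space M" for x
    using power_mono[OF assms(3)[OF that], of 2] by simp
  then show ?thesis unfolding L2_def using assms(2)
    by (auto intro!: finite_measure.integrable_const_bound[OF assms(1), where B="B\<^sup>2"] AE_I2)
qed

definition cube_index :: "boundary_wavelets \<Rightarrow> nat \<Rightarrow> ('d \<Rightarrow> widx) set" where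
  "cube_index W j = {l. \<forall>i. l i \<in> phi_idx W j}"

lemma V_cube_alt: "V_cube W j = l2_span unit_cube (cube_index W j) (phi_cube W j)"
  by (simp add: V_cube_def cube_index_def)

lemma cube_index_PiE: "cube_index W j = PiE UNIV (\<lambda>_. phi_idx W j)"
  by (auto simp: cube_index_def PiE_def Pi_def extensional_def)

locale cdv =
  fixes W :: boundary_wavelets and R :: real and N :: nat
  assumes cdv: "cdv_wavelets W R N"
begin

abbreviation "J0 \<equiv> coarse_level W"

lemma level:
  assumes "J0 \<le> j"
  shows "card (phi_idx W j) = 2 ^ j" "l2_orthonormal unit_interval (phi_idx W j) (phi_I W j)"
    "V_I W (Suc j) = {\<lambda>x. u x + w x | u w. u \<in> V_I W j \<and> w \<in> W_I W j}"
  using cdv assms unfolding cdv_wavelets_def by blast+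

lemma finite_phi_idx: "J0 \<le> j \<Longrightarrow> finite (phi_idx W j)"
  using level(1)[of j] by (intro card_ge_0_finite) simp

lemma onb_interval: "J0 \<le> j \<Longrightarrow> l2_onb unit_interval (phi_idx W j) (phi_I W j)"
  using level(2) finite_phi_idx by (simp add: l2_onb_def)

lemma finite_cube_index: "J0 \<le> j \<Longrightarrow> finite (cube_index W j :: ('d :: finite \<Rightarrow> widx) set)"
  unfolding cube_index_PiE by (intro finite_PiE finite_phi_idx) auto

lemma card_cube_index: "J0 \<le> j \<Longrightarrow> card (cube_index W j :: ('d :: finite \<Rightarrow> widx) set) = 2 ^ (j * CARD('d))"
  unfolding cube_index_PiE by (subst card_PiE) (auto simp: level(1) power_mult)

lemma phi_cube_L2: "J0 \<le> j \<Longrightarrow> l \<in> cube_index W j \<Longrightarrow> phi_cube W j (l :: 'd :: finite \<Rightarrow> widx) \<in> L2 unit_cube"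
  using tensor_L2[of "\<lambda>i. phi_I W j (l i)"] l2_onb.e_L2[OF onb_interval]
  by (auto simp: phi_cube_def[abs_def] cube_index_def)

lemma onb_cube: 
  assumes j: "J0 \<le> j"
  shows "l2_onb unit_cube (cube_index W j :: ('d :: finite \<Rightarrow> widx) set) (phi_cube W j)"
  unfolding l2_onb_def l2_orthonormal_def
proof (intro conjI ballI finite_cube_index j phi_cube_L2)
  fix k l :: "'d \<Rightarrow> widx" assume kl: "k \<in> cube_index W j" "l \<in> cube_index W j"
  interpret l2_onb unit_interval "phi_idx W j" "phi_I W j" using j by (rule onb_interval)
  have kl': "k i \<in> phi_idx W j" "l i \<in> phi_idx W j" for i using kl by (auto simp: cube_index_def)
  have "l2_inner unit_cube (phi_cube W j k) (phi_cube W j l) =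
      (\<Prod>i\<in>UNIV. l2_inner unit_interval (phi_I W j (k i)) (phi_I W j (l i)))"
    unfolding phi_cube_def[abs_def] by (intro tensor_inner e_L2 kl')
  also have "\<dots> = (\<Prod>i\<in>UNIV. if k i = l i then 1 else 0)"
    using kl' by (simp add: e_inner)
  also have "\<dots> = (if k = l then 1 else 0)"
  proof (cases "k = l")
    case False
    then obtain i where "k i \<noteq> l i" by auto
    then have "(\<Prod>i\<in>UNIV. if k i = l i then 1 else 0 :: real) = 0"
      by (intro prod_zero) (auto intro!: exI[of _ i])
    then show ?thesis using False by simp
  qed simp
  finally show "l2_inner unit_cube (phi_cube W j k) (phi_cube W j l) = (if k = l then 1 else 0)" .
qed

text \<open>The space on the cube is spanned by products of basis functions only.  Expanding the product shows that it contains
  the products of arbitrary elements of the one-dimensional spaces; nestedness and density on the cube then follow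
  from the corresponding properties on the interval.\<close>

lemma tensor_V_cube:
  assumes j: "J0 \<le> j" and u: "\<And>i. u i \<in> V_I W j"
  shows "(\<lambda>x :: real ^ 'd. \<Prod>i\<in>UNIV. u i (x $ i)) \<in> V_cube W j"
proof -
  interpret l2_onb unit_interval "phi_idx W j" "phi_I W j" using j by (rule onb_interval)
  have "\<forall>i. \<exists>a. AE t in unit_interval. u i t = (\<Sum>k\<in>phi_idx W j. a k * phi_I W j k t)"
    and uL: "\<And>i. u i \<in> L2 unit_interval"
    using u by (auto simp: V_I_def l2_span_finite_iff[OF fin])
  then obtain a where "\<And>i. AE t in unit_interval. u i t = (\<Sum>k\<in>phi_idx W j. a i k * phi_I W j k t)"
    by metis
  then have "AE x in (unit_cube :: (real ^ 'd) measure). \<forall>i. u i (x $ i) = (\<Sum>k\<in>phi_idx W j. a i k * phi_I W j k (x $ i))"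
    by (subst AE_all_countable) (auto intro: AE_coord)
  then have "AE x in (unit_cube :: (real ^ 'd) measure). (\<Prod>i\<in>UNIV. u i (x $ i)) =
      (\<Sum>l\<in>cube_index W j. (\<Prod>i\<in>UNIV. a i (l i)) * phi_cube W j l x)"
  proof eventually_elim
    case (elim x)
    then have "(\<Prod>i\<in>UNIV. u i (x $ i)) = (\<Prod>i\<in>UNIV. \<Sum>k\<in>phi_idx W j. a i k * phi_I W j k (x $ i))"
      by simp
    also have "\<dots> = (\<Sum>l\<in>cube_index W j. \<Prod>i\<in>UNIV. a i (l i) * phi_I W j (l i) (x $ i))"
      unfolding cube_index_PiE by (subst prod_sum_PiE) (auto simp: fin)
    finally show ?case by (simp add: prod.distrib phi_cube_def)
  qed
  then show ?thesis
    unfolding V_cube_alt l2_span_finite_iff[OF finite_cube_index[OF j]]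
    using tensor_L2[of u, OF uL] by (intro conjI exI[of _ "\<lambda>l. \<Prod>i\<in>UNIV. a i (l i)"])
qed

lemma V_I_Suc: "J0 \<le> j \<Longrightarrow> V_I W j \<subseteq> V_I W (Suc j)"
proof
  fix u assume j: "J0 \<le> j" and u: "u \<in> V_I W j"
  have "(\<lambda>x. 0) \<in> W_I W j" unfolding W_I_def l2_span_def by (auto intro!: exI[of _ "{}"])
  then show "u \<in> V_I W (Suc j)" unfolding level(3)[OF j] using u by force
qed

lemma V_I_mono: "i \<le> j \<Longrightarrow> J0 \<le> i \<Longrightarrow> V_I W i \<subseteq> V_I W j"
proof (induction j rule: dec_induct)
  case (step n)
  then show ?case using V_I_Suc[of n] by auto
qed simp

lemma V_cube_mono:
  assumes i: "J0 \<le> i" and ij: "i \<le> j"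
  shows "V_cube W i \<subseteq> (V_cube W j :: (real ^ 'd \<Rightarrow> real) set)"
proof
  fix h :: "real ^ 'd \<Rightarrow> real" assume "h \<in> V_cube W i"
  then obtain a where h: "h \<in> L2 unit_cube" "AE x in unit_cube. h x = (\<Sum>l\<in>cube_index W i. a l * phi_cube W i l x)"
    by (auto simp: V_cube_alt l2_span_finite_iff[OF finite_cube_index[OF i]])
  interpret l2_onb unit_interval "phi_idx W i" "phi_I W i" using i by (rule onb_interval)
  have j: "J0 \<le> j" using i ij by simp
  have "phi_cube W i l \<in> V_cube W j" if "l \<in> cube_index W i" for l :: "'d \<Rightarrow> widx"
    unfolding phi_cube_def[abs_def]
  proof (intro tensor_V_cube j)
    fix k
    have "phi_I W i (l k) \<in> V_I W i"
      using that unfolding V_I_def cube_index_def by (intro l2_span_base fin e_L2) auto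
    then show "phi_I W i (l k) \<in> V_I W j" using V_I_mono[OF ij i] by blast
  qed
  then have "(\<lambda>x. \<Sum>l\<in>cube_index W i. a l * phi_cube W i l x) \<in> V_cube W j"
    unfolding V_cube_alt by (intro l2_span_sum l2_span_scale finite_cube_index j)
  then show "h \<in> V_cube W j"
    using h unfolding V_cube_alt by (rule l2_span_cong_AE)
qed


subsection \<open>Density of the approximation spaces\<close>

text \<open>The Hilbert sum decomposition is given on the interval.  It is transported to the cube as follows: the approximable
  functions form a closed linear space; they contain products of functions of one coordinate, hence indicators of
  boxes, hence (by the \<open>\<pi>\<close>-\<open>\<lambda>\<close> theorem) indicators of Borel sets, hence everything.\<close>

definition approximable :: "(real ^ 'd \<Rightarrow> real) \<Rightarrow> bool" where
  "approximable h \<longleftrightarrow> h \<in> L2 unit_cube \<and>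
     (\<forall>e>0. \<exists>j\<ge>J0. \<exists>v\<in>V_cube W j. l2_dist unit_cube h v < e)"

lemma V_cube_L2: "v \<in> V_cube W j \<Longrightarrow> v \<in> L2 unit_cube"
  by (auto simp: V_cube_def l2_span_def)

lemma approximable_add:
  assumes u: "approximable u" and v: "approximable v"
  shows "approximable (\<lambda>x. u x + v x :: real)"
  unfolding approximable_def
proof (intro conjI allI impI)
  have L: "u \<in> L2 unit_cube" "v \<in> L2 unit_cube" using u v by (auto simp: approximable_def)
  show "(\<lambda>x. u x + v x) \<in> L2 unit_cube" using L by auto
  fix e :: real assume "0 < e"
  then have "0 < e / 2" by simp
  then obtain i u' where i: "J0 \<le> i" "u' \<in> V_cube W i" "l2_dist unit_cube u u' < e / 2"
    using u unfolding approximable_def by blast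
  obtain j v' where j: "J0 \<le> j" "v' \<in> V_cube W j" "l2_dist unit_cube v v' < e / 2"
    using v \<open>0 < e / 2\<close> unfolding approximable_def by blast
  let ?k = "max i j"
  have "u' \<in> V_cube W ?k" "v' \<in> V_cube W ?k"
    using V_cube_mono[of i ?k] V_cube_mono[of j ?k] i j by auto
  then have *: "(\<lambda>x. u' x + v' x) \<in> V_cube W ?k"
    unfolding V_cube_alt using i by (intro l2_span_add finite_cube_index) auto
  have "l2_dist unit_cube (\<lambda>x. u x + v x) (\<lambda>x. u' x + v' x) \<le> l2_dist unit_cube u u' + l2_dist unit_cube v v'"
    using l2_norm_triangle[of "\<lambda>x. u x - u' x" unit_cube "\<lambda>x. v x - v' x"] L V_cube_L2[OF i(2)] V_cube_L2[OF j(2)]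
    by (auto simp: l2_dist_def algebra_simps)
  then show "\<exists>j\<ge>J0. \<exists>w\<in>V_cube W j. l2_dist unit_cube (\<lambda>x. u x + v x) w < e"
    using i j * by (intro exI[of _ ?k] conjI bexI[of _ "\<lambda>x. u' x + v' x"]) auto
qed

lemma approximable_scale:
  assumes u: "approximable u"
  shows "approximable (\<lambda>x. c * u x :: real)"
  unfolding approximable_def
proof (intro conjI allI impI)
  show "(\<lambda>x. c * u x) \<in> L2 unit_cube" using u by (auto simp: approximable_def)
  fix e :: real assume "0 < e"
  then have "0 < e / (1 + \<bar>c\<bar>)" by (simp add: add_pos_nonneg)
  then obtain i u' where i: "J0 \<le> i" "u' \<in> V_cube W i" "l2_dist unit_cube u u' < e / (1 + \<bar>c\<bar>)"
    using u unfolding approximable_def by blast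
  have *: "(\<lambda>x. c * u' x) \<in> V_cube W i"
    using i unfolding V_cube_alt by (intro l2_span_scale finite_cube_index) auto
  have "l2_dist unit_cube (\<lambda>x. c * u x) (\<lambda>x. c * u' x) = \<bar>c\<bar> * l2_dist unit_cube u u'"
    unfolding l2_dist_def l2_norm_scale[symmetric] by (simp add: algebra_simps)
  also have "\<dots> \<le> (1 + \<bar>c\<bar>) * l2_dist unit_cube u u'"
    by (intro mult_right_mono) auto
  also have "\<dots> < e" using i(3) by (simp add: field_simps add_pos_nonneg)
  finally show "\<exists>j\<ge>J0. \<exists>w\<in>V_cube W j. l2_dist unit_cube (\<lambda>x. c * u x) w < e"
    using i * by (intro exI[of _ i] conjI bexI[of _ "\<lambda>x. c * u' x"]) auto
qed

lemma approximable_zero: "approximable (\<lambda>x. 0)"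
proof -
  have "(\<lambda>x. 0) \<in> V_cube W J0" unfolding V_cube_def l2_span_def by (auto intro!: exI[of _ "{}"])
  then show ?thesis unfolding approximable_def
    by (auto intro!: exI[of _ J0] bexI[of _ "\<lambda>x. 0"] simp: l2_dist_def l2_norm_def)
qed

lemma approximable_sum:
  "(\<And>i. i \<in> A \<Longrightarrow> approximable (u i)) \<Longrightarrow> approximable (\<lambda>x. \<Sum>i\<in>A. u i x)"
  by (induction A rule: infinite_finite_induct) (auto intro: approximable_add approximable_zero)

lemma approximable_closed:
  assumes h: "h \<in> L2 unit_cube" and lim: "\<And>e. 0 < e \<Longrightarrow> \<exists>u. approximable u \<and> l2_dist unit_cube h u < e"
  shows "approximable h"
  unfolding approximable_def
proof (intro conjI allI impI h)
  fix e :: real assume "0 < e"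
  then have e: "0 < e / 2" by simp
  obtain u where u: "approximable u" "l2_dist unit_cube h u < e / 2" using lim[OF e] by blast
  then obtain j v where v: "J0 \<le> j" "v \<in> V_cube W j" "l2_dist unit_cube u v < e / 2"
    using e unfolding approximable_def by blast
  have "l2_dist unit_cube h v < e"
    using l2_dist_triangle[of h unit_cube u v] u v h V_cube_L2[OF v(2)] by (auto simp: approximable_def)
  then show "\<exists>j\<ge>J0. \<exists>v\<in>V_cube W j. l2_dist unit_cube h v < e" using v by blast
qed

lemma approximable_dominated:
  assumes h: "h \<in> L2 unit_cube" and s: "\<And>n. approximable (s n)"
    and lim: "\<And>x. x \<in> space unit_cube \<Longrightarrow> (\<lambda>n. s n x) \<longlonglongrightarrow> h x"
    and dom: "\<And>n x. x \<in> space unit_cube \<Longrightarrow> \<bar>h x - s n x\<bar> \<le> w x"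
    and w: "integrable unit_cube (\<lambda>x. (w x)\<^sup>2)"
  shows "approximable h"
proof (rule approximable_closed[OF h])
  fix e :: real assume e: "0 < e"
  have sL: "s n \<in> L2 unit_cube" for n using s by (auto simp: approximable_def)
  have m[measurable]: "h \<in> borel_measurable unit_cube" "\<And>n. s n \<in> borel_measurable unit_cube"
    using h sL by (auto simp: L2_def)
  have "(\<lambda>n. \<integral>x. (h x - s n x)\<^sup>2 \<partial>unit_cube) \<longlonglongrightarrow> (\<integral>x. 0 \<partial>(unit_cube :: (real ^ 'a) measure))"
  proof (rule integral_dominated_convergence[where w="\<lambda>x. (w x)\<^sup>2"])
    show "AE x in unit_cube. (\<lambda>n. (h x - s n x)\<^sup>2) \<longlonglongrightarrow> 0"
    proof (rule AE_I2)
      fix x :: "real ^ 'a" assume "x \<in> space unit_cube"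
      then have "(\<lambda>n. (h x - s n x)\<^sup>2) \<longlonglongrightarrow> (h x - h x)\<^sup>2"
        by (intro tendsto_intros lim)
      then show "(\<lambda>n. (h x - s n x)\<^sup>2) \<longlonglongrightarrow> 0" by simp
    qed
    show "AE x in unit_cube. norm ((h x - s n x)\<^sup>2) \<le> (w x)\<^sup>2" for n
    proof (rule AE_I2)
      fix x :: "real ^ 'a" assume "x \<in> space unit_cube"
      from power_mono[OF dom[OF this, of n], of 2] show "norm ((h x - s n x)\<^sup>2) \<le> (w x)\<^sup>2" by simp
    qed
  qed (use w in auto)
  then have "(\<lambda>n. l2_dist unit_cube h (s n)) \<longlonglongrightarrow> sqrt 0"
    unfolding l2_dist_def l2_norm_def by (intro tendsto_real_sqrt) simp
  then have "eventually (\<lambda>n. l2_dist unit_cube h (s n) < e) sequentially"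
    using e by (intro order_tendstoD(2)) auto
  then show "\<exists>u. approximable u \<and> l2_dist unit_cube h u < e"
    using s by (auto simp: eventually_sequentially)
qed

text \<open>Products of one-dimensional functions: by Fubini, \<open>\<parallel>\<Otimes>u\<^sub>i - \<Otimes>v\<^sub>i\<parallel>\<^sup>2\<close> is a polynomial in the inner products of
  the factors, so convergence of every factor forces convergence of the tensor product.\<close>

lemma approximable_tensor:
  assumes h: "\<And>i :: 'd. h i \<in> L2 unit_interval"
  shows "approximable (\<lambda>x :: real ^ 'd. \<Prod>i\<in>UNIV. h i (x $ i))"
proof (rule approximable_closed)
  let ?h = "\<lambda>x :: real ^ 'd. \<Prod>i\<in>UNIV. h i (x $ i)"
  show hL: "?h \<in> L2 unit_cube" by (rule tensor_L2[OF h])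
  fix e :: real assume e: "0 < e"
  have "\<exists>u j. J0 \<le> j \<and> u \<in> V_I W j \<and> l2_dist unit_interval (h i) u < inverse (real (Suc n))" for i n
    using cdv h[of i] unfolding cdv_wavelets_def by (metis inverse_positive_iff_positive of_nat_0_less_iff zero_less_Suc)
  then obtain u j where uj: "\<And>i n. J0 \<le> j i n" "\<And>i n. u i n \<in> V_I W (j i n)"
    "\<And>i n. l2_dist unit_interval (h i) (u i n) < inverse (real (Suc n))" by metis
  have uL: "u i n \<in> L2 unit_interval" for i n using uj(2)[of i n] by (auto simp: V_I_def l2_span_def)
  have d0: "(\<lambda>n. l2_dist unit_interval (h i) (u i n)) \<longlonglongrightarrow> 0" for i
    by (rule tendsto_sandwich[OF _ _ tendsto_const LIMSEQ_inverse_real_of_nat])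
      (use uj(3)[of i] in \<open>auto intro!: always_eventually less_imp_le\<close>)
  have hu: "(\<lambda>n. l2_inner unit_interval (h i) (u i n)) \<longlonglongrightarrow> l2_inner unit_interval (h i) (h i)" for i
  proof (rule LIM_zero_cancel, rule Lim_null_comparison)
    show "(\<lambda>n. l2_norm unit_interval (h i) * l2_dist unit_interval (h i) (u i n)) \<longlonglongrightarrow> 0"
      using tendsto_mult_right_zero[OF d0] by simp
    show "\<forall>\<^sub>F n in sequentially. norm (l2_inner unit_interval (h i) (u i n) - l2_inner unit_interval (h i) (h i))
        \<le> l2_norm unit_interval (h i) * l2_dist unit_interval (h i) (u i n)"
    proof (rule always_eventually, rule allI)
      fix n
      have "l2_inner unit_interval (h i) (h i) - l2_inner unit_interval (h i) (u i n) =
          l2_inner unit_interval (h i) (\<lambda>t. h i t - u i n t)"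
        using h uL by (subst (1 2 3) l2_inner_commute, subst l2_inner_diff_left) auto
      then show "norm (l2_inner unit_interval (h i) (u i n) - l2_inner unit_interval (h i) (h i))
        \<le> l2_norm unit_interval (h i) * l2_dist unit_interval (h i) (u i n)"
        using l2_Cauchy_Schwarz[of "h i" unit_interval "\<lambda>t. h i t - u i n t"] h uL
        by (simp add: abs_minus_commute l2_dist_def L2_diff)
    qed
  qed
  have uu: "(\<lambda>n. l2_inner unit_interval (u i n) (u i n)) \<longlonglongrightarrow> l2_inner unit_interval (h i) (h i)" for i
  proof -
    have "l2_inner unit_interval (u i n) (u i n) =
        (l2_dist unit_interval (h i) (u i n))\<^sup>2 - l2_inner unit_interval (h i) (h i)
          + 2 * l2_inner unit_interval (h i) (u i n)" for n
    proof -
      have "(l2_dist unit_interval (h i) (u i n))\<^sup>2 =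
         l2_inner unit_interval (h i) (\<lambda>t. h i t - u i n t) - l2_inner unit_interval (u i n) (\<lambda>t. h i t - u i n t)"
        unfolding l2_dist_def l2_norm_sq using h uL by (subst l2_inner_diff_left) auto
      also have "l2_inner unit_interval (h i) (\<lambda>t. h i t - u i n t) =
          l2_inner unit_interval (h i) (h i) - l2_inner unit_interval (h i) (u i n)"
        using h uL by (subst (1 2 3) l2_inner_commute, subst l2_inner_diff_left) auto
      also have "l2_inner unit_interval (u i n) (\<lambda>t. h i t - u i n t) =
          l2_inner unit_interval (h i) (u i n) - l2_inner unit_interval (u i n) (u i n)"
        using h uL by (subst l2_inner_commute, subst l2_inner_diff_left) auto
      finally show ?thesis by simp
    qed
    moreover have "(\<lambda>n. (l2_dist unit_interval (h i) (u i n))\<^sup>2 - l2_inner unit_interval (h i) (h i)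
          + 2 * l2_inner unit_interval (h i) (u i n)) \<longlonglongrightarrow>
       0\<^sup>2 - l2_inner unit_interval (h i) (h i) + 2 * l2_inner unit_interval (h i) (h i)"
      by (intro tendsto_intros d0 hu)
    ultimately show ?thesis by simp
  qed
  let ?u = "\<lambda>n. \<lambda>x :: real ^ 'd. \<Prod>i\<in>UNIV. u i n (x $ i)"
  have uL': "?u n \<in> L2 unit_cube" for n by (rule tensor_L2[OF uL])
  have uV: "\<exists>j\<ge>J0. ?u n \<in> V_cube W j" for n
  proof (intro exI conjI tensor_V_cube)
    show "J0 \<le> (Max (range (\<lambda>i. j i n)))" using uj(1)
      by (meson Max_ge UNIV_I finite finite_imageI image_eqI le_trans)
    then show "J0 \<le> (Max (range (\<lambda>i. j i n)))" .
    show "u i n \<in> V_I W (Max (range (\<lambda>i. j i n)))" for i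
      using V_I_mono[OF _ uj(1)[of i n], of "Max (range (\<lambda>i. j i n))"] uj(2)[of i n] by auto
  qed
  have "(l2_dist unit_cube ?h (?u n))\<^sup>2 = (\<Prod>i\<in>UNIV. l2_inner unit_interval (h i) (h i)) -
      2 * (\<Prod>i\<in>UNIV. l2_inner unit_interval (h i) (u i n)) + (\<Prod>i\<in>UNIV. l2_inner unit_interval (u i n) (u i n))" for n
  proof -
    have "(l2_dist unit_cube ?h (?u n))\<^sup>2 = l2_inner unit_cube ?h (\<lambda>x. ?h x - ?u n x) - l2_inner unit_cube (?u n) (\<lambda>x. ?h x - ?u n x)"
      unfolding l2_dist_def l2_norm_sq using hL uL' by (subst l2_inner_diff_left) auto
    also have "l2_inner unit_cube ?h (\<lambda>x. ?h x - ?u n x) = l2_inner unit_cube ?h ?h - l2_inner unit_cube ?h (?u n)"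
      using hL uL' by (subst (1 2 3) l2_inner_commute, subst l2_inner_diff_left) auto
    also have "l2_inner unit_cube (?u n) (\<lambda>x. ?h x - ?u n x) = l2_inner unit_cube ?h (?u n) - l2_inner unit_cube (?u n) (?u n)"
      using hL uL' by (subst l2_inner_commute, subst l2_inner_diff_left) auto
    finally show ?thesis by (simp add: tensor_inner[of h h] tensor_inner[of h "\<lambda>i. u i n"] tensor_inner[of "\<lambda>i. u i n" "\<lambda>i. u i n"] h uL)
  qed
  moreover have "(\<lambda>n. (\<Prod>i\<in>UNIV. l2_inner unit_interval (h i) (h i)) -
      2 * (\<Prod>i\<in>UNIV. l2_inner unit_interval (h i) (u i n)) + (\<Prod>i\<in>UNIV. l2_inner unit_interval (u i n) (u i n)))
      \<longlonglongrightarrow> (\<Prod>i\<in>UNIV. l2_inner unit_interval (h i) (h i)) -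
      2 * (\<Prod>i\<in>UNIV. l2_inner unit_interval (h i) (h i)) + (\<Prod>i\<in>UNIV. l2_inner unit_interval (h i) (h i))"
    by (intro tendsto_intros hu uu)
  ultimately have "(\<lambda>n. (l2_dist unit_cube ?h (?u n))\<^sup>2) \<longlonglongrightarrow> 0" by simp
  then have "eventually (\<lambda>n. (l2_dist unit_cube ?h (?u n))\<^sup>2 < e\<^sup>2) sequentially"
    by (rule order_tendstoD(2)) (use e in simp)
  then obtain n where "(l2_dist unit_cube ?h (?u n))\<^sup>2 < e\<^sup>2"
    using eventually_happens'[OF sequentially_bot] by blast
  then have "l2_dist unit_cube ?h (?u n) < e" by (rule power2_less_imp_less) (use e in simp)
  moreover have "approximable (?u n)"
  proof -
    obtain j where "J0 \<le> j" "?u n \<in> V_cube W j" using uV by blast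
    moreover have "l2_dist unit_cube (?u n) (?u n) = 0" by (simp add: l2_dist_def l2_norm_def)
    ultimately show ?thesis unfolding approximable_def using uL'
      by (auto intro!: exI[of _ j] bexI[of _ "?u n"])
  qed
  ultimately show "\<exists>u. approximable u \<and> l2_dist unit_cube ?h u < e" by blast
qed

lemma approximable_indicator:
  assumes A: "A \<in> sets (borel :: (real ^ 'd) measure)"
  shows "approximable (indicator A :: real ^ 'd \<Rightarrow> real)"
proof -
  have L: "(indicator A :: real ^ 'd \<Rightarrow> real) \<in> L2 unit_cube" if "A \<in> sets borel" for A
    by (rule bounded_L2[where B=1, OF unit_cube.finite_measure_axioms]) (use that in \<open>auto simp: unit_cube_def measurable_restrict_space1 indicator_def\<close>)
  have rect: "approximable (\<lambda>x :: real ^ 'd. \<Prod>i\<in>UNIV. indicator (B i) (x $ i))" if "\<And>i. B i \<in> sets borel" for B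
  proof (rule approximable_tensor)
    fix i
    have "(indicator (B i) :: real \<Rightarrow> real) \<in> borel_measurable unit_interval"
      unfolding unit_interval_def using that by (intro measurable_restrict_space1) auto
    then show "indicator (B i) \<in> L2 unit_interval"
      by (rule bounded_L2[where B=1, OF unit_interval.finite_measure_axioms]) (auto simp: indicator_def)
  qed
  let ?G = "range (\<lambda>(a, b). box a b) :: (real ^ 'd) set set"
  have G: "Int_stable ?G" "?G \<subseteq> Pow UNIV" by (auto simp: Int_stable_def box_Int_box)
  have S: "sigma_sets UNIV ?G = sets borel"
    by (subst borel_eq_box) (simp add: sets_measure_of)
  have "A \<in> sigma_sets UNIV ?G" using A S by simp
  from G this show ?thesis
  proof (induction rule: sigma_sets_induct_disjoint)
    case (basic A)
    then obtain a b where A: "A = box a b" by auto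
    have "indicator A = (\<lambda>x :: real ^ 'd. \<Prod>i\<in>UNIV. indicator {a $ i <..< b $ i} (x $ i) :: real)"
    proof
      fix x
      show "indicator A x = (\<Prod>i\<in>UNIV. indicator {a $ i <..< b $ i} (x $ i) :: real)"
      proof (cases "x \<in> A")
        case False
        then obtain i where "x $ i \<notin> {a $ i <..< b $ i}" by (auto simp: A mem_box_cart)
        then have "(\<Prod>i\<in>UNIV. indicator {a $ i <..< b $ i} (x $ i) :: real) = 0"
          by (intro prod_zero) (auto intro!: exI[of _ i] simp: indicator_def)
        then show ?thesis using False by simp
      qed (auto simp: A mem_box_cart)
    qed
    then show ?case using rect[of "\<lambda>i. {a $ i <..< b $ i}"] by simp
  next
    case empty
    then show ?case using approximable_zero by (simp add: indicator_def[abs_def])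
  next
    case (compl A)
    have "indicator (UNIV - A) = (\<lambda>x :: real ^ 'd. (\<Prod>i\<in>UNIV. indicator UNIV (x $ i)) + (-1) * (indicator A x :: real))"
      by (auto simp: indicator_def)
    then show ?case using approximable_add[OF rect[of "\<lambda>_. UNIV"] approximable_scale[OF compl.IH, of "-1"]] by simp
  next
    case (union A)
    have A: "A i \<in> sets borel" for i using union S by auto
    then have "(\<Union>i. A i) \<in> sets borel" by auto
    then show ?case
    proof (rule approximable_dominated[OF L, where s="\<lambda>n x. \<Sum>i<n. indicator (A i) x" and w="\<lambda>_. 1"])
      show "approximable (\<lambda>x. \<Sum>i<n. indicator (A i) x :: real)" for n
        by (intro approximable_sum union)
      have eq: "(\<Sum>i<n. indicator (A i) x :: real) = indicator (\<Union>i<n. A i) x" for n x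
        using union(1) by (subst indicator_UN_disjoint) (auto intro: disjoint_family_on_mono)
      show "(\<lambda>n. \<Sum>i<n. indicator (A i) x :: real) \<longlonglongrightarrow> indicator (\<Union>i. A i) x" for x
        unfolding eq by (rule LIMSEQ_indicator_UN)
      show "\<bar>indicator (\<Union>i. A i) x - (\<Sum>i<n. indicator (A i) x)\<bar> \<le> (1 :: real)" for n x
        unfolding eq by (auto simp: indicator_def)
    qed auto
  qed
qed

text \<open>Simple functions dominated by \<open>2 \<bar>h\<bar>\<close> that converge pointwise to \<open>h\<close> reduce the claim to indicators.\<close>

lemma approximable_L2:
  assumes h: "(h :: real ^ 'd \<Rightarrow> real) \<in> L2 unit_cube"
  shows "approximable h"
proof -
  obtain s where s: "\<And>n. simple_function unit_cube (s n)"
    "\<And>x. x \<in> space unit_cube \<Longrightarrow> (\<lambda>n. s n x) \<longlonglongrightarrow> h x"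
    "\<And>n x. x \<in> space unit_cube \<Longrightarrow> dist (s n x) 0 \<le> 2 * dist (h x) 0"
    using borel_measurable_implies_sequence_metric[OF L2_D(1)[OF h], of 0] by metis
  have A: "approximable (s n)" for n
  proof -
    let ?B = "\<lambda>y. s n -` {y} \<inter> space unit_cube"
    have fin: "finite (s n ` space unit_cube)" using s(1) by (rule simple_functionD)
    have "?B y \<in> sets unit_cube" for y using s(1) by (rule simple_functionD)
    then have "?B y \<in> sets borel" for y
      unfolding unit_cube_def by (subst (asm) sets_restrict_space_iff) auto
    then have *: "approximable (\<lambda>x. \<Sum>y\<in>s n ` space unit_cube. y * indicator (?B y) x)"
      by (intro approximable_sum approximable_scale approximable_indicator)
    have eq: "s n x = (\<Sum>y\<in>s n ` space unit_cube. y * indicator (?B y) x)" if "x \<in> space unit_cube" for x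
    proof -
      have "(\<Sum>y\<in>s n ` space unit_cube. y * indicator (?B y) x) = (\<Sum>y\<in>s n ` space unit_cube. if y = s n x then y else 0)"
        using that by (intro sum.cong) (auto simp: indicator_def)
      then show ?thesis using fin that by (simp add: sum.delta')
    qed
    have sm: "s n \<in> borel_measurable unit_cube" using s(1) by (rule borel_measurable_simple_function)
    have "integrable unit_cube (\<lambda>x. (s n x)\<^sup>2)"
    proof (rule Bochner_Integration.integrable_bound)
      show "integrable unit_cube (\<lambda>x. 4 * (h x)\<^sup>2)" using L2_D(2)[OF h] by simp
      show "AE x in unit_cube. norm ((s n x)\<^sup>2) \<le> norm (4 * (h x)\<^sup>2)"
      proof (rule AE_I2)
        fix x :: "real ^ 'd" assume "x \<in> space unit_cube"
        from s(3)[OF this, of n] have "\<bar>s n x\<bar>\<^sup>2 \<le> (2 * \<bar>h x\<bar>)\<^sup>2" by (intro power_mono) auto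
        then show "norm ((s n x)\<^sup>2) \<le> norm (4 * (h x)\<^sup>2)" by (simp add: power_mult_distrib)
      qed
    qed (use sm in simp)
    then have sL: "s n \<in> L2 unit_cube" using sm by (simp add: L2_def)
    let ?t = "\<lambda>x. \<Sum>y\<in>s n ` space unit_cube. y * indicator (?B y) x"
    have "(\<integral>x. (s n x - ?t x)\<^sup>2 \<partial>unit_cube) = (\<integral>x. 0 \<partial>(unit_cube :: (real ^ 'd) measure))"
    proof (rule Bochner_Integration.integral_cong[OF refl])
      fix x :: "real ^ 'd" assume "x \<in> space unit_cube"
      from eq[OF this] have "s n x - ?t x = 0" by linarith
      then show "(s n x - ?t x)\<^sup>2 = 0" by (simp only: power2_eq_square mult_zero_left)
    qed
    then have "l2_dist unit_cube (s n) ?t = 0" by (simp only: l2_dist_def l2_norm_def) simp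
    then show ?thesis
      by (intro approximable_closed[OF sL] exI[of _ ?t] conjI *) (simp only:)
  qed
  show ?thesis
  proof (rule approximable_dominated[OF h A s(2)])
    fix n and x :: "real ^ 'd" assume "x \<in> space unit_cube"
    from s(3)[OF this, of n] show "\<bar>h x - s n x\<bar> \<le> 3 * \<bar>h x\<bar>" by auto
  next
    show "integrable unit_cube (\<lambda>x. (3 * \<bar>h x\<bar>)\<^sup>2)" using L2_D(2)[OF h] by (simp add: power_mult_distrib)
  qed auto
qed

lemma P_cube_L2: "J0 \<le> j \<Longrightarrow> h \<in> L2 unit_cube \<Longrightarrow> P_cube W j h \<in> L2 (unit_cube :: (real ^ 'd) measure)"
  unfolding P_cube_def V_cube_alt by (intro l2_onb.proj_L2 onb_cube)

lemma P_cube_V: "J0 \<le> j \<Longrightarrow> h \<in> L2 unit_cube \<Longrightarrow> P_cube W j h \<in> V_cube W j"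
  unfolding P_cube_def V_cube_alt by (intro l2_onb.proj_span onb_cube)

lemma P_cube_best:
  "J0 \<le> j \<Longrightarrow> h \<in> L2 unit_cube \<Longrightarrow> v \<in> V_cube W j \<Longrightarrow>
    l2_dist unit_cube h (P_cube W j h) \<le> l2_dist unit_cube h v"
  unfolding P_cube_def V_cube_alt by (intro l2_onb.proj_best onb_cube)

text \<open>Density gives some fine level \<open>K\<close> at which the projection is within \<open>e\<close> of \<open>h\<close>; from \<open>J\<close> to \<open>K\<close> the details
  \<open>Q\<^sub>i h\<close> telescope into a geometric series.\<close>

lemma P_cube_approx_decay:
  assumes h: "(h :: real ^ 'd \<Rightarrow> real) \<in> L2 unit_cube" and s: "0 < s" and J: "J0 \<le> J"
    and Q: "\<And>j. J0 \<le> j \<Longrightarrow> 2 powr (real j * s) * l2_norm unit_cube (Q_cube W j h) \<le> B"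
  shows "l2_dist unit_cube h (P_cube W J h) \<le> B / (1 - 2 powr (- s)) * 2 powr (- (real J * s))"
proof (rule field_le_epsilon)
  fix e :: real assume "0 < e"
  have B: "0 \<le> B" using Q[OF J] by (rule order_trans[rotated]) auto
  have s1: "2 powr (- s) < 1" using s by (simp add: powr_less_one)
  obtain j v where jv: "J0 \<le> j" "v \<in> V_cube W j" "l2_dist unit_cube h v < e"
    using approximable_L2[OF h] \<open>0 < e\<close> unfolding approximable_def by blast
  define K where "K = max j J"
  have K: "J0 \<le> K" "J \<le> K" using J by (auto simp: K_def)
  have "v \<in> V_cube W K" using V_cube_mono[OF jv(1), of K] jv(2) by (auto simp: K_def)
  then have hK: "l2_dist unit_cube h (P_cube W K h) < e"
    using P_cube_best[OF K(1) h] jv(3) by (meson order_le_less_trans)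
  have Qb: "l2_norm unit_cube (Q_cube W i h) \<le> B * 2 powr (- (real i * s))" if "J0 \<le> i" for i
    using Q[OF that] by (simp add: powr_minus field_simps)
  have "l2_dist unit_cube (P_cube W K h) (P_cube W J h) \<le> (\<Sum>i=J..<K. l2_norm unit_cube (Q_cube W i h))"
    using K(2)
  proof (induction K rule: dec_induct)
    case base
    show ?case by (simp add: l2_dist_def l2_norm_def)
  next
    case (step n)
    have "l2_dist unit_cube (P_cube W (Suc n) h) (P_cube W J h) \<le>
      l2_dist unit_cube (P_cube W (Suc n) h) (P_cube W n h) + l2_dist unit_cube (P_cube W n h) (P_cube W J h)"
      using step J h by (intro l2_dist_triangle P_cube_L2) auto
    also have "l2_dist unit_cube (P_cube W (Suc n) h) (P_cube W n h) = l2_norm unit_cube (Q_cube W n h)"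
      by (simp add: l2_dist_def Q_cube_def[abs_def])
    finally show ?case using step by simp
  qed
  also have "\<dots> \<le> (\<Sum>i=J..<K. B * 2 powr (- (real i * s)))"
    using J by (intro sum_mono Qb) auto
  also have "\<dots> = B * 2 powr (- (real J * s)) * (\<Sum>i<K - J. (2 powr (- s)) ^ i)"
    unfolding sum_distrib_left using K(2)
    by (intro sum.reindex_bij_witness[where i="\<lambda>i. i + J" and j="\<lambda>i. i - J"])
      (auto simp: powr_realpow[symmetric] powr_powr powr_add[symmetric] of_nat_diff algebra_simps)
  also have "(\<Sum>i<K - J. (2 powr (- s)) ^ i) \<le> 1 / (1 - 2 powr (- s))"
  proof -
    have "(\<Sum>i<K - J. (2 powr (- s)) ^ i) = (1 - (2 powr (- s)) ^ (K - J)) / (1 - 2 powr (- s))"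
      using s1 by (subst sum_gp_strict) auto
    also have "\<dots> \<le> 1 / (1 - 2 powr (- s))" using s1 by (intro divide_right_mono) auto
    finally show ?thesis .
  qed
  then have "B * 2 powr (- (real J * s)) * (\<Sum>i<K - J. (2 powr (- s)) ^ i) \<le>
     B * 2 powr (- (real J * s)) * (1 / (1 - 2 powr (- s)))"
    using B by (intro mult_left_mono) auto
  finally have "l2_dist unit_cube (P_cube W K h) (P_cube W J h) \<le> B / (1 - 2 powr (- s)) * 2 powr (- (real J * s))"
    by (simp add: mult_ac)
  moreover have "l2_dist unit_cube h (P_cube W J h) \<le> l2_dist unit_cube h (P_cube W K h) + l2_dist unit_cube (P_cube W K h) (P_cube W J h)"
    using J K h by (intro l2_dist_triangle P_cube_L2) auto
  ultimately show "l2_dist unit_cube h (P_cube W J h) \<le> B / (1 - 2 powr (- s)) * 2 powr (- (real J * s)) + e"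
    using hK by linarith
qed

lemma besov_norm_Q:
  assumes "besov_norm W s h \<le> ennreal B" "0 \<le> B" "J0 \<le> j"
  shows "2 powr (real j * s) * l2_norm unit_cube (Q_cube W j h) \<le> B"
proof -
  have "ennreal (2 powr (real j * s) * l2_norm unit_cube (Q_cube W j h)) \<le>
      (SUP j\<in>{J0..}. ennreal (2 powr (real j * s) * l2_norm unit_cube (Q_cube W j h)))"
    using assms(3) by (intro SUP_upper) auto
  also have "\<dots> \<le> besov_norm W s h" unfolding besov_norm_def by simp
  also note assms(1)
  finally show ?thesis using assms(2) by simp
qed

lemma besov_ball_approx:
  assumes h: "h \<in> besov_ball W s B" and s: "0 < s" and B: "0 \<le> B" and J: "J0 \<le> J"
  shows "l2_dist unit_cube h (P_cube W J h) \<le> B / (1 - 2 powr (- s)) * 2 powr (- (real J * s))"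
  using h besov_norm_Q[OF _ B] unfolding besov_ball_def
  by (intro P_cube_approx_decay s J) auto

lemma besov_ball_antimono:
  assumes "s \<le> t" shows "besov_ball W t B \<subseteq> besov_ball W s B"
proof -
  have "besov_norm W s h \<le> besov_norm W t h" for h :: "real ^ 'b \<Rightarrow> real"
    unfolding besov_norm_def using assms
    by (intro add_mono SUP_mono' ennreal_leI mult_right_mono powr_mono mult_left_mono) auto
  then show ?thesis unfolding besov_ball_def by (auto intro: order_trans)
qed

lemma regression_class_antimono:
  assumes "s \<le> t" shows "regression_class W t B \<subseteq> regression_class W s B"
  using besov_ball_antimono[OF assms] by (auto simp: regression_class_def)

end


section \<open>A design density without any Besov smoothness\<close>

text \<open>The density is \<open>1 + \<delta> \<Sum>\<^sub>k 2\<^sup>-\<^sup>k cos(2 \<pi> F\<^sub>k x\<^sub>1)\<close> with frequencies \<open>F\<^sub>k = 2 powr k\<^sup>2\<close>.  Its coefficient at frequency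
  \<open>F\<^sub>k\<close> decays only geometrically in \<open>k\<close>, that is, more slowly than every negative power of \<open>F\<^sub>k\<close>.  In every
  wavelet basis the functions spanning \<open>V\<^sub>j\<close> have second differences of a positive order, with constants geometric in \<open>j\<close>, so their coefficient at
  \<open>F\<^sub>k\<close> is at most geometric in \<open>j\<close> times a negative power of \<open>F\<^sub>k\<close>.  With \<open>j\<close> proportional to \<open>k\<close>, this beats
  the coefficient of the density, which must therefore sit in the tail beyond level \<open>j\<close>; and a finite Besov norm makes
  that tail smaller than \<open>2\<^sup>-\<^sup>k\<close>.\<close>

lemma hoelder_zygmund_bounded:
  assumes "hoelder_zygmund R f"
  shows "continuous_on UNIV f" "bounded (range f)"
  using assms unfolding hoelder_zygmund_def Let_def by force+

lemma hoelder_zygmund_second_difference: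
  assumes f: "hoelder_zygmund R f"
  shows "\<exists>B. \<forall>x t. \<bar>f (x + t) - 2 * f x + f (x - t)\<bar> \<le> B * \<bar>t\<bar> powr (min R 1)"
proof -
  define m where "m = nat (\<lceil>R\<rceil> - 1)"
  obtain D B where R: "R > 0" and D: "D 0 = f" "\<And>i x. i < m \<Longrightarrow> (D i has_real_derivative D (Suc i) x) (at x)"
    "\<And>i. i \<le> m \<Longrightarrow> bounded (range (D i))"
    "\<And>x t. \<bar>D m (x + t) - 2 * D m x + D m (x - t)\<bar> \<le> B * \<bar>t\<bar> powr (R - real m)"
    using f unfolding hoelder_zygmund_def Let_def m_def[symmetric] by metis
  show ?thesis
  proof (cases "R \<le> 1")
    case True
    have "\<lceil>R\<rceil> \<le> 1" using True by (simp add: ceiling_le_iff)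
    then have "m = 0" by (simp add: m_def)
    then show ?thesis using D(1,4) True by (auto simp: min_def)
  next
    case False
    then have "1 < \<lceil>R\<rceil>" by linarith
    then have m: "0 < m" by (simp add: m_def)
    have "bounded (range (D 1))" using D(3)[of 1] m by auto
    then obtain K where K: "\<And>x. \<bar>D 1 x\<bar> \<le> K" unfolding bounded_iff by auto
    have lip: "\<bar>f x - f y\<bar> \<le> K * \<bar>x - y\<bar>" for x y
    proof -
      have "norm (f x - f y) \<le> K * norm (x - y)"
        using D(2)[OF m] K unfolding D(1)
        by (intro field_differentiable_bound[of UNIV f "D 1"]) auto
      then show ?thesis by simp
    qed
    have "\<bar>f (x + t) - 2 * f x + f (x - t)\<bar> \<le> 2 * K * \<bar>t\<bar> powr (min R 1)" for x t
      using lip[of "x + t" x] lip[of "x - t" x] False by (simp add: min_def)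
    then show ?thesis by blast
  qed
qed

text \<open>The basis enters the argument only through the size of second differences.  The edge functions are cut off at \<open>0\<close>, where
  they may jump, so their second differences are controlled only while all three points stay on the half-line.\<close>

definition sd_bound :: "real \<Rightarrow> (real \<Rightarrow> real) \<Rightarrow> real \<Rightarrow> bool" where
  "sd_bound \<eta> p B \<longleftrightarrow> (\<forall>x. \<bar>p x\<bar> \<le> B) \<and>
     (\<forall>x t. \<bar>t\<bar> \<le> x \<longrightarrow> \<bar>p (x + t) - 2 * p x + p (x - t)\<bar> \<le> B * \<bar>t\<bar> powr \<eta>)"

lemma sd_bound_mono: "sd_bound \<eta> p B \<Longrightarrow> B \<le> B' \<Longrightarrow> sd_bound \<eta> p B'"
  unfolding sd_bound_def by (meson mult_right_mono order_trans powr_ge_zero)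

lemma sd_boundD:
  assumes "sd_bound \<eta> p B" "\<bar>t\<bar> \<le> x" "0 \<le> c"
  shows "\<bar>p (c * x + c * t) - 2 * p (c * x) + p (c * x - c * t)\<bar> \<le> B * (c * \<bar>t\<bar>) powr \<eta>"
proof -
  have e: "\<bar>c * t\<bar> = c * \<bar>t\<bar>" using assms(3) by (simp add: abs_mult)
  moreover have "c * \<bar>t\<bar> \<le> c * x" using assms by (intro mult_left_mono)
  ultimately show ?thesis using assms(1) unfolding sd_bound_def by metis
qed

lemma sd_bound_edge:
  assumes p: "edge_combination \<phi> r p" and r: "\<bar>r\<bar> = 1"
    and b: "\<And>x. \<bar>\<phi> x\<bar> \<le> B" and s: "\<And>x t. \<bar>\<phi> (x + t) - 2 * \<phi> x + \<phi> (x - t)\<bar> \<le> B * \<bar>t\<bar> powr \<eta>"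
  shows "\<exists>B'. sd_bound \<eta> p B'"
proof -
  obtain A :: "int set" and a where A: "finite A"
    "p = (\<lambda>x. indicator {0..} x * (\<Sum>k\<in>A. a k * \<phi> (r * x - of_int k)))"
    using p unfolding edge_combination_def by blast
  have B: "0 \<le> B" using b[of 0] by linarith
  have "\<bar>p x\<bar> \<le> (\<Sum>k\<in>A. \<bar>a k\<bar>) * B" for x
  proof -
    have "\<bar>\<Sum>k\<in>A. a k * \<phi> (r * x - of_int k)\<bar> \<le> (\<Sum>k\<in>A. \<bar>a k\<bar> * B)"
      by (rule order_trans[OF sum_abs]) (auto intro!: sum_mono mult_left_mono b simp: abs_mult)
    moreover have "0 \<le> (\<Sum>k\<in>A. \<bar>a k\<bar>) * B" using B by (simp add: sum_nonneg)
    ultimately show ?thesis by (auto simp: A(2) indicator_def sum_distrib_right)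
  qed
  moreover have "\<bar>p (x + t) - 2 * p x + p (x - t)\<bar> \<le> (\<Sum>k\<in>A. \<bar>a k\<bar>) * B * \<bar>t\<bar> powr \<eta>" if "\<bar>t\<bar> \<le> x" for x t
  proof -
    have "\<bar>p (x + t) - 2 * p x + p (x - t)\<bar> =
      \<bar>\<Sum>k\<in>A. a k * (\<phi> ((r * x - of_int k) + r * t) - 2 * \<phi> (r * x - of_int k) + \<phi> ((r * x - of_int k) - r * t))\<bar>"
      using that by (simp add: A(2) sum.distrib sum_subtractf sum_distrib_left algebra_simps)
    also have "\<dots> \<le> (\<Sum>k\<in>A. \<bar>a k\<bar> * (B * \<bar>t\<bar> powr \<eta>))"
    proof (rule order_trans[OF sum_abs], rule sum_mono)
      fix k
      have "\<bar>\<phi> ((r * x - of_int k) + r * t) - 2 * \<phi> (r * x - of_int k) + \<phi> ((r * x - of_int k) - r * t)\<bar>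
          \<le> B * \<bar>r * t\<bar> powr \<eta>" by (rule s)
      also have "\<bar>r * t\<bar> = \<bar>t\<bar>" using r by (simp only: abs_mult mult_1_left)
      finally show "\<bar>a k * (\<phi> ((r * x - of_int k) + r * t) - 2 * \<phi> (r * x - of_int k) + \<phi> ((r * x - of_int k) - r * t))\<bar>
          \<le> \<bar>a k\<bar> * (B * \<bar>t\<bar> powr \<eta>)"
        unfolding abs_mult[of "a k"] by (rule mult_left_mono) (rule abs_ge_zero)
    qed
    also have "\<dots> = (\<Sum>k\<in>A. \<bar>a k\<bar>) * B * \<bar>t\<bar> powr \<eta>"
      by (simp only: sum_distrib_right[symmetric] mult.assoc)
    finally show ?thesis .
  qed
  ultimately show ?thesis unfolding sd_bound_def by blast
qed

lemma sd_bound_uniform: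
  assumes "finite P" "\<And>p. p \<in> P \<Longrightarrow> \<exists>B. sd_bound \<eta> p B"
  shows "\<exists>B. \<forall>p\<in>P. sd_bound \<eta> p B"
  using assms
proof (induction P rule: finite_induct)
  case (insert p P)
  obtain B' where B': "sd_bound \<eta> p B'" using insert.prems[of p] by blast
  obtain B where "\<forall>p\<in>P. sd_bound \<eta> p B" using insert.IH insert.prems by blast
  with B' show ?case by (intro exI[of _ "max B B'"]) (auto intro: sd_bound_mono)
qed simp

text \<open>The constants grow at most geometrically in \<open>j\<close>: normalisation contributes \<open>2 powr (j / 2) \<le> 2\<^sup>j\<close> and dilation
  \<open>(2\<^sup>j \<bar>t\<bar>) powr \<eta> \<le> 2\<^sup>j \<bar>t\<bar> powr \<eta>\<close>, hence the factor \<open>4\<^sup>j\<close>.\<close>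

lemma (in cdv) phi_I_oscillation:
  "\<exists>\<eta> B. 0 < \<eta> \<and> \<eta> \<le> 1 \<and> (\<forall>j k x. J0 \<le> j \<longrightarrow> k \<in> phi_idx W j \<longrightarrow> \<bar>phi_I W j k x\<bar> \<le> B * 4 ^ j) \<and>
    (\<forall>j k x t. J0 \<le> j \<longrightarrow> k \<in> phi_idx W j \<longrightarrow> \<bar>t\<bar> \<le> x \<longrightarrow> \<bar>t\<bar> \<le> 1 - x \<longrightarrow>
       \<bar>phi_I W j k (x + t) - 2 * phi_I W j k x + phi_I W j k (x - t)\<bar> \<le> B * 4 ^ j * \<bar>t\<bar> powr \<eta>)"
proof -
  let ?\<phi> = "father W" and ?\<eta> = "min R 1"
  have hz: "hoelder_zygmund R ?\<phi>"
    and edges: "\<And>p. p \<in> set (father_left W) \<Longrightarrow> edge_combination ?\<phi> 1 p"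
      "\<And>p. p \<in> set (father_right W) \<Longrightarrow> edge_combination ?\<phi> (-1) p"
    using cdv unfolding cdv_wavelets_def daubechies_system_def by blast+
  have R: "0 < R" using hz by (simp add: hoelder_zygmund_def)
  obtain B1 where B1: "\<And>x t. \<bar>?\<phi> (x + t) - 2 * ?\<phi> x + ?\<phi> (x - t)\<bar> \<le> B1 * \<bar>t\<bar> powr ?\<eta>"
    using hoelder_zygmund_second_difference[OF hz] by blast
  obtain B2 where B2: "\<And>x. \<bar>?\<phi> x\<bar> \<le> B2"
    using hoelder_zygmund_bounded(2)[OF hz] unfolding bounded_iff by auto
  define B3 where "B3 = max B1 B2"
  have B3: "\<bar>?\<phi> x\<bar> \<le> B3" "\<bar>?\<phi> (x + t) - 2 * ?\<phi> x + ?\<phi> (x - t)\<bar> \<le> B3 * \<bar>t\<bar> powr ?\<eta>" for x t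
  proof -
    show "\<bar>?\<phi> x\<bar> \<le> B3" using B2[of x] by (simp add: B3_def)
    have "B1 * \<bar>t\<bar> powr ?\<eta> \<le> B3 * \<bar>t\<bar> powr ?\<eta>" by (intro mult_right_mono) (auto simp: B3_def)
    then show "\<bar>?\<phi> (x + t) - 2 * ?\<phi> x + ?\<phi> (x - t)\<bar> \<le> B3 * \<bar>t\<bar> powr ?\<eta>" using B1[of x t] by linarith
  qed
  have "\<exists>B. \<forall>p\<in>set (father_left W) \<union> set (father_right W). sd_bound ?\<eta> p B"
    using sd_bound_edge[OF edges(1) _ B3] sd_bound_edge[OF edges(2) _ B3] by (intro sd_bound_uniform) auto
  then obtain B4 where B4: "\<And>p. p \<in> set (father_left W) \<union> set (father_right W) \<Longrightarrow> sd_bound ?\<eta> p B4" by blast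
  define B where "B = max B3 B4"
  have B0: "0 \<le> B" using B3(1)[of 0] by (simp add: B_def)
  have edge: "sd_bound ?\<eta> p B" if "p \<in> set (father_left W) \<union> set (father_right W)" for p
    using B4[OF that] by (rule sd_bound_mono) (simp add: B_def)
  have fath: "\<bar>?\<phi> x\<bar> \<le> B" "\<bar>?\<phi> (x + t) - 2 * ?\<phi> x + ?\<phi> (x - t)\<bar> \<le> B * \<bar>t\<bar> powr ?\<eta>" for x t
  proof -
    show "\<bar>?\<phi> x\<bar> \<le> B" using B3(1)[of x] by (simp add: B_def)
    have "B3 * \<bar>t\<bar> powr ?\<eta> \<le> B * \<bar>t\<bar> powr ?\<eta>" by (intro mult_right_mono) (auto simp: B_def)
    then show "\<bar>?\<phi> (x + t) - 2 * ?\<phi> x + ?\<phi> (x - t)\<bar> \<le> B * \<bar>t\<bar> powr ?\<eta>" using B3(2)[of x t] by linarith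
  qed
  have half: "2 powr (real j / 2) \<le> 2 ^ j" for j
    by (simp add: powr_realpow[symmetric])
  have pw: "(2 ^ j * \<bar>t\<bar>) powr ?\<eta> \<le> 2 ^ j * \<bar>t\<bar> powr ?\<eta>" for j t
  proof -
    have "(2 ^ j :: real) powr ?\<eta> \<le> (2 ^ j) powr 1" by (intro powr_mono) auto
    then have "(2 ^ j :: real) powr ?\<eta> \<le> 2 ^ j" by simp
    then show ?thesis by (simp add: powr_mult mult_right_mono)
  qed
  have scale: "2 powr (real j / 2) * z \<le> B * 4 ^ j * y"
    if "z \<le> B * (2 ^ j * y)" "0 \<le> z" for j z y
  proof -
    have "2 powr (real j / 2) * z \<le> 2 ^ j * (B * (2 ^ j * y))"
      using that half[of j] by (intro mult_mono) auto
    also have "\<dots> = B * 4 ^ j * y" by (simp add: power_mult_distrib[symmetric] mult_ac flip: power_add)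
    finally show ?thesis .
  qed
  have bnd: "\<bar>phi_I W j k x\<bar> \<le> B * 4 ^ j" if k: "k \<in> phi_idx W j" for j k x
  proof -
    have "B \<le> B * (2 ^ j * 1)" using B0 by (simp add: mult_le_cancel_left1)
    then have "2 powr (real j / 2) * \<bar>q\<bar> \<le> B * 4 ^ j * 1" if "\<bar>q\<bar> \<le> B" for q
      using that by (intro scale) auto
    note * = this
    show ?thesis
    proof (cases k)
      case (Inner i)
      then show ?thesis using *[OF fath(1)] by (simp add: phi_I_def dilate_def abs_mult)
    next
      case (Left_Edge i)
      then have "father_left W ! i \<in> set (father_left W)"
        using k by (auto simp: phi_idx_def interval_index_def)
      then have "\<bar>(father_left W ! i) y\<bar> \<le> B" for y using edge by (auto simp: sd_bound_def)
      from *[OF this] Left_Edge show ?thesis by (simp add: phi_I_def abs_mult)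
    next
      case (Right_Edge i)
      then have "father_right W ! i \<in> set (father_right W)"
        using k by (auto simp: phi_idx_def interval_index_def)
      then have "\<bar>(father_right W ! i) y\<bar> \<le> B" for y using edge by (auto simp: sd_bound_def)
      from *[OF this] Right_Edge show ?thesis by (simp add: phi_I_def abs_mult)
    qed
  qed
  have osc: "\<bar>phi_I W j k (x + t) - 2 * phi_I W j k x + phi_I W j k (x - t)\<bar> \<le> B * 4 ^ j * \<bar>t\<bar> powr ?\<eta>"
    if k: "k \<in> phi_idx W j" and t: "\<bar>t\<bar> \<le> x" "\<bar>t\<bar> \<le> 1 - x" for j k x t
  proof -
    have main: "\<bar>2 powr (real j / 2) * q1 - 2 * (2 powr (real j / 2) * q2) + 2 powr (real j / 2) * q3\<bar> \<le> B * 4 ^ j * \<bar>t\<bar> powr ?\<eta>"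
      if "\<bar>q1 - 2 * q2 + q3\<bar> \<le> B * (2 ^ j * \<bar>t\<bar>) powr ?\<eta>" for q1 q2 q3
    proof -
      have "\<bar>q1 - 2 * q2 + q3\<bar> \<le> B * (2 ^ j * \<bar>t\<bar> powr ?\<eta>)"
        using that mult_left_mono[OF pw[of j t] B0] by linarith
      from scale[OF this] have "\<bar>2 powr (real j / 2) * (q1 - 2 * q2 + q3)\<bar> \<le> B * 4 ^ j * \<bar>t\<bar> powr ?\<eta>"
        by (simp add: abs_mult)
      then show ?thesis by (simp add: algebra_simps)
    qed
    show ?thesis
    proof (cases k)
      case (Inner i)
      then show ?thesis using main[OF fath(2)[of "2 ^ j * x - of_int i" "2 ^ j * t", simplified abs_mult, simplified]]
        by (simp add: phi_I_def dilate_def algebra_simps)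
    next
      case (Left_Edge i)
      then have "father_left W ! i \<in> set (father_left W)"
        using k by (auto simp: phi_idx_def interval_index_def)
      then have "sd_bound ?\<eta> (father_left W ! i) B" using edge by auto
      from sd_boundD[OF this t(1), of "2 ^ j"] have "\<bar>(father_left W ! i) (2 ^ j * x + 2 ^ j * t) - 2 * (father_left W ! i) (2 ^ j * x)
          + (father_left W ! i) (2 ^ j * x - 2 ^ j * t)\<bar> \<le> B * (2 ^ j * \<bar>t\<bar>) powr ?\<eta>"
        by simp
      from main[OF this] Left_Edge show ?thesis by (simp add: phi_I_def algebra_simps)
    next
      case (Right_Edge i)
      then have "father_right W ! i \<in> set (father_right W)"
        using k by (auto simp: phi_idx_def interval_index_def)
      then have "sd_bound ?\<eta> (father_right W ! i) B" using edge by auto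
      from sd_boundD[OF this t(2), of "2 ^ j"] have "\<bar>(father_right W ! i) (2 ^ j * (1 - x) + 2 ^ j * t) - 2 * (father_right W ! i) (2 ^ j * (1 - x))
          + (father_right W ! i) (2 ^ j * (1 - x) - 2 ^ j * t)\<bar> \<le> B * (2 ^ j * \<bar>t\<bar>) powr ?\<eta>"
        by simp
      then have "\<bar>(father_right W ! i) (2 ^ j * (1 - (x + t))) - 2 * (father_right W ! i) (2 ^ j * (1 - x))
          + (father_right W ! i) (2 ^ j * (1 - (x - t)))\<bar> \<le> B * (2 ^ j * \<bar>t\<bar>) powr ?\<eta>"
        by (simp add: algebra_simps)
      from main[OF this] Right_Edge show ?thesis by (simp add: phi_I_def)
    qed
  qed
  show ?thesis
    by (rule exI[of _ ?\<eta>], rule exI[of _ B]) (use R bnd osc in auto)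
qed

lemma integral_unit_interval:
  "(\<integral>x. f x \<partial>unit_interval) = (\<integral>x. indicator {0..1} x * (f x :: real) \<partial>lborel)"
  unfolding unit_interval_def by (subst integral_restrict_space) auto

text \<open>Shifting by half a period \<open>h\<close> changes the sign of the cosine, so
  \<open>-4 \<integral> V c = \<integral> V(x) (c(x+h) - 2 c(x) + c(x-h)) dx = \<integral> (V(x-h) - 2 V(x) + V(x+h)) c(x) dx\<close> for
  \<open>V = 1\<^sub>[\<^sub>0\<^sub>,\<^sub>1\<^sub>] v\<close>; only two windows of length \<open>2h\<close> see the cut-off.\<close>

lemma cos_integral_second_difference:
  assumes v: "v \<in> borel_measurable unit_interval" and S: "\<And>x. \<bar>v x\<bar> \<le> S"
    and osc: "\<And>x. h \<le> x \<Longrightarrow> h \<le> 1 - x \<Longrightarrow> \<bar>v (x + h) - 2 * v x + v (x - h)\<bar> \<le> D"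
    and h: "h = 1 / (2 * F)" "0 < F" and D: "0 \<le> D"
  shows "\<bar>\<integral>x. v x * cos (2 * pi * F * x) \<partial>unit_interval\<bar> \<le> D + 4 * S * h"
proof -
  let ?c = "\<lambda>x. cos (2 * pi * F * x)"
  define V where "V = (\<lambda>x. indicator {0..1} x * v x)"
  have S0: "0 \<le> S" using S[of 0] by linarith
  have h0: "0 < h" using h by simp
  have ch: "?c (x + h) = - ?c x" "?c (x - h) = - ?c x" for x
  proof -
    have "2 * pi * F * (x + h) = 2 * pi * F * x + pi" "2 * pi * F * (x - h) = 2 * pi * F * x - pi"
      using h by (simp_all add: distrib_left right_diff_distrib)
    then show "?c (x + h) = - ?c x" "?c (x - h) = - ?c x" by (simp_all add: cos_diff)
  qed
  have Vm[measurable]: "V \<in> borel_measurable borel"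
    using v unfolding V_def unit_interval_def by (subst (asm) borel_measurable_restrict_space_iff) auto
  have Vi: "integrable lborel (\<lambda>x. V x * u x)" if [measurable]: "u \<in> borel_measurable borel" and u: "\<And>x. \<bar>u x\<bar> \<le> 1" for u
  proof (rule Bochner_Integration.integrable_bound)
    show "integrable lborel (\<lambda>x. indicator {0..1 :: real} x * S)" by simp
    have "\<bar>v x\<bar> * \<bar>u x\<bar> \<le> S * 1" for x by (intro mult_mono S u S0) auto
    then show "AE x in lborel. norm (V x * u x) \<le> norm (indicator {0..1 :: real} x * S)"
      using S0 by (auto simp: V_def indicator_def abs_mult)
  qed simp
  have c1: "\<bar>?c x\<bar> \<le> 1" for x by simp
  have shift: "(\<integral>x. V x * ?c (x + t) \<partial>lborel) = (\<integral>x. V (x - t) * ?c x \<partial>lborel)" for t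
    by (subst lborel_integral_real_affine[of 1 _ "-t"]) auto
  have shift_i: "integrable lborel (\<lambda>x. V (x - t) * ?c x)" for t
    using lborel_integrable_real_affine[OF Vi[of "\<lambda>x. ?c (x + t)"], of 1 "-t"] by simp
  let ?d = "\<lambda>x. V (x - h) - 2 * V x + V (x + h)"
  have "- 4 * (\<integral>x. V x * ?c x \<partial>lborel) =
      (\<integral>x. V x * ?c (x + h) \<partial>lborel) - 2 * (\<integral>x. V x * ?c x \<partial>lborel) + (\<integral>x. V x * ?c (x + - h) \<partial>lborel)"
    using ch by simp
  also have "\<dots> = (\<integral>x. V (x - h) * ?c x - 2 * (V x * ?c x) + V (x - - h) * ?c x \<partial>lborel)"
    unfolding shift using shift_i[of h] shift_i[of "-h"] Vi[of ?c] by simp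
  also have "\<dots> = (\<integral>x. ?d x * ?c x \<partial>lborel)" by (simp add: algebra_simps)
  finally have eq: "- 4 * (\<integral>x. V x * ?c x \<partial>lborel) = (\<integral>x. ?d x * ?c x \<partial>lborel)" .
  let ?w = "\<lambda>x. indicator {0..1} x * D + (indicator {-h..h} x + indicator {1 - h..1 + h} x) * (4 * S)"
  have ind: "integrable lborel (indicator {a..b} :: real \<Rightarrow> real)" for a b :: real
    by (intro integrable_real_indicator) (auto simp: emeasure_lborel_Icc_eq)
  have wi: "integrable lborel ?w"
    by (intro Bochner_Integration.integrable_add integrable_mult_left ind)
  have Vb: "\<bar>V x\<bar> \<le> S" for x using S[of x] S0 by (auto simp: V_def indicator_def)
  have pt: "\<bar>?d x * ?c x\<bar> \<le> ?w x" for x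
  proof -
    have "\<bar>?d x\<bar> \<le> ?w x"
    proof (cases "h \<le> x \<and> h \<le> 1 - x")
      case True
      then have "?d x = v (x + h) - 2 * v x + v (x - h)" using h0 by (simp add: V_def)
      moreover have "D \<le> ?w x" using True h0 S0 by (auto simp: indicator_def)
      ultimately show ?thesis using osc[of x] True by linarith
    next
      case False
      show ?thesis
      proof (cases "x \<in> {-h..h} \<union> {1 - h..1 + h}")
        case True
        then have "4 * S \<le> ?w x" using S0 D by (auto simp: indicator_def)
        moreover have "\<bar>?d x\<bar> \<le> 4 * S" using Vb[of x] Vb[of "x - h"] Vb[of "x + h"] by linarith
        ultimately show ?thesis by linarith
      next
        case 2: False
        then have "x < - h \<or> 1 + h < x" using False by auto
        then have "?d x = 0" using h0 by (auto simp: V_def indicator_def)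
        then show ?thesis using S0 D by (auto simp: indicator_def)
      qed
    qed
    have "\<bar>?d x * ?c x\<bar> \<le> \<bar>?d x\<bar> * 1" unfolding abs_mult by (intro mult_left_mono) auto
    also have "\<dots> \<le> ?w x" using \<open>\<bar>?d x\<bar> \<le> ?w x\<close> by (simp only: mult_1_right)
    finally show ?thesis .
  qed
  have "\<bar>\<integral>x. ?d x * ?c x \<partial>lborel\<bar> \<le> (\<integral>x. ?w x \<partial>lborel)"
  proof (rule order_trans[OF integral_abs_bound], rule integral_mono)
    have "integrable lborel (\<lambda>x. V (x - h) * ?c x - 2 * (V x * ?c x) + V (x - - h) * ?c x)"
      using shift_i[of h] shift_i[of "-h"] Vi[of ?c] by simp
    then show "integrable lborel (\<lambda>x. \<bar>?d x * ?c x\<bar>)"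
      by (intro integrable_abs) (simp add: algebra_simps)
  qed (use wi pt in auto)
  also have "(\<integral>x. ?w x \<partial>lborel) = D + (2 * h + 2 * h) * (4 * S)"
    using h0 ind by (simp add: distrib_right)
  finally have "\<bar>- 4 * (\<integral>x. V x * ?c x \<partial>lborel)\<bar> \<le> D + 16 * (S * h)"
    unfolding eq by (simp add: mult_ac)
  then have "4 * \<bar>\<integral>x. V x * ?c x \<partial>lborel\<bar> \<le> D + 16 * (S * h)" by (simp only: abs_mult abs_neg_numeral)
  moreover have "(\<integral>x. v x * ?c x \<partial>unit_interval) = (\<integral>x. V x * ?c x \<partial>lborel)"
    unfolding integral_unit_interval V_def by (simp only: mult.assoc)
  ultimately show ?thesis using D by (simp add: mult.assoc)
qed

text \<open>The bound for one basis function, with shift \<open>1 / (2 F)\<close>, is summed over the \<open>2\<^sup>j\<^sup>d\<close> coefficients, each of which is at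
  most the norm of \<open>v\<close>.  In the coordinates other than \<open>i0\<close> the basis functions are tested against the constant \<open>1\<close>
  and contribute at most \<open>1\<close>.\<close>

lemma (in cdv) V_cube_oscillation:
  fixes i0 :: "'d :: finite"
  shows "\<exists>\<eta> K. 0 < \<eta> \<and> 0 \<le> K \<and> (\<forall>j\<ge>J0. \<forall>v\<in>V_cube W j. \<forall>F\<ge>1.
    \<bar>l2_inner unit_cube v (\<lambda>x :: real ^ 'd. cos (2 * pi * F * x $ i0))\<bar>
      \<le> l2_norm unit_cube v * K * (4 * 2 ^ CARD('d)) ^ j * F powr (- \<eta>))"
proof -
  obtain \<eta> B where \<eta>: "0 < \<eta>" "\<eta> \<le> 1"
    and B: "\<And>j k x. J0 \<le> j \<Longrightarrow> k \<in> phi_idx W j \<Longrightarrow> \<bar>phi_I W j k x\<bar> \<le> B * 4 ^ j"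
    and osc: "\<And>j k x t. J0 \<le> j \<Longrightarrow> k \<in> phi_idx W j \<Longrightarrow> \<bar>t\<bar> \<le> x \<Longrightarrow> \<bar>t\<bar> \<le> 1 - x \<Longrightarrow>
       \<bar>phi_I W j k (x + t) - 2 * phi_I W j k x + phi_I W j k (x - t)\<bar> \<le> B * 4 ^ j * \<bar>t\<bar> powr \<eta>"
    using phi_I_oscillation by blast
  define K where "K = 5 * \<bar>B\<bar>"
  have B': "B * x \<le> \<bar>B\<bar> * x" if "0 \<le> x" for x using that by (intro mult_right_mono) auto
  have one_dim: "\<bar>l2_inner unit_interval (phi_I W j k) (\<lambda>t. cos (2 * pi * F * t))\<bar> \<le> K * 4 ^ j * F powr (- \<eta>)"
    if j: "J0 \<le> j" and k: "k \<in> phi_idx W j" and F: "1 \<le> F" for j k F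
  proof -
    define h where "h = 1 / (2 * F)"
    have h: "0 < h" "h \<le> 1" using F by (auto simp: h_def field_simps)
    have "\<bar>l2_inner unit_interval (phi_I W j k) (\<lambda>t. cos (2 * pi * F * t))\<bar>
        \<le> \<bar>B\<bar> * 4 ^ j * h powr \<eta> + 4 * (\<bar>B\<bar> * 4 ^ j) * h"
      unfolding l2_inner_def
    proof (rule cos_integral_second_difference)
      show "phi_I W j k \<in> borel_measurable unit_interval"
        using l2_onb.e_L2[OF onb_interval[OF j] k] by (rule L2_D)
      show "\<bar>phi_I W j k x\<bar> \<le> \<bar>B\<bar> * 4 ^ j" for x
        using B[OF j k, of x] B'[of "4 ^ j"] by (meson order_trans zero_le_numeral zero_le_power)
      show "\<bar>phi_I W j k (x + h) - 2 * phi_I W j k x + phi_I W j k (x - h)\<bar> \<le> \<bar>B\<bar> * 4 ^ j * h powr \<eta>"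
        if "h \<le> x" "h \<le> 1 - x" for x
      proof -
        have "\<bar>phi_I W j k (x + h) - 2 * phi_I W j k x + phi_I W j k (x - h)\<bar> \<le> B * (4 ^ j * h powr \<eta>)"
          using osc[OF j k, of h x] that h by (simp add: mult.assoc)
        also have "\<dots> \<le> \<bar>B\<bar> * (4 ^ j * h powr \<eta>)" by (rule B') simp
        finally show ?thesis by (simp only: mult.assoc)
      qed
    qed (use F in \<open>auto simp: h_def\<close>)
    also have "h \<le> h powr \<eta>" using powr_mono'[of \<eta> 1 h] h \<eta> by simp
    then have "\<bar>B\<bar> * 4 ^ j * h powr \<eta> + 4 * (\<bar>B\<bar> * 4 ^ j) * h \<le> \<bar>B\<bar> * 4 ^ j * h powr \<eta> + 4 * (\<bar>B\<bar> * 4 ^ j) * h powr \<eta>"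
      by (intro add_left_mono mult_left_mono) auto
    also have "\<dots> = K * 4 ^ j * h powr \<eta>" by (simp add: K_def algebra_simps)
    also have "\<dots> \<le> K * 4 ^ j * F powr (- \<eta>)"
    proof (intro mult_left_mono)
      have "h powr \<eta> \<le> (1 / F) powr \<eta>" using F \<eta> h by (intro powr_mono2) (auto simp: h_def field_simps)
      then show "h powr \<eta> \<le> F powr (- \<eta>)" using F by (simp add: powr_divide powr_minus_divide)
    qed (auto simp: K_def)
    finally show ?thesis .
  qed
  have "\<bar>l2_inner unit_cube v (\<lambda>x :: real ^ 'd. cos (2 * pi * F * x $ i0))\<bar>
      \<le> l2_norm unit_cube v * K * (4 * 2 ^ CARD('d)) ^ j * F powr (- \<eta>)"
    if j: "J0 \<le> j" and v: "v \<in> V_cube W j" and F: "1 \<le> F" for j v and F :: real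
  proof -
    interpret I: l2_onb unit_interval "phi_idx W j" "phi_I W j" using j by (rule onb_interval)
    interpret C: l2_onb unit_cube "cube_index W j :: ('d \<Rightarrow> widx) set" "phi_cube W j" using j by (rule onb_cube)
    let ?c = "\<lambda>x :: real ^ 'd. cos (2 * pi * F * x $ i0)"
    let ?q = "\<lambda>i t. if i = i0 then cos (2 * pi * F * t) else 1 :: real"
    have qL: "?q i \<in> L2 unit_interval" for i
      by (rule bounded_L2[where B=1, OF unit_interval.finite_measure_axioms])
        (auto simp: unit_interval_def intro!: measurable_restrict_space1)
    have ceq: "?c = (\<lambda>x. \<Prod>i\<in>UNIV. ?q i (x $ i))" by (simp add: prod.delta)
    have cL: "?c \<in> L2 unit_cube" unfolding ceq by (rule tensor_L2[OF qL])
    obtain a where a: "AE x in unit_cube. v x = (\<Sum>l\<in>cube_index W j. a l * phi_cube W j l x)" and vL: "v \<in> L2 unit_cube"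
      using v by (auto simp: V_cube_alt l2_span_finite_iff[OF C.fin])
    have na: "(l2_norm unit_cube v)\<^sup>2 = (\<Sum>l\<in>cube_index W j. (a l)\<^sup>2)"
      unfolding C.norm_comb[symmetric] using a vL C.comb_L2 by (subst l2_norm_cong_AE) (auto intro: L2_D)
    have one: "\<bar>l2_inner unit_cube (phi_cube W j l) ?c\<bar> \<le> K * 4 ^ j * F powr (- \<eta>)" if l: "l \<in> cube_index W j" for l
    proof -
      have li: "l i \<in> phi_idx W j" for i using l by (simp add: cube_index_def)
      have "l2_inner unit_cube (phi_cube W j l) ?c = (\<Prod>i\<in>UNIV. l2_inner unit_interval (phi_I W j (l i)) (?q i))"
        unfolding ceq phi_cube_def[abs_def] by (intro tensor_inner I.e_L2 li qL)
      then have "\<bar>l2_inner unit_cube (phi_cube W j l) ?c\<bar> = (\<Prod>i\<in>UNIV. \<bar>l2_inner unit_interval (phi_I W j (l i)) (?q i)\<bar>)" by (simp only: abs_prod)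
      also have "\<dots> \<le> (\<Prod>i\<in>UNIV. if i = i0 then K * 4 ^ j * F powr (- \<eta>) else 1)"
      proof (intro prod_mono conjI)
        fix i
        show "\<bar>l2_inner unit_interval (phi_I W j (l i)) (?q i)\<bar> \<le> (if i = i0 then K * 4 ^ j * F powr (- \<eta>) else 1)"
        proof (cases "i = i0")
          case True
          then show ?thesis using one_dim[OF j li F] by simp
        next
          case False
          have "l2_norm unit_interval (phi_I W j (l i)) = 1"
            using I.e_inner[OF li li, of i i] l2_norm_sq[of unit_interval "phi_I W j (l i)"]
            by (simp add: power2_eq_1_iff) (metis l2_norm_nonneg not_one_le_zero le_minus_one_simps(3))
          moreover have "l2_norm unit_interval (\<lambda>_. 1) = 1"
            using unit_interval.prob_space by (simp add: l2_norm_def)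
          ultimately show ?thesis
            using l2_Cauchy_Schwarz[OF I.e_L2[OF li[of i]] qL[of i]] False by simp
        qed
      qed auto
      also have "\<dots> = K * 4 ^ j * F powr (- \<eta>)" by (simp add: prod.delta)
      finally show ?thesis .
    qed
    have "l2_inner unit_cube v ?c = l2_inner unit_cube (\<lambda>x. \<Sum>l\<in>cube_index W j. a l * phi_cube W j l x) ?c"
      by (intro l2_inner_cong_AE L2_D(1) a vL C.comb_L2 cL)
    also have "\<dots> = (\<Sum>l\<in>cube_index W j. a l * l2_inner unit_cube (phi_cube W j l) ?c)"
      by (rule C.inner_comb_left[OF cL])
    finally have "\<bar>l2_inner unit_cube v ?c\<bar> = \<bar>\<Sum>l\<in>cube_index W j. a l * l2_inner unit_cube (phi_cube W j l) ?c\<bar>"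
      by (rule arg_cong)
    also have "\<dots> \<le> (\<Sum>l\<in>cube_index W j. \<bar>a l\<bar> * (K * 4 ^ j * F powr (- \<eta>)))"
      by (rule order_trans[OF sum_abs]) (auto intro!: sum_mono mult_left_mono one simp: abs_mult)
    also have "\<dots> \<le> (\<Sum>l\<in>(cube_index W j :: ('d \<Rightarrow> widx) set). l2_norm unit_cube v * (K * 4 ^ j * F powr (- \<eta>)))"
    proof (intro sum_mono mult_right_mono)
      fix l :: "'d \<Rightarrow> widx" assume "l \<in> cube_index W j"
      then have "\<bar>a l\<bar>\<^sup>2 \<le> (l2_norm unit_cube v)\<^sup>2"
        unfolding na power2_abs by (intro member_le_sum C.fin) auto
      then show "\<bar>a l\<bar> \<le> l2_norm unit_cube v" by (rule power2_le_imp_le) simp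
    qed (auto simp: K_def)
    also have "\<dots> = l2_norm unit_cube v * K * (4 * 2 ^ CARD('d)) ^ j * F powr (- \<eta>)"
      by (simp add: card_cube_index[OF j] power_mult_distrib power_mult[symmetric] mult_ac)
    finally show ?thesis .
  qed
  moreover have "0 \<le> K" by (simp add: K_def)
  ultimately show ?thesis using \<eta>(1) by blast
qed

lemma integral_cos_unit_interval:
  assumes m: "m \<noteq> 0"
  shows "(\<integral>t. cos (2 * pi * of_int m * t) \<partial>unit_interval) = 0"
proof -
  let ?a = "2 * pi * of_int m"
  have a: "?a \<noteq> 0" using m by simp
  have "(\<integral>t. cos (?a * t) * indicator {0..1} t \<partial>lborel) = sin (?a * 1) / ?a - sin (?a * 0) / ?a"
    using a by (intro integral_FTC_Icc_real) (auto intro!: derivative_eq_intros continuous_intros)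
  also have "\<dots> = 0" using sin_integer_2pi[of "of_int m"] by (simp add: mult_ac)
  finally show ?thesis by (simp add: integral_unit_interval mult.commute)
qed

text \<open>Frequencies whose logarithm is quadratic in \<open>k\<close>: any negative power of them outweighs every geometric factor in \<open>k\<close>.\<close>

definition osc_freq :: "nat \<Rightarrow> int" where "osc_freq k = 2 ^ ((k + 1)\<^sup>2)"

lemma osc_freq_pos: "0 < osc_freq k" by (simp add: osc_freq_def)

lemma osc_freq_inj: "osc_freq k = osc_freq m \<longleftrightarrow> k = m"
  by (auto simp: osc_freq_def power2_eq_iff)

lemma integral_cos_cos:
  "(\<integral>t. cos (2 * pi * of_int (osc_freq k) * t) * cos (2 * pi * of_int (osc_freq m) * t) \<partial>unit_interval)
    = (if k = m then 1 / 2 else 0)"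
proof -
  have i: "integrable unit_interval (\<lambda>t. cos (a * t))" for a :: real
    by (rule unit_interval.integrable_const_bound[where B=1])
      (auto simp: unit_interval_def intro!: measurable_restrict_space1)
  have "cos (2 * pi * of_int (osc_freq k) * t) * cos (2 * pi * of_int (osc_freq m) * t) =
      (cos (2 * pi * of_int (osc_freq k - osc_freq m) * t) + cos (2 * pi * of_int (osc_freq k + osc_freq m) * t)) / 2" for t
    by (simp add: cos_times_cos algebra_simps)
  then have "(\<integral>t. cos (2 * pi * of_int (osc_freq k) * t) * cos (2 * pi * of_int (osc_freq m) * t) \<partial>unit_interval) =
     (\<integral>t. (cos (2 * pi * of_int (osc_freq k - osc_freq m) * t) + cos (2 * pi * of_int (osc_freq k + osc_freq m) * t)) / 2 \<partial>unit_interval)"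
    by (simp only:)
  also have "\<dots> = ((\<integral>t. cos (2 * pi * of_int (osc_freq k - osc_freq m) * t) \<partial>unit_interval)
       + (\<integral>t. cos (2 * pi * of_int (osc_freq k + osc_freq m) * t) \<partial>unit_interval)) / 2"
    using i by simp
  also have "(\<integral>t. cos (2 * pi * of_int (osc_freq k + osc_freq m) * t) \<partial>unit_interval) = 0"
    using osc_freq_pos[of k] osc_freq_pos[of m] by (intro integral_cos_unit_interval) linarith
  also have "(\<integral>t. cos (2 * pi * of_int (osc_freq k - osc_freq m) * t) \<partial>unit_interval) = (if k = m then 1 else 0)"
  proof (cases "k = m")
    case True
    then show ?thesis using unit_interval.prob_space by simp
  next
    case False
    then have "osc_freq k - osc_freq m \<noteq> 0" by (simp add: osc_freq_inj)
    from integral_cos_unit_interval[OF this] show ?thesis using False by simp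
  qed
  finally show ?thesis by (cases "k = m") simp_all
qed

definition rough_profile :: "real \<Rightarrow> real" where
  "rough_profile t = (\<Sum>k. (1 / 2) ^ Suc k * cos (2 * pi * of_int (osc_freq k) * t))"

lemma rough_term_le: "\<bar>(1 / 2 :: real) ^ Suc k * cos x\<bar> \<le> (1 / 2) ^ Suc k"
proof -
  have "\<bar>(1 / 2 :: real) ^ Suc k * cos x\<bar> = (1 / 2) ^ Suc k * \<bar>cos x\<bar>" unfolding abs_mult by simp
  also have "\<dots> \<le> (1 / 2) ^ Suc k * 1" by (intro mult_left_mono) auto
  finally show ?thesis by simp
qed

lemma summable_rough: "summable (\<lambda>k. \<bar>(1 / 2 :: real) ^ Suc k * cos (x k)\<bar>)"
  by (rule summable_comparison_test[OF _ sums_summable[OF power_half_series]])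
    (auto intro!: exI[of _ 0] rough_term_le simp del: power_Suc)

lemma rough_profile_le: "\<bar>rough_profile t\<bar> \<le> 1"
proof -
  have "\<bar>rough_profile t\<bar> \<le> (\<Sum>k. \<bar>(1 / 2) ^ Suc k * cos (2 * pi * of_int (osc_freq k) * t)\<bar>)"
    unfolding rough_profile_def by (rule summable_rabs[OF summable_rough])
  also have "\<dots> \<le> (\<Sum>k. (1 / 2) ^ Suc k)"
    by (rule suminf_le[OF rough_term_le summable_rough sums_summable[OF power_half_series]])
  also have "\<dots> = 1" using sums_unique[OF power_half_series] by simp
  finally show ?thesis .
qed

lemma rough_profile_measurable [measurable]: "rough_profile \<in> borel_measurable borel"
  unfolding rough_profile_def[abs_def] by measurable

text \<open>Uniform convergence of the cosine series allows testing it term by term.\<close>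

lemma rough_profile_inner:
  assumes [measurable]: "u \<in> borel_measurable unit_interval" and u: "\<And>t. \<bar>u t\<bar> \<le> 1"
  shows "(\<integral>t. rough_profile t * u t \<partial>unit_interval) =
    (\<Sum>k. (1 / 2) ^ Suc k * (\<integral>t. cos (2 * pi * of_int (osc_freq k) * t) * u t \<partial>unit_interval))"
proof -
  let ?f = "\<lambda>k t. (1 / 2) ^ Suc k * cos (2 * pi * of_int (osc_freq k) * t) * u t"
  have m: "(\<lambda>t. cos (a * t)) \<in> borel_measurable unit_interval" for a :: real
    unfolding unit_interval_def by (intro measurable_restrict_space1) auto
  have b: "\<bar>?f k t\<bar> \<le> (1 / 2) ^ Suc k" for k t
  proof -
    have "\<bar>?f k t\<bar> = \<bar>(1 / 2) ^ Suc k * cos (2 * pi * of_int (osc_freq k) * t)\<bar> * \<bar>u t\<bar>" by (simp add: abs_mult)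
    also have "\<dots> \<le> (1 / 2) ^ Suc k * 1" by (intro mult_mono rough_term_le u) auto
    finally show ?thesis by simp
  qed
  have i: "integrable unit_interval (?f k)" for k
    by (rule unit_interval.integrable_const_bound[where B="(1 / 2) ^ Suc k"]) (use b m in \<open>auto simp del: power_Suc\<close>)
  have s: "summable (\<lambda>k. \<bar>?f k t\<bar>)" for t
    by (rule summable_comparison_test[OF _ sums_summable[OF power_half_series]])
      (use b in \<open>auto intro!: exI[of _ 0] simp del: power_Suc\<close>)
  have "rough_profile t * u t = (\<Sum>k. ?f k t)" for t
    unfolding rough_profile_def by (rule suminf_mult2[OF summable_rabs_cancel[OF summable_rough]])
  then have "(\<integral>t. rough_profile t * u t \<partial>unit_interval) = (\<integral>t. (\<Sum>k. ?f k t) \<partial>unit_interval)" by simp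
  also have "\<dots> = (\<Sum>k. \<integral>t. ?f k t \<partial>unit_interval)"
  proof (rule integral_suminf[OF i])
    show "AE t in unit_interval. summable (\<lambda>k. norm (?f k t))" using s by simp
    show "summable (\<lambda>k. \<integral>t. norm (?f k t) \<partial>unit_interval)"
    proof (rule summable_comparison_test[OF _ sums_summable[OF power_half_series]], intro exI[of _ 0] allI impI)
      fix k
      have "(\<integral>t. norm (?f k t) \<partial>unit_interval) \<le> (\<integral>t. (1 / 2) ^ Suc k \<partial>unit_interval)"
        by (intro integral_mono integrable_norm i) (use b in \<open>auto simp del: power_Suc\<close>)
      then show "norm (\<integral>t. norm (?f k t) \<partial>unit_interval) \<le> (1 / 2) ^ Suc k"
        using unit_interval.prob_space by simp
    qed
  qed
  finally show ?thesis by (simp add: mult.assoc)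
qed

lemma rough_profile_mean: "(\<integral>t. rough_profile t \<partial>unit_interval) = 0"
proof -
  have "(\<integral>t. rough_profile t * 1 \<partial>unit_interval) =
    (\<Sum>k. (1 / 2) ^ Suc k * (\<integral>t. cos (2 * pi * of_int (osc_freq k) * t) * 1 \<partial>unit_interval))"
    by (rule rough_profile_inner) auto
  also have "\<dots> = 0"
  proof -
    have "osc_freq k \<noteq> 0" for k using osc_freq_pos[of k] by simp
    then show ?thesis by (simp add: integral_cos_unit_interval)
  qed
  finally show ?thesis by simp
qed

lemma rough_profile_coeff:
  "(\<integral>t. rough_profile t * cos (2 * pi * of_int (osc_freq m) * t) \<partial>unit_interval) = (1 / 2) ^ Suc m / 2"
proof -
  have "(\<integral>t. rough_profile t * cos (2 * pi * of_int (osc_freq m) * t) \<partial>unit_interval) =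
    (\<Sum>k. (1 / 2) ^ Suc k * (if k = m then 1 / 2 else 0))"
    unfolding integral_cos_cos[symmetric] by (rule rough_profile_inner)
      (auto simp: unit_interval_def intro!: measurable_restrict_space1)
  also have "\<dots> = (\<Sum>k\<in>{m}. (1 / 2) ^ Suc k * (if k = m then 1 / 2 else 0))"
    by (intro suminf_finite) auto
  finally show ?thesis by simp
qed

definition rough_density :: "'d :: finite \<Rightarrow> real \<Rightarrow> real ^ 'd \<Rightarrow> real" where
  "rough_density i0 \<delta> x = 1 + \<delta> * rough_profile (x $ i0)"

lemma measurable_unit_cube_coord:
  "u \<in> borel_measurable borel \<Longrightarrow> (\<lambda>x :: real ^ 'd. u (x $ i)) \<in> borel_measurable unit_cube"
  using measurable_compose[OF nth_borel_measurable[of i], of u borel]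
  unfolding unit_cube_def by (intro measurable_restrict_space1) simp

lemma integral_coord:
  assumes "u \<in> borel_measurable borel"
  shows "(\<integral>x. (u (x $ i) :: real) \<partial>(unit_cube :: (real ^ 'd) measure)) = (\<integral>t. u t \<partial>unit_interval)"
proof -
  have "u \<in> borel_measurable unit_interval"
    using assms unfolding unit_interval_def by (intro measurable_restrict_space1) simp
  then have "(\<integral>t. u t \<partial>distr (unit_cube :: (real ^ 'd) measure) unit_interval (\<lambda>x. x $ i)) =
      (\<integral>x. u (x $ i) \<partial>(unit_cube :: (real ^ 'd) measure))"
    by (intro integral_distr) auto
  then show ?thesis unfolding distr_coord by simp
qed

lemma rough_density_design:
  fixes i0 :: "'d :: finite"
  assumes "c \<le> 1" "1 \<le> C" "0 \<le> \<delta>" "\<delta> \<le> 1 - c" "\<delta> \<le> C - 1"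
  shows "rough_density i0 \<delta> \<in> design_class c C"
proof -
  have m: "rough_density i0 \<delta> \<in> borel_measurable unit_cube"
    unfolding rough_density_def[abs_def] by (intro measurable_unit_cube_coord[of "\<lambda>t. 1 + \<delta> * rough_profile t"]) auto
  have rp: "rough_profile \<in> borel_measurable unit_interval"
    unfolding unit_interval_def by (intro measurable_restrict_space1) auto
  have i: "integrable unit_interval rough_profile"
    by (rule unit_interval.integrable_const_bound[where B=1]) (use rp rough_profile_le in auto)
  have "(\<integral>x. rough_density i0 \<delta> x \<partial>unit_cube) = (\<integral>t. 1 + \<delta> * rough_profile t \<partial>unit_interval)"
    unfolding rough_density_def by (rule integral_coord) auto
  also have "\<dots> = 1" using i unit_interval.prob_space by (simp add: rough_profile_mean)
  finally have "(\<integral>x. rough_density i0 \<delta> x \<partial>unit_cube) = 1" .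
  moreover have "c \<le> rough_density i0 \<delta> x \<and> rough_density i0 \<delta> x \<le> C" for x
  proof -
    have "\<bar>\<delta> * rough_profile (x $ i0)\<bar> \<le> \<delta> * 1"
      unfolding abs_mult using assms rough_profile_le by (intro mult_mono) auto
    then show ?thesis using assms unfolding rough_density_def by linarith
  qed
  ultimately show ?thesis using m by (simp add: design_class_def)
qed

lemma rough_density_not_besov:
  fixes i0 :: "'d :: finite"
  assumes \<delta>: "0 < \<delta>" and \<gamma>: "0 < \<gamma>"
  shows "rough_density i0 \<delta> \<notin> besov_space \<gamma>"
proof
  let ?g = "rough_density i0 \<delta>"
  assume "?g \<in> besov_space \<gamma>"
  then obtain W R N where W: "cdv_wavelets W R N" and fin: "besov_norm W \<gamma> ?g < \<infinity>" and gL: "?g \<in> L2 unit_cube"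
    unfolding besov_space_def by blast
  interpret cdv W R N using W by (rule cdv.intro)
  define B where "B = enn2real (besov_norm W \<gamma> ?g)"
  have B: "besov_norm W \<gamma> ?g \<le> ennreal B" "0 \<le> B" using fin by (auto simp: B_def less_top)
  define B' where "B' = B / (1 - 2 powr (- \<gamma>))"
  have approx: "l2_dist unit_cube ?g (P_cube W j ?g) \<le> B' * 2 powr (- (real j * \<gamma>))" if "J0 \<le> j" for j
    using besov_norm_Q[OF B] that gL \<gamma> unfolding B'_def by (intro P_cube_approx_decay)
  obtain \<eta> K where \<eta>: "0 < \<eta>" "0 \<le> K" and osc: "\<And>j v F. J0 \<le> j \<Longrightarrow> v \<in> V_cube W j \<Longrightarrow> 1 \<le> F \<Longrightarrow>
    \<bar>l2_inner unit_cube v (\<lambda>x :: real ^ 'd. cos (2 * pi * F * x $ i0))\<bar>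
      \<le> l2_norm unit_cube v * K * (4 * 2 ^ CARD('d)) ^ j * F powr (- \<eta>)"
    using V_cube_oscillation[of i0] by blast
  define E :: real where "E = 4 * 2 ^ CARD('d)"
  have E: "1 \<le> E" using one_le_power[of "2 :: real" "CARD('d)"] unfolding E_def by linarith
  define a where "a = nat \<lceil>2 / \<gamma>\<rceil>"
  have a: "2 \<le> real a * \<gamma>"
  proof -
    have "2 / \<gamma> \<le> real a" unfolding a_def by linarith
    then show ?thesis using \<gamma> by (simp add: field_simps)
  qed
  define K' where "K' = l2_norm unit_cube ?g * K * E ^ J0"
  have K': "0 \<le> K'" using \<eta> E by (simp add: K'_def)
  have "2 powr (- \<gamma>) < 1" using \<gamma> by (simp add: powr_less_one)
  then have B'0: "0 \<le> B'" using B by (simp add: B'_def)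
  \<comment> \<open>Compare the coefficients at the \<open>k\<close>-th frequency with the projection to level \<open>J0 + a k\<close>, where \<open>a \<gamma> \<ge> 2\<close> makes the
    Besov tail \<open>O(4\<^sup>-\<^sup>k)\<close>; then multiply by \<open>2\<^sup>k\<close>.\<close>
  have key: "\<delta> / 2 \<le> B' * (1 / 2) ^ k + K' * ((2 * E ^ a) ^ k * (2 powr (- \<eta>)) ^ (k\<^sup>2))" if k: "0 < k" for k
  proof -
    obtain m where m: "k = Suc m" using k by (cases k) auto
    define F where "F = real_of_int (osc_freq m)"
    have F: "F = 2 ^ (k\<^sup>2)" by (simp add: F_def osc_freq_def m)
    have F1: "1 \<le> F" unfolding F by (rule one_le_power) simp
    let ?c = "\<lambda>x :: real ^ 'd. cos (2 * pi * F * x $ i0)"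
    define j where "j = J0 + a * k"
    let ?p = "P_cube W j ?g"
    have j: "J0 \<le> j" by (simp add: j_def)
    have pL: "?p \<in> L2 unit_cube" by (rule P_cube_L2[OF j gL])
    have cL: "?c \<in> L2 unit_cube"
      by (rule bounded_L2[where B=1, OF unit_cube.finite_measure_axioms])
        (auto intro!: measurable_unit_cube_coord[of "\<lambda>t. cos (2 * pi * F * t)"])
    have rp: "rough_profile \<in> borel_measurable unit_interval" "(\<lambda>t. cos (2 * pi * F * t)) \<in> borel_measurable unit_interval"
      unfolding unit_interval_def by (auto intro!: measurable_restrict_space1)
    have int1: "integrable unit_interval (\<lambda>t. cos (2 * pi * F * t))"
      by (rule unit_interval.integrable_const_bound[where B=1]) (use rp in auto)
    have "\<bar>rough_profile t\<bar> * \<bar>cos (2 * pi * F * t)\<bar> \<le> 1 * 1" for t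
      by (intro mult_mono rough_profile_le) auto
    then have int2: "integrable unit_interval (\<lambda>t. rough_profile t * cos (2 * pi * F * t))"
      by (intro unit_interval.integrable_const_bound[where B=1]) (use rp in \<open>auto simp: abs_mult\<close>)
    have "l2_inner unit_cube ?g ?c = (\<integral>t. (1 + \<delta> * rough_profile t) * cos (2 * pi * F * t) \<partial>unit_interval)"
      unfolding l2_inner_def rough_density_def
      by (rule integral_coord[of "\<lambda>t. (1 + \<delta> * rough_profile t) * cos (2 * pi * F * t)"]) auto
    also have "\<dots> = (\<integral>t. cos (2 * pi * F * t) \<partial>unit_interval) + \<delta> * (\<integral>t. rough_profile t * cos (2 * pi * F * t) \<partial>unit_interval)"
      using int1 int2 by (simp add: distrib_right mult.assoc)
    also have "\<dots> = \<delta> * ((1 / 2) ^ k / 2)"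
      using integral_cos_unit_interval[of "osc_freq m"] rough_profile_coeff[of m] osc_freq_pos[of m] by (simp add: F_def m)
    finally have 1: "l2_inner unit_cube ?g ?c = \<delta> * ((1 / 2) ^ k / 2)" .
    have "l2_inner unit_cube ?g ?c = l2_inner unit_cube (\<lambda>x. ?g x - ?p x) ?c + l2_inner unit_cube ?p ?c"
      using gL pL cL by (simp add: l2_inner_diff_left)
    moreover have "\<bar>l2_inner unit_cube (\<lambda>x. ?g x - ?p x) ?c\<bar> \<le> l2_dist unit_cube ?g ?p * l2_norm unit_cube ?c"
      unfolding l2_dist_def using gL pL cL by (intro l2_Cauchy_Schwarz) auto
    moreover have "l2_dist unit_cube ?g ?p * l2_norm unit_cube ?c \<le> B' * (1 / 4) ^ k * 1"
    proof (intro mult_mono)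
      have "2 powr (- (real j * \<gamma>)) \<le> 2 powr (- (2 * real k))"
      proof -
        have "2 * real k \<le> (real a * \<gamma>) * real k" using a by (intro mult_right_mono) auto
        also have "\<dots> \<le> real j * \<gamma>" using \<gamma> by (simp add: j_def algebra_simps)
        finally show ?thesis by (intro powr_mono) auto
      qed
      also have "2 powr (- (2 * real k)) = (1 / 4 :: real) ^ k"
        by (simp add: powr_minus powr_powr[symmetric] powr_realpow power_one_over inverse_eq_divide)
      finally have "B' * 2 powr (- (real j * \<gamma>)) \<le> B' * (1 / 4) ^ k" using B'0 by (rule mult_left_mono)
      then show "l2_dist unit_cube ?g ?p \<le> B' * (1 / 4) ^ k" using approx[OF j] by linarith
      have "(l2_norm unit_cube ?c)\<^sup>2 \<le> (\<integral>x. 1 \<partial>(unit_cube :: (real ^ 'd) measure))"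
        unfolding l2_norm_sq_int using L2_D(2)[OF cL] by (intro integral_mono) (auto simp: power_le_one abs_square_le_1)
      moreover have "measure (unit_cube :: (real ^ 'd) measure) (space unit_cube) = 1" by (rule unit_cube.prob_space)
      ultimately have "(l2_norm unit_cube ?c)\<^sup>2 \<le> 1\<^sup>2" by simp
      then show "l2_norm unit_cube ?c \<le> 1" by (rule power2_le_imp_le) simp
    qed (use B'0 in auto)
    moreover have "\<bar>l2_inner unit_cube ?p ?c\<bar> \<le> K' * ((E ^ a) ^ k * (2 powr (- \<eta>)) ^ (k\<^sup>2))"
    proof -
      have "\<bar>l2_inner unit_cube ?p ?c\<bar> \<le> l2_norm unit_cube ?p * K * E ^ j * F powr (- \<eta>)"
        unfolding E_def by (rule osc[OF j P_cube_V[OF j gL] F1])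
      also have "\<dots> \<le> l2_norm unit_cube ?g * K * E ^ j * F powr (- \<eta>)"
      proof (intro mult_right_mono)
        show "l2_norm unit_cube ?p \<le> l2_norm unit_cube ?g"
          unfolding P_cube_def V_cube_alt by (rule l2_onb.norm_proj_le[OF onb_cube[OF j] gL])
      qed (use \<eta> E in auto)
      also have "F powr (- \<eta>) = (2 powr (- \<eta>)) ^ (k\<^sup>2)"
        unfolding F by (simp add: powr_realpow[symmetric] powr_powr mult.commute)
      also have "E ^ j = E ^ J0 * (E ^ a) ^ k" by (simp add: j_def power_add power_mult)
      finally show ?thesis by (simp add: K'_def mult_ac)
    qed
    ultimately have "\<delta> * ((1 / 2) ^ k / 2) \<le> B' * (1 / 4) ^ k + K' * ((E ^ a) ^ k * (2 powr (- \<eta>)) ^ (k\<^sup>2))"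
      unfolding 1 by linarith
    then have "2 ^ k * (\<delta> * ((1 / 2) ^ k / 2)) \<le> 2 ^ k * (B' * (1 / 4) ^ k + K' * ((E ^ a) ^ k * (2 powr (- \<eta>)) ^ (k\<^sup>2)))"
      by (intro mult_left_mono) auto
    moreover have "2 ^ k * (\<delta> * ((1 / 2) ^ k / 2)) = \<delta> / 2" by (simp add: power_one_over)
    moreover have "2 ^ k * (1 / 4 :: real) ^ k = (1 / 2) ^ k" by (simp add: power_mult_distrib[symmetric])
    then have "2 ^ k * (B' * (1 / 4) ^ k) = B' * (1 / 2) ^ k" by (simp only: mult.left_commute)
    moreover have "2 ^ k * (K' * ((E ^ a) ^ k * (2 powr (- \<eta>)) ^ (k\<^sup>2))) = K' * ((2 * E ^ a) ^ k * (2 powr (- \<eta>)) ^ (k\<^sup>2))"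
      by (simp add: power_mult_distrib mult_ac)
    ultimately show ?thesis by (simp only: distrib_left)
  qed
  define q where "q = 2 * E ^ a"
  define r where "r = 2 powr (- \<eta>)"
  have r: "0 < r" "r < 1" using \<eta> by (auto simp: r_def powr_less_one)
  have lim: "(\<lambda>k. q ^ k * r ^ (k\<^sup>2)) \<longlonglongrightarrow> 0"
  proof (rule Lim_null_comparison)
    have q0: "0 < q" using E by (simp add: q_def)
    have "(\<lambda>k. q * r ^ k) \<longlonglongrightarrow> q * 0" using r by (intro tendsto_intros LIMSEQ_realpow_zero) auto
    then have "eventually (\<lambda>k. q * r ^ k < 1 / 2) sequentially" by (intro order_tendstoD(2)) auto
    then show "eventually (\<lambda>k. norm (q ^ k * r ^ (k\<^sup>2)) \<le> (1 / 2) ^ k) sequentially"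
    proof eventually_elim
      case (elim k)
      have "norm (q ^ k * r ^ (k\<^sup>2)) = (q * r ^ k) ^ k"
        using q0 r by (simp add: power_mult_distrib power2_eq_square power_mult abs_mult)
      also have "\<dots> \<le> (1 / 2) ^ k" using elim q0 r by (intro power_mono) auto
      finally show ?case .
    qed
    show "(\<lambda>k. (1 / 2 :: real) ^ k) \<longlonglongrightarrow> 0" by (intro LIMSEQ_realpow_zero) auto
  qed
  have "(\<lambda>k. B' * (1 / 2) ^ k + K' * (q ^ k * r ^ (k\<^sup>2))) \<longlonglongrightarrow> B' * 0 + K' * 0"
    by (intro tendsto_intros lim LIMSEQ_realpow_zero) auto
  then have "eventually (\<lambda>k. B' * (1 / 2) ^ k + K' * (q ^ k * r ^ (k\<^sup>2)) < \<delta> / 2) sequentially"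
    using \<delta> by (intro order_tendstoD(2)) auto
  then obtain k0 where k0: "\<And>k. k0 \<le> k \<Longrightarrow> B' * (1 / 2) ^ k + K' * (q ^ k * r ^ (k\<^sup>2)) < \<delta> / 2"
    unfolding eventually_sequentially by blast
  show False using k0[of "Suc k0"] key[of "Suc k0"] by (simp add: q_def r_def)
qed

theorem exists_rough_density:
  assumes "c < 1" "1 < C"
  shows "\<exists>g\<in>(design_class c C :: (real ^ 'd \<Rightarrow> real) set). \<forall>\<gamma>>0. g \<notin> besov_space \<gamma>"
proof -
  obtain i0 :: 'd where True by blast
  have "rough_density i0 (min (1 - c) (C - 1)) \<in> design_class c C"
    using assms by (intro rough_density_design) auto
  moreover have "rough_density i0 (min (1 - c) (C - 1)) \<notin> besov_space \<gamma>" if "0 < \<gamma>" for \<gamma>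
    using assms that by (intro rough_density_not_besov) auto
  ultimately show ?thesis by blast
qed


section \<open>Moments in the regression model\<close>

text \<open>Bounded measurable functions.  All functions of the observations used below are of this kind, which makes
  integrability of sums and products a closure property.\<close>

definition bmf :: "'a measure \<Rightarrow> ('a \<Rightarrow> real) set" where
  "bmf M = {h \<in> borel_measurable M. \<exists>B. \<forall>x\<in>space M. \<bar>h x\<bar> \<le> B}"

lemma bmfI: "h \<in> borel_measurable M \<Longrightarrow> (\<And>x. x \<in> space M \<Longrightarrow> \<bar>h x\<bar> \<le> B) \<Longrightarrow> h \<in> bmf M"
  by (auto simp: bmf_def)

lemma bmf_measurable: "h \<in> bmf M \<Longrightarrow> h \<in> borel_measurable M"
  by (simp add: bmf_def)

lemma bmf_const [simp]: "(\<lambda>x. a) \<in> bmf M"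
  by (auto simp: bmf_def)

lemma bmf_add [intro]:
  assumes "u \<in> bmf M" "v \<in> bmf M" shows "(\<lambda>x. u x + v x) \<in> bmf M"
proof -
  obtain A B where "\<And>x. x \<in> space M \<Longrightarrow> \<bar>u x\<bar> \<le> A" "\<And>x. x \<in> space M \<Longrightarrow> \<bar>v x\<bar> \<le> B"
    using assms by (auto simp: bmf_def)
  then show ?thesis using assms[THEN bmf_measurable]
    by (intro bmfI[where B="A + B"]) (auto intro: order_trans[OF abs_triangle_ineq add_mono])
qed

lemma bmf_mult [intro]:
  assumes "u \<in> bmf M" "v \<in> bmf M" shows "(\<lambda>x. u x * v x) \<in> bmf M"
proof -
  obtain A B where "\<And>x. x \<in> space M \<Longrightarrow> \<bar>u x\<bar> \<le> A" "\<And>x. x \<in> space M \<Longrightarrow> \<bar>v x\<bar> \<le> B"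
    using assms by (auto simp: bmf_def)
  then have "\<bar>u x * v x\<bar> \<le> \<bar>A\<bar> * \<bar>B\<bar>" if "x \<in> space M" for x
    unfolding abs_mult using that by (intro mult_mono) fastforce+
  then show ?thesis using assms[THEN bmf_measurable] by (intro bmfI) auto
qed

lemma bmf_scale [intro]: "u \<in> bmf M \<Longrightarrow> (\<lambda>x. a * u x) \<in> bmf M"
  by (rule bmf_mult) auto

lemma bmf_diff [intro]: "u \<in> bmf M \<Longrightarrow> v \<in> bmf M \<Longrightarrow> (\<lambda>x. u x - v x) \<in> bmf M"
  using bmf_add[of u M "\<lambda>x. -1 * v x"] bmf_scale[of v M "-1"] by simp

lemma bmf_power2 [intro]: "u \<in> bmf M \<Longrightarrow> (\<lambda>x. (u x)\<^sup>2) \<in> bmf M"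
  using bmf_mult[of u M u] by (simp add: power2_eq_square)

lemma bmf_divide [intro]: "u \<in> bmf M \<Longrightarrow> (\<lambda>x. u x / a) \<in> bmf M"
  using bmf_scale[of u M "1 / a"] by simp

lemma bmf_sum [intro]: "(\<And>i. i \<in> A \<Longrightarrow> u i \<in> bmf M) \<Longrightarrow> (\<lambda>x. \<Sum>i\<in>A. u i x) \<in> bmf M"
  by (induction A rule: infinite_finite_induct) auto

lemma bmf_compose: "h \<in> N \<rightarrow>\<^sub>M M \<Longrightarrow> u \<in> bmf M \<Longrightarrow> (\<lambda>x. u (h x)) \<in> bmf N"
  by (auto simp: bmf_def dest: measurable_space)

lemma bmf_integrable:
  assumes "finite_measure M" "u \<in> bmf M" shows "integrable M u"
proof -
  obtain B where "\<And>x. x \<in> space M \<Longrightarrow> \<bar>u x\<bar> \<le> B" using assms by (auto simp: bmf_def)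
  then show ?thesis using assms(2)
    by (intro finite_measure.integrable_const_bound[OF assms(1), where B=B] AE_I2 bmf_measurable) auto
qed

lemma bmf_L2: "finite_measure M \<Longrightarrow> u \<in> bmf M \<Longrightarrow> u \<in> L2 M"
  using bmf_integrable[of M "\<lambda>x. (u x)\<^sup>2"] by (auto simp: L2_def bmf_measurable)


abbreviation cube_obs :: "((real ^ 'd) \<times> bool) measure" where
  "cube_obs \<equiv> unit_cube \<Otimes>\<^sub>M count_space UNIV"

text \<open>The Bernoulli distribution clips its parameter to \<open>[0,1]\<close>, so the density of an observation is a measurable
  expression in \<open>f\<close> and \<open>g\<close> at every point.\<close>

context
begin

interpretation pmf_as_function .

lemma pmf_bernoulli_clip:
  "pmf (bernoulli_pmf p) b = (if b then min 1 (max 0 p) else 1 - min 1 (max 0 p))"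
  by transfer simp

end

lemma measurable_obs_case:
  assumes [measurable]: "u \<in> borel_measurable unit_cube" "v \<in> borel_measurable unit_cube"
  shows "(\<lambda>z. if snd z then u (fst z) else v (fst z) :: real) \<in> borel_measurable cube_obs"
  by measurable

lemma sets_pair_law [simp]: "sets (pair_law f g) = sets cube_obs"
  by (simp add: pair_law_def)

lemma space_pair_law [simp]: "space (pair_law f g) = space cube_obs"
  by (simp add: pair_law_def)

lemma sets_sample_law: "sets (sample_law f g n) = sets (sample_space n)"
  unfolding sample_law_def sample_space_def by (intro sets_PiM_cong) auto

lemma space_sample_law: "space (sample_law f g n) = space (sample_space n)"
  by (rule sets_eq_imp_space_eq[OF sets_sample_law])

definition resid :: "(real ^ 'd \<Rightarrow> real) \<Rightarrow> (real ^ 'd) \<times> bool \<Rightarrow> real" where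
  "resid u z = of_bool (snd z) - u (fst z)"

text \<open>The regression function and the design density satisfy their bounds everywhere; arbitrary members of the classes are
  reduced to this case by changing them on null sets.\<close>

locale bernoulli_regression =
  fixes f g :: "real ^ 'd \<Rightarrow> real" and c C :: real
  assumes f_meas: "f \<in> borel_measurable unit_cube" and f_range: "\<And>x. 0 \<le> f x \<and> f x \<le> 1"
    and g_meas: "g \<in> borel_measurable unit_cube" and g_range: "\<And>x. c \<le> g x \<and> g x \<le> C"
    and g_int: "(\<integral>x. g x \<partial>unit_cube) = 1" and c_pos: "0 < c"
begin

abbreviation "P \<equiv> pair_law f g"

lemma C_pos: "0 < C" using g_range[of undefined] c_pos by linarith

lemma g_bmf: "g \<in> bmf unit_cube"
proof (rule bmfI[OF g_meas])
  fix x show "\<bar>g x\<bar> \<le> C" using g_range[of x] c_pos by simp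
qed

lemma f_bmf: "f \<in> bmf unit_cube"
proof (rule bmfI[OF f_meas])
  fix x show "\<bar>f x\<bar> \<le> 1" using f_range[of x] by simp
qed

lemma cube_integrable: "u \<in> bmf (unit_cube :: (real ^ 'd) measure) \<Longrightarrow> integrable unit_cube u"
  by (rule bmf_integrable[OF unit_cube.finite_measure_axioms])

definition w :: "(real ^ 'd) \<times> bool \<Rightarrow> real" where
  "w z = (if snd z then g (fst z) * f (fst z) else g (fst z) * (1 - f (fst z)))"

lemma w_meas: "w \<in> borel_measurable cube_obs"
  unfolding w_def[abs_def] using f_meas g_meas
  by (intro measurable_obs_case[of "\<lambda>x. g x * f x" "\<lambda>x. g x * (1 - f x)"]) auto

lemma w_nonneg: "0 \<le> w z"
  using f_range[of "fst z"] g_range[of "fst z"] c_pos by (auto simp: w_def)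

lemma P_eq: "P = density cube_obs (\<lambda>z. ennreal (w z))"
  unfolding pair_law_def
  using f_range by (intro arg_cong[where f="density cube_obs"] ext) (auto simp: w_def split: prod.split)

sublocale obs: pair_sigma_finite "unit_cube :: (real ^ 'd) measure" "count_space (UNIV :: bool set)"
  unfolding pair_sigma_finite_def
  by (auto intro!: unit_cube.sigma_finite_measure_axioms sigma_finite_measure_count_space_countable)

lemma prob_space_P: "prob_space P"
proof (rule prob_spaceI)
  have gf: "(\<lambda>x. g x * f x) \<in> bmf unit_cube" "(\<lambda>x. g x * (1 - f x)) \<in> bmf unit_cube"
    by (intro bmf_mult bmf_diff g_bmf f_bmf bmf_const)+
  have nn: "0 \<le> g x * f x" "0 \<le> g x * (1 - f x)" for x
    using f_range[of x] g_range[of x] c_pos by auto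
  have "emeasure P (space P) = (\<integral>\<^sup>+z. ennreal (w z) \<partial>cube_obs)"
    using w_meas unfolding P_eq by (subst emeasure_density) (auto intro!: nn_integral_cong)
  also have "\<dots> = (\<integral>\<^sup>+x. \<integral>\<^sup>+b. ennreal (w (x, b)) \<partial>count_space UNIV \<partial>unit_cube)"
    using w_meas by (intro sigma_finite_measure.nn_integral_fst[symmetric]) (auto intro: sigma_finite_measure_count_space_countable)
  also have "\<dots> = (\<integral>\<^sup>+x. ennreal (g x) \<partial>unit_cube)"
  proof (rule nn_integral_cong)
    fix x
    have "(\<integral>\<^sup>+b. ennreal (w (x, b)) \<partial>count_space UNIV) = ennreal (g x * f x) + ennreal (g x * (1 - f x))"
      by (simp add: nn_integral_count_space_finite UNIV_bool w_def add.commute)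
    also have "\<dots> = ennreal (g x)" using nn[of x] by (subst ennreal_plus[symmetric]) (auto simp: algebra_simps)
    finally show "(\<integral>\<^sup>+b. ennreal (w (x, b)) \<partial>count_space UNIV) = ennreal (g x)" .
  qed
  also have "\<dots> = ennreal (\<integral>x. g x \<partial>unit_cube)"
  proof (rule nn_integral_eq_integral[OF cube_integrable[OF g_bmf]], rule AE_I2)
    fix x show "0 \<le> g x" using g_range[of x] c_pos by linarith
  qed
  finally show "emeasure P (space P) = 1" by (simp add: g_int)
qed

sublocale P: prob_space P by (rule prob_space_P)

lemma bmf_P: "bmf P = bmf cube_obs"
  unfolding bmf_def by (simp add: measurable_cong_sets[OF sets_pair_law refl])

lemma P_integrable: "\<psi> \<in> bmf cube_obs \<Longrightarrow> integrable P \<psi>"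
  by (rule bmf_integrable[OF P.finite_measure_axioms]) (simp add: bmf_P)

lemma P_expectation:
  assumes \<psi>: "\<psi> \<in> bmf cube_obs"
  shows "(\<integral>z. \<psi> z \<partial>P) = (\<integral>x. g x * (f x * \<psi> (x, True) + (1 - f x) * \<psi> (x, False)) \<partial>unit_cube)"
proof -
  have m: "\<psi> \<in> borel_measurable cube_obs" using \<psi> by (rule bmf_measurable)
  have "integrable cube_obs (\<lambda>z. w z * \<psi> z)"
    using P_integrable[OF \<psi>] w_nonneg unfolding P_eq by (subst (asm) integrable_real_density) (auto intro: m w_meas)
  then have i: "integrable cube_obs (\<lambda>(x, b). w (x, b) * \<psi> (x, b))" by (simp add: case_prod_unfold)
  have "(\<integral>z. \<psi> z \<partial>P) = (\<integral>z. w z * \<psi> z \<partial>cube_obs)"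
    unfolding P_eq using w_nonneg by (subst integral_real_density) (auto intro: m w_meas)
  also have "\<dots> = (\<integral>x. \<integral>b. w (x, b) * \<psi> (x, b) \<partial>count_space UNIV \<partial>unit_cube)"
    by (subst obs.integral_fst[OF i]) (simp add: case_prod_unfold)
  also have "\<dots> = (\<integral>x. g x * (f x * \<psi> (x, True) + (1 - f x) * \<psi> (x, False)) \<partial>unit_cube)"
    by (intro Bochner_Integration.integral_cong refl)
      (simp add: lebesgue_integral_count_space_finite UNIV_bool w_def algebra_simps)
  finally show ?thesis .
qed

lemma P_expectation_le:
  assumes \<psi>: "\<psi> \<in> bmf cube_obs" and v: "v \<in> bmf unit_cube" and le: "\<And>x b. x \<in> space unit_cube \<Longrightarrow> \<psi> (x, b) \<le> v x"
  shows "(\<integral>z. \<psi> z \<partial>P) \<le> (\<integral>x. g x * v x \<partial>unit_cube)"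
  unfolding P_expectation[OF \<psi>]
proof (rule integral_mono)
  have s: "(\<lambda>x. \<psi> (x, b)) \<in> bmf unit_cube" for b
    by (rule bmf_compose[OF _ \<psi>]) auto
  show "integrable unit_cube (\<lambda>x. g x * (f x * \<psi> (x, True) + (1 - f x) * \<psi> (x, False)))"
    by (intro cube_integrable bmf_mult bmf_add bmf_diff s f_bmf g_bmf bmf_const)
  show "integrable unit_cube (\<lambda>x. g x * v x)" by (intro cube_integrable bmf_mult g_bmf v)
  fix x :: "real ^ 'd" assume x: "x \<in> space unit_cube"
  have "f x * \<psi> (x, True) + (1 - f x) * \<psi> (x, False) \<le> f x * v x + (1 - f x) * v x"
    using f_range[of x] le[OF x] by (intro add_mono mult_left_mono) auto
  then show "g x * (f x * \<psi> (x, True) + (1 - f x) * \<psi> (x, False)) \<le> g x * v x"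
    using g_range[of x] c_pos by (intro mult_left_mono) (auto simp: algebra_simps)
qed

lemma g_integral_bounds:
  assumes v: "v \<in> bmf unit_cube" and nn: "\<And>x. 0 \<le> v x"
  shows "(\<integral>x. g x * v x \<partial>unit_cube) \<le> C * (\<integral>x. v x \<partial>unit_cube)"
    and "c * (\<integral>x. v x \<partial>unit_cube) \<le> (\<integral>x. g x * v x \<partial>unit_cube)"
proof -
  have i: "integrable unit_cube v" "integrable unit_cube (\<lambda>x. g x * v x)"
    by (intro cube_integrable bmf_mult g_bmf v)+
  have "(\<integral>x. g x * v x \<partial>unit_cube) \<le> (\<integral>x. C * v x \<partial>unit_cube)"
    using i g_range nn by (intro integral_mono) (auto intro: mult_right_mono)
  then show "(\<integral>x. g x * v x \<partial>unit_cube) \<le> C * (\<integral>x. v x \<partial>unit_cube)" by simp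
  have "(\<integral>x. c * v x \<partial>unit_cube) \<le> (\<integral>x. g x * v x \<partial>unit_cube)"
    using i g_range nn by (intro integral_mono) (auto intro: mult_right_mono)
  then show "c * (\<integral>x. v x \<partial>unit_cube) \<le> (\<integral>x. g x * v x \<partial>unit_cube)" by simp
qed

lemma obs_fst_bmf: "v \<in> bmf unit_cube \<Longrightarrow> (\<lambda>z. v (fst z)) \<in> bmf cube_obs"
  by (rule bmf_compose[of fst]) auto

lemma resid_bmf: "u \<in> bmf unit_cube \<Longrightarrow> resid u \<in> bmf cube_obs"
proof -
  assume u: "u \<in> bmf unit_cube"
  have "(\<lambda>z. of_bool (snd z) :: real) \<in> bmf cube_obs"
    by (rule bmfI[where B=1]) auto
  then show ?thesis unfolding resid_def[abs_def] by (intro bmf_diff obs_fst_bmf u)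
qed

lemma resid_abs_le: "0 \<le> u x \<Longrightarrow> u x \<le> 1 \<Longrightarrow> \<bar>resid u (x, b)\<bar> \<le> 1"
  by (cases b) (auto simp: resid_def)

lemma resid_mean:
  assumes u: "u \<in> bmf unit_cube" and v: "v \<in> bmf unit_cube"
  shows "(\<integral>z. resid u z * v (fst z) \<partial>P) = (\<integral>x. g x * (f x - u x) * v x \<partial>unit_cube)"
proof -
  have "(\<lambda>z. resid u z * v (fst z)) \<in> bmf cube_obs"
    by (intro bmf_mult resid_bmf obs_fst_bmf u v)
  then show ?thesis
    by (subst P_expectation) (auto intro!: Bochner_Integration.integral_cong simp: resid_def algebra_simps)
qed

end


subsection \<open>Independent blocks of observations\<close>

lemma indep_vars_PiM_coordinates:
  assumes M: "\<And>i. i \<in> I \<Longrightarrow> prob_space (M i)" and I: "I \<noteq> {}" "finite I"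
  shows "prob_space.indep_vars (PiM I M) M (\<lambda>i \<omega>. \<omega> i) I"
proof -
  interpret prob_space "PiM I M" using M by (intro prob_space_PiM)
  have "distr (PiM I M) (PiM I M) (\<lambda>x. \<lambda>i\<in>I. x i) = PiM I M"
  proof -
    have "distr (PiM I M) (PiM I M) (\<lambda>x. \<lambda>i\<in>I. x i) = distr (PiM I M) (PiM I M) (\<lambda>x. x)"
      by (intro distr_cong refl) (auto simp: space_PiM PiE_restrict)
    then show ?thesis by simp
  qed
  also have "\<dots> = (\<Pi>\<^sub>M i\<in>I. distr (PiM I M) (M i) (\<lambda>\<omega>. \<omega> i))"
    using M I by (intro PiM_cong refl distr_PiM_component[symmetric]) auto
  finally show ?thesis using I by (subst indep_vars_iff_distr_eq_PiM') auto
qed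

locale iid_sample =
  fixes P :: "'a measure" and I :: "nat set"
  assumes P_prob: "prob_space P" and I_fin: "finite I" and I_ne: "I \<noteq> {}"
begin

abbreviation "\<Omega> \<equiv> PiM I (\<lambda>_. P)"

sublocale P: prob_space P by (rule P_prob)
sublocale \<Omega>: prob_space \<Omega> by (intro prob_space_PiM P_prob)
sublocale prd: product_sigma_finite "\<lambda>_ :: nat. P" ..

lemma coord_measurable: "i \<in> I \<Longrightarrow> (\<lambda>\<omega>. \<omega> i) \<in> \<Omega> \<rightarrow>\<^sub>M P"
  by (rule measurable_component_singleton)

lemma coord_bmf: "i \<in> I \<Longrightarrow> \<psi> \<in> bmf P \<Longrightarrow> (\<lambda>\<omega>. \<psi> (\<omega> i)) \<in> bmf \<Omega>"
  by (rule bmf_compose[OF coord_measurable])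

lemma \<Omega>_integrable: "h \<in> bmf \<Omega> \<Longrightarrow> integrable \<Omega> h"
  by (rule bmf_integrable[OF \<Omega>.finite_measure_axioms])

lemma P_integrable: "h \<in> bmf P \<Longrightarrow> integrable P h"
  by (rule bmf_integrable[OF P.finite_measure_axioms])

lemma coord_pair_expectation:
  assumes "i \<in> I" "k \<in> I" and \<psi>: "\<psi> \<in> bmf P" "\<xi> \<in> bmf P"
  shows "(\<integral>\<omega>. \<psi> (\<omega> i) * \<xi> (\<omega> k) \<partial>\<Omega>) = (if i = k then (\<integral>z. \<psi> z * \<xi> z \<partial>P) else (\<integral>z. \<psi> z \<partial>P) * (\<integral>z. \<xi> z \<partial>P))"
proof -
  let ?h = "\<lambda>j z. (if j = i then \<psi> z else 1) * (if j = k then \<xi> z else 1)"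
  have h: "integrable P (?h j)" for j
    using \<psi> by (intro P_integrable bmf_mult) (cases "j = i"; cases "j = k"; simp)+
  have "(\<integral>\<omega>. \<psi> (\<omega> i) * \<xi> (\<omega> k) \<partial>\<Omega>) = (\<integral>\<omega>. (\<Prod>j\<in>I. ?h j (\<omega> j)) \<partial>\<Omega>)"
    using assms(1,2) I_fin by (intro Bochner_Integration.integral_cong refl) (simp add: prod.distrib prod.delta)
  also have "\<dots> = (\<Prod>j\<in>I. (\<integral>z. ?h j z \<partial>P))"
    by (rule prd.product_integral_prod[OF I_fin h])
  also have "\<dots> = (if i = k then (\<integral>z. \<psi> z * \<xi> z \<partial>P) else (\<integral>z. \<psi> z \<partial>P) * (\<integral>z. \<xi> z \<partial>P))"
  proof (cases "i = k")
    case True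
    then have "(\<Prod>j\<in>I. (\<integral>z. ?h j z \<partial>P)) = (\<Prod>j\<in>I. if j = i then (\<integral>z. \<psi> z * \<xi> z \<partial>P) else 1)"
      by (intro prod.cong refl) (auto simp: P.prob_space)
    then show ?thesis using True assms(1) I_fin by (simp add: prod.delta)
  next
    case False
    then have "(\<Prod>j\<in>I. (\<integral>z. ?h j z \<partial>P)) =
        (\<Prod>j\<in>I. (if j = i then (\<integral>z. \<psi> z \<partial>P) else 1) * (if j = k then (\<integral>z. \<xi> z \<partial>P) else 1))"
      by (intro prod.cong refl) (auto simp: P.prob_space)
    then show ?thesis using False assms(1,2) I_fin by (simp add: prod.distrib prod.delta)
  qed
  finally show ?thesis .
qed

lemma indep_blocks:
  assumes "A \<subseteq> I" "B \<subseteq> I" "A \<inter> B = {}"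
  shows "\<Omega>.indep_var (PiM A (\<lambda>_. P)) (\<lambda>\<omega>. restrict \<omega> A) (PiM B (\<lambda>_. P)) (\<lambda>\<omega>. restrict \<omega> B)"
  using \<Omega>.indep_var_restrict[OF indep_vars_PiM_coordinates[OF P_prob I_ne I_fin] assms(3,1,2)] .

lemma block_expectation_mult:
  assumes AB: "A \<subseteq> I" "B \<subseteq> I" "A \<inter> B = {}"
    and F: "F \<in> bmf (PiM A (\<lambda>_. P))" and G: "G \<in> bmf (PiM B (\<lambda>_. P))"
  shows "(\<integral>\<omega>. F (restrict \<omega> A) * G (restrict \<omega> B) \<partial>\<Omega>) = (\<integral>\<omega>. F (restrict \<omega> A) \<partial>\<Omega>) * (\<integral>\<omega>. G (restrict \<omega> B) \<partial>\<Omega>)"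
proof -
  have "\<Omega>.indep_var borel (F \<circ> (\<lambda>\<omega>. restrict \<omega> A)) borel (G \<circ> (\<lambda>\<omega>. restrict \<omega> B))"
    by (rule \<Omega>.indep_var_compose[OF indep_blocks[OF AB]]) (use F G in \<open>auto simp: bmf_measurable\<close>)
  moreover have "integrable \<Omega> (F \<circ> (\<lambda>\<omega>. restrict \<omega> A))" "integrable \<Omega> (G \<circ> (\<lambda>\<omega>. restrict \<omega> B))"
    unfolding comp_def by (intro \<Omega>_integrable bmf_compose[OF _ F] bmf_compose[OF _ G] measurable_restrict_subset AB)+
  ultimately show ?thesis using \<Omega>.indep_var_lebesgue_integral by (simp add: comp_def)
qed

lemma block_prob_mult:
  assumes AB: "A \<subseteq> I" "B \<subseteq> I" "A \<inter> B = {}"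
    and X: "X \<in> sets (PiM A (\<lambda>_. P))" and Y: "Y \<in> sets (PiM B (\<lambda>_. P))"
  shows "\<Omega>.prob {\<omega> \<in> space \<Omega>. restrict \<omega> A \<in> X \<and> restrict \<omega> B \<in> Y} =
    \<Omega>.prob {\<omega> \<in> space \<Omega>. restrict \<omega> A \<in> X} * \<Omega>.prob {\<omega> \<in> space \<Omega>. restrict \<omega> B \<in> Y}"
proof -
  have e: "{\<omega> \<in> space \<Omega>. restrict \<omega> A \<in> X \<and> restrict \<omega> B \<in> Y} = (\<lambda>\<omega>. (restrict \<omega> A, restrict \<omega> B)) -` (X \<times> Y) \<inter> space \<Omega>"
    "{\<omega> \<in> space \<Omega>. restrict \<omega> A \<in> X} = (\<lambda>\<omega>. restrict \<omega> A) -` X \<inter> space \<Omega>"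
    "{\<omega> \<in> space \<Omega>. restrict \<omega> B \<in> Y} = (\<lambda>\<omega>. restrict \<omega> B) -` Y \<inter> space \<Omega>" by auto
  show ?thesis unfolding e by (rule \<Omega>.indep_varD[OF indep_blocks[OF AB] X Y])
qed

end

definition block_mean :: "nat set \<Rightarrow> ('a \<Rightarrow> real) \<Rightarrow> (nat \<Rightarrow> 'a) \<Rightarrow> real" where
  "block_mean A \<psi> \<omega> = (\<Sum>i\<in>A. \<psi> (\<omega> i)) / real (card A)"

lemma block_mean_restrict: "block_mean A \<psi> (restrict \<omega> A) = block_mean A \<psi> \<omega>"
  by (simp add: block_mean_def)

lemma block_mean_bmf_block: "\<psi> \<in> bmf P \<Longrightarrow> block_mean A \<psi> \<in> bmf (PiM A (\<lambda>_. P))"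
  unfolding block_mean_def[abs_def]
  by (intro bmf_divide bmf_sum bmf_compose[OF measurable_component_singleton])

lemma block_mean_sum: "(\<Sum>l\<in>L. a l * block_mean A (\<psi> l) \<omega>) = block_mean A (\<lambda>z. \<Sum>l\<in>L. a l * \<psi> l z) \<omega>"
  unfolding block_mean_def
  by (simp add: sum_divide_distrib sum_distrib_left sum.swap[of _ L A])

context iid_sample
begin

lemma block_mean_bmf: "A \<subseteq> I \<Longrightarrow> \<psi> \<in> bmf P \<Longrightarrow> block_mean A \<psi> \<in> bmf \<Omega>"
  unfolding block_mean_def[abs_def] by (intro bmf_divide bmf_sum coord_bmf) auto

text \<open>Centring of one of the two functions already kills all off-diagonal terms.\<close>

lemma block_mean_covariance:
  assumes A: "A \<subseteq> I" "A \<noteq> {}" and \<psi>: "\<psi> \<in> bmf P" "\<xi> \<in> bmf P" and z: "(\<integral>z. \<psi> z \<partial>P) = 0"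
  shows "(\<integral>\<omega>. block_mean A \<psi> \<omega> * block_mean A \<xi> \<omega> \<partial>\<Omega>) = (\<integral>z. \<psi> z * \<xi> z \<partial>P) / real (card A)"
proof -
  have fin: "finite A" using A I_fin finite_subset by blast
  then have m: "0 < real (card A)" using A by (simp add: card_gt_0_iff)
  have int: "integrable \<Omega> (\<lambda>\<omega>. \<psi> (\<omega> i) * \<xi> (\<omega> k))" if "i \<in> A" "k \<in> A" for i k
    using that A by (intro \<Omega>_integrable bmf_mult coord_bmf \<psi>) auto
  have "(\<integral>\<omega>. block_mean A \<psi> \<omega> * block_mean A \<xi> \<omega> \<partial>\<Omega>) =
      (\<integral>\<omega>. (\<Sum>i\<in>A. \<Sum>k\<in>A. \<psi> (\<omega> i) * \<xi> (\<omega> k)) / (real (card A))\<^sup>2 \<partial>\<Omega>)"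
    by (simp add: block_mean_def sum_product power2_eq_square)
  also have "\<dots> = (\<Sum>i\<in>A. \<Sum>k\<in>A. \<integral>\<omega>. \<psi> (\<omega> i) * \<xi> (\<omega> k) \<partial>\<Omega>) / (real (card A))\<^sup>2"
    using int by (simp add: Bochner_Integration.integral_sum integrable_sum)
  also have "(\<Sum>i\<in>A. \<Sum>k\<in>A. \<integral>\<omega>. \<psi> (\<omega> i) * \<xi> (\<omega> k) \<partial>\<Omega>) = (\<Sum>i\<in>A. \<Sum>k\<in>A. if i = k then (\<integral>z. \<psi> z * \<xi> z \<partial>P) else 0)"
    using A z by (intro sum.cong refl) (auto simp: coord_pair_expectation[OF _ _ \<psi>] subset_iff)
  also have "\<dots> = real (card A) * (\<integral>z. \<psi> z * \<xi> z \<partial>P)" using fin by (simp add: sum.delta)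
  finally show ?thesis using m by (simp add: power2_eq_square)
qed

end


section \<open>Estimating a weighted squared distance\<close>

text \<open>For a candidate \<open>u\<close> and an orthonormal family, \<open>E((Y - u(X)) e\<^sub>l(X))\<close> is the \<open>l\<close>-th coefficient of \<open>g (f - u)\<close>.  The sum of
  products of empirical means from two independent blocks estimates the sum \<open>\<theta>\<^sup>2\<close> of the squared coefficients without
  bias, and no knowledge of \<open>g\<close> is required to compute it.\<close>

definition quad_term :: "(real ^ 'd \<Rightarrow> real) \<Rightarrow> (real ^ 'd \<Rightarrow> real) \<Rightarrow> (real ^ 'd) \<times> bool \<Rightarrow> real" where
  "quad_term u v z = resid u z * v (fst z)"

definition quad_stat ::
  "nat set \<Rightarrow> nat set \<Rightarrow> 'i set \<Rightarrow> ('i \<Rightarrow> real ^ 'd \<Rightarrow> real) \<Rightarrow> (real ^ 'd \<Rightarrow> real) \<Rightarrow>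
     (nat \<Rightarrow> (real ^ 'd) \<times> bool) \<Rightarrow> real" where
  "quad_stat A B L e u \<omega> =
     (\<Sum>l\<in>L. block_mean A (quad_term u (e l)) \<omega> * block_mean B (quad_term u (e l)) \<omega>)"

locale quad_setting =
  reg: bernoulli_regression f g c C + smp: iid_sample "pair_law f g" I + onb: l2_onb unit_cube L e
  for f g :: "real ^ 'd \<Rightarrow> real" and c C :: real and I :: "nat set" and L :: "'i set"
    and e :: "'i \<Rightarrow> real ^ 'd \<Rightarrow> real" +
  fixes u :: "real ^ 'd \<Rightarrow> real" and A B :: "nat set" and m :: nat
  assumes e_bmf: "\<And>l. l \<in> L \<Longrightarrow> e l \<in> bmf unit_cube"
    and u_meas: "u \<in> borel_measurable unit_cube" and u_range: "\<And>x. 0 \<le> u x \<and> u x \<le> 1"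
    and A: "A \<subseteq> I" "card A = m" and B: "B \<subseteq> I" "card B = m" and AB: "A \<inter> B = {}" and m: "0 < m"
begin

abbreviation "P \<equiv> pair_law f g"
abbreviation "\<Omega> \<equiv> PiM I (\<lambda>_. pair_law f g)"

definition mu :: "'i \<Rightarrow> real" where "mu l = (\<integral>z. quad_term u (e l) z \<partial>P)"

definition theta_sq :: real where "theta_sq = (\<Sum>l\<in>L. (mu l)\<^sup>2)"

definition cterm :: "'i \<Rightarrow> (real ^ 'd) \<times> bool \<Rightarrow> real" where "cterm l z = quad_term u (e l) z - mu l"

definition cov :: "'i \<Rightarrow> 'i \<Rightarrow> real" where "cov l k = (\<integral>z. cterm l z * cterm k z \<partial>P)"

lemma u_bmf: "u \<in> bmf unit_cube"
proof (rule bmfI[OF u_meas])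
  fix x show "\<bar>u x\<bar> \<le> 1" using u_range[of x] by simp
qed

lemma quad_term_bmf: "v \<in> bmf unit_cube \<Longrightarrow> quad_term u v \<in> bmf P"
  unfolding reg.bmf_P quad_term_def[abs_def] by (intro bmf_mult reg.resid_bmf reg.obs_fst_bmf u_bmf)

lemma cterm_bmf: "l \<in> L \<Longrightarrow> cterm l \<in> bmf P"
  unfolding cterm_def[abs_def] by (intro bmf_diff quad_term_bmf e_bmf bmf_const)

lemma cterm_mean: "l \<in> L \<Longrightarrow> (\<integral>z. cterm l z \<partial>P) = 0"
  unfolding cterm_def using smp.P_integrable[OF quad_term_bmf[OF e_bmf]] reg.P.prob_space
  by (simp add: mu_def)

lemma quad_term_second_moment:
  assumes v: "v \<in> bmf unit_cube"
  shows "(\<integral>z. (quad_term u v z)\<^sup>2 \<partial>P) \<le> C * (l2_norm unit_cube v)\<^sup>2"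
proof -
  have "(quad_term u v (x, b))\<^sup>2 \<le> (v x)\<^sup>2" for x b
  proof -
    have "\<bar>resid u (x, b)\<bar> * \<bar>v x\<bar> \<le> 1 * \<bar>v x\<bar>"
      using u_range[of x] by (intro mult_right_mono reg.resid_abs_le) auto
    then have "\<bar>quad_term u v (x, b)\<bar>\<^sup>2 \<le> \<bar>v x\<bar>\<^sup>2"
      by (intro power_mono) (simp_all add: quad_term_def abs_mult)
    then show ?thesis by simp
  qed
  then have "(\<integral>z. (quad_term u v z)\<^sup>2 \<partial>P) \<le> (\<integral>x. g x * (v x)\<^sup>2 \<partial>unit_cube)"
    using quad_term_bmf[OF v] v unfolding reg.bmf_P by (intro reg.P_expectation_le) auto
  also have "\<dots> \<le> C * (\<integral>x. (v x)\<^sup>2 \<partial>unit_cube)"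
    using v by (intro reg.g_integral_bounds) auto
  finally show ?thesis by (simp add: l2_norm_sq_int)
qed

text \<open>A residual is at most \<open>1\<close> in absolute value and \<open>g \<le> C\<close>; by orthonormality a linear combination of the terms
  therefore has second moment at most \<open>C\<close> times the square sum of its coefficients, whatever the sup norms of the \<open>e\<^sub>l\<close>.\<close>

lemma cterm_comb_second_moment: "(\<integral>z. (\<Sum>l\<in>L. a l * cterm l z)\<^sup>2 \<partial>P) \<le> C * (\<Sum>l\<in>L. (a l)\<^sup>2)"
proof -
  let ?v = "\<lambda>x. \<Sum>l\<in>L. a l * e l x"
  have v: "?v \<in> bmf unit_cube" by (intro bmf_sum bmf_scale e_bmf)
  let ?M = "\<Sum>l\<in>L. a l * mu l"
  have eq: "(\<Sum>l\<in>L. a l * cterm l z) = quad_term u ?v z - ?M" for z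
    by (simp add: cterm_def quad_term_def sum_subtractf right_diff_distrib sum_distrib_left mult_ac)
  have int: "integrable P (quad_term u ?v)" "integrable P (\<lambda>z. (quad_term u ?v z)\<^sup>2)"
    by (intro smp.P_integrable bmf_power2 quad_term_bmf v)+
  have M: "(\<integral>z. quad_term u ?v z \<partial>P) = ?M"
  proof -
    have "(\<integral>z. quad_term u ?v z \<partial>P) = (\<integral>z. (\<Sum>l\<in>L. a l * quad_term u (e l) z) \<partial>P)"
      by (simp add: quad_term_def sum_distrib_left mult_ac)
    also have "\<dots> = ?M"
      using smp.P_integrable[OF quad_term_bmf[OF e_bmf]] by (subst Bochner_Integration.integral_sum) (auto simp: mu_def)
    finally show ?thesis .
  qed
  have "(\<integral>z. (\<Sum>l\<in>L. a l * cterm l z)\<^sup>2 \<partial>P) = (\<integral>z. (quad_term u ?v z)\<^sup>2 - 2 * ?M * quad_term u ?v z + ?M\<^sup>2 \<partial>P)"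
    unfolding eq by (simp add: power2_diff algebra_simps)
  also have "\<dots> = (\<integral>z. (quad_term u ?v z)\<^sup>2 \<partial>P) - ?M\<^sup>2"
    using int M reg.P.prob_space by (simp add: power2_eq_square)
  also have "\<dots> \<le> C * (l2_norm unit_cube ?v)\<^sup>2" using quad_term_second_moment[OF v] zero_le_power2[of ?M] by linarith
  finally show ?thesis by (simp only: onb.norm_comb)
qed

text \<open>Every row of the covariance matrix has square sum at most \<open>C\<^sup>2\<close>: testing the row against itself gives
  \<open>\<parallel>row\<parallel>\<^sup>2 = E(\<psi>\<^sub>l X)\<close> with \<open>X = \<Sum> cov(l,k) \<psi>\<^sub>k\<close>, and \<open>E \<psi>\<^sub>l\<^sup>2 \<le> C\<close>, \<open>E X\<^sup>2 \<le> C \<parallel>row\<parallel>\<^sup>2\<close>.\<close>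

lemma cov_row: assumes l: "l \<in> L" shows "(\<Sum>k\<in>L. (cov l k)\<^sup>2) \<le> C\<^sup>2"
proof -
  let ?X = "\<lambda>z. \<Sum>k\<in>L. cov l k * cterm k z" and ?S = "\<Sum>k\<in>L. (cov l k)\<^sup>2"
  have C: "0 < C" by (rule reg.C_pos)
  have X: "?X \<in> bmf P" by (intro bmf_sum bmf_scale cterm_bmf)
  have i: "integrable P (\<lambda>z. cterm l z * ?X z)" "integrable P (\<lambda>z. (cterm l z)\<^sup>2)" "integrable P (\<lambda>z. (?X z)\<^sup>2)"
    by (intro smp.P_integrable bmf_mult bmf_power2 X cterm_bmf l)+
  have "?S = (\<Sum>k\<in>L. \<integral>z. cov l k * (cterm l z * cterm k z) \<partial>P)"
    by (simp add: cov_def power2_eq_square)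
  also have "\<dots> = (\<integral>z. (\<Sum>k\<in>L. cov l k * (cterm l z * cterm k z)) \<partial>P)"
    by (subst Bochner_Integration.integral_sum) (auto intro!: smp.P_integrable bmf_scale bmf_mult cterm_bmf l)
  also have "\<dots> = (\<integral>z. cterm l z * ?X z \<partial>P)" by (simp add: sum_distrib_left mult_ac)
  also have "\<dots> \<le> (\<integral>z. (C * (cterm l z)\<^sup>2 + (?X z)\<^sup>2 / C) / 2 \<partial>P)"
  proof (rule integral_mono)
    fix z
    have "0 \<le> (C * cterm l z - ?X z)\<^sup>2 / C" using C by simp
    also have "\<dots> = C * (cterm l z)\<^sup>2 + (?X z)\<^sup>2 / C - 2 * (cterm l z * ?X z)"
      using C by (simp add: power2_eq_square field_simps)
    finally show "cterm l z * ?X z \<le> (C * (cterm l z)\<^sup>2 + (?X z)\<^sup>2 / C) / 2" by simp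
  qed (use i in simp_all)
  also have "\<dots> = (C * (\<integral>z. (cterm l z)\<^sup>2 \<partial>P) + (\<integral>z. (?X z)\<^sup>2 \<partial>P) / C) / 2" using i by simp
  also have "\<dots> \<le> (C * C + C * ?S / C) / 2"
  proof -
    have "(\<integral>z. (cterm l z)\<^sup>2 \<partial>P) = (\<integral>z. (\<Sum>k\<in>L. (if k = l then 1 else 0) * cterm k z)\<^sup>2 \<partial>P)"
    proof -
      have "(\<Sum>k\<in>L. (if k = l then 1 else 0) * cterm k z) = cterm l z" for z
        using l onb.fin by (simp add: if_distrib[of "\<lambda>a. a * _"] sum.delta cong: if_cong)
      then show ?thesis by simp
    qed
    also have "\<dots> \<le> C * (\<Sum>k\<in>L. (if k = l then 1 else 0)\<^sup>2)" by (rule cterm_comb_second_moment)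
    also have "(\<Sum>k\<in>L. (if k = l then 1 else 0 :: real)\<^sup>2) = 1"
      using l onb.fin by (simp add: if_distrib[of "\<lambda>a. a\<^sup>2"] sum.delta cong: if_cong)
    finally have "(\<integral>z. (cterm l z)\<^sup>2 \<partial>P) \<le> C" by simp
    then show ?thesis using C cterm_comb_second_moment[of "cov l"]
      by (intro divide_right_mono add_mono mult_left_mono) auto
  qed
  finally show ?thesis using C by (simp add: power2_eq_square)
qed

lemma block_mean_split:
  assumes "D \<subseteq> I" "card D = m" "l \<in> L"
  shows "block_mean D (quad_term u (e l)) \<omega> = mu l + block_mean D (cterm l) \<omega>"
  using assms m by (simp add: block_mean_def cterm_def sum_subtractf field_simps)

lemma linear_second_moment:
  assumes D: "D \<subseteq> I" "card D = m"
  shows "(\<integral>\<omega>. (\<Sum>l\<in>L. mu l * block_mean D (cterm l) \<omega>)\<^sup>2 \<partial>\<Omega>) \<le> C * theta_sq / m"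
proof -
  let ?\<psi> = "\<lambda>z. \<Sum>l\<in>L. mu l * cterm l z"
  have \<psi>: "?\<psi> \<in> bmf P" by (intro bmf_sum bmf_scale cterm_bmf)
  have z: "(\<integral>z. ?\<psi> z \<partial>P) = 0"
    using smp.P_integrable[OF cterm_bmf] by (subst Bochner_Integration.integral_sum) (auto simp: cterm_mean)
  have "D \<noteq> {}" using D m by auto
  then have "(\<integral>\<omega>. (\<Sum>l\<in>L. mu l * block_mean D (cterm l) \<omega>)\<^sup>2 \<partial>\<Omega>) = (\<integral>z. ?\<psi> z * ?\<psi> z \<partial>P) / real (card D)"
    unfolding block_mean_sum power2_eq_square using smp.block_mean_covariance[OF D(1) _ \<psi> \<psi> z] by simp
  also have "\<dots> \<le> C * theta_sq / m"
    using cterm_comb_second_moment[of mu] unfolding D(2) theta_sq_def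
    by (intro divide_right_mono) (auto simp: power2_eq_square)
  finally show ?thesis .
qed

text \<open>By independence of the blocks the second moment is the squared Frobenius norm of the covariance matrix divided by
  \<open>m\<^sup>2\<close>, and every row contributes at most \<open>C\<^sup>2\<close>.\<close>

lemma bilinear_second_moment:
  "(\<integral>\<omega>. (\<Sum>l\<in>L. block_mean A (cterm l) \<omega> * block_mean B (cterm l) \<omega>)\<^sup>2 \<partial>\<Omega>) \<le> card L * C\<^sup>2 / m\<^sup>2"
proof -
  let ?a = "\<lambda>l \<omega>. block_mean A (cterm l) \<omega>" and ?b = "\<lambda>l \<omega>. block_mean B (cterm l) \<omega>"
  have ne: "A \<noteq> {}" "B \<noteq> {}" using A B m by auto
  have bm: "?a l \<in> bmf \<Omega>" "?b l \<in> bmf \<Omega>" if "l \<in> L" for l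
    using that by (auto intro!: smp.block_mean_bmf A B cterm_bmf)
  have E: "(\<integral>\<omega>. (?a l \<omega> * ?a k \<omega>) * (?b l \<omega> * ?b k \<omega>) \<partial>\<Omega>) = (cov l k)\<^sup>2 / m\<^sup>2" if l: "l \<in> L" "k \<in> L" for l k
  proof -
    have "(\<integral>\<omega>. (?a l \<omega> * ?a k \<omega>) * (?b l \<omega> * ?b k \<omega>) \<partial>\<Omega>) = (\<integral>\<omega>. ?a l \<omega> * ?a k \<omega> \<partial>\<Omega>) * (\<integral>\<omega>. ?b l \<omega> * ?b k \<omega> \<partial>\<Omega>)"
      using smp.block_expectation_mult[OF A(1) B(1) AB, of "\<lambda>\<omega>. ?a l \<omega> * ?a k \<omega>" "\<lambda>\<omega>. ?b l \<omega> * ?b k \<omega>"]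
      unfolding block_mean_restrict using l by (auto intro!: bmf_mult block_mean_bmf_block cterm_bmf)
    also have "\<dots> = (cov l k / m) * (cov l k / m)"
      using smp.block_mean_covariance[OF A(1) ne(1) cterm_bmf[OF l(1)] cterm_bmf[OF l(2)] cterm_mean[OF l(1)]]
        smp.block_mean_covariance[OF B(1) ne(2) cterm_bmf[OF l(1)] cterm_bmf[OF l(2)] cterm_mean[OF l(1)]]
      by (simp add: A B cov_def)
    finally show ?thesis by (simp add: power2_eq_square)
  qed
  have i: "integrable \<Omega> (\<lambda>\<omega>. (?a l \<omega> * ?a k \<omega>) * (?b l \<omega> * ?b k \<omega>))" if "l \<in> L" "k \<in> L" for l k
    using that by (intro smp.\<Omega>_integrable bmf_mult bm)
  have "(\<integral>\<omega>. (\<Sum>l\<in>L. ?a l \<omega> * ?b l \<omega>)\<^sup>2 \<partial>\<Omega>) = (\<integral>\<omega>. (\<Sum>l\<in>L. \<Sum>k\<in>L. (?a l \<omega> * ?a k \<omega>) * (?b l \<omega> * ?b k \<omega>)) \<partial>\<Omega>)"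
    by (simp add: power2_eq_square sum_product mult_ac)
  also have "\<dots> = (\<Sum>l\<in>L. \<Sum>k\<in>L. (cov l k)\<^sup>2 / m\<^sup>2)"
    using i E by (simp add: Bochner_Integration.integral_sum integrable_sum)
  also have "\<dots> = (\<Sum>l\<in>L. (\<Sum>k\<in>L. (cov l k)\<^sup>2) / m\<^sup>2)" by (simp add: sum_divide_distrib)
  also have "\<dots> \<le> (\<Sum>l\<in>L. C\<^sup>2 / m\<^sup>2)" using cov_row by (intro sum_mono divide_right_mono) auto
  finally show ?thesis by simp
qed

lemma quad_stat_bmf: "quad_stat A B L e u \<in> bmf \<Omega>"
  unfolding quad_stat_def[abs_def]
  by (intro bmf_sum bmf_mult smp.block_mean_bmf A B quad_term_bmf e_bmf)

lemma quad_stat_second_moment: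
  "(\<integral>\<omega>. (quad_stat A B L e u \<omega> - theta_sq)\<^sup>2 \<partial>\<Omega>) \<le> 6 * C * theta_sq / m + 3 * C\<^sup>2 * card L / m\<^sup>2"
proof -
  let ?l = "\<lambda>D \<omega>. \<Sum>l\<in>L. mu l * block_mean D (cterm l) \<omega>"
  let ?q = "\<lambda>\<omega>. \<Sum>l\<in>L. block_mean A (cterm l) \<omega> * block_mean B (cterm l) \<omega>"
  have eq: "quad_stat A B L e u \<omega> - theta_sq = ?l A \<omega> + ?l B \<omega> + ?q \<omega>" for \<omega>
  proof -
    have "quad_stat A B L e u \<omega> = (\<Sum>l\<in>L. (mu l)\<^sup>2 + mu l * block_mean A (cterm l) \<omega> + mu l * block_mean B (cterm l) \<omega>
        + block_mean A (cterm l) \<omega> * block_mean B (cterm l) \<omega>)"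
      unfolding quad_stat_def using A B
      by (intro sum.cong refl) (simp add: block_mean_split algebra_simps power2_eq_square)
    then show ?thesis by (simp add: sum.distrib theta_sq_def)
  qed
  have lb: "?l D \<in> bmf \<Omega>" if "D \<subseteq> I" for D
    using that by (intro bmf_sum bmf_scale smp.block_mean_bmf cterm_bmf)
  have qb: "?q \<in> bmf \<Omega>" by (intro bmf_sum bmf_mult smp.block_mean_bmf A B cterm_bmf)
  have i: "integrable \<Omega> (\<lambda>\<omega>. (?l A \<omega>)\<^sup>2)" "integrable \<Omega> (\<lambda>\<omega>. (?l B \<omega>)\<^sup>2)" "integrable \<Omega> (\<lambda>\<omega>. (?q \<omega>)\<^sup>2)"
    by (intro smp.\<Omega>_integrable bmf_power2 lb qb A B)+
  have "(\<integral>\<omega>. (quad_stat A B L e u \<omega> - theta_sq)\<^sup>2 \<partial>\<Omega>) \<le> (\<integral>\<omega>. 3 * ((?l A \<omega>)\<^sup>2 + (?l B \<omega>)\<^sup>2 + (?q \<omega>)\<^sup>2) \<partial>\<Omega>)"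
  proof (rule integral_mono)
    show "integrable \<Omega> (\<lambda>\<omega>. (quad_stat A B L e u \<omega> - theta_sq)\<^sup>2)"
      by (intro smp.\<Omega>_integrable bmf_power2 bmf_diff quad_stat_bmf bmf_const)
    show "integrable \<Omega> (\<lambda>\<omega>. 3 * ((?l A \<omega>)\<^sup>2 + (?l B \<omega>)\<^sup>2 + (?q \<omega>)\<^sup>2))" using i by simp
    fix \<omega>
    have "(x + y + z)\<^sup>2 \<le> 3 * (x\<^sup>2 + y\<^sup>2 + z\<^sup>2)" for x y z :: real
    proof -
      have "0 \<le> (x - y)\<^sup>2 + (y - z)\<^sup>2 + (x - z)\<^sup>2" by simp
      also have "\<dots> = 3 * (x\<^sup>2 + y\<^sup>2 + z\<^sup>2) - (x + y + z)\<^sup>2" by (simp add: power2_eq_square algebra_simps)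
      finally show ?thesis by simp
    qed
    then show "(quad_stat A B L e u \<omega> - theta_sq)\<^sup>2 \<le> 3 * ((?l A \<omega>)\<^sup>2 + (?l B \<omega>)\<^sup>2 + (?q \<omega>)\<^sup>2)"
      unfolding eq .
  qed
  also have "\<dots> = 3 * ((\<integral>\<omega>. (?l A \<omega>)\<^sup>2 \<partial>\<Omega>) + (\<integral>\<omega>. (?l B \<omega>)\<^sup>2 \<partial>\<Omega>) + (\<integral>\<omega>. (?q \<omega>)\<^sup>2 \<partial>\<Omega>))"
    using i by simp
  also have "\<dots> \<le> 3 * (C * theta_sq / m + C * theta_sq / m + card L * C\<^sup>2 / m\<^sup>2)"
    by (intro mult_left_mono add_mono linear_second_moment bilinear_second_moment A B) auto
  finally show ?thesis by (simp add: field_simps)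
qed

text \<open>The statistic determines \<open>\<theta>\<^sup>2\<close> up to a factor \<open>2\<close> and an additive \<open>\<surd>(card L) / m\<close>: the linear part of the error
  is proportional to \<open>\<theta>\<close> itself and is absorbed by the multiplicative slack.\<close>

lemma quad_stat_deviation:
  assumes \<eta>: "0 < \<eta>" "\<eta> \<le> 1" and r: "sqrt (card L) / m \<le> r" and L: "L \<noteq> {}"
  shows "\<P>(\<omega> in \<Omega>. \<not> (quad_stat A B L e u \<omega> \<le> 2 * theta_sq + 12 * C / \<eta> * r \<and>
      theta_sq \<le> 2 * quad_stat A B L e u \<omega> + 12 * C / \<eta> * r)) \<le> \<eta>"
proof -
  define K where "K = 12 * C / \<eta>"
  have C: "0 < C" by (rule reg.C_pos)
  have K: "0 < K" using C \<eta> by (simp add: K_def)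
  have L1: "1 \<le> real (card L)" using L onb.fin by (simp add: Suc_le_eq card_gt_0_iff)
  have m0: "0 < real m" using m by simp
  have rm: "1 / m \<le> r"
  proof -
    have "1 / m \<le> sqrt (card L) / m" using L1 m0 by (intro divide_right_mono) auto
    then show ?thesis using r by linarith
  qed
  have r0: "0 < r" using rm m0 by (meson less_le_trans zero_less_divide_1_iff)
  have rL: "card L / m\<^sup>2 \<le> r\<^sup>2"
  proof -
    have "(sqrt (card L) / m)\<^sup>2 \<le> r\<^sup>2" using r m0 by (intro power_mono) auto
    then show ?thesis by (simp add: power_divide)
  qed
  have \<theta>: "0 \<le> theta_sq" by (simp add: theta_sq_def sum_nonneg)
  \<comment> \<open>A deviation below \<open>t\<close> implies both inequalities; \<open>t\<^sup>2\<close> contains the cross term \<open>K r \<theta>\<^sup>2 / 2\<close> that dominates the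
    linear part of the variance.\<close>
  define t where "t = theta_sq / 2 + K * r / 2"
  have t: "0 < t" using \<theta> K r0 by (simp add: t_def add_nonneg_pos)
  let ?Z = "\<lambda>\<omega>. quad_stat A B L e u \<omega> - theta_sq"
  have Z: "?Z \<in> bmf \<Omega>" by (intro bmf_diff quad_stat_bmf bmf_const)
  have "\<P>(\<omega> in \<Omega>. \<not> (quad_stat A B L e u \<omega> \<le> 2 * theta_sq + K * r \<and> theta_sq \<le> 2 * quad_stat A B L e u \<omega> + K * r))
      \<le> \<P>(\<omega> in \<Omega>. t \<le> \<bar>?Z \<omega>\<bar>)"
    using bmf_measurable[OF Z] bmf_measurable[OF quad_stat_bmf] \<theta> K r0
    by (intro smp.\<Omega>.finite_measure_mono) (auto simp: t_def)
  also have "\<dots> \<le> (\<integral>\<omega>. (?Z \<omega>)\<^sup>2 \<partial>\<Omega>) / t\<^sup>2"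
    by (rule smp.\<Omega>.second_moment_method[OF bmf_measurable[OF Z] smp.\<Omega>_integrable[OF bmf_power2[OF Z]] t])
  also have "\<dots> \<le> \<eta>"
  proof -
    have "(\<integral>\<omega>. (?Z \<omega>)\<^sup>2 \<partial>\<Omega>) \<le> 6 * C * theta_sq * (1 / m) + 3 * C\<^sup>2 * (card L / m\<^sup>2)"
      using quad_stat_second_moment by simp
    also have "\<dots> \<le> 6 * C * theta_sq * r + 3 * C\<^sup>2 * r\<^sup>2"
      using \<theta> C rm rL by (intro add_mono mult_left_mono) auto
    also have "\<dots> \<le> \<eta> * (K * (theta_sq * r) / 2) + \<eta> * (K\<^sup>2 * r\<^sup>2 / 4)"
    proof (intro add_mono)
      show "6 * C * theta_sq * r \<le> \<eta> * (K * (theta_sq * r) / 2)" using \<eta> by (simp add: K_def)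
      have "3 * C\<^sup>2 * \<eta> \<le> 36 * C\<^sup>2" using \<eta> by (simp add: mult_left_mono mult.commute[of _ \<eta>] mult_right_mono mult_le_one)
      then have "3 * C\<^sup>2 \<le> \<eta> * (K\<^sup>2 / 4)" using \<eta> by (simp add: K_def power2_eq_square field_simps)
      from mult_right_mono[OF this, of "r\<^sup>2"] show "3 * C\<^sup>2 * r\<^sup>2 \<le> \<eta> * (K\<^sup>2 * r\<^sup>2 / 4)" by simp
    qed
    also have "\<dots> \<le> \<eta> * t\<^sup>2"
    proof -
      have "K * (theta_sq * r) / 2 + K\<^sup>2 * r\<^sup>2 / 4 \<le> t\<^sup>2" using \<theta>
        by (simp add: t_def power2_eq_square algebra_simps)
      then show ?thesis using \<eta> by (simp only: distrib_left[symmetric] mult_left_mono less_imp_le)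
    qed
    finally show ?thesis using t by (simp add: divide_le_eq)
  qed
  finally show ?thesis by (simp add: K_def)
qed

text \<open>\<open>\<theta>\<close> is the norm of the projection of \<open>g (f - u)\<close>.  Although \<open>g\<close> may be arbitrarily rough, this norm is
  equivalent to \<open>\<parallel>f - u\<parallel>\<close> up to the distance of \<open>f - u\<close> itself from the span: test \<open>g (f - u)\<close> against an element
  close to \<open>f - u\<close> and use \<open>c \<le> g \<le> C\<close>.\<close>

lemma mu_eq: "l \<in> L \<Longrightarrow> mu l = l2_inner unit_cube (\<lambda>x. g x * (f x - u x)) (e l)"
  unfolding mu_def quad_term_def l2_inner_def using e_bmf by (intro reg.resid_mean u_bmf)

lemma fu_bmf: "(\<lambda>x. f x - u x) \<in> bmf unit_cube" "(\<lambda>x. g x * (f x - u x)) \<in> bmf unit_cube"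
  by (intro bmf_mult bmf_diff reg.f_bmf reg.g_bmf u_bmf)+

lemma weighted_norm_le:
  assumes "v \<in> bmf unit_cube"
  shows "l2_norm unit_cube (\<lambda>x. g x * v x) \<le> C * l2_norm unit_cube v"
proof (rule power2_le_imp_le)
  have "(l2_norm unit_cube (\<lambda>x. g x * v x))\<^sup>2 \<le> (\<integral>x. C\<^sup>2 * (v x)\<^sup>2 \<partial>unit_cube)"
    unfolding l2_norm_sq_int
  proof (rule integral_mono)
    show "integrable unit_cube (\<lambda>x. (g x * v x)\<^sup>2)" "integrable unit_cube (\<lambda>x. C\<^sup>2 * (v x)\<^sup>2)"
      by (intro reg.cube_integrable bmf_power2 bmf_mult reg.g_bmf assms bmf_const)+
    fix x :: "real ^ 'd"
    have "(g x)\<^sup>2 \<le> C\<^sup>2" using reg.g_range[of x] reg.c_pos by (intro power_mono) auto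
    then show "(g x * v x)\<^sup>2 \<le> C\<^sup>2 * (v x)\<^sup>2" by (simp add: power_mult_distrib mult_right_mono)
  qed
  then show "(l2_norm unit_cube (\<lambda>x. g x * v x))\<^sup>2 \<le> (C * l2_norm unit_cube v)\<^sup>2"
    by (simp add: power_mult_distrib l2_norm_sq_int)
qed (use reg.C_pos in simp)

lemma theta_le: "theta_sq \<le> (C * l2_dist unit_cube f u)\<^sup>2"
proof -
  have "theta_sq = (\<Sum>l\<in>L. (l2_inner unit_cube (\<lambda>x. g x * (f x - u x)) (e l))\<^sup>2)"
    unfolding theta_sq_def by (intro sum.cong refl) (simp add: mu_eq)
  also have "\<dots> \<le> (l2_norm unit_cube (\<lambda>x. g x * (f x - u x)))\<^sup>2"
    by (rule onb.bessel[OF bmf_L2[OF unit_cube.finite_measure_axioms fu_bmf(2)]])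
  also have "\<dots> \<le> (C * l2_dist unit_cube f u)\<^sup>2"
    unfolding l2_dist_def by (intro power_mono weighted_norm_le fu_bmf) auto
  finally show ?thesis .
qed

lemma dist_le_theta:
  assumes v: "v \<in> l2_span unit_cube L e" and b: "l2_dist unit_cube (\<lambda>x. f x - u x) v \<le> b"
  shows "l2_dist unit_cube f u \<le> sqrt theta_sq / c + (C / c + 1) * b"
proof -
  let ?h = "\<lambda>x. f x - u x"
  have c: "0 < c" by (rule reg.c_pos)
  obtain a where a: "AE x in unit_cube. v x = (\<Sum>l\<in>L. a l * e l x)" and vL: "v \<in> L2 unit_cube"
    using v by (auto simp: l2_span_finite_iff[OF onb.fin])
  define w where "w = (\<lambda>x. \<Sum>l\<in>L. a l * e l x)"
  have w: "w \<in> bmf unit_cube" unfolding w_def by (intro bmf_sum bmf_scale e_bmf)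
  have hL: "?h \<in> L2 unit_cube" and wL: "w \<in> L2 unit_cube"
    by (intro bmf_L2 unit_cube.finite_measure_axioms fu_bmf w)+
  have b': "l2_dist unit_cube ?h w \<le> b"
    using b a vL wL hL unfolding l2_dist_commute[of _ ?h] w_def
    by (subst l2_dist_cong_AE[of _ _ v]) (auto intro: L2_D)
  have bm: "(\<lambda>x. g x * ?h x) \<in> L2 unit_cube" "(\<lambda>x. g x * w x) \<in> L2 unit_cube"
    "(\<lambda>x. g x * (?h x - w x)) \<in> L2 unit_cube" "(\<lambda>x. ?h x - w x) \<in> bmf unit_cube"
    by (intro bmf_L2 unit_cube.finite_measure_axioms bmf_mult bmf_diff reg.g_bmf fu_bmf w)+
  have "c * (l2_norm unit_cube w)\<^sup>2 \<le> l2_inner unit_cube (\<lambda>x. g x * w x) w"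
    using reg.g_integral_bounds(2)[of "\<lambda>x. (w x)\<^sup>2"] bmf_power2[OF w]
    unfolding l2_norm_sq_int l2_inner_def by (simp add: power2_eq_square mult.assoc)
  also have "\<dots> = l2_inner unit_cube (\<lambda>x. g x * ?h x) w - l2_inner unit_cube (\<lambda>x. g x * (?h x - w x)) w"
    using bm wL by (subst l2_inner_diff_left[symmetric]) (auto simp: algebra_simps)
  also have "\<dots> \<le> sqrt theta_sq * l2_norm unit_cube w + C * b * l2_norm unit_cube w"
  proof -
    have "l2_inner unit_cube (\<lambda>x. g x * ?h x) w = (\<Sum>l\<in>L. a l * mu l)"
      unfolding w_def using bm by (subst l2_inner_commute, subst onb.inner_comb_left) (auto simp: mu_eq l2_inner_commute[of _ "e _"])
    also have "\<dots> \<le> sqrt theta_sq * l2_norm unit_cube w"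
    proof (rule power2_le_imp_le)
      have "(\<Sum>l\<in>L. a l * mu l)\<^sup>2 \<le> (\<Sum>l\<in>L. (a l)\<^sup>2) * (\<Sum>l\<in>L. (mu l)\<^sup>2)" by (rule Cauchy_Schwarz_ineq_sum)
      also have "\<dots> = (sqrt theta_sq * l2_norm unit_cube w)\<^sup>2"
        by (simp add: power_mult_distrib theta_sq_def w_def onb.norm_comb sum_nonneg)
      finally show "(\<Sum>l\<in>L. a l * mu l)\<^sup>2 \<le> (sqrt theta_sq * l2_norm unit_cube w)\<^sup>2" .
    qed (simp add: theta_sq_def sum_nonneg)
    finally have 1: "l2_inner unit_cube (\<lambda>x. g x * ?h x) w \<le> sqrt theta_sq * l2_norm unit_cube w" .
    have "\<bar>l2_inner unit_cube (\<lambda>x. g x * (?h x - w x)) w\<bar> \<le> l2_norm unit_cube (\<lambda>x. g x * (?h x - w x)) * l2_norm unit_cube w"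
      by (rule l2_Cauchy_Schwarz[OF bm(3) wL])
    also have "\<dots> \<le> C * b * l2_norm unit_cube w"
    proof (rule mult_right_mono)
      have "l2_norm unit_cube (\<lambda>x. g x * (?h x - w x)) \<le> C * l2_dist unit_cube ?h w"
        unfolding l2_dist_def by (rule weighted_norm_le[OF bm(4)])
      also have "\<dots> \<le> C * b" using b' reg.C_pos by (intro mult_left_mono) auto
      finally show "l2_norm unit_cube (\<lambda>x. g x * (?h x - w x)) \<le> C * b" .
    qed simp
    finally show ?thesis using 1 by linarith
  qed
  finally have main: "c * (l2_norm unit_cube w)\<^sup>2 \<le> (sqrt theta_sq + C * b) * l2_norm unit_cube w"
    by (simp add: distrib_right)
  have b0: "0 \<le> b" using b' by (rule order_trans[rotated]) simp
  have "c * l2_norm unit_cube w \<le> sqrt theta_sq + C * b"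
  proof (cases "l2_norm unit_cube w = 0")
    case True
    then show ?thesis using b0 reg.C_pos by (simp add: theta_sq_def sum_nonneg)
  next
    case False
    then have "0 < l2_norm unit_cube w" using l2_norm_nonneg[of unit_cube w] by linarith
    then show ?thesis using main by (simp add: power2_eq_square)
  qed
  then have "l2_norm unit_cube w \<le> (sqrt theta_sq + C * b) / c" using c by (simp add: field_simps)
  moreover have "l2_dist unit_cube f u \<le> l2_norm unit_cube w + b"
    using l2_norm_le_dist[OF hL wL] b' by (simp add: l2_dist_def)
  ultimately have "l2_dist unit_cube f u \<le> (sqrt theta_sq + C * b) / c + b" by linarith
  also have "\<dots> = sqrt theta_sq / c + (C / c + 1) * b" by (simp add: add_divide_distrib distrib_right)
  finally show ?thesis .
qed

end


section \<open>Penalised least squares over lattice nets\<close>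

lemma exp_le_quadratic:
  assumes "\<bar>x\<bar> \<le> (1 :: real)" shows "exp x \<le> 1 + x + x\<^sup>2"
proof (cases "0 \<le> x")
  case True
  then show ?thesis using exp_bound[of x] assms by simp
next
  case False
  define y where "y = - x"
  have y: "0 < y" using False by (simp add: y_def)
  have "exp x = 1 / exp y" by (simp add: y_def exp_minus inverse_eq_divide)
  also have "\<dots> \<le> 1 / (1 + y)" using y exp_ge_add_one_self[of y] by (intro divide_left_mono) auto
  also have "\<dots> \<le> 1 - y + y\<^sup>2"
  proof -
    have "(1 - y + y\<^sup>2) * (1 + y) = 1 + y ^ 3" by (simp add: algebra_simps power2_eq_square power3_eq_cube)
    then have "1 \<le> (1 - y + y\<^sup>2) * (1 + y)" using y by simp
    then show ?thesis using y by (simp add: divide_le_eq)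
  qed
  finally show ?thesis by (simp add: y_def)
qed

text \<open>The bound does not depend on the centre \<open>\<alpha>\<close>: at an integer \<open>z\<close> other than the one nearest to \<open>\<alpha>\<close>, the distance to
  \<open>\<alpha>\<close> is at least half the distance to that nearest integer, and a geometric series dominates.\<close>

lemma lattice_gaussian_sum:
  assumes \<kappa>: "0 < (\<kappa> :: real)"
  shows "\<exists>A\<ge>1. \<forall>\<alpha>. \<forall>Z :: int set. finite Z \<longrightarrow> (\<Sum>z\<in>Z. exp (- \<kappa> * (of_int z - \<alpha>)\<^sup>2)) \<le> A"
proof -
  have halve: "a / 2 \<le> b" if "a \<le> b + a / 2" for a b :: real using that by simp
  define \<rho> where "\<rho> = exp (- (\<kappa> / 4))"
  have \<rho>: "0 < \<rho>" "\<rho> < 1" using \<kappa> by (auto simp: \<rho>_def)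
  have geo: "(\<Sum>k\<in>K. \<rho> ^ k) \<le> 1 / (1 - \<rho>)" if "finite K" for K
    using sum_le_suminf[OF summable_geometric[of \<rho>] that] suminf_geometric[of \<rho>] \<rho> by simp
  have main: "(\<Sum>z\<in>Z. exp (- \<kappa> * (of_int z - \<alpha>)\<^sup>2)) \<le> 2 / (1 - \<rho>)" if Z: "finite Z" for \<alpha> and Z :: "int set"
  proof -
    define z0 where "z0 = round \<alpha>"
    have pt: "exp (- \<kappa> * (of_int z - \<alpha>)\<^sup>2) \<le> \<rho> ^ nat \<bar>z - z0\<bar>" for z
    proof -
      have z0: "\<bar>of_int z0 - \<alpha>\<bar> \<le> 1 / 2" unfolding z0_def by (rule of_int_round_abs_le)
      have "of_int \<bar>z - z0\<bar> / 2 \<le> \<bar>of_int z - \<alpha>\<bar>"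
      proof (cases "z = z0")
        case False
        then have "1 \<le> \<bar>z - z0\<bar>" by linarith
        then have N: "(1 :: real) \<le> of_int \<bar>z - z0\<bar>" by linarith
        have "of_int \<bar>z - z0\<bar> \<le> \<bar>of_int z - \<alpha>\<bar> + \<bar>of_int z0 - \<alpha>\<bar>" by simp
        also have "\<dots> \<le> \<bar>of_int z - \<alpha>\<bar> + 1 / 2" using z0 by (rule add_left_mono)
        also have "\<dots> \<le> \<bar>of_int z - \<alpha>\<bar> + of_int \<bar>z - z0\<bar> / 2" using N by (intro add_left_mono divide_right_mono) auto
        finally show ?thesis by (rule halve)
      qed simp
      then have "(of_int \<bar>z - z0\<bar> / 2)\<^sup>2 \<le> \<bar>of_int z - \<alpha>\<bar>\<^sup>2" by (intro power_mono) auto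
      moreover have "real_of_int \<bar>z - z0\<bar> \<le> (of_int \<bar>z - z0\<bar>)\<^sup>2"
      proof -
        have "k \<le> k\<^sup>2" if "0 \<le> k" for k :: int
          using mult_right_mono[of 1 k k] that by (cases "k = 0") (auto simp: power2_eq_square)
        from this[of "\<bar>z - z0\<bar>"] have "\<bar>z - z0\<bar> \<le> \<bar>z - z0\<bar>\<^sup>2" by (simp only: abs_ge_zero)
        then show ?thesis by (metis of_int_le_iff of_int_power)
      qed
      ultimately have "real (nat \<bar>z - z0\<bar>) / 4 \<le> (of_int z - \<alpha>)\<^sup>2" by (simp add: power_divide)
      then have "- \<kappa> * (of_int z - \<alpha>)\<^sup>2 \<le> real (nat \<bar>z - z0\<bar>) * (- (\<kappa> / 4))"
        using mult_left_mono[of "real (nat \<bar>z - z0\<bar>) / 4" "(of_int z - \<alpha>)\<^sup>2" \<kappa>] \<kappa> by (simp add: mult_ac)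
      then show ?thesis unfolding \<rho>_def exp_of_nat_mult[symmetric] by simp
    qed
    let ?P = "{z\<in>Z. z0 \<le> z}" and ?N = "{z\<in>Z. z < z0}"
    have "(\<Sum>z\<in>Z. exp (- \<kappa> * (of_int z - \<alpha>)\<^sup>2)) \<le> (\<Sum>z\<in>Z. \<rho> ^ nat \<bar>z - z0\<bar>)" by (intro sum_mono pt)
    also have "\<dots> = (\<Sum>z\<in>?P. \<rho> ^ nat \<bar>z - z0\<bar>) + (\<Sum>z\<in>?N. \<rho> ^ nat \<bar>z - z0\<bar>)"
      using Z by (subst sum.union_disjoint[symmetric]) (auto intro!: sum.cong)
    also have "(\<Sum>z\<in>?P. \<rho> ^ nat \<bar>z - z0\<bar>) = (\<Sum>k\<in>(\<lambda>z. nat \<bar>z - z0\<bar>) ` ?P. \<rho> ^ k)"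
      by (subst sum.reindex) (auto simp: inj_on_def)
    also have "\<dots> \<le> 1 / (1 - \<rho>)" using Z by (intro geo) auto
    also have "(\<Sum>z\<in>?N. \<rho> ^ nat \<bar>z - z0\<bar>) = (\<Sum>k\<in>(\<lambda>z. nat \<bar>z - z0\<bar>) ` ?N. \<rho> ^ k)"
      by (subst sum.reindex) (auto simp: inj_on_def)
    also have "\<dots> \<le> 1 / (1 - \<rho>)" using Z by (intro geo) auto
    finally show ?thesis by simp
  qed
  have "1 \<le> 2 / (1 - \<rho>)" using \<rho> by (simp add: le_divide_eq)
  then show ?thesis using main by blast
qed

definition ls_crit :: "nat set \<Rightarrow> (real ^ 'd \<Rightarrow> real) \<Rightarrow> (nat \<Rightarrow> (real ^ 'd) \<times> bool) \<Rightarrow> real" where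
  "ls_crit E u \<omega> = (\<Sum>i\<in>E. (resid u (\<omega> i))\<^sup>2)"

locale regression_sample =
  reg: bernoulli_regression f g c C + smp: iid_sample "pair_law f g" I
  for f g :: "real ^ 'd \<Rightarrow> real" and c C :: real and I :: "nat set"
begin

abbreviation "P \<equiv> pair_law f g"
abbreviation "\<Omega> \<equiv> PiM I (\<lambda>_. pair_law f g)"

lemma unit_fun_bmf:
  assumes "u \<in> borel_measurable unit_cube" "\<And>x. 0 \<le> u x \<and> u x \<le> 1"
  shows "u \<in> bmf unit_cube"
proof (rule bmfI[OF assms(1)])
  fix x show "\<bar>u x\<bar> \<le> 1" using assms(2)[of x] by simp
qed

text \<open>The likelihood-type comparison of two candidates.  The bound \<open>e\<^sup>x \<le> 1 + x + x\<^sup>2\<close> turns the Bernstein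
  condition \<open>E W\<^sup>2 \<le> 4 \<parallel>u\<^sub>1 - u\<^sub>0\<parallel>\<^sub>g\<^sup>2\<close> into an exponential inequality.  With the factor \<open>1 / 16\<close> the quadratic term
  \<open>4 \<parallel>u\<^sub>1 - u\<^sub>0\<parallel>\<^sub>g\<^sup>2 / 256\<close> is half of the drift \<open>\<parallel>u\<^sub>1 - u\<^sub>0\<parallel>\<^sub>g\<^sup>2 / 32\<close>.  The bias \<open>\<parallel>f - u\<^sub>0\<parallel>\<close> enters additively, so
  that a net point near \<open>f\<close> can take the place of \<open>f\<close> in the comparison.\<close>

lemma ls_comparison:
  assumes u0: "u0 \<in> borel_measurable unit_cube" "\<And>x. 0 \<le> u0 x \<and> u0 x \<le> 1"
    and u1: "u1 \<in> borel_measurable unit_cube" "\<And>x. 0 \<le> u1 x \<and> u1 x \<le> 1"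
    and E: "E \<subseteq> I"
  shows "\<P>(\<omega> in \<Omega>. ls_crit E u1 \<omega> + p1 \<le> ls_crit E u0 \<omega> + p0) \<le>
    exp ((p0 - p1) / 16 + card E * (C * (l2_dist unit_cube f u0)\<^sup>2 / 8 - c * (l2_dist unit_cube u1 u0)\<^sup>2 / 64))"
proof -
  note ub = unit_fun_bmf[OF u0] unit_fun_bmf[OF u1]
  define W where "W z = (resid u0 z)\<^sup>2 - (resid u1 z)\<^sup>2" for z
  have W: "W \<in> bmf cube_obs" unfolding W_def by (intro bmf_diff bmf_power2 reg.resid_bmf ub)
  have Wf: "W (x, b) = (u1 x - u0 x) * (2 * of_bool b - u0 x - u1 x)" for x b
    by (simp add: W_def resid_def power2_eq_square algebra_simps)
  have two: "\<bar>2 * of_bool b - u0 x - u1 x\<bar> \<le> 2" and one: "\<bar>u1 x - u0 x\<bar> \<le> 1" for x b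
    using u0(2)[of x] u1(2)[of x] by (cases b; simp add: abs_le_iff)+
  let ?d = "\<lambda>x. u1 x - u0 x" and ?b = "\<lambda>x. f x - u0 x"
  have db: "?d \<in> bmf unit_cube" "?b \<in> bmf unit_cube" by (intro bmf_diff ub reg.f_bmf)+
  let ?Gd = "\<integral>x. g x * (?d x)\<^sup>2 \<partial>unit_cube" and ?Gb = "\<integral>x. g x * (?b x)\<^sup>2 \<partial>unit_cube"
  have gi: "integrable unit_cube (\<lambda>x. g x * (?d x)\<^sup>2)" "integrable unit_cube (\<lambda>x. g x * (?b x)\<^sup>2)"
    by (intro reg.cube_integrable bmf_mult bmf_power2 reg.g_bmf db)+
  have EW: "(\<integral>z. W z \<partial>P) \<le> 2 * ?Gb - ?Gd / 2"
  proof -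
    have "(\<integral>z. W z \<partial>P) = (\<integral>x. g x * (f x * W (x, True) + (1 - f x) * W (x, False)) \<partial>unit_cube)"
      by (rule reg.P_expectation[OF W])
    also have "\<dots> \<le> (\<integral>x. 2 * (g x * (?b x)\<^sup>2) - (g x * (?d x)\<^sup>2) / 2 \<partial>unit_cube)"
    proof (rule integral_mono)
      show "integrable unit_cube (\<lambda>x. g x * (f x * W (x, True) + (1 - f x) * W (x, False)))"
        by (intro reg.cube_integrable bmf_mult bmf_add bmf_diff reg.g_bmf reg.f_bmf bmf_const bmf_compose[OF _ W]) auto
      show "integrable unit_cube (\<lambda>x. 2 * (g x * (?b x)\<^sup>2) - (g x * (?d x)\<^sup>2) / 2)" using gi by simp
      fix x :: "real ^ 'd"
      have "f x * W (x, True) + (1 - f x) * W (x, False) = 2 * (?d x * ?b x) - (?d x)\<^sup>2"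
        by (simp add: Wf power2_eq_square algebra_simps)
      also have "\<dots> \<le> 2 * (?b x)\<^sup>2 - (?d x)\<^sup>2 / 2"
      proof -
        have "0 \<le> (?d x - 2 * ?b x)\<^sup>2 / 2" by simp
        also have "\<dots> = (?d x)\<^sup>2 / 2 - 2 * (?d x * ?b x) + 2 * (?b x)\<^sup>2" by (simp add: power2_eq_square field_simps)
        finally show ?thesis by linarith
      qed
      finally have "g x * (f x * W (x, True) + (1 - f x) * W (x, False)) \<le> g x * (2 * (?b x)\<^sup>2 - (?d x)\<^sup>2 / 2)"
        using reg.g_range[of x] reg.c_pos by (intro mult_left_mono) auto
      then show "g x * (f x * W (x, True) + (1 - f x) * W (x, False)) \<le> 2 * (g x * (?b x)\<^sup>2) - (g x * (?d x)\<^sup>2) / 2"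
        by (simp add: algebra_simps)
    qed
    also have "\<dots> = 2 * ?Gb - ?Gd / 2" using gi by simp
    finally show ?thesis .
  qed
  have EW2: "(\<integral>z. (W z)\<^sup>2 \<partial>P) \<le> 4 * ?Gd"
  proof -
    have "(\<integral>z. (W z)\<^sup>2 \<partial>P) \<le> (\<integral>x. g x * (4 * (?d x)\<^sup>2) \<partial>unit_cube)"
    proof (rule reg.P_expectation_le)
      fix x :: "real ^ 'd" and b
      have "\<bar>2 * of_bool b - u0 x - u1 x\<bar>\<^sup>2 \<le> 2\<^sup>2" by (intro power_mono two) auto
      then show "(W (x, b))\<^sup>2 \<le> 4 * (?d x)\<^sup>2"
        unfolding Wf power_mult_distrib by (simp add: mult.commute[of 4] mult_left_mono)
    qed (auto intro!: W bmf_power2 db bmf_scale)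
    also have "\<dots> = 4 * ?Gd" by (simp add: mult.left_commute[of _ 4])
    finally show ?thesis .
  qed
  define X where "X = (\<lambda>z. exp (W z / 16))"
  have Xle: "X z \<le> 1 + W z / 16 + (W z)\<^sup>2 / 256" for z
  proof -
    obtain x b where z: "z = (x, b)" by (cases z)
    have "\<bar>W z\<bar> \<le> 1 * 2" unfolding z Wf abs_mult by (intro mult_mono one two) auto
    then have "exp (W z / 16) \<le> 1 + W z / 16 + (W z / 16)\<^sup>2" by (intro exp_le_quadratic) simp
    then show ?thesis by (simp add: X_def power_divide)
  qed
  have Xb: "X \<in> bmf P" unfolding reg.bmf_P
  proof (rule bmfI[where B="exp 1"])
    show "X \<in> borel_measurable cube_obs" unfolding X_def using bmf_measurable[OF W] by measurable
    fix z :: "(real ^ 'd) \<times> bool"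
    obtain x b where z: "z = (x, b)" by (cases z)
    have "\<bar>W z\<bar> \<le> 1 * 2" unfolding z Wf abs_mult by (intro mult_mono one two) auto
    then show "\<bar>X z\<bar> \<le> exp 1" by (simp add: X_def)
  qed
  have EX: "(\<integral>z. X z \<partial>P) \<le> exp (C * (l2_dist unit_cube f u0)\<^sup>2 / 8 - c * (l2_dist unit_cube u1 u0)\<^sup>2 / 64)" (is "_ \<le> exp ?t")
  proof -
    have Wi: "integrable P W" "integrable P (\<lambda>z. (W z)\<^sup>2)" using W by (auto intro!: reg.P_integrable)
    have "(\<integral>z. X z \<partial>P) \<le> (\<integral>z. 1 + W z / 16 + (W z)\<^sup>2 / 256 \<partial>P)"
      using Wi smp.P_integrable[OF Xb] Xle by (intro integral_mono) auto
    also have "\<dots> = 1 + (\<integral>z. W z \<partial>P) / 16 + (\<integral>z. (W z)\<^sup>2 \<partial>P) / 256" using Wi reg.P.prob_space by simp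
    also have "\<dots> \<le> 1 + (?Gb / 8 - ?Gd / 64)" using EW EW2 by simp
    also have "\<dots> \<le> 1 + ?t"
      using reg.g_integral_bounds(1)[of "\<lambda>x. (?b x)\<^sup>2"] reg.g_integral_bounds(2)[of "\<lambda>x. (?d x)\<^sup>2"]
        bmf_power2[OF db(1)] bmf_power2[OF db(2)]
      by (auto simp: l2_dist_def l2_norm_sq_int intro!: add_mono diff_mono)
    also have "\<dots> \<le> exp ?t" by (rule exp_ge_add_one_self)
    finally show ?thesis .
  qed
  have fE: "finite E" using E smp.I_fin finite_subset by blast
  have prod: "(\<integral>\<omega>. (\<Prod>i\<in>E. X (\<omega> i)) \<partial>\<Omega>) = (\<integral>z. X z \<partial>P) ^ card E"
    and prod_i: "integrable \<Omega> (\<lambda>\<omega>. \<Prod>i\<in>E. X (\<omega> i))"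
  proof -
    let ?h = "\<lambda>i z. if i \<in> E then X z else 1"
    have h: "integrable P (?h i)" for i using smp.P_integrable[OF Xb] by (cases "i \<in> E") auto
    have eq: "(\<Prod>i\<in>E. X (\<omega> i)) = (\<Prod>i\<in>I. ?h i (\<omega> i))" for \<omega>
      using E smp.I_fin by (intro prod.mono_neutral_cong_left) auto
    show "integrable \<Omega> (\<lambda>\<omega>. \<Prod>i\<in>E. X (\<omega> i))" unfolding eq by (rule smp.prd.product_integrable_prod[OF smp.I_fin h])
    have "(\<integral>\<omega>. (\<Prod>i\<in>I. ?h i (\<omega> i)) \<partial>\<Omega>) = (\<Prod>i\<in>I. \<integral>z. ?h i z \<partial>P)" by (rule smp.prd.product_integral_prod[OF smp.I_fin h])
    also have "\<dots> = (\<Prod>i\<in>E. \<integral>z. X z \<partial>P)"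
      using E smp.I_fin reg.P.prob_space by (intro prod.mono_neutral_cong_right) auto
    finally show "(\<integral>\<omega>. (\<Prod>i\<in>E. X (\<omega> i)) \<partial>\<Omega>) = (\<integral>z. X z \<partial>P) ^ card E" unfolding eq by simp
  qed
  have prod_exp: "(\<Prod>i\<in>E. X (\<omega> i)) = exp ((ls_crit E u0 \<omega> - ls_crit E u1 \<omega>) / 16)" for \<omega>
    using fE by (simp add: X_def exp_sum[symmetric] sum_divide_distrib[symmetric] W_def ls_crit_def sum_subtractf)
  have "\<P>(\<omega> in \<Omega>. ls_crit E u1 \<omega> + p1 \<le> ls_crit E u0 \<omega> + p0) = \<P>(\<omega> in \<Omega>. exp ((p1 - p0) / 16) \<le> (\<Prod>i\<in>E. X (\<omega> i)))"
    unfolding prod_exp by (intro arg_cong[where f="measure \<Omega>"] Collect_cong conj_cong refl) auto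
  also have "\<dots> \<le> (\<integral>\<omega>. (\<Prod>i\<in>E. X (\<omega> i)) \<partial>\<Omega>) / exp ((p1 - p0) / 16)"
    by (rule integral_Markov_inequality_measure[OF prod_i sets.top]) (auto simp: X_def prod_nonneg)
  also have "\<dots> \<le> exp ?t ^ card E / exp ((p1 - p0) / 16)"
    unfolding prod using EX by (intro divide_right_mono power_mono) (auto simp: X_def)
  also have "\<dots> = exp ((p0 - p1) / 16 + card E * ?t)"
    by (simp add: exp_of_nat_mult[symmetric] exp_diff[symmetric] diff_divide_distrib)
  finally show ?thesis .
qed

text \<open>Half of the exponent in the comparison pays for the radius \<open>R\<close>, the other half makes the sum over the net converge.\<close>

lemma net_union_bound:
  assumes fin: "finite \<Theta>"
    and U: "\<And>\<theta>. \<theta> \<in> \<Theta> \<Longrightarrow> U \<theta> \<in> borel_measurable unit_cube" "\<And>\<theta> x. \<theta> \<in> \<Theta> \<Longrightarrow> 0 \<le> U \<theta> x \<and> U \<theta> x \<le> 1"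
    and \<theta>0: "\<theta>0 \<in> \<Theta>" and E: "E \<subseteq> I" and R: "0 \<le> R"
    and net: "(\<Sum>\<theta>\<in>\<Theta>. exp (- pen \<theta> / 16 - card E * c * (l2_dist unit_cube (U \<theta>) (U \<theta>0))\<^sup>2 / 128)) \<le> 1"
  shows "\<P>(\<omega> in \<Omega>. \<exists>\<theta>\<in>\<Theta>. ls_crit E (U \<theta>) \<omega> + pen \<theta> \<le> ls_crit E (U \<theta>0) \<omega> + pen \<theta>0 \<and> R \<le> l2_dist unit_cube (U \<theta>) (U \<theta>0))
    \<le> exp (pen \<theta>0 / 16 + card E * C * (l2_dist unit_cube f (U \<theta>0))\<^sup>2 / 8 - card E * c * R\<^sup>2 / 128)"
proof -
  let ?d = "\<lambda>\<theta>. l2_dist unit_cube (U \<theta>) (U \<theta>0)"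
  let ?Far = "{\<theta>\<in>\<Theta>. R \<le> ?d \<theta>}"
  let ?ev = "\<lambda>\<theta>. {\<omega>\<in>space \<Omega>. ls_crit E (U \<theta>) \<omega> + pen \<theta> \<le> ls_crit E (U \<theta>0) \<omega> + pen \<theta>0}"
  have cm: "ls_crit E (U \<theta>) \<in> borel_measurable \<Omega>" if "\<theta> \<in> \<Theta>" for \<theta>
  proof (rule bmf_measurable)
    show "ls_crit E (U \<theta>) \<in> bmf \<Omega>" unfolding ls_crit_def[abs_def] using E
      by (intro bmf_sum smp.coord_bmf[where \<psi>="\<lambda>z. (resid (U \<theta>) z)\<^sup>2"])
        (auto simp: reg.bmf_P intro!: bmf_power2 reg.resid_bmf unit_fun_bmf U that)
  qed
  have ev: "?ev \<theta> \<in> sets \<Omega>" if "\<theta> \<in> \<Theta>" for \<theta>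
    using cm[OF that] cm[OF \<theta>0] by measurable
  have "\<P>(\<omega> in \<Omega>. \<exists>\<theta>\<in>\<Theta>. ls_crit E (U \<theta>) \<omega> + pen \<theta> \<le> ls_crit E (U \<theta>0) \<omega> + pen \<theta>0 \<and> R \<le> ?d \<theta>)
      = measure \<Omega> (\<Union>\<theta>\<in>?Far. ?ev \<theta>)" by (intro arg_cong[where f="measure \<Omega>"]) auto
  also have "\<dots> \<le> (\<Sum>\<theta>\<in>?Far. measure \<Omega> (?ev \<theta>))"
    using fin ev by (intro smp.\<Omega>.finite_measure_subadditive_finite) auto
  also have "\<dots> \<le> (\<Sum>\<theta>\<in>?Far. exp (pen \<theta>0 / 16 + card E * C * (l2_dist unit_cube f (U \<theta>0))\<^sup>2 / 8 - card E * c * R\<^sup>2 / 128)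
      * exp (- pen \<theta> / 16 - card E * c * (?d \<theta>)\<^sup>2 / 128))"
  proof (rule sum_mono)
    fix \<theta> assume \<theta>: "\<theta> \<in> ?Far"
    have "R\<^sup>2 \<le> (?d \<theta>)\<^sup>2" using \<theta> R by (intro power_mono) auto
    then have "card E * c * R\<^sup>2 \<le> card E * c * (?d \<theta>)\<^sup>2" using reg.c_pos by (intro mult_left_mono) auto
    then have "(pen \<theta>0 - pen \<theta>) / 16 + card E * (C * (l2_dist unit_cube f (U \<theta>0))\<^sup>2 / 8 - c * (?d \<theta>)\<^sup>2 / 64)
      \<le> (pen \<theta>0 / 16 + card E * C * (l2_dist unit_cube f (U \<theta>0))\<^sup>2 / 8 - card E * c * R\<^sup>2 / 128)
        + (- pen \<theta> / 16 - card E * c * (?d \<theta>)\<^sup>2 / 128)"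
      by (simp add: field_simps)
    then show "measure \<Omega> (?ev \<theta>) \<le> exp (pen \<theta>0 / 16 + card E * C * (l2_dist unit_cube f (U \<theta>0))\<^sup>2 / 8 - card E * c * R\<^sup>2 / 128)
      * exp (- pen \<theta> / 16 - card E * c * (?d \<theta>)\<^sup>2 / 128)"
      using ls_comparison[OF U(1)[OF \<theta>0] U(2)[OF \<theta>0] U(1) U(2) E, of \<theta> "pen \<theta>" "pen \<theta>0"] \<theta>
      unfolding exp_add[symmetric] by (auto intro: order_trans)
  qed
  also have "\<dots> \<le> exp (pen \<theta>0 / 16 + card E * C * (l2_dist unit_cube f (U \<theta>0))\<^sup>2 / 8 - card E * c * R\<^sup>2 / 128) *
      (\<Sum>\<theta>\<in>\<Theta>. exp (- pen \<theta> / 16 - card E * c * (?d \<theta>)\<^sup>2 / 128))"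
    unfolding sum_distrib_left[symmetric] using fin by (intro mult_left_mono sum_mono2) auto
  also have "\<dots> \<le> exp (pen \<theta>0 / 16 + card E * C * (l2_dist unit_cube f (U \<theta>0))\<^sup>2 / 8 - card E * c * R\<^sup>2 / 128) * 1"
    by (intro mult_left_mono net) auto
  finally show ?thesis by simp
qed

end

definition lattice_fun :: "'i set \<Rightarrow> ('i \<Rightarrow> 'a \<Rightarrow> real) \<Rightarrow> real \<Rightarrow> ('i \<Rightarrow> int) \<Rightarrow> 'a \<Rightarrow> real" where
  "lattice_fun L e \<delta> z x = (\<Sum>l\<in>L. (\<delta> * of_int (z l)) * e l x)"

text \<open>The Gaussian sum over the lattice factorises over the coordinates, hence is exponential in the dimension with a
  constant that does not depend on the centre.  This plays the part of a bound on local metric entropy.\<close>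

lemma (in l2_onb) lattice_net_sum:
  assumes q: "0 < (q :: real)" and c: "0 < c"
    and A: "1 \<le> A" "\<And>\<alpha> Z. finite Z \<Longrightarrow> (\<Sum>z\<in>Z. exp (- (c / 256) * (of_int z - \<alpha>)\<^sup>2)) \<le> A"
    and Z: "finite Z" and S: "S \<subseteq> PiE I (\<lambda>_. Z)"
    and u0: "u0 \<in> L2 M" and U: "\<And>z. z \<in> S \<Longrightarrow> U z \<in> L2 M"
    and close: "\<And>z. z \<in> S \<Longrightarrow> l2_dist M (U z) (lattice_fun I e (1 / sqrt q) z) \<le> K * sqrt (card I / q)"
    and K: "0 \<le> K"
  shows "(\<Sum>z\<in>S. exp (- q * c * (l2_dist M (U z) u0)\<^sup>2 / 128)) \<le> (A * exp (c * K\<^sup>2 / 128)) ^ card I"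
proof -
  define a where "a i = l2_inner M u0 (e i)" for i
  have pt: "exp (- q * c * (l2_dist M (U z) u0)\<^sup>2 / 128) \<le>
      exp (c * K\<^sup>2 / 128) ^ card I * (\<Prod>i\<in>I. exp (- (c / 256) * (of_int (z i) - sqrt q * a i)\<^sup>2))" if z: "z \<in> S" for z
  proof -
    let ?v = "lattice_fun I e (1 / sqrt q) z"
    have vL: "?v \<in> L2 M" unfolding lattice_fun_def[abs_def] by (rule comb_L2)
    have "(\<Sum>i\<in>I. (1 / sqrt q * of_int (z i) - a i)\<^sup>2) = (\<Sum>i\<in>I. (l2_inner M (\<lambda>x. ?v x - u0 x) (e i))\<^sup>2)"
    proof (intro sum.cong refl)
      fix i assume i: "i \<in> I"
      have "l2_inner M (\<lambda>x. ?v x - u0 x) (e i) = l2_inner M ?v (e i) - a i"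
        using vL u0 e_L2[OF i] by (simp add: l2_inner_diff_left a_def)
      also have "l2_inner M ?v (e i) = 1 / sqrt q * of_int (z i)"
        unfolding lattice_fun_def[abs_def] by (rule inner_comb_e[OF i])
      finally show "(1 / sqrt q * of_int (z i) - a i)\<^sup>2 = (l2_inner M (\<lambda>x. ?v x - u0 x) (e i))\<^sup>2" by simp
    qed
    also have "\<dots> \<le> (l2_norm M (\<lambda>x. ?v x - u0 x))\<^sup>2" using vL u0 by (intro bessel) auto
    also have "\<dots> = (l2_dist M ?v u0)\<^sup>2" by (simp add: l2_dist_def)
    also have "\<dots> \<le> (K * sqrt (card I / q) + l2_dist M (U z) u0)\<^sup>2"
      using l2_dist_triangle[OF vL U[OF z] u0] close[OF z] unfolding l2_dist_commute[of M ?v]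
      by (intro power_mono) auto
    also have "\<dots> \<le> 2 * (K * sqrt (card I / q))\<^sup>2 + 2 * (l2_dist M (U z) u0)\<^sup>2"
      using sum_squares_bound[of "K * sqrt (card I / q)" "l2_dist M (U z) u0"] by (simp add: power2_sum)
    also have "(K * sqrt (card I / q))\<^sup>2 = K\<^sup>2 * (card I / q)" using q by (simp add: power_mult_distrib)
    finally have "q * (\<Sum>i\<in>I. (1 / sqrt q * of_int (z i) - a i)\<^sup>2) \<le> q * (2 * (K\<^sup>2 * (card I / q)) + 2 * (l2_dist M (U z) u0)\<^sup>2)"
      using q by (intro mult_left_mono) auto
    also have "q * (\<Sum>i\<in>I. (1 / sqrt q * of_int (z i) - a i)\<^sup>2) = (\<Sum>i\<in>I. (of_int (z i) - sqrt q * a i)\<^sup>2)"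
      unfolding sum_distrib_left
    proof (intro sum.cong refl)
      fix i
      have "q * (1 / sqrt q * of_int (z i) - a i)\<^sup>2 = (sqrt q * (1 / sqrt q * of_int (z i) - a i))\<^sup>2"
        using q by (simp add: power_mult_distrib)
      also have "sqrt q * (1 / sqrt q * of_int (z i) - a i) = of_int (z i) - sqrt q * a i"
        using q by (simp add: right_diff_distrib)
      finally show "q * (1 / sqrt q * of_int (z i) - a i)\<^sup>2 = (of_int (z i) - sqrt q * a i)\<^sup>2" .
    qed
    also have "q * (2 * (K\<^sup>2 * (card I / q)) + 2 * (l2_dist M (U z) u0)\<^sup>2) = 2 * K\<^sup>2 * card I + 2 * q * (l2_dist M (U z) u0)\<^sup>2"
      using q by (simp add: field_simps)
    finally have "(\<Sum>i\<in>I. (of_int (z i) - sqrt q * a i)\<^sup>2) \<le> 2 * K\<^sup>2 * card I + 2 * q * (l2_dist M (U z) u0)\<^sup>2" .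
    from mult_left_mono[OF this, of "c / 256"] c
    have "- q * c * (l2_dist M (U z) u0)\<^sup>2 / 128 \<le> card I * (c * K\<^sup>2 / 128) + (\<Sum>i\<in>I. - (c / 256) * (of_int (z i) - sqrt q * a i)\<^sup>2)"
      unfolding sum_distrib_left[symmetric] by (simp add: field_simps)
    then show ?thesis using fin by (simp add: exp_of_nat_mult[symmetric] exp_sum[symmetric] exp_add[symmetric])
  qed
  have "(\<Sum>z\<in>S. exp (- q * c * (l2_dist M (U z) u0)\<^sup>2 / 128)) \<le>
      (\<Sum>z\<in>S. exp (c * K\<^sup>2 / 128) ^ card I * (\<Prod>i\<in>I. exp (- (c / 256) * (of_int (z i) - sqrt q * a i)\<^sup>2)))"
    by (intro sum_mono pt)
  also have "\<dots> \<le> exp (c * K\<^sup>2 / 128) ^ card I * (\<Sum>z\<in>PiE I (\<lambda>_. Z). \<Prod>i\<in>I. exp (- (c / 256) * (of_int (z i) - sqrt q * a i)\<^sup>2))"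
    unfolding sum_distrib_left[symmetric] using S fin Z
    by (intro mult_left_mono sum_mono2 finite_PiE) (auto simp: prod_nonneg)
  also have "(\<Sum>z\<in>PiE I (\<lambda>_. Z). \<Prod>i\<in>I. exp (- (c / 256) * (of_int (z i) - sqrt q * a i)\<^sup>2)) =
      (\<Prod>i\<in>I. \<Sum>z\<in>Z. exp (- (c / 256) * (of_int z - sqrt q * a i)\<^sup>2))"
    using fin Z by (subst prod_sum_PiE) auto
  also have "exp (c * K\<^sup>2 / 128) ^ card I * \<dots> \<le> exp (c * K\<^sup>2 / 128) ^ card I * (\<Prod>i\<in>I. A)"
    using A Z by (intro mult_left_mono prod_mono) (auto simp: sum_nonneg)
  finally show ?thesis by (simp add: power_mult_distrib mult.commute)
qed


subsection \<open>Selection from a finite set\<close>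

definition argmin_choice :: "'k set \<Rightarrow> ('k \<Rightarrow> 'w \<Rightarrow> real) \<Rightarrow> 'w \<Rightarrow> 'k" where
  "argmin_choice \<Theta> crit \<omega> = (SOME \<theta>. \<theta> \<in> {\<theta>\<in>\<Theta>. \<forall>\<theta>'\<in>\<Theta>. crit \<theta> \<omega> \<le> crit \<theta>' \<omega>})"

lemma argmin_choice:
  assumes "finite \<Theta>" "\<Theta> \<noteq> {}"
  shows "argmin_choice \<Theta> crit \<omega> \<in> \<Theta>" "\<theta>' \<in> \<Theta> \<Longrightarrow> crit (argmin_choice \<Theta> crit \<omega>) \<omega> \<le> crit \<theta>' \<omega>"
proof -
  obtain \<theta> where "\<theta> \<in> \<Theta>" "\<forall>\<theta>'\<in>\<Theta>. crit \<theta> \<omega> \<le> crit \<theta>' \<omega>"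
    using ex_is_arg_min_if_finite[OF assms, of "\<lambda>\<theta>. crit \<theta> \<omega>"] by (auto simp: is_arg_min_linorder)
  then have "argmin_choice \<Theta> crit \<omega> \<in> {\<theta>\<in>\<Theta>. \<forall>\<theta>'\<in>\<Theta>. crit \<theta> \<omega> \<le> crit \<theta>' \<omega>}"
    unfolding argmin_choice_def by (intro someI[of "\<lambda>\<theta>. \<theta> \<in> {\<theta>\<in>\<Theta>. \<forall>\<theta>'\<in>\<Theta>. crit \<theta> \<omega> \<le> crit \<theta>' \<omega>}" \<theta>]) auto
  then show "argmin_choice \<Theta> crit \<omega> \<in> \<Theta>" "\<theta>' \<in> \<Theta> \<Longrightarrow> crit (argmin_choice \<Theta> crit \<omega>) \<omega> \<le> crit \<theta>' \<omega>" by auto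
qed

text \<open>The choice depends on the data only through the finite set of minimisers, so it is measurable into
  the discrete space, whatever the tie-breaking rule.\<close>

lemma argmin_choice_measurable:
  assumes fin: "finite \<Theta>" and crit: "\<And>\<theta>. \<theta> \<in> \<Theta> \<Longrightarrow> crit \<theta> \<in> borel_measurable N"
  shows "argmin_choice \<Theta> crit \<in> N \<rightarrow>\<^sub>M count_space UNIV"
proof -
  let ?S = "\<lambda>\<omega>. {\<theta>\<in>\<Theta>. \<forall>\<theta>'\<in>\<Theta>. crit \<theta> \<omega> \<le> crit \<theta>' \<omega>}"
  have "?S \<in> N \<rightarrow>\<^sub>M count_space (Pow \<Theta>)"
  proof (subst measurable_count_space_eq2)
    show "finite (Pow \<Theta>)" using fin by simp
    have "?S -` {T} \<inter> space N \<in> sets N" if "T \<subseteq> \<Theta>" for T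
    proof -
      let ?B = "\<lambda>\<theta>. {\<omega>\<in>space N. \<forall>\<theta>'\<in>\<Theta>. crit \<theta> \<omega> \<le> crit \<theta>' \<omega>}"
      have B: "?B \<theta> \<in> sets N" if "\<theta> \<in> \<Theta>" for \<theta>
        using fin crit that by (intro sets.sets_Collect_finite_All borel_measurable_le) auto
      have "?S -` {T} \<inter> space N = {\<omega>\<in>space N. \<forall>\<theta>\<in>\<Theta>. \<omega> \<in> (if \<theta> \<in> T then ?B \<theta> else space N - ?B \<theta>)}"
      proof -
        have "?S \<omega> = T \<longleftrightarrow> (\<forall>\<theta>\<in>\<Theta>. (\<forall>\<theta>'\<in>\<Theta>. crit \<theta> \<omega> \<le> crit \<theta>' \<omega>) \<longleftrightarrow> \<theta> \<in> T)" for \<omega>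
          using that by blast
        moreover have "(\<omega> \<in> (if \<theta> \<in> T then ?B \<theta> else space N - ?B \<theta>)) \<longleftrightarrow>
            ((\<forall>\<theta>'\<in>\<Theta>. crit \<theta> \<omega> \<le> crit \<theta>' \<omega>) \<longleftrightarrow> \<theta> \<in> T)" if "\<omega> \<in> space N" for \<omega> \<theta>
          using that by (cases "\<theta> \<in> T") simp_all
        ultimately show ?thesis by (simp add: vimage_def Int_def conj_commute cong: conj_cong)
      qed
      also have "\<dots> \<in> sets N"
      proof (rule sets.sets_Collect_finite_All[OF _ fin])
        fix \<theta> assume \<theta>: "\<theta> \<in> \<Theta>"
        have "{\<omega>\<in>space N. \<omega> \<in> (if \<theta> \<in> T then ?B \<theta> else space N - ?B \<theta>)} = (if \<theta> \<in> T then ?B \<theta> else space N - ?B \<theta>)"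
          by auto
        then show "{\<omega>\<in>space N. \<omega> \<in> (if \<theta> \<in> T then ?B \<theta> else space N - ?B \<theta>)} \<in> sets N" using B[OF \<theta>] by auto
      qed
      finally show ?thesis .
    qed
    then show "?S \<in> space N \<rightarrow> Pow \<Theta> \<and> (\<forall>a\<in>Pow \<Theta>. ?S -` {a} \<inter> space N \<in> sets N)" by auto
  qed
  then have "(\<lambda>\<omega>. (\<lambda>T. SOME \<theta>. \<theta> \<in> T) (?S \<omega>)) \<in> N \<rightarrow>\<^sub>M count_space UNIV"
    by (rule measurable_compose) simp
  then show ?thesis by (simp add: argmin_choice_def[abs_def])
qed

text \<open>Given the value that the data of block \<open>E\<close> select, block \<open>A\<close> is still an independent sample, so a bound that is uniform
  over the possible values holds at the selected one.\<close>

lemma (in iid_sample) random_index_bound: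
  assumes EA: "E \<subseteq> I" "A \<subseteq> I" "E \<inter> A = {}" and fin: "finite \<Theta>"
    and \<tau>: "\<tau> \<in> PiM E (\<lambda>_. P) \<rightarrow>\<^sub>M count_space UNIV" "\<And>\<omega>. \<omega> \<in> space \<Omega> \<Longrightarrow> \<tau> (restrict \<omega> E) \<in> \<Theta>"
    and X: "\<And>\<theta>. \<theta> \<in> \<Theta> \<Longrightarrow> X \<theta> \<in> sets (PiM A (\<lambda>_. P))"
    and bnd: "\<And>\<theta>. \<theta> \<in> \<Theta> \<Longrightarrow> \<Omega>.prob {\<omega>\<in>space \<Omega>. restrict \<omega> A \<in> X \<theta>} \<le> \<eta>"
  shows "\<Omega>.prob {\<omega>\<in>space \<Omega>. restrict \<omega> A \<in> X (\<tau> (restrict \<omega> E))} \<le> \<eta>"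
proof -
  let ?T = "\<lambda>\<theta>. {x\<in>space (PiM E (\<lambda>_. P)). \<tau> x = \<theta>}"
  have T: "?T \<theta> \<in> sets (PiM E (\<lambda>_. P))" for \<theta>
    using measurable_sets[OF \<tau>(1), of "{\<theta>}"] by (simp add: vimage_def Int_def conj_commute)
  have rE: "(\<lambda>\<omega>. restrict \<omega> E) \<in> \<Omega> \<rightarrow>\<^sub>M PiM E (\<lambda>_. P)" and rA: "(\<lambda>\<omega>. restrict \<omega> A) \<in> \<Omega> \<rightarrow>\<^sub>M PiM A (\<lambda>_. P)"
    using EA by (auto intro!: measurable_restrict_subset)
  have TE: "{\<omega>\<in>space \<Omega>. restrict \<omega> E \<in> ?T \<theta>} \<in> sets \<Omega>" for \<theta>
    using measurable_sets[OF rE T[of \<theta>]] by (simp add: vimage_def Int_def conj_commute)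
  have XA: "{\<omega>\<in>space \<Omega>. restrict \<omega> A \<in> X \<theta>} \<in> sets \<Omega>" if "\<theta> \<in> \<Theta>" for \<theta>
    using measurable_sets[OF rA X[OF that]] by (simp add: vimage_def Int_def conj_commute)
  have TX: "{\<omega>\<in>space \<Omega>. restrict \<omega> E \<in> ?T \<theta> \<and> restrict \<omega> A \<in> X \<theta>} \<in> sets \<Omega>" if "\<theta> \<in> \<Theta>" for \<theta>
  proof -
    have "{\<omega>\<in>space \<Omega>. restrict \<omega> E \<in> ?T \<theta> \<and> restrict \<omega> A \<in> X \<theta>} = {\<omega>\<in>space \<Omega>. restrict \<omega> E \<in> ?T \<theta>} \<inter> {\<omega>\<in>space \<Omega>. restrict \<omega> A \<in> X \<theta>}" by auto
    then show ?thesis using TE XA[OF that] by auto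
  qed
  have rs: "restrict \<omega> E \<in> space (PiM E (\<lambda>_. P))" if "\<omega> \<in> space \<Omega>" for \<omega> using measurable_space[OF rE that] .
  have "{\<omega>\<in>space \<Omega>. restrict \<omega> A \<in> X (\<tau> (restrict \<omega> E))} =
      (\<Union>\<theta>\<in>\<Theta>. {\<omega>\<in>space \<Omega>. restrict \<omega> E \<in> ?T \<theta> \<and> restrict \<omega> A \<in> X \<theta>})"
    using \<tau>(2) rs by auto
  then have "\<Omega>.prob {\<omega>\<in>space \<Omega>. restrict \<omega> A \<in> X (\<tau> (restrict \<omega> E))} \<le>
      (\<Sum>\<theta>\<in>\<Theta>. \<Omega>.prob {\<omega>\<in>space \<Omega>. restrict \<omega> E \<in> ?T \<theta> \<and> restrict \<omega> A \<in> X \<theta>})"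
    using TX fin by (simp only:) (intro \<Omega>.finite_measure_subadditive_finite, auto)
  also have "\<dots> = (\<Sum>\<theta>\<in>\<Theta>. \<Omega>.prob {\<omega>\<in>space \<Omega>. restrict \<omega> E \<in> ?T \<theta>} * \<Omega>.prob {\<omega>\<in>space \<Omega>. restrict \<omega> A \<in> X \<theta>})"
    using EA by (intro sum.cong refl block_prob_mult T X)
  also have "\<dots> \<le> (\<Sum>\<theta>\<in>\<Theta>. \<Omega>.prob {\<omega>\<in>space \<Omega>. restrict \<omega> E \<in> ?T \<theta>} * \<eta>)"
    by (intro sum_mono mult_left_mono bnd) auto
  also have "\<dots> = \<Omega>.prob (\<Union>\<theta>\<in>\<Theta>. {\<omega>\<in>space \<Omega>. restrict \<omega> E \<in> ?T \<theta>}) * \<eta>"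
    unfolding sum_distrib_right[symmetric] using fin TE
    by (subst \<Omega>.finite_measure_finite_Union) (auto simp: disjoint_family_on_def)
  also have "(\<Union>\<theta>\<in>\<Theta>. {\<omega>\<in>space \<Omega>. restrict \<omega> E \<in> ?T \<theta>}) = space \<Omega>" using \<tau>(2) rs by auto
  finally show ?thesis by (simp only: \<Omega>.prob_space mult_1_left)
qed


section \<open>The adaptive estimator\<close>

subsection \<open>Representatives with values in the unit interval\<close>

definition clip01 :: "('a \<Rightarrow> real) \<Rightarrow> 'a \<Rightarrow> real" where
  "clip01 u x = max 0 (min 1 (u x))"

lemma clip01_range: "0 \<le> clip01 u x \<and> clip01 u x \<le> 1"
  by (auto simp: clip01_def)

lemma clip01_measurable: "u \<in> borel_measurable M \<Longrightarrow> clip01 u \<in> borel_measurable M"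
  unfolding clip01_def[abs_def] by (intro borel_measurable_max borel_measurable_min borel_measurable_const)

lemma clip01_AE: "AE x in M. 0 \<le> u x \<and> u x \<le> 1 \<Longrightarrow> AE x in M. clip01 u x = u x"
  by (erule eventually_mono) (auto simp: clip01_def)

lemma clip01_L2:
  "u \<in> borel_measurable unit_cube \<Longrightarrow> clip01 u \<in> L2 (unit_cube :: (real ^ 'd) measure)"
proof (rule bounded_L2[OF unit_cube.finite_measure_axioms clip01_measurable])
  fix x show "\<bar>clip01 u x\<bar> \<le> 1" using clip01_range[of u x] by auto
qed

text \<open>Smoothness classes are invariant under modification on null sets.\<close>

lemma l2_proj_cong_AE:
  assumes "h \<in> L2 M" "h' \<in> L2 M" "AE x in M. h x = h' x" "V \<subseteq> L2 M"
  shows "l2_proj M V h = l2_proj M V h'"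
proof -
  have "l2_inner M (\<lambda>x. h x - p x) v = l2_inner M (\<lambda>x. h' x - p x) v" if "p \<in> V" "v \<in> V" for p v
  proof (rule l2_inner_cong_AE)
    have "p \<in> L2 M" "v \<in> L2 M" using that assms(4) by auto
    then show "(\<lambda>x. h x - p x) \<in> borel_measurable M" "(\<lambda>x. h' x - p x) \<in> borel_measurable M" "v \<in> borel_measurable M"
      using assms(1,2) by (auto simp: L2_def)
    show "AE x in M. h x - p x = h' x - p x" using assms(3) by eventually_elim simp
  qed
  then have "(\<lambda>p. p \<in> V \<and> (\<forall>v\<in>V. l2_inner M (\<lambda>x. h x - p x) v = 0)) =
    (\<lambda>p. p \<in> V \<and> (\<forall>v\<in>V. l2_inner M (\<lambda>x. h' x - p x) v = 0))" by auto
  then show ?thesis by (simp add: l2_proj_def)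
qed

lemma regression_class_L2: "u \<in> regression_class W s B \<Longrightarrow> u \<in> L2 unit_cube"
  by (simp add: regression_class_def besov_ball_def)

lemma regression_class_range: "u \<in> regression_class W s B \<Longrightarrow> AE x in unit_cube. 0 \<le> u x \<and> u x \<le> 1"
  by (simp add: regression_class_def)

lemma regression_class_clip01:
  assumes u: "(u :: real ^ 'd \<Rightarrow> real) \<in> regression_class W s B"
  shows "clip01 u \<in> regression_class W s B"
proof -
  have L: "u \<in> L2 unit_cube" "clip01 u \<in> L2 unit_cube"
    using regression_class_L2[OF u] by (auto intro: clip01_L2 L2_D)
  have "P_cube W j (clip01 u) = P_cube W j u" for j
    unfolding P_cube_def using clip01_AE[OF regression_class_range[OF u]]
    by (intro l2_proj_cong_AE L) (auto simp: V_cube_def l2_span_def)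
  then have "besov_norm W s (clip01 u) = besov_norm W s u"
    by (simp add: besov_norm_def Q_cube_def[abs_def])
  then show ?thesis using u L clip01_range[of u]
    by (auto simp: regression_class_def besov_ball_def intro!: AE_I2)
qed

lemma l2_dist_clip01:
  assumes "u \<in> regression_class W s B" "v \<in> borel_measurable unit_cube"
  shows "l2_dist unit_cube (clip01 u) v = l2_dist unit_cube u v"
  using L2_D(1)[OF regression_class_L2[OF assms(1)]] assms(2) clip01_AE[OF regression_class_range[OF assms(1)]]
  by (intro l2_dist_cong_AE clip01_measurable)


subsection \<open>The candidate net\<close>

text \<open>A candidate is indexed by a level and a lattice point; it is some member of the class \<open>\<UU>\<close> near the lattice
  function, so the estimator stays inside \<open>\<UU>\<close>.  The lattice width \<open>1 / \<surd>q\<close> is the noise level of one coefficient and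
  is the same at all resolution levels.  The coefficients of \<open>f\<close> are at most \<open>1\<close>, so the integers up to \<open>\<surd>q + 1 \<le> q + 1\<close> suffice.\<close>

definition net_index :: "boundary_wavelets \<Rightarrow> nat \<Rightarrow> nat \<Rightarrow> (nat \<times> (('d :: finite \<Rightarrow> widx) \<Rightarrow> int)) set" where
  "net_index W n q = Sigma {coarse_level W..n} (\<lambda>l. PiE (cube_index W l) (\<lambda>_. {- int (q + 1)..int (q + 1)}))"

definition near_lattice ::
  "boundary_wavelets \<Rightarrow> real \<Rightarrow> nat \<Rightarrow> nat \<times> (('d :: finite \<Rightarrow> widx) \<Rightarrow> int) \<Rightarrow> (real ^ 'd \<Rightarrow> real) \<Rightarrow> bool" where
  "near_lattice W K q \<theta> u \<longleftrightarrow>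
     l2_dist unit_cube u (lattice_fun (cube_index W (fst \<theta>)) (phi_cube W (fst \<theta>)) (1 / sqrt q) (snd \<theta>))
       \<le> K * sqrt (card (cube_index W (fst \<theta>) :: ('d \<Rightarrow> widx) set) / q)"

definition net ::
  "boundary_wavelets \<Rightarrow> (real ^ 'd \<Rightarrow> real) set \<Rightarrow> real \<Rightarrow> nat \<Rightarrow> nat \<Rightarrow> (nat \<times> (('d \<Rightarrow> widx) \<Rightarrow> int)) set" where
  "net W \<UU> K n q = {\<theta> \<in> net_index W n q. \<exists>u\<in>\<UU>. near_lattice W K q \<theta> u}"

definition net_member ::
  "boundary_wavelets \<Rightarrow> (real ^ 'd \<Rightarrow> real) set \<Rightarrow> real \<Rightarrow> nat \<Rightarrow> nat \<times> (('d \<Rightarrow> widx) \<Rightarrow> int) \<Rightarrow> real ^ 'd \<Rightarrow> real" where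
  "net_member W \<UU> K q \<theta> = (SOME u. u \<in> \<UU> \<and> near_lattice W K q \<theta> u)"

text \<open>The value \<open>0\<close> at inadmissible indices keeps the function measurable and within \<open>[0,1]\<close> for every index.\<close>

definition net_fun ::
  "boundary_wavelets \<Rightarrow> (real ^ 'd \<Rightarrow> real) set \<Rightarrow> real \<Rightarrow> nat \<Rightarrow> nat \<times> (('d \<Rightarrow> widx) \<Rightarrow> int) \<Rightarrow> real ^ 'd \<Rightarrow> real" where
  "net_fun W \<UU> K q \<theta> = (if \<exists>u\<in>\<UU>. near_lattice W K q \<theta> u then clip01 (net_member W \<UU> K q \<theta>) else (\<lambda>_. 0))"

text \<open>The penalty is proportional to the dimension of the level; the factor \<open>16\<close> cancels the one in the exponential comparison
  of two candidates.\<close>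

definition net_crit ::
  "boundary_wavelets \<Rightarrow> (real ^ 'd \<Rightarrow> real) set \<Rightarrow> real \<Rightarrow> real \<Rightarrow> nat set \<Rightarrow>
     nat \<times> (('d \<Rightarrow> widx) \<Rightarrow> int) \<Rightarrow> (nat \<Rightarrow> (real ^ 'd) \<times> bool) \<Rightarrow> real" where
  "net_crit W \<UU> K a E \<theta> \<omega> = ls_crit E (net_fun W \<UU> K (card E) \<theta>) \<omega>
     + 16 * a * card (cube_index W (fst \<theta>) :: ('d \<Rightarrow> widx) set)"

definition net_choice ::
  "boundary_wavelets \<Rightarrow> (real ^ 'd \<Rightarrow> real) set \<Rightarrow> real \<Rightarrow> real \<Rightarrow> nat \<Rightarrow> nat set \<Rightarrow>
     (nat \<Rightarrow> (real ^ 'd) \<times> bool) \<Rightarrow> nat \<times> (('d \<Rightarrow> widx) \<Rightarrow> int)" where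
  "net_choice W \<UU> K a n E = argmin_choice (net W \<UU> K n (card E)) (net_crit W \<UU> K a E)"

locale net_setting = cdv W R N for W R N +
  fixes \<UU> :: "(real ^ 'd \<Rightarrow> real) set" and s B :: real
  assumes \<UU>: "\<UU> = regression_class W s B"
begin

lemma finite_net: "finite (net W \<UU> K n q)"
proof -
  have "finite (net_index W n q :: (nat \<times> (('d \<Rightarrow> widx) \<Rightarrow> int)) set)"
    unfolding net_index_def by (intro finite_SigmaI finite_PiE finite_cube_index) auto
  then show ?thesis by (auto simp: net_def)
qed

lemma net_member: "\<theta> \<in> net W \<UU> K n q \<Longrightarrow> net_member W \<UU> K q \<theta> \<in> \<UU> \<and> near_lattice W K q \<theta> (net_member W \<UU> K q \<theta>)"
proof -
  assume "\<theta> \<in> net W \<UU> K n q"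
  then have "\<exists>u. u \<in> \<UU> \<and> near_lattice W K q \<theta> u" unfolding net_def by blast
  from someI_ex[OF this] show ?thesis unfolding net_member_def .
qed

lemma net_fun_eq: "\<theta> \<in> net W \<UU> K n q \<Longrightarrow> net_fun W \<UU> K q \<theta> = clip01 (net_member W \<UU> K q \<theta>)"
  by (auto simp: net_def net_fun_def)

lemma net_fun_range: "0 \<le> net_fun W \<UU> K q \<theta> x \<and> net_fun W \<UU> K q \<theta> x \<le> 1"
  by (simp add: net_fun_def clip01_range)

lemma net_fun_measurable: "net_fun W \<UU> K q \<theta> \<in> borel_measurable unit_cube"
proof (cases "\<exists>u\<in>\<UU>. near_lattice W K q \<theta> u")
  case True
  then have "\<exists>u. u \<in> \<UU> \<and> near_lattice W K q \<theta> u" by blast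
  from someI_ex[OF this] have "net_member W \<UU> K q \<theta> \<in> \<UU>" unfolding net_member_def by blast
  then have "net_member W \<UU> K q \<theta> \<in> borel_measurable unit_cube"
    unfolding \<UU> by (auto intro!: L2_D(1) regression_class_L2)
  then show ?thesis using True by (auto simp: net_fun_def intro: clip01_measurable)
qed (simp add: net_fun_def)

lemma net_fun_L2: "net_fun W \<UU> K q \<theta> \<in> L2 unit_cube"
proof (rule bounded_L2[OF unit_cube.finite_measure_axioms net_fun_measurable])
  fix x show "\<bar>net_fun W \<UU> K q \<theta> x\<bar> \<le> 1" using net_fun_range[of K q \<theta> x] by auto
qed

lemma net_fun_class: "\<theta> \<in> net W \<UU> K n q \<Longrightarrow> net_fun W \<UU> K q \<theta> \<in> \<UU>"
  using net_member[of \<theta> K n q] net_fun_eq[of \<theta> K n q] unfolding \<UU> by (auto intro: regression_class_clip01)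

lemma lattice_fun_L2: "J0 \<le> l \<Longrightarrow> lattice_fun (cube_index W l :: ('d \<Rightarrow> widx) set) (phi_cube W l) \<delta> z \<in> L2 unit_cube"
  unfolding lattice_fun_def[abs_def] by (intro l2_onb.comb_L2 onb_cube)

lemma net_fun_near: 
  assumes \<theta>: "\<theta> \<in> net W \<UU> K n q" shows "near_lattice W K q \<theta> (net_fun W \<UU> K q \<theta>)"
proof -
  have "J0 \<le> fst \<theta>" using \<theta> by (auto simp: net_def net_index_def)
  then show ?thesis
    using net_member[OF \<theta>] unfolding net_fun_eq[OF \<theta>] near_lattice_def
    by (subst l2_dist_clip01[where W=W and s=s and B=B]) (auto simp: \<UU> intro!: L2_D(1) lattice_fun_L2)
qed

text \<open>At a level of dimension \<open>D\<close> the Gaussian sum is at most \<open>exp (a - 1)\<close> to the power \<open>D\<close>, and the penalty contributes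
  \<open>exp (- a D)\<close>.  What remains is \<open>exp (- D)\<close>, which is summable over the levels since \<open>D \<ge> l + 1\<close>.\<close>

lemma net_sum_le:
  fixes A K a c :: real
  assumes q: "0 < q" and c: "0 < c" and A: "1 \<le> A"
    "\<And>\<alpha> Z. finite Z \<Longrightarrow> (\<Sum>z\<in>Z. exp (- (c / 256) * (of_int z - \<alpha>)\<^sup>2)) \<le> A"
    and K: "0 \<le> K" and a: "a = 1 + ln (A * exp (c * K\<^sup>2 / 128))" and u0: "u0 \<in> L2 unit_cube"
  shows "(\<Sum>\<theta>\<in>net W \<UU> K n q. exp (- (16 * a * card (cube_index W (fst \<theta>) :: ('d \<Rightarrow> widx) set)) / 16
      - q * c * (l2_dist unit_cube (net_fun W \<UU> K q \<theta>) u0)\<^sup>2 / 128)) \<le> 1"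
proof -
  let ?Z = "{- int (q + 1)..int (q + 1)}"
  let ?S = "\<lambda>l. {z. (l, z) \<in> net W \<UU> K n q}"
  let ?D = "\<lambda>l. card (cube_index W l :: ('d \<Rightarrow> widx) set)"
  let ?x = "\<lambda>l z. exp (- real q * c * (l2_dist unit_cube (net_fun W \<UU> K q (l, z)) u0)\<^sup>2 / 128)"
  have netS: "net W \<UU> K n q = Sigma {J0..n} ?S" by (auto simp: net_def net_index_def)
  have finS: "finite (?S l)" for l
    by (rule finite_subset[OF _ finite_imageI[OF finite_net[of K n q], of snd]]) force
  have inner: "(\<Sum>z\<in>?S l. ?x l z) \<le> (A * exp (c * K\<^sup>2 / 128)) ^ ?D l" if l: "J0 \<le> l" "l \<le> n" for l
  proof (rule l2_onb.lattice_net_sum[OF onb_cube[OF l(1)] _ c A(1) A(2) _ _ u0 net_fun_L2 _ K])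
    show "?S l \<subseteq> cube_index W l \<rightarrow>\<^sub>E ?Z" by (auto simp: net_def net_index_def)
    show "l2_dist unit_cube (net_fun W \<UU> K q (l, z)) (lattice_fun (cube_index W l) (phi_cube W l) (1 / sqrt (real q)) z)
         \<le> K * sqrt (real (?D l) / real q)" if "z \<in> ?S l" for z
      using net_fun_near[of "(l, z)" K n q] that by (simp add: near_lattice_def)
  qed (use q in auto)
  have ea: "exp (- a * real k) * (A * exp (c * K\<^sup>2 / 128)) ^ k = exp (- real k)" for k
  proof -
    have p: "0 < A * exp (c * K\<^sup>2 / 128)" using A by simp
    have "(A * exp (c * K\<^sup>2 / 128)) ^ k = exp (real k * (a - 1))"
      unfolding exp_of_nat_mult a using p by simp
    then show ?thesis by (simp add: exp_add[symmetric] algebra_simps)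
  qed
  have "(\<Sum>\<theta>\<in>net W \<UU> K n q. exp (- (16 * a * ?D (fst \<theta>)) / 16 - q * c * (l2_dist unit_cube (net_fun W \<UU> K q \<theta>) u0)\<^sup>2 / 128))
     = (\<Sum>\<theta>\<in>Sigma {J0..n} ?S. exp (- a * ?D (fst \<theta>)) * ?x (fst \<theta>) (snd \<theta>))"
    by (rule sum.cong[OF netS]) (simp add: exp_add[symmetric])
  also have "\<dots> = (\<Sum>l\<in>{J0..n}. \<Sum>z\<in>?S l. exp (- a * ?D l) * ?x l z)"
    using sum.Sigma[of "{J0..n}" ?S "\<lambda>l z. exp (- a * ?D l) * ?x l z"] finS by (simp add: case_prod_unfold)
  also have "\<dots> = (\<Sum>l\<in>{J0..n}. exp (- a * ?D l) * (\<Sum>z\<in>?S l. ?x l z))" by (simp only: sum_distrib_left)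
  also have "\<dots> \<le> (\<Sum>l\<in>{J0..n}. exp (- a * ?D l) * (A * exp (c * K\<^sup>2 / 128)) ^ ?D l)"
    by (intro sum_mono mult_left_mono inner) auto
  also have "\<dots> = (\<Sum>l\<in>{J0..n}. exp (- real (?D l)))" by (simp only: ea)
  also have "\<dots> \<le> (\<Sum>l\<in>{J0..n}. (1 / 2) ^ Suc l)"
  proof (rule sum_mono)
    fix l assume l: "l \<in> {J0..n}"
    have "Suc l \<le> 2 ^ l" by (induction l) auto
    also have "\<dots> \<le> 2 ^ (l * CARD('d))" by (intro power_increasing) auto
    finally have "Suc l \<le> ?D l" using l by (simp add: card_cube_index)
    then have "real (Suc l) \<le> real (?D l)" by (simp only: of_nat_le_iff)
    then have "exp (- real (?D l)) \<le> exp (real (Suc l) * (- 1))" by (simp only: exp_le_cancel_iff) simp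
    also have "\<dots> = (exp (- 1)) ^ Suc l" by (rule exp_of_nat_mult)
    also have "\<dots> \<le> (1 / 2) ^ Suc l"
    proof (rule power_mono)
      have "(2 :: real) \<le> exp 1" using exp_ge_add_one_self[of 1] by simp
      then show "exp (- 1) \<le> 1 / (2 :: real)" by (simp add: exp_minus field_simps)
    qed simp
    finally show "exp (- real (?D l)) \<le> (1 / 2) ^ Suc l" .
  qed
  also have "\<dots> \<le> (\<Sum>l. (1 / 2) ^ Suc l)"
    by (rule sum_le_suminf[OF sums_summable[OF power_half_series]]) auto
  also have "\<dots> = 1" using sums_unique[OF power_half_series] by simp
  finally show ?thesis .
qed

text \<open>Rounding the wavelet coefficients of \<open>f\<close> gives a net point whose bias is of the order of the stochastic error.\<close>

lemma net_point_exists: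
  assumes f: "f \<in> \<UU>" and l: "J0 \<le> l" "l \<le> n" and q: "0 < q" and K: "1 \<le> K"
    and bias: "l2_dist unit_cube f (P_cube W l f) \<le> (K - 1) * sqrt (card (cube_index W l :: ('d \<Rightarrow> widx) set) / q)"
  shows "\<exists>\<theta>0\<in>net W \<UU> K n q. fst \<theta>0 = l \<and>
    l2_dist unit_cube f (net_fun W \<UU> K q \<theta>0) \<le> 2 * K * sqrt (card (cube_index W l :: ('d \<Rightarrow> widx) set) / q)"
proof -
  let ?I = "cube_index W l :: ('d \<Rightarrow> widx) set"
  let ?r = "sqrt (card ?I / q)"
  interpret C: l2_onb unit_cube ?I "phi_cube W l" by (rule onb_cube[OF l(1)])
  have fL: "f \<in> L2 unit_cube" using f unfolding \<UU> by (rule regression_class_L2)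
  have pL: "P_cube W l f \<in> L2 unit_cube" by (rule P_cube_L2[OF l(1) fL])
  obtain a where a: "AE x in unit_cube. P_cube W l f x = (\<Sum>i\<in>?I. a i * phi_cube W l i x)"
    using P_cube_V[OF l(1) fL] by (auto simp: V_cube_alt l2_span_finite_iff[OF C.fin])
  have "(l2_norm unit_cube (P_cube W l f))\<^sup>2 = (\<Sum>i\<in>?I. (a i)\<^sup>2)"
    unfolding C.norm_comb[symmetric] using a pL C.comb_L2 by (subst l2_norm_cong_AE) (auto intro: L2_D)
  moreover have "l2_norm unit_cube (P_cube W l f) \<le> 1"
  proof -
    have "l2_norm unit_cube (P_cube W l f) \<le> l2_norm unit_cube f"
      unfolding P_cube_def V_cube_alt by (rule C.norm_proj_le[OF fL])
    also have "\<dots> \<le> 1"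
    proof -
      have "(l2_norm unit_cube f)\<^sup>2 \<le> (\<integral>x. 1 \<partial>(unit_cube :: (real ^ 'd) measure))"
        unfolding l2_norm_sq_int
      proof (rule integral_mono_AE)
        show "AE x in unit_cube. (f x)\<^sup>2 \<le> 1"
          using regression_class_range[OF f[unfolded \<UU>]]
          by (rule eventually_mono) (auto simp: power_le_one)
      qed (use L2_D(2)[OF fL] in auto)
      moreover have "measure (unit_cube :: (real ^ 'd) measure) (space unit_cube) = 1" by (rule unit_cube.prob_space)
      ultimately have "(l2_norm unit_cube f)\<^sup>2 \<le> 1\<^sup>2" by simp
      then show ?thesis by (rule power2_le_imp_le) simp
    qed
    finally show ?thesis .
  qed
  ultimately have na: "(\<Sum>i\<in>?I. (a i)\<^sup>2) \<le> 1" by (metis l2_norm_nonneg power_le_one)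
  have ai: "\<bar>a i\<bar> \<le> 1" if "i \<in> ?I" for i
  proof -
    have "(a i)\<^sup>2 \<le> (\<Sum>i\<in>?I. (a i)\<^sup>2)" using that by (intro member_le_sum C.fin) auto
    then show ?thesis using na by (simp add: abs_square_le_1[symmetric])
  qed
  define z where "z = restrict (\<lambda>i. round (sqrt q * a i)) ?I"
  have zr: "\<bar>of_int (z i) - sqrt q * a i\<bar> \<le> 1 / 2" if "i \<in> ?I" for i
    using that of_int_round_abs_le[of "sqrt q * a i"] by (simp add: z_def)
  have zb: "z i \<in> {- int (q + 1)..int (q + 1)}" if i: "i \<in> ?I" for i
  proof -
    have "\<bar>sqrt q * a i\<bar> \<le> sqrt q * 1" unfolding abs_mult using ai[OF i] by (intro mult_mono) auto
    also have "sqrt q \<le> q"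
    proof (rule real_le_lsqrt)
      show "real q \<le> (real q)\<^sup>2" using q by (simp add: power2_eq_square)
    qed auto
    finally have "\<bar>sqrt q * a i\<bar> \<le> q" by simp
    then have "\<bar>real_of_int (z i)\<bar> \<le> q + 1" using zr[OF i] by linarith
    then show ?thesis by auto
  qed
  have zE: "z \<in> PiE ?I (\<lambda>_. {- int (q + 1)..int (q + 1)})" using zb by (auto simp: z_def)
  let ?v = "lattice_fun ?I (phi_cube W l) (1 / sqrt q) z"
  have vL: "?v \<in> L2 unit_cube" by (rule lattice_fun_L2[OF l(1)])
  have pv: "l2_dist unit_cube (P_cube W l f) ?v \<le> ?r"
  proof (rule power2_le_imp_le)
    have "l2_dist unit_cube (P_cube W l f) ?v = l2_norm unit_cube (\<lambda>x. \<Sum>i\<in>?I. (a i - 1 / sqrt q * of_int (z i)) * phi_cube W l i x)"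
      unfolding l2_dist_def
    proof (rule l2_norm_cong_AE)
      show "AE x in unit_cube. P_cube W l f x - ?v x = (\<Sum>i\<in>?I. (a i - 1 / sqrt q * of_int (z i)) * phi_cube W l i x)"
        using a by eventually_elim (simp add: lattice_fun_def sum_subtractf left_diff_distrib)
    qed (use pL vL C.comb_L2 in \<open>auto intro!: borel_measurable_diff L2_D(1)\<close>)
    then have "(l2_dist unit_cube (P_cube W l f) ?v)\<^sup>2 = (\<Sum>i\<in>?I. (a i - 1 / sqrt q * of_int (z i))\<^sup>2)"
      by (simp only: C.norm_comb)
    also have "\<dots> \<le> (\<Sum>i\<in>?I. 1 / q)"
    proof (rule sum_mono)
      fix i assume i: "i \<in> ?I"
      have "a i - 1 / sqrt q * of_int (z i) = (sqrt q * a i - of_int (z i)) / sqrt q" using q by (simp add: field_simps)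
      then have "(a i - 1 / sqrt q * of_int (z i))\<^sup>2 = (sqrt q * a i - of_int (z i))\<^sup>2 / q" using q by (simp add: power_divide)
      also have "(sqrt q * a i - of_int (z i))\<^sup>2 \<le> 1"
        using zr[OF i] by (simp add: abs_square_le_1 abs_minus_commute)
      finally show "(a i - 1 / sqrt q * of_int (z i))\<^sup>2 \<le> 1 / q" using q by (simp add: divide_right_mono)
    qed
    finally show "(l2_dist unit_cube (P_cube W l f) ?v)\<^sup>2 \<le> ?r\<^sup>2" by simp
  qed simp
  have fv: "l2_dist unit_cube f ?v \<le> K * ?r"
  proof -
    have "l2_dist unit_cube f ?v \<le> (K - 1) * ?r + ?r"
      using l2_dist_triangle[OF fL pL vL] bias pv by linarith
    then show ?thesis by (simp add: left_diff_distrib)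
  qed
  have \<theta>0: "(l, z) \<in> net W \<UU> K n q"
    using f fv l zE by (auto simp: net_def net_index_def near_lattice_def intro!: bexI[of _ f])
  have "l2_dist unit_cube f (net_fun W \<UU> K q (l, z)) \<le> K * ?r + K * ?r"
    using l2_dist_triangle[OF fL vL net_fun_L2[of K q "(l, z)"]] fv net_fun_near[OF \<theta>0]
    unfolding near_lattice_def l2_dist_commute[of _ ?v] fst_conv snd_conv by (simp only: l2_dist_commute[of _ f ?v])
  then show ?thesis using \<theta>0 by (intro bexI[of _ "(l, z)"]) auto
qed

lemma net_crit_measurable:
  "net_crit W \<UU> K a E \<theta> \<in> borel_measurable (PiM E (\<lambda>_. cube_obs))"
proof -
  have r: "resid (net_fun W \<UU> K (card E) \<theta>) \<in> borel_measurable cube_obs"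
    unfolding resid_def[abs_def] using net_fun_measurable by measurable
  have "(\<lambda>\<omega>. resid (net_fun W \<UU> K (card E) \<theta>) (\<omega> i)) \<in> borel_measurable (PiM E (\<lambda>_. cube_obs))" if "i \<in> E" for i
    by (rule measurable_compose[OF measurable_component_singleton[OF that] r])
  then show ?thesis unfolding net_crit_def[abs_def] ls_crit_def
    by (intro borel_measurable_add borel_measurable_sum borel_measurable_power) auto
qed

lemma net_choice_measurable: "net_choice W \<UU> K a n E \<in> PiM E (\<lambda>_. cube_obs) \<rightarrow>\<^sub>M count_space UNIV"
  unfolding net_choice_def by (intro argmin_choice_measurable finite_net net_crit_measurable)

lemma net_choice_restrict: "net_choice W \<UU> K a n E (restrict \<omega> E) = net_choice W \<UU> K a n E \<omega>"
  by (simp add: net_choice_def argmin_choice_def net_crit_def ls_crit_def)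

text \<open>An oracle inequality: the level \<open>l\<close> is arbitrary, and the estimator, which does not know it, attains the order of the
  stochastic error at \<open>l\<close> as soon as the bias at \<open>l\<close> is not larger.\<close>

lemma estimator_risk:
  fixes A K a c C x :: real
  assumes A: "1 \<le> A" "\<And>\<alpha> Z. finite Z \<Longrightarrow> (\<Sum>z\<in>Z. exp (- (c / 256) * (of_int z - \<alpha>)\<^sup>2)) \<le> A"
    and a: "a = 1 + ln (A * exp (c * K\<^sup>2 / 128))" and K: "1 \<le> K"
    and reg: "regression_sample f g c C I"
    and f: "f \<in> \<UU>" and l: "J0 \<le> l" "l \<le> n" and E: "E \<subseteq> I" "E \<noteq> {}"
    and bias: "l2_dist unit_cube f (P_cube W l f) \<le> (K - 1) * sqrt (card (cube_index W l :: ('d \<Rightarrow> widx) set) / card E)"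
    and x: "0 \<le> x"
  shows "\<P>(\<omega> in PiM I (\<lambda>_. pair_law f g).
      \<not> l2_dist unit_cube f (net_fun W \<UU> K (card E) (net_choice W \<UU> K a n E \<omega>))
        \<le> (2 * K + sqrt (128 * (a + C * K\<^sup>2 / 2 + x) / c)) * sqrt (card (cube_index W l :: ('d \<Rightarrow> widx) set) / card E))
    \<le> exp (- x)"
proof -
  interpret regression_sample f g c C I by (rule reg)
  let ?U = "net_fun W \<UU> K (card E)" and ?D = "card (cube_index W l :: ('d \<Rightarrow> widx) set)"
  let ?r = "sqrt (?D / card E)" and ?net = "net W \<UU> K n (card E)"
  define K' where "K' = 128 * (a + C * K\<^sup>2 / 2 + x) / c"
  have q: "0 < card E" using E smp.I_fin by (meson card_gt_0_iff finite_subset)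
  have c: "0 < c" by (rule reg.c_pos)
  have "1 \<le> A * exp (c * K\<^sup>2 / 128)" using A(1) c mult_mono[of 1 A 1 "exp (c * K\<^sup>2 / 128)"] by simp
  then have a1: "1 \<le> a" unfolding a by simp
  have K'0: "0 \<le> K'" unfolding K'_def using a1 x reg.C_pos c by simp
  have D1: "1 \<le> real ?D" using card_cube_index[OF l(1), where 'd='d] by simp
  obtain \<theta>0 where \<theta>0: "\<theta>0 \<in> ?net" "fst \<theta>0 = l" "l2_dist unit_cube f (?U \<theta>0) \<le> 2 * K * ?r"
    using net_point_exists[OF f l q K bias] by blast
  define R where "R = sqrt K' * ?r"
  have R: "0 \<le> R" using K'0 by (simp add: R_def)
  have ne: "?net \<noteq> {}" using \<theta>0 by auto
  have "\<P>(\<omega> in \<Omega>. \<not> l2_dist unit_cube f (?U (net_choice W \<UU> K a n E \<omega>)) \<le> (2 * K + sqrt K') * ?r) \<le>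
      \<P>(\<omega> in \<Omega>. \<exists>\<theta>\<in>?net. ls_crit E (?U \<theta>) \<omega> + 16 * a * card (cube_index W (fst \<theta>) :: ('d \<Rightarrow> widx) set)
        \<le> ls_crit E (?U \<theta>0) \<omega> + 16 * a * card (cube_index W (fst \<theta>0) :: ('d \<Rightarrow> widx) set)
        \<and> R \<le> l2_dist unit_cube (?U \<theta>) (?U \<theta>0))"
  proof (rule smp.\<Omega>.finite_measure_mono)
    show "{\<omega> \<in> space \<Omega>. \<not> l2_dist unit_cube f (?U (net_choice W \<UU> K a n E \<omega>)) \<le> (2 * K + sqrt K') * ?r}
      \<subseteq> {\<omega> \<in> space \<Omega>. \<exists>\<theta>\<in>?net. ls_crit E (?U \<theta>) \<omega> + 16 * a * card (cube_index W (fst \<theta>) :: ('d \<Rightarrow> widx) set)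
        \<le> ls_crit E (?U \<theta>0) \<omega> + 16 * a * card (cube_index W (fst \<theta>0) :: ('d \<Rightarrow> widx) set)
        \<and> R \<le> l2_dist unit_cube (?U \<theta>) (?U \<theta>0)}"
    proof (rule subsetI, rule CollectI)
      fix \<omega> assume \<omega>: "\<omega> \<in> {\<omega> \<in> space \<Omega>. \<not> l2_dist unit_cube f (?U (net_choice W \<UU> K a n E \<omega>)) \<le> (2 * K + sqrt K') * ?r}"
      let ?\<theta> = "net_choice W \<UU> K a n E \<omega>"
      have "l2_dist unit_cube f (?U ?\<theta>) \<le> l2_dist unit_cube f (?U \<theta>0) + l2_dist unit_cube (?U \<theta>0) (?U ?\<theta>)"
        by (intro l2_dist_triangle net_fun_L2 regression_class_L2[OF f[unfolded \<UU>]])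
      moreover have "(2 * K + sqrt K') * ?r < l2_dist unit_cube f (?U ?\<theta>)" using \<omega> by auto
      ultimately have "R \<le> l2_dist unit_cube (?U ?\<theta>) (?U \<theta>0)"
        using \<theta>0(3) unfolding R_def l2_dist_commute[of _ "?U \<theta>0" "?U ?\<theta>"] distrib_right by linarith
      moreover have "net_crit W \<UU> K a E ?\<theta> \<omega> \<le> net_crit W \<UU> K a E \<theta>0 \<omega>"
        unfolding net_choice_def by (rule argmin_choice(2)[OF finite_net ne \<theta>0(1), where crit="net_crit W \<UU> K a E"])
      moreover have "?\<theta> \<in> ?net"
        unfolding net_choice_def by (rule argmin_choice(1)[OF finite_net ne])
      ultimately show "\<omega> \<in> space \<Omega> \<and> (\<exists>\<theta>\<in>?net. ls_crit E (?U \<theta>) \<omega> + 16 * a * card (cube_index W (fst \<theta>) :: ('d \<Rightarrow> widx) set)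
        \<le> ls_crit E (?U \<theta>0) \<omega> + 16 * a * card (cube_index W (fst \<theta>0) :: ('d \<Rightarrow> widx) set)
        \<and> R \<le> l2_dist unit_cube (?U \<theta>) (?U \<theta>0))"
        using \<omega> by (auto simp: net_crit_def)
    qed
    have cm: "ls_crit E (?U \<theta>) \<in> borel_measurable \<Omega>" for \<theta>
    proof (rule bmf_measurable)
      show "ls_crit E (?U \<theta>) \<in> bmf \<Omega>" unfolding ls_crit_def[abs_def] using E
        by (intro bmf_sum smp.coord_bmf[where \<psi>="\<lambda>z. (resid (?U \<theta>) z)\<^sup>2"])
          (auto simp: reg.bmf_P intro!: bmf_power2 reg.resid_bmf unit_fun_bmf net_fun_measurable net_fun_range)
    qed
    show "{\<omega> \<in> space \<Omega>. \<exists>\<theta>\<in>?net. ls_crit E (?U \<theta>) \<omega> + 16 * a * card (cube_index W (fst \<theta>) :: ('d \<Rightarrow> widx) set)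
        \<le> ls_crit E (?U \<theta>0) \<omega> + 16 * a * card (cube_index W (fst \<theta>0) :: ('d \<Rightarrow> widx) set)
        \<and> R \<le> l2_dist unit_cube (?U \<theta>) (?U \<theta>0)} \<in> sets \<Omega>"
      using cm by (intro sets.sets_Collect_finite_Ex finite_net sets.sets_Collect_conj borel_measurable_le borel_measurable_add) auto
  qed
  also have "\<dots> \<le> exp (16 * a * card (cube_index W (fst \<theta>0) :: ('d \<Rightarrow> widx) set) / 16
      + card E * C * (l2_dist unit_cube f (?U \<theta>0))\<^sup>2 / 8 - card E * c * R\<^sup>2 / 128)"
    by (rule net_union_bound[OF finite_net net_fun_measurable net_fun_range \<theta>0(1) E(1) R
        net_sum_le[OF q c A _ a net_fun_L2]]) (use K in auto)
  also have "\<dots> \<le> exp (- x)"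
  proof -
    have r2: "card E * ?r\<^sup>2 = ?D" using q by simp
    have "card E * C * (l2_dist unit_cube f (?U \<theta>0))\<^sup>2 / 8 \<le> card E * C * (2 * K * ?r)\<^sup>2 / 8"
      using \<theta>0(3) reg.C_pos by (intro divide_right_mono mult_left_mono power_mono) auto
    also have "\<dots> = C * K\<^sup>2 / 2 * (card E * ?r\<^sup>2)" by (simp only: power_mult_distrib) simp
    finally have 1: "card E * C * (l2_dist unit_cube f (?U \<theta>0))\<^sup>2 / 8 \<le> C * K\<^sup>2 / 2 * ?D" unfolding r2 .
    have "card E * c * R\<^sup>2 / 128 = c * K' / 128 * (card E * ?r\<^sup>2)"
      unfolding R_def power_mult_distrib using K'0 by (simp only: real_sqrt_pow2) simp
    also have "\<dots> = (a + C * K\<^sup>2 / 2 + x) * ?D" unfolding r2 K'_def using c by simp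
    finally have 2: "card E * c * R\<^sup>2 / 128 = (a + C * K\<^sup>2 / 2 + x) * ?D" .
    have "x \<le> x * ?D" using mult_left_mono[OF D1 x] by simp
    then show ?thesis using 1 2 \<theta>0(2) by (simp add: algebra_simps)
  qed
  finally show ?thesis by (simp only: K'_def)
qed

end


section \<open>Rates and resolution levels\<close>

text \<open>The testing rate at smoothness \<open>s\<close> is the estimation rate at smoothness \<open>2 s\<close>.  This identity is behind the doubling of
  the smoothness from one level to the next.\<close>

lemma rho_rate_eq: "rho_rate d n s = eps_rate d n (2 * s)"
  by (simp add: rho_rate_def eps_rate_def)

lemma eps_rate_pos: "0 < n \<Longrightarrow> 0 < eps_rate d n s"
  by (simp add: eps_rate_def)

lemma eps_rate_antimono:
  assumes n: "0 < n" and d: "0 < d" and b: "0 < b" "b \<le> b'"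
  shows "eps_rate d n b' \<le> eps_rate d n b"
proof -
  have "b / (2 * b + d) \<le> b' / (2 * b' + d)"
    using d b by (simp add: field_simps)
  then show ?thesis unfolding eps_rate_def using n by (intro powr_mono) auto
qed

definition res_level :: "nat \<Rightarrow> real \<Rightarrow> nat" where
  "res_level n t = nat \<lfloor>log 2 n * t\<rfloor>"

lemma res_level_bounds:
  assumes n: "1 \<le> n" and t: "0 \<le> t"
  shows "2 ^ res_level n t \<le> real n powr t" "real n powr t \<le> 2 * 2 ^ res_level n t"
proof -
  let ?x = "log 2 n * t"
  have x: "0 \<le> ?x" using n t by simp
  have n2: "real n powr t = 2 powr ?x" using n by (simp add: powr_powr[symmetric])
  have l: "real (res_level n t) = of_int \<lfloor>?x\<rfloor>" using x by (simp add: res_level_def)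
  have p: "(2 :: real) ^ res_level n t = 2 powr (of_int \<lfloor>?x\<rfloor>)" by (simp add: powr_realpow[symmetric] l)
  show "2 ^ res_level n t \<le> real n powr t" unfolding p n2 by (intro powr_mono) auto
  have "2 powr ?x \<le> 2 powr (1 + of_int \<lfloor>?x\<rfloor>)" by (intro powr_mono) linarith+
  also have "\<dots> = 2 * 2 powr (of_int \<lfloor>?x\<rfloor>)" by (simp add: powr_add)
  finally show "real n powr t \<le> 2 * 2 ^ res_level n t" unfolding p n2 .
qed

lemma res_level_le: "1 \<le> n \<Longrightarrow> 0 \<le> t \<Longrightarrow> t \<le> 1 \<Longrightarrow> res_level n t \<le> n"
proof -
  assume n: "1 \<le> n" and t: "0 \<le> t" "t \<le> 1"
  have "real n \<le> 2 ^ n" using less_exp[of n] by (metis less_imp_le of_nat_le_iff of_nat_numeral of_nat_power)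
  then have "log 2 n \<le> n" using n by (subst log_le_iff) (auto simp: powr_realpow)
  moreover have "0 \<le> log 2 n" using n by simp
  ultimately have "log 2 n * t \<le> real n * 1" using t by (intro mult_mono) auto
  then show ?thesis unfolding res_level_def by linarith
qed

lemma bias_rate:
  assumes n: "1 \<le> n" and t: "0 \<le> t" and s: "0 \<le> s"
  shows "2 powr (- (real (res_level n t) * s)) \<le> 2 powr s * real n powr (- (t * s))"
proof -
  have "2 powr (- (real (res_level n t) * s)) = (2 ^ res_level n t) powr (- s)"
    by (simp add: powr_realpow[symmetric] powr_powr)
  also have "\<dots> \<le> (real n powr t / 2) powr (- s)"
    using res_level_bounds(2)[OF n t] s n by (intro powr_mono2') auto
  also have "\<dots> = 2 powr s * real n powr (- (t * s))"
    using n by (simp add: powr_divide powr_powr powr_minus field_simps)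
  finally show ?thesis .
qed

text \<open>The level at which the fluctuation \<open>\<surd>D / m\<close> of the quadratic statistic balances the squared bias; both are then of the
  order \<open>\<rho>\<^sub>n(s)\<^sup>2\<close>.\<close>

lemma quad_level_rates:
  fixes s :: real and n m d :: nat
  assumes n: "1 \<le> n" "n \<le> 4 * m" and d: "0 < d" and s: "0 < s"
  defines "J \<equiv> res_level n (2 / (4 * s + d))"
  shows "sqrt (2 ^ (J * d)) / m \<le> 4 * (rho_rate d n s)\<^sup>2"
    and "2 powr (- (real J * s)) \<le> 2 powr s * rho_rate d n s"
proof -
  let ?t = "2 / (4 * s + d)"
  have t: "0 \<le> ?t" using d s by simp
  have n0: "0 < real n" and m0: "0 < real m" using n by auto
  have "sqrt (2 ^ (J * d)) = (2 ^ J) powr (d / 2)"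
    using d by (simp add: power_mult powr_half_sqrt[symmetric] powr_realpow[symmetric] powr_powr)
  also have "\<dots> \<le> (real n powr ?t) powr (d / 2)"
    unfolding J_def using res_level_bounds(1)[OF n(1) t] by (intro powr_mono2) auto
  also have "\<dots> = real n powr (d / (4 * s + d))"
  proof -
    have "2 / x * (y / 2) = y / x" for x y :: real by (cases "x = 0") (auto simp: field_simps)
    then show ?thesis unfolding powr_powr by (simp only:)
  qed
  finally have "sqrt (2 ^ (J * d)) / m \<le> real n powr (d / (4 * s + d)) / m" using m0 by (intro divide_right_mono) auto
  also have "\<dots> \<le> real n powr (d / (4 * s + d)) / (n / 4)"
    using n n0 m0 by (intro divide_left_mono) auto
  also have "\<dots> = 4 * (real n powr (d / (4 * s + d)) / real n powr 1)" using n0 by simp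
  also have "\<dots> = 4 * real n powr (d / (4 * s + d) - 1)" by (simp only: powr_diff)
  also have "d / (4 * s + d) - 1 = - (2 * s / (4 * s + d)) + - (2 * s / (4 * s + d))"
  proof -
    have q: "4 * s + d \<noteq> 0" using d s by (simp add: add_pos_pos less_imp_neq[symmetric])
    have "d / (4 * s + d) - 1 = d / (4 * s + d) - (4 * s + d) / (4 * s + d)" using q by simp
    also have "\<dots> = (- (2 * s) + - (2 * s)) / (4 * s + d)" unfolding diff_divide_distrib[symmetric] by simp
    finally show ?thesis by (simp only: add_divide_distrib minus_divide_left)
  qed
  also have "4 * real n powr \<dots> = 4 * (rho_rate d n s)\<^sup>2"
    by (simp only: powr_add rho_rate_def power2_eq_square)
  finally show "sqrt (2 ^ (J * d)) / m \<le> 4 * (rho_rate d n s)\<^sup>2" .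
  show "2 powr (- (real J * s)) \<le> 2 powr s * rho_rate d n s"
    using bias_rate[OF n(1) t, of s] s unfolding J_def rho_rate_def by (simp add: mult.commute)
qed

text \<open>The level at which the variance \<open>D / m\<close> of linear estimation balances the squared bias.\<close>

lemma est_level_rates:
  fixes s :: real and n m d :: nat
  assumes n: "1 \<le> n" "n \<le> 4 * m" "m \<le> n" and d: "0 < d" and s: "0 < s"
  defines "l \<equiv> res_level n (1 / (2 * s + d))"
  shows "sqrt (2 ^ (l * d) / m) \<le> 2 * eps_rate d n s"
    and "2 powr (- (real l * s)) \<le> 2 powr (s + d) * sqrt (2 ^ (l * d) / m)"
proof -
  let ?t = "1 / (2 * s + d)"
  have t: "0 \<le> ?t" using d s by simp
  have n0: "0 < real n" and m0: "0 < real m" using n by auto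
  have e2: "(eps_rate d n s)\<^sup>2 = real n powr (?t * d) / n"
  proof -
    have "(eps_rate d n s)\<^sup>2 = real n powr (- (s / (2 * s + d)) + - (s / (2 * s + d)))"
      by (simp only: powr_add eps_rate_def power2_eq_square)
    also have "- (s / (2 * s + d)) + - (s / (2 * s + d)) = ?t * d - 1"
    proof -
      have q: "2 * s + d \<noteq> 0" using d s by (simp add: add_pos_pos less_imp_neq[symmetric])
      have "?t * d - 1 = d / (2 * s + d) - (2 * s + d) / (2 * s + d)" using q by simp
      also have "\<dots> = (- s + - s) / (2 * s + d)" unfolding diff_divide_distrib[symmetric] by simp
      finally show ?thesis by (simp only: add_divide_distrib minus_divide_left)
    qed
    finally show ?thesis using n0 by (simp add: powr_diff)
  qed
  have up: "2 ^ (l * d) \<le> real n powr (?t * d)"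
  proof -
    have "(2 :: real) ^ (l * d) = (2 ^ l) powr d" by (simp add: power_mult powr_realpow)
    also have "\<dots> \<le> (real n powr ?t) powr d"
      unfolding l_def using res_level_bounds(1)[OF n(1) t] by (intro powr_mono2) auto
    finally show ?thesis by (simp add: powr_powr)
  qed
  have lo: "real n powr (?t * d) \<le> 2 ^ d * 2 ^ (l * d)"
  proof -
    have "real n powr (?t * d) = (real n powr ?t) powr d" by (simp add: powr_powr)
    also have "\<dots> \<le> (2 * 2 ^ l) powr d"
      unfolding l_def using res_level_bounds(2)[OF n(1) t] by (intro powr_mono2) auto
    also have "\<dots> = 2 ^ d * 2 ^ (l * d)" by (simp add: powr_realpow power_mult power_mult_distrib)
    finally show ?thesis .
  qed
  have "2 ^ (l * d) / m \<le> real n powr (?t * d) / (n / 4)"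
    using up n n0 m0 by (intro frac_le) auto
  also have "\<dots> = (2 * eps_rate d n s)\<^sup>2" using n0 by (simp add: power_mult_distrib e2)
  finally have "2 ^ (l * d) / m \<le> (2 * eps_rate d n s)\<^sup>2" .
  then show "sqrt (2 ^ (l * d) / m) \<le> 2 * eps_rate d n s"
    by (intro real_le_lsqrt) (simp_all add: eps_rate_def)
  have "(eps_rate d n s)\<^sup>2 \<le> 2 ^ d * (2 ^ (l * d) / m)"
  proof -
    have "(eps_rate d n s)\<^sup>2 \<le> 2 ^ d * 2 ^ (l * d) / n" unfolding e2 using lo n0 by (intro divide_right_mono) auto
    also have "\<dots> \<le> 2 ^ d * 2 ^ (l * d) / m" using n m0 n0 by (intro divide_left_mono) auto
    finally show ?thesis by simp
  qed
  also have "\<dots> \<le> (2 ^ d)\<^sup>2 * (2 ^ (l * d) / m)"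
    using m0 by (intro mult_right_mono) (auto simp: power2_eq_square)
  also have "\<dots> = (2 ^ d * sqrt (2 ^ (l * d) / m))\<^sup>2" by (simp add: power_mult_distrib)
  finally have e: "eps_rate d n s \<le> 2 ^ d * sqrt (2 ^ (l * d) / m)" by (rule power2_le_imp_le) simp
  have "2 powr (- (real l * s)) \<le> 2 powr s * eps_rate d n s"
    using bias_rate[OF n(1) t, of s] s unfolding l_def eps_rate_def by simp
  also have "\<dots> \<le> 2 powr s * (2 ^ d * sqrt (2 ^ (l * d) / m))" using e by (intro mult_left_mono) auto
  also have "\<dots> = 2 powr (s + d) * sqrt (2 ^ (l * d) / m)" by (simp add: powr_add powr_realpow)
  finally show "2 powr (- (real l * s)) \<le> 2 powr (s + d) * sqrt (2 ^ (l * d) / m)" .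
qed


section \<open>Reduction to pointwise bounded functions\<close>

lemma measurable_pair_density:
  assumes [measurable]: "f \<in> borel_measurable unit_cube" "g \<in> borel_measurable unit_cube"
  shows "(\<lambda>(x, y). ennreal (g x * pmf (bernoulli_pmf (f x)) y)) \<in> borel_measurable cube_obs"
proof -
  have "(\<lambda>z. if snd z then g (fst z) * min 1 (max 0 (f (fst z))) else g (fst z) * (1 - min 1 (max 0 (f (fst z)))))
      \<in> borel_measurable cube_obs"
    by (rule measurable_obs_case[of "\<lambda>x. g x * min 1 (max 0 (f x))" "\<lambda>x. g x * (1 - min 1 (max 0 (f x)))"]) auto
  then have "(\<lambda>z. ennreal (if snd z then g (fst z) * min 1 (max 0 (f (fst z))) else g (fst z) * (1 - min 1 (max 0 (f (fst z))))))
      \<in> borel_measurable cube_obs"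
    by (rule measurable_compose) simp
  also have "(\<lambda>z. ennreal (if snd z then g (fst z) * min 1 (max 0 (f (fst z))) else g (fst z) * (1 - min 1 (max 0 (f (fst z))))))
      = (\<lambda>(x, y). ennreal (g x * pmf (bernoulli_pmf (f x)) y))"
    by (auto simp: pmf_bernoulli_clip fun_eq_iff)
  finally show ?thesis .
qed

lemma pair_law_cong_AE:
  fixes f g f' g' :: "real ^ 'd \<Rightarrow> real"
  assumes [measurable]: "f \<in> borel_measurable unit_cube" "g \<in> borel_measurable unit_cube"
    "f' \<in> borel_measurable unit_cube" "g' \<in> borel_measurable unit_cube"
    and ae: "AE x in unit_cube. f x = f' x \<and> g x = g' x"
  shows "pair_law f g = pair_law f' g'"
  unfolding pair_law_def
proof (rule density_cong)
  interpret obs: pair_sigma_finite "unit_cube :: (real ^ 'd) measure" "count_space (UNIV :: bool set)"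
    unfolding pair_sigma_finite_def
    by (auto intro!: unit_cube.sigma_finite_measure_axioms sigma_finite_measure_count_space_countable)
  let ?h = "\<lambda>f g (x :: real ^ 'd, y). ennreal (g x * pmf (bernoulli_pmf (f x)) y)"
  show m: "?h f g \<in> borel_measurable cube_obs" "?h f' g' \<in> borel_measurable cube_obs"
    by (rule measurable_pair_density; measurable)+
  show "AE z in cube_obs. ?h f g z = ?h f' g' z"
  proof (rule obs.AE_pair_measure)
    show "{z \<in> space cube_obs. ?h f g z = ?h f' g' z} \<in> sets cube_obs"
      using m by (rule borel_measurable_eq)
    show "AE x in unit_cube. AE y in count_space UNIV. ?h f g (x, y) = ?h f' g' (x, y)"
      using ae by eventually_elim simp
  qed
qed

text \<open>Membership in the classes bounds \<open>f\<close> and \<open>g\<close> only almost everywhere.  Changing them on a null set leaves the law of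
  the sample unchanged and makes the bounds hold everywhere.\<close>

lemma clip_to_pointwise:
  fixes f g :: "real ^ 'd \<Rightarrow> real"
  assumes f: "f \<in> regression_class W s B" and g: "g \<in> design_class c C" and c: "0 < c" "c \<le> C"
  shows "\<exists>g'. bernoulli_regression (clip01 f) g' c C \<and> (\<forall>n. sample_law f g n = sample_law (clip01 f) g' n)"
proof -
  define g' where "g' = (\<lambda>x. max c (min C (g x)))"
  have fm: "f \<in> borel_measurable unit_cube" using regression_class_L2[OF f] by (rule L2_D)
  have gm: "g \<in> borel_measurable unit_cube" and gi: "(\<integral>x. g x \<partial>unit_cube) = 1"
    and gr: "AE x in unit_cube. c \<le> g x \<and> g x \<le> C" using g by (auto simp: design_class_def)
  have gm': "g' \<in> borel_measurable unit_cube"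
    unfolding g'_def using gm by (intro borel_measurable_max borel_measurable_min borel_measurable_const)
  have ge: "AE x in unit_cube. g x = g' x" using gr by eventually_elim (auto simp: g'_def)
  have "(\<integral>x. g' x \<partial>unit_cube) = (\<integral>x. g x \<partial>unit_cube)"
    using ge gm gm' by (intro integral_cong_AE) auto
  then have "bernoulli_regression (clip01 f) g' c C"
    using gi gm' clip01_measurable[OF fm] clip01_range[of f] c by unfold_locales (auto simp: g'_def)
  moreover have "AE x in unit_cube. f x = clip01 f x \<and> g x = g' x"
    using ge clip01_AE[OF regression_class_range[OF f]] by eventually_elim simp
  then have "pair_law f g = pair_law (clip01 f) g'"
    by (intro pair_law_cong_AE fm gm gm' clip01_measurable)
  then have "\<forall>n. sample_law f g n = sample_law (clip01 f) g' n" by (simp add: sample_law_def)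
  ultimately show ?thesis by blast
qed


section \<open>The confidence set\<close>

text \<open>For a statistic evaluated at a data-dependent parameter, partition by the finitely many values of the parameter.\<close>

lemma discrete_choice_measurable:
  assumes X: "X \<in> N \<rightarrow>\<^sub>M count_space UNIV" "\<And>\<omega>. \<omega> \<in> space N \<Longrightarrow> X \<omega> \<in> S" and S: "finite S"
    and Y: "\<And>x. x \<in> S \<Longrightarrow> Y x \<in> N \<rightarrow>\<^sub>M count_space UNIV"
  shows "(\<lambda>\<omega>. (X \<omega>, Y (X \<omega>) \<omega>)) \<in> N \<rightarrow>\<^sub>M count_space UNIV"
proof (rule measurableI)
  fix T
  have "(\<lambda>\<omega>. (X \<omega>, Y (X \<omega>) \<omega>)) -` T \<inter> space N =
    (\<Union>x\<in>S. (X -` {x} \<inter> space N) \<inter> (Y x -` {y. (x, y) \<in> T} \<inter> space N))"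
    using X(2) by auto
  also have "\<dots> \<in> sets N"
  proof (rule sets.finite_UN[OF S], rule sets.Int)
    fix x assume x: "x \<in> S"
    show "X -` {x} \<inter> space N \<in> sets N" by (rule measurable_sets[OF X(1)]) simp
    show "Y x -` {y. (x, y) \<in> T} \<inter> space N \<in> sets N" by (rule measurable_sets[OF Y[OF x]]) simp
  qed
  finally show "(\<lambda>\<omega>. (X \<omega>, Y (X \<omega>) \<omega>)) -` T \<inter> space N \<in> sets N" .
qed auto

lemma discrete_choice_pred:
  assumes X: "X \<in> N \<rightarrow>\<^sub>M count_space UNIV" "\<And>\<omega>. \<omega> \<in> space N \<Longrightarrow> X \<omega> \<in> S" and S: "finite S"
    and Q: "\<And>x. x \<in> S \<Longrightarrow> {\<omega>\<in>space N. Q x \<omega>} \<in> sets N"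
  shows "{\<omega>\<in>space N. Q (X \<omega>) \<omega>} \<in> sets N"
proof -
  have "{\<omega>\<in>space N. Q (X \<omega>) \<omega>} = (\<Union>x\<in>S. (X -` {x} \<inter> space N) \<inter> {\<omega>\<in>space N. Q x \<omega>})"
    using X(2) by auto
  also have "\<dots> \<in> sets N"
  proof (rule sets.finite_UN[OF S], rule sets.Int)
    fix x assume "x \<in> S"
    then show "X -` {x} \<inter> space N \<in> sets N" "{\<omega>\<in>space N. Q x \<omega>} \<in> sets N"
      using measurable_sets[OF X(1)] Q by simp_all
  qed
  finally show ?thesis .
qed

text \<open>The extra element is the junk value of the choice over an empty net, which occurs for small \<open>n\<close> only.\<close>

lemma argmin_choice_range: "finite \<Theta> \<Longrightarrow> argmin_choice \<Theta> crit \<omega> \<in> insert (SOME \<theta>. False) \<Theta>"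
  using argmin_choice(1)[of \<Theta> crit \<omega>] by (cases "\<Theta> = {}") (auto simp: argmin_choice_def)

lemma (in cdv) zero_in_regression_class:
  assumes B: "0 \<le> B" shows "(\<lambda>x. 0 :: real) \<in> regression_class W s B"
proof -
  let ?z = "\<lambda>x :: real ^ 'a. 0 :: real"
  have P0: "l2_norm unit_cube (P_cube W j ?z) = 0" if "J0 \<le> j" for j
  proof -
    have "l2_norm unit_cube (P_cube W j ?z) \<le> l2_norm unit_cube ?z"
      unfolding P_cube_def V_cube_alt by (rule l2_onb.norm_proj_le[OF onb_cube[OF that] L2_zero])
    moreover have "l2_norm (unit_cube :: (real ^ 'a) measure) (\<lambda>x. 0) = 0" by (simp add: l2_norm_def)
    ultimately show ?thesis by (metis l2_norm_nonneg order_antisym)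
  qed
  have "l2_norm unit_cube (Q_cube W j ?z) = 0" if j: "J0 \<le> j" for j
  proof -
    have "l2_dist unit_cube (P_cube W (Suc j) ?z) (P_cube W j ?z)
       \<le> l2_dist unit_cube (P_cube W (Suc j) ?z) ?z + l2_dist unit_cube ?z (P_cube W j ?z)"
      using j by (intro l2_dist_triangle P_cube_L2) auto
    also have "\<dots> = 0" using P0[OF j] P0[of "Suc j"] j by (simp add: l2_dist_def l2_norm_uminus)
    finally have "l2_norm unit_cube (Q_cube W j ?z) \<le> 0"
      by (simp only: l2_dist_def Q_cube_def[abs_def])
    then show ?thesis by (metis l2_norm_nonneg order_antisym)
  qed
  then have "besov_norm W s ?z = 0" using P0[of J0] by (simp add: besov_norm_def image_constant_conv)
  then show ?thesis by (simp add: regression_class_def besov_ball_def)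
qed

text \<open>Blocks \<open>A\<close> and \<open>B\<close> feed the quadratic statistic, block \<open>E\<close> the estimators.\<close>

definition blockA :: "nat \<Rightarrow> nat set" where "blockA n = {..<n div 3}"
definition blockB :: "nat \<Rightarrow> nat set" where "blockB n = {n div 3..<2 * (n div 3)}"
definition blockE :: "nat \<Rightarrow> nat set" where "blockE n = {2 * (n div 3)..<3 * (n div 3)}"

lemma blocks:
  "blockA n \<subseteq> {..<n}" "blockB n \<subseteq> {..<n}" "blockE n \<subseteq> {..<n}"
  "card (blockA n) = n div 3" "card (blockB n) = n div 3" "card (blockE n) = n div 3"
  "blockA n \<inter> blockB n = {}" "blockE n \<inter> (blockA n \<union> blockB n) = {}"
  by (auto simp: blockA_def blockB_def blockE_def)

text \<open>There are \<open>Nl\<close> levels of smoothness; \<open>A\<close> is the constant of the Gaussian lattice sum and \<open>\<eta>\<close> the probability allotted to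
  each undesirable event.\<close>

locale confidence = cdv W R N for W R N +
  fixes Dim :: "'d :: finite itself" and dim Nl :: nat and \<beta>m M c C \<eta> A :: real
  assumes dim: "dim = CARD('d)" and \<beta>m: "0 < \<beta>m" and Nl: "1 \<le> Nl" and M: "0 < M" and c: "0 < c" "c \<le> C" and \<eta>: "0 < \<eta>" "\<eta> \<le> 1"
    and A: "1 \<le> A" "\<And>\<alpha> Z. finite Z \<Longrightarrow> (\<Sum>z\<in>Z. exp (- (c / 256) * (of_int z - \<alpha>)\<^sup>2)) \<le> A"
begin

abbreviation "s \<equiv> smooth_level \<beta>m"

definition F :: "nat \<Rightarrow> (real ^ 'd \<Rightarrow> real) set" where "F j = regression_class W (s j) M"

text \<open>The constants: \<open>\<kappa>\<close> bounds the approximation error of all classes, \<open>K1\<close> the ratio of bias to noise at the oracle level,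
  \<open>a\<close> is the weight of the penalty, \<open>Ke\<close> the constant in the risk of the estimators, \<open>KT\<close> and \<open>Kb\<close> are the additive errors in
  the two comparisons between the quadratic statistic and the distance.  The threshold \<open>\<tau>\<close> is the size that the statistic may
  reach, in units of \<open>\<rho>\<^sub>n\<^sup>2\<close>, when the estimator is within \<open>Ke \<rho>\<^sub>n\<close> of \<open>f\<close>.\<close>

definition \<kappa> where "\<kappa> = M / (1 - 2 powr (- \<beta>m))"
definition K1 where "K1 = \<kappa> * 2 powr (2 * s Nl + dim) + 1"
definition a where "a = 1 + ln (A * exp (c * K1\<^sup>2 / 128))"
definition Ke where "Ke = 2 * (2 * K1 + sqrt (128 * (a + C * K1\<^sup>2 / 2 + ln (1 / \<eta>)) / c))"
definition KT where "KT = 48 * C / \<eta>"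
definition Kb where "Kb = (C / c + 1) * (2 * \<kappa> * 2 powr s Nl)"
definition \<tau> where "\<tau> = 2 * C\<^sup>2 * Ke\<^sup>2 + KT"

definition quad_level :: "nat \<Rightarrow> nat \<Rightarrow> nat" where "quad_level i n = max J0 (res_level n (2 / (4 * s i + dim)))"
definition \<rho> :: "nat \<Rightarrow> nat \<Rightarrow> real" where "\<rho> i n = rho_rate dim n (s i)"

definition U where "U j n \<theta> = net_fun W (F j) K1 (n div 3) \<theta>"
definition choice where "choice j n \<omega> = net_choice W (F j) K1 a n (blockE n) \<omega>"
definition estimate where "estimate j n \<omega> = U j n (choice j n \<omega>)"

definition T :: "nat \<Rightarrow> nat \<Rightarrow> (real ^ 'd \<Rightarrow> real) \<Rightarrow> (nat \<Rightarrow> (real ^ 'd) \<times> bool) \<Rightarrow> real" where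
  "T i n u \<omega> = quad_stat (blockA n) (blockB n) (cube_index W (quad_level i n)) (phi_cube W (quad_level i n)) u \<omega>"

text \<open>The test at level \<open>i\<close> asks whether \<open>f\<close> might belong to the next smoother class: it compares the data with an estimator
  that takes values in that class.  The first rejection selects the level; if all tests accept, the smoothest class is
  selected.\<close>

definition rejects where "rejects i n \<omega> \<longleftrightarrow> \<tau> * (\<rho> i n)\<^sup>2 < T i n (estimate (Suc i) n \<omega>) \<omega>"
definition selected_level where "selected_level n \<omega> = (LEAST i. i = Nl \<or> 1 \<le> i \<and> rejects i n \<omega>)"
text \<open>The squared radius is measured by the statistic in units of \<open>\<rho>\<^sub>n\<^sup>2\<close>, rounded up to an integer, so that the confidence set
  takes only countably many values and measurability becomes a statement about discrete random variables.\<close>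

definition radius :: "nat \<Rightarrow> real" where "radius k = sqrt (2 * k + KT) / c + Kb"
definition scaled_stat where "scaled_stat j n u \<omega> = nat \<lceil>T j n u \<omega> / (\<rho> j n)\<^sup>2\<rceil>"

definition Cn :: "nat \<Rightarrow> (nat \<Rightarrow> (real ^ 'd) \<times> bool) \<Rightarrow> (real ^ 'd \<Rightarrow> real) set" where
  "Cn n \<omega> = (let j = selected_level n \<omega>; u = estimate j n \<omega> in {v \<in> L2 unit_cube. l2_dist unit_cube u v \<le> \<rho> j n * radius (scaled_stat j n u \<omega>)})"

text \<open>From this sample size on, all resolution levels prescribed by the rates lie above the coarsest level of the basis.\<close>

definition large :: "nat \<Rightarrow> bool" where
  "large n \<longleftrightarrow> 8 \<le> n \<and> J0 \<le> log 2 n * (1 / (4 * s Nl + dim))"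

lemma eventually_large: "eventually large sequentially"
  unfolding large_def
proof (intro eventually_conj eventually_ge_at_top)
  have sN: "0 < 4 * s Nl + dim" using \<beta>m by (simp add: smooth_level_def add_pos_nonneg)
  have "eventually (\<lambda>n. J0 * (4 * s Nl + dim) * ln 2 \<le> ln (real n)) sequentially"
    using filterlim_compose[OF ln_at_top filterlim_real_sequentially] unfolding filterlim_at_top by blast
  then show "\<forall>\<^sub>F n in sequentially. real J0 \<le> log 2 n * (1 / (4 * s Nl + dim))"
  proof eventually_elim
    case (elim n)
    have p: "0 < (4 * s Nl + dim) * ln 2" using sN by simp
    have "real J0 = J0 * (4 * s Nl + dim) * ln 2 / ((4 * s Nl + dim) * ln 2)" using p sN by simp
    also have "\<dots> \<le> ln (real n) / ((4 * s Nl + dim) * ln 2)" using elim p by (intro divide_right_mono) auto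
    also have "\<dots> = log 2 n * (1 / (4 * s Nl + dim))" by (simp add: log_def)
    finally show ?case .
  qed
qed

lemma s_pos: "0 < s j" using \<beta>m by (simp add: smooth_level_def)

lemma s_mono: "i \<le> j \<Longrightarrow> s i \<le> s j"
  using \<beta>m unfolding smooth_level_def by (intro mult_right_mono power_increasing) auto

lemma s_ge: "\<beta>m \<le> s j" using \<beta>m by (simp add: smooth_level_def mult_le_cancel_right1)

lemma s_Suc: "1 \<le> i \<Longrightarrow> s (Suc i) = 2 * s i" by (cases i) (auto simp: smooth_level_def)

lemma dim_pos: "0 < dim" by (simp add: dim)

lemma F_antimono: "i \<le> j \<Longrightarrow> F j \<subseteq> F i" unfolding F_def by (intro regression_class_antimono s_mono)

lemma C_pos: "0 < C" using c by linarith

lemma \<kappa>_pos: "0 < \<kappa>"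
proof -
  have "2 powr (- \<beta>m) < 1" using \<beta>m by (simp add: powr_less_one)
  then show ?thesis using M by (simp add: \<kappa>_def)
qed

lemma K1_ge: "1 \<le> K1" using \<kappa>_pos by (simp add: K1_def)

lemma KT_pos: "0 < KT" using C_pos \<eta> by (simp add: KT_def)

lemma Kb_nonneg: "0 \<le> Kb" using \<kappa>_pos C_pos c by (simp add: Kb_def)

lemma \<tau>_nonneg: "0 \<le> \<tau>" using KT_pos by (simp add: \<tau>_def)

lemma net: "net_setting W R N (F j) (s j) M"
  by unfold_locales (simp add: F_def)

text \<open>The geometric series of the details is largest at the smallest smoothness \<open>\<beta>m\<close>.\<close>

lemma bias:
  assumes "u \<in> regression_class W \<beta> M" "\<beta>m \<le> \<beta>" "J0 \<le> J"
  shows "l2_dist unit_cube u (P_cube W J u) \<le> \<kappa> * 2 powr (- (real J * \<beta>))"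
proof -
  have b0: "0 < \<beta>" using assms(2) \<beta>m by linarith
  have "l2_dist unit_cube u (P_cube W J u) \<le> M / (1 - 2 powr (- \<beta>)) * 2 powr (- (real J * \<beta>))"
    using assms(1,3) M b0 by (intro besov_ball_approx) (auto simp: regression_class_def)
  also have "\<dots> \<le> \<kappa> * 2 powr (- (real J * \<beta>))"
  proof (intro mult_right_mono)
    have "2 powr (- \<beta>) \<le> 2 powr (- \<beta>m)" using assms(2) by (intro powr_mono) auto
    moreover have "2 powr (- \<beta>m) < 1" using \<beta>m by (simp add: powr_less_one)
    ultimately show "M / (1 - 2 powr (- \<beta>)) \<le> \<kappa>"
      unfolding \<kappa>_def using M by (intro divide_left_mono mult_pos_pos) linarith+
  qed simp
  finally show ?thesis .
qed

lemma U_props: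
  "U j n \<theta> \<in> borel_measurable unit_cube" "0 \<le> U j n \<theta> x \<and> U j n \<theta> x \<le> 1" "U j n \<theta> \<in> L2 unit_cube"
  unfolding U_def
  using net_setting.net_fun_measurable[OF net] net_setting.net_fun_range[OF net] net_setting.net_fun_L2[OF net] by auto

lemma large_div: "large n \<Longrightarrow> 1 \<le> n \<and> n \<le> 4 * (n div 3) \<and> 0 < n div 3 \<and> n div 3 \<le> n"
  unfolding large_def by auto

text \<open>The zero function belongs to every class and has no approximation error.\<close>

lemma net_nonempty:
  assumes n: "large n" shows "net W (F j) K1 n (n div 3) \<noteq> {}"
proof -
  interpret net_setting W R N "F j" "s j" M by (rule net)
  have "(\<lambda>x. 0) \<in> F j" unfolding F_def using M by (intro zero_in_regression_class) simp
  moreover have "J0 \<le> n"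
  proof -
    have t: "0 \<le> 1 / (4 * s Nl + dim)" "1 / (4 * s Nl + dim) \<le> 1"
      using s_pos[of Nl] dim_pos by (auto simp: field_simps intro: order_trans[of 1 "real dim"])
    have "J0 \<le> res_level n (1 / (4 * s Nl + dim))" using n unfolding large_def res_level_def by linarith
    also have "\<dots> \<le> n" using t large_div[OF n] by (intro res_level_le) auto
    finally show ?thesis .
  qed
  moreover have "l2_dist unit_cube (\<lambda>x :: real ^ 'd. 0) (P_cube W J0 (\<lambda>x. 0)) \<le> (K1 - 1) * sqrt (card (cube_index W J0 :: ('d \<Rightarrow> widx) set) / (n div 3))"
  proof -
    have "(\<lambda>x. 0) \<in> V_cube W J0" unfolding V_cube_def l2_span_def by (auto intro!: exI[of _ "{}"])
    then have "l2_dist unit_cube (\<lambda>x :: real ^ 'd. 0) (P_cube W J0 (\<lambda>x. 0)) \<le> l2_dist unit_cube (\<lambda>x :: real ^ 'd. 0) (\<lambda>x. 0)"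
      by (intro P_cube_best) auto
    also have "\<dots> = 0" by (simp add: l2_dist_def l2_norm_def)
    also have "0 \<le> (K1 - 1) * sqrt (card (cube_index W J0 :: ('d \<Rightarrow> widx) set) / (n div 3))" using K1_ge by simp
    finally show ?thesis .
  qed
  ultimately show ?thesis
    using net_point_exists[of "\<lambda>x. 0" J0 n "n div 3" K1] K1_ge large_div[OF n] by auto
qed

lemma choice_in_net: "large n \<Longrightarrow> choice j n \<omega> \<in> net W (F j) K1 n (n div 3)"
  unfolding choice_def net_choice_def blocks
  by (rule argmin_choice(1)[OF net_setting.finite_net[OF net] net_nonempty])

lemma estimate_in_F: "large n \<Longrightarrow> estimate j n \<omega> \<in> F j"
  unfolding estimate_def U_def by (rule net_setting.net_fun_class[OF net choice_in_net])


subsection \<open>Measurability\<close>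

lemma sample_space_restrict: "S \<subseteq> {..<n} \<Longrightarrow> (\<lambda>\<omega>. restrict \<omega> S) \<in> sample_space n \<rightarrow>\<^sub>M PiM S (\<lambda>_. cube_obs)"
  unfolding sample_space_def by (rule measurable_restrict_subset)

lemma choice_measurable: "choice j n \<in> sample_space n \<rightarrow>\<^sub>M count_space UNIV"
proof -
  have "(\<lambda>\<omega>. net_choice W (F j) K1 a n (blockE n) (restrict \<omega> (blockE n))) \<in> sample_space n \<rightarrow>\<^sub>M count_space UNIV"
    by (rule measurable_compose[OF sample_space_restrict[OF blocks(3)] net_setting.net_choice_measurable[OF net]])
  then show ?thesis by (simp only: net_setting.net_choice_restrict[OF net] choice_def[abs_def])
qed

lemma choice_range: "choice j n \<omega> \<in> insert (SOME \<theta>. False) (net W (F j) K1 n (n div 3))"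
  unfolding choice_def net_choice_def blocks by (intro argmin_choice_range net_setting.finite_net[OF net])

lemma finite_choice_range: "finite (insert (SOME \<theta>. False) (net W (F j) K1 n (n div 3)))"
  by (intro finite.insertI net_setting.finite_net[OF net])

lemma T_measurable_block:
  assumes u: "u \<in> borel_measurable unit_cube" and S: "blockA n \<union> blockB n \<subseteq> S"
  shows "T i n u \<in> borel_measurable (PiM S (\<lambda>_. cube_obs))"
proof -
  have J: "J0 \<le> quad_level i n" by (simp add: quad_level_def)
  have q: "quad_term u (phi_cube W (quad_level i n) l) \<in> borel_measurable cube_obs" if "l \<in> cube_index W (quad_level i n)" for l
  proof -
    have "phi_cube W (quad_level i n) l \<in> borel_measurable unit_cube" using phi_cube_L2[OF J that] by (rule L2_D)
    then show ?thesis unfolding quad_term_def[abs_def] resid_def using u by measurable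
  qed
  have "block_mean D (quad_term u (phi_cube W (quad_level i n) l)) \<in> borel_measurable (PiM S (\<lambda>_. cube_obs))"
    if "l \<in> cube_index W (quad_level i n)" "D \<subseteq> S" for l D
  proof -
    have "(\<lambda>\<omega>. quad_term u (phi_cube W (quad_level i n) l) (\<omega> k)) \<in> borel_measurable (PiM S (\<lambda>_. cube_obs))" if "k \<in> D" for k
    proof -
      have "k \<in> S" using that \<open>D \<subseteq> S\<close> by blast
      then have "(\<lambda>\<omega>. \<omega> k) \<in> PiM S (\<lambda>_. cube_obs) \<rightarrow>\<^sub>M cube_obs" by (rule measurable_component_singleton)
      then show ?thesis by (rule measurable_compose) (rule q[OF \<open>l \<in> cube_index W (quad_level i n)\<close>])
    qed
    then show ?thesis unfolding block_mean_def[abs_def]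
      by (intro borel_measurable_divide borel_measurable_sum borel_measurable_const)
  qed
  then show ?thesis unfolding T_def[abs_def] quad_stat_def using S
    by (intro borel_measurable_sum borel_measurable_times) auto
qed

lemma T_measurable: "u \<in> borel_measurable unit_cube \<Longrightarrow> T i n u \<in> borel_measurable (sample_space n)"
  unfolding sample_space_def using blocks by (intro T_measurable_block) auto

lemma T_restrict: "T i n u (restrict \<omega> (blockA n \<union> blockB n)) = T i n u \<omega>"
  by (simp add: T_def quad_stat_def block_mean_def)

lemma rejects_sets: "{\<omega>\<in>space (sample_space n). rejects i n \<omega>} \<in> sets (sample_space n)"
  unfolding rejects_def estimate_def
  by (rule discrete_choice_pred[where Q="\<lambda>\<theta> \<omega>. \<tau> * (\<rho> i n)\<^sup>2 < T i n (U (Suc i) n \<theta>) \<omega>",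
        OF choice_measurable choice_range finite_choice_range])
    (intro borel_measurable_less T_measurable U_props borel_measurable_const)

lemma selected_level_measurable: "selected_level n \<in> sample_space n \<rightarrow>\<^sub>M count_space UNIV"
proof -
  have "Measurable.pred (sample_space n) (\<lambda>\<omega>. i = Nl \<or> 1 \<le> i \<and> rejects i n \<omega>)" for i
    using rejects_sets[of n i] by (intro pred_intros_logic) (auto simp: pred_def)
  then show ?thesis unfolding selected_level_def[abs_def] by (rule measurable_Least)
qed

lemma selected_level_range: "1 \<le> selected_level n \<omega>" "selected_level n \<omega> \<le> Nl"
proof -
  have *: "Nl = Nl \<or> 1 \<le> Nl \<and> rejects Nl n \<omega>" by simp
  show "selected_level n \<omega> \<le> Nl" unfolding selected_level_def by (rule Least_le) (rule *)
  from LeastI[of "\<lambda>i. i = Nl \<or> 1 \<le> i \<and> rejects i n \<omega>", OF *] show "1 \<le> selected_level n \<omega>"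
    unfolding selected_level_def[symmetric] using Nl by auto
qed

text \<open>A discrete random variable that determines the confidence set, written with data-dependent parameters as explicit
  arguments.\<close>

definition state where "state n \<omega> = (selected_level n \<omega>, (\<lambda>j \<omega>. (choice j n \<omega>, (\<lambda>\<theta> \<omega>. scaled_stat j n (U j n \<theta>) \<omega>) (choice j n \<omega>) \<omega>)) (selected_level n \<omega>) \<omega>)"

definition ball_of where
  "ball_of n = (\<lambda>(j, \<theta>, k). {v \<in> L2 unit_cube. l2_dist unit_cube (U j n \<theta>) v \<le> \<rho> j n * radius k})"

lemma Cn_eq: "Cn n \<omega> = ball_of n (state n \<omega>)"
  by (simp add: Cn_def ball_of_def state_def estimate_def Let_def)

lemma state_measurable: "state n \<in> sample_space n \<rightarrow>\<^sub>M count_space UNIV"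
proof -
  have scaled_stat: "(\<lambda>\<omega>. scaled_stat j n (U j n \<theta>) \<omega>) \<in> sample_space n \<rightarrow>\<^sub>M count_space UNIV" for j \<theta>
  proof -
    have "(\<lambda>\<omega>. T j n (U j n \<theta>) \<omega> / (\<rho> j n)\<^sup>2) \<in> borel_measurable (sample_space n)"
      using T_measurable[OF U_props(1)] by (intro borel_measurable_divide borel_measurable_const)
    then have "(\<lambda>\<omega>. \<lceil>T j n (U j n \<theta>) \<omega> / (\<rho> j n)\<^sup>2\<rceil>) \<in> sample_space n \<rightarrow>\<^sub>M count_space UNIV"
      by (rule measurable_compose) (rule measurable_real_ceiling)
    then show ?thesis unfolding scaled_stat_def by (rule measurable_compose) simp
  qed
  have "(\<lambda>\<omega>. (choice j n \<omega>, (\<lambda>\<theta> \<omega>. scaled_stat j n (U j n \<theta>) \<omega>) (choice j n \<omega>) \<omega>)) \<in> sample_space n \<rightarrow>\<^sub>M count_space UNIV" for j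
    by (rule discrete_choice_measurable[OF choice_measurable choice_range finite_choice_range scaled_stat])
  then show ?thesis unfolding state_def[abs_def]
    by (intro discrete_choice_measurable[OF selected_level_measurable, where S="{..Nl}"]) (auto simp: selected_level_range)
qed

text \<open>Every property whatsoever of the confidence set is an event.  Effros measurability, coverage and the diameter bound are
  all instances.\<close>

lemma Cn_sets: "{\<omega>\<in>space (sample_space n). Q (Cn n \<omega>)} \<in> sets (sample_space n)"
proof -
  have "{\<omega>\<in>space (sample_space n). Q (Cn n \<omega>)} = state n -` {t. Q (ball_of n t)} \<inter> space (sample_space n)"
    by (auto simp: Cn_eq)
  also have "\<dots> \<in> sets (sample_space n)" by (rule measurable_sets[OF state_measurable]) simp
  finally show ?thesis .
qed

lemma random_closed_Cn: "random_closed_sets Cn"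
  unfolding random_closed_sets_def
proof (intro allI conjI ballI impI)
  fix n \<omega>
  show "closedin (l2_topology unit_cube) (Cn n \<omega>)"
    unfolding Cn_def Let_def estimate_def by (intro closedin_l2_cball U_props)
next
  fix n O'
  show "{\<omega> \<in> space (sample_space n). Cn n \<omega> \<inter> O' \<noteq> {}} \<in> sets (sample_space n)"
    by (rule Cn_sets)
qed

end


section \<open>Coverage and diameter\<close>

text \<open>Boundedness is a by-product of the oscillation estimate for the basis functions of the interval.\<close>

lemma (in cdv) phi_cube_bmf:
  assumes j: "J0 \<le> j" and l: "l \<in> cube_index W j"
  shows "phi_cube W j (l :: 'd :: finite \<Rightarrow> widx) \<in> bmf unit_cube"
proof -
  obtain \<eta> B where B: "\<And>j k x. J0 \<le> j \<Longrightarrow> k \<in> phi_idx W j \<Longrightarrow> \<bar>phi_I W j k x\<bar> \<le> B * 4 ^ j"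
    using phi_I_oscillation by blast
  show ?thesis
  proof (rule bmfI)
    show "phi_cube W j l \<in> borel_measurable unit_cube" using phi_cube_L2[OF j l] by (rule L2_D)
    fix x :: "real ^ 'd"
    have "\<bar>phi_cube W j l x\<bar> = (\<Prod>i\<in>UNIV. \<bar>phi_I W j (l i) (x $ i)\<bar>)" unfolding phi_cube_def by (rule abs_prod)
    also have "\<dots> \<le> (\<Prod>i\<in>(UNIV :: 'd set). B * 4 ^ j)"
      using B[OF j] l by (intro prod_mono) (auto simp: cube_index_def)
    finally show "\<bar>phi_cube W j l x\<bar> \<le> (\<Prod>i\<in>(UNIV :: 'd set). B * 4 ^ j)" .
  qed
qed

context confidence
begin

text \<open>The statistic and the distance from \<open>f\<close> to \<open>u\<close> control each other, up to constants and the testing rate.\<close>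

definition calibrated :: "nat \<Rightarrow> nat \<Rightarrow> (real ^ 'd \<Rightarrow> real) \<Rightarrow> (real ^ 'd \<Rightarrow> real) \<Rightarrow> (nat \<Rightarrow> (real ^ 'd) \<times> bool) \<Rightarrow> bool" where
  "calibrated i n f u \<omega> \<longleftrightarrow> T i n u \<omega> \<le> 2 * C\<^sup>2 * (l2_dist unit_cube f u)\<^sup>2 + KT * (\<rho> i n)\<^sup>2 \<and>
     l2_dist unit_cube f u \<le> sqrt (2 * max 0 (T i n u \<omega>) + KT * (\<rho> i n)\<^sup>2) / c + Kb * \<rho> i n"

lemma F_L2: "f \<in> F j \<Longrightarrow> f \<in> L2 unit_cube"
  unfolding F_def by (rule regression_class_L2)

lemma \<rho>_pos: "large n \<Longrightarrow> 0 < \<rho> i n"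
  unfolding \<rho>_def rho_rate_eq using large_div[of n] by (intro eps_rate_pos) auto

lemma large_nonempty: "large n \<Longrightarrow> {..<n} \<noteq> {}"
  by (simp add: large_def lessThan_empty_iff)

lemma Ke_bound: "2 * K1 + sqrt (128 * (a + C * K1\<^sup>2 / 2 + ln (1 / \<eta>)) / c) = Ke / 2" "0 \<le> Ke"
proof -
  have "1 \<le> A * exp (c * K1\<^sup>2 / 128)" using A(1) c mult_mono[of 1 A 1 "exp (c * K1\<^sup>2 / 128)"] by simp
  then have "1 \<le> a" unfolding a_def by simp
  then have "0 \<le> 128 * (a + C * K1\<^sup>2 / 2 + ln (1 / \<eta>)) / c" using C_pos c \<eta> by simp
  then show "0 \<le> Ke" using K1_ge by (simp add: Ke_def)
qed (simp add: Ke_def)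

lemma level_ge:
  assumes n: "large n" and t: "1 / (4 * s Nl + dim) \<le> t"
  shows "J0 \<le> res_level n t"
proof -
  have "log 2 n * (1 / (4 * s Nl + dim)) \<le> log 2 n * t"
    using t large_div[OF n] by (intro mult_left_mono) auto
  then have "J0 \<le> log 2 n * t" using n unfolding large_def by linarith
  then show ?thesis unfolding res_level_def by linarith
qed

lemma quad_level_eq:
  assumes "large n" "i \<le> Nl" shows "quad_level i n = res_level n (2 / (4 * s i + dim))"
proof -
  have "1 / (4 * s Nl + dim) \<le> 2 / (4 * s i + dim)"
    using s_mono[OF assms(2)] s_pos[of i] dim_pos by (intro frac_le) auto
  then show ?thesis using level_ge[OF assms(1)] unfolding quad_level_def by simp
qed

lemma sets_law: "sets (sample_law f g n) = sets (sample_space n)"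
  by (rule sets_sample_law)

lemma law_sets_iff: "{\<omega>\<in>space (sample_law f g n). Q \<omega>} \<in> sets (sample_law f g n) \<longleftrightarrow>
    {\<omega>\<in>space (sample_space n). Q \<omega>} \<in> sets (sample_space n)"
  by (simp add: sets_law space_sample_law)

lemma estimate_sets: "{\<omega>\<in>space (sample_space n). Q (estimate j n \<omega>)} \<in> sets (sample_space n)"
  unfolding estimate_def
  by (rule discrete_choice_pred[where Q="\<lambda>\<theta> \<omega>. Q (U j n \<theta>)", OF choice_measurable choice_range finite_choice_range]) simp

lemma calibrated_sets_fixed:
  assumes "u \<in> borel_measurable unit_cube" and S: "blockA n \<union> blockB n \<subseteq> S"
  shows "{\<omega>\<in>space (PiM S (\<lambda>_. cube_obs)). \<not> calibrated i n f u \<omega>} \<in> sets (PiM S (\<lambda>_. cube_obs))"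
proof -
  have [measurable]: "T i n u \<in> borel_measurable (PiM S (\<lambda>_. cube_obs))" by (rule T_measurable_block[OF assms])
  show ?thesis unfolding calibrated_def by measurable
qed

lemma calibrated_sets: "{\<omega>\<in>space (sample_space n). \<not> calibrated i n f (estimate j n \<omega>) \<omega>} \<in> sets (sample_space n)"
  unfolding estimate_def
proof (rule discrete_choice_pred[where Q="\<lambda>\<theta> \<omega>. \<not> calibrated i n f (U j n \<theta>) \<omega>", OF choice_measurable choice_range finite_choice_range])
  fix \<theta>
  show "{\<omega> \<in> space (sample_space n). \<not> calibrated i n f (U j n \<theta>) \<omega>} \<in> sets (sample_space n)"
    unfolding sample_space_def using blocks by (intro calibrated_sets_fixed U_props) auto
qed

text \<open>The estimator for level \<open>j\<close> adapts to every smoothness \<open>\<beta>\<close> in the range that \<open>f\<close> may have in addition.\<close>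

lemma estimate_prob:
  assumes n: "large n" and reg: "bernoulli_regression f g c C"
    and f: "f \<in> F j" "f \<in> regression_class W \<beta> M" and \<beta>: "\<beta>m \<le> \<beta>" "\<beta> \<le> 2 * s Nl"
  shows "\<P>(\<omega> in sample_law f g n. \<not> l2_dist unit_cube f (estimate j n \<omega>) \<le> Ke * eps_rate dim n \<beta>) \<le> \<eta>"
proof -
  interpret net_setting W R N "F j" "s j" M by (rule net)
  have smp: "regression_sample f g c C {..<n}"
  proof -
    interpret bernoulli_regression f g c C by (rule reg)
    show ?thesis using reg large_nonempty[OF n]
      by (intro regression_sample.intro iid_sample.intro prob_space_P) simp_all
  qed
  interpret S: regression_sample f g c C "{..<n}" by (rule smp)
  define l where "l = res_level n (1 / (2 * \<beta> + dim))"
  let ?m = "n div 3"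
  have \<beta>0: "0 < \<beta>" using \<beta> \<beta>m by linarith
  note nm = large_div[OF n]
  have lJ: "J0 \<le> l" unfolding l_def
    using \<beta> \<beta>0 dim_pos by (intro level_ge[OF n] frac_le) auto
  have ln: "l \<le> n" unfolding l_def using nm \<beta>0 dim_pos by (intro res_level_le) (auto simp: divide_le_eq)
  let ?r = "sqrt (2 ^ (l * dim) / ?m)"
  have card: "real (card (cube_index W l :: ('d \<Rightarrow> widx) set)) = 2 ^ (l * dim)"
    using card_cube_index[OF lJ, where 'd='d] by (simp add: dim)
  have r: "?r \<le> 2 * eps_rate dim n \<beta>" "2 powr (- (real l * \<beta>)) \<le> 2 powr (\<beta> + dim) * ?r"
    unfolding l_def using est_level_rates[of n ?m dim \<beta>] nm dim_pos \<beta>0 by auto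
  have bias: "l2_dist unit_cube f (P_cube W l f) \<le> (K1 - 1) * sqrt (card (cube_index W l :: ('d \<Rightarrow> widx) set) / card (blockE n))"
  proof -
    have "l2_dist unit_cube f (P_cube W l f) \<le> \<kappa> * 2 powr (- (real l * \<beta>))"
      by (rule bias[OF f(2) \<beta>(1) lJ])
    also have "\<dots> \<le> \<kappa> * (2 powr (\<beta> + dim) * ?r)" using r(2) \<kappa>_pos by (intro mult_left_mono) auto
    also have "\<dots> \<le> \<kappa> * (2 powr (2 * s Nl + dim) * ?r)"
      using \<beta> \<kappa>_pos by (intro mult_left_mono mult_right_mono powr_mono) auto
    finally show ?thesis unfolding card blocks by (simp add: K1_def mult.assoc)
  qed
  have E: "blockE n \<noteq> {}" using nm blocks(6)[of n] by auto
  have x: "0 \<le> ln (1 / \<eta>)" using \<eta> by simp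
  have "\<P>(\<omega> in sample_law f g n. \<not> l2_dist unit_cube f (estimate j n \<omega>) \<le> Ke / 2 * ?r) \<le> exp (- ln (1 / \<eta>))"
    using estimator_risk[OF A a_def K1_ge smp f(1) lJ ln blocks(3) E bias x]
    unfolding Ke_bound card blocks sample_law_def estimate_def U_def choice_def by simp
  moreover have "exp (- ln (1 / \<eta>)) = \<eta>" using \<eta> by (simp add: ln_div)
  moreover have "\<P>(\<omega> in sample_law f g n. \<not> l2_dist unit_cube f (estimate j n \<omega>) \<le> Ke * eps_rate dim n \<beta>) \<le>
      \<P>(\<omega> in sample_law f g n. \<not> l2_dist unit_cube f (estimate j n \<omega>) \<le> Ke / 2 * ?r)"
  proof (rule finite_measure.finite_measure_mono)
    show "finite_measure (sample_law f g n)" unfolding sample_law_def by (rule S.smp.\<Omega>.finite_measure_axioms)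
    have "Ke / 2 * ?r \<le> Ke / 2 * (2 * eps_rate dim n \<beta>)" using r(1) Ke_bound(2) by (intro mult_left_mono) auto
    then show "{\<omega> \<in> space (sample_law f g n). \<not> l2_dist unit_cube f (estimate j n \<omega>) \<le> Ke * eps_rate dim n \<beta>} \<subseteq>
        {\<omega> \<in> space (sample_law f g n). \<not> l2_dist unit_cube f (estimate j n \<omega>) \<le> Ke / 2 * ?r}" by auto
    show "{\<omega> \<in> space (sample_law f g n). \<not> l2_dist unit_cube f (estimate j n \<omega>) \<le> Ke / 2 * ?r} \<in> sets (sample_law f g n)"
      unfolding law_sets_iff by (rule estimate_sets)
  qed
  ultimately show ?thesis by linarith
qed

lemma calibrated_prob_fixed:
  assumes n: "large n" and reg: "bernoulli_regression f g c C" and i: "i \<le> Nl"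
    and f: "f \<in> F i" and u: "u \<in> F i" "u \<in> borel_measurable unit_cube" "\<And>x. 0 \<le> u x \<and> u x \<le> 1"
  shows "\<P>(\<omega> in sample_law f g n. \<not> calibrated i n f u \<omega>) \<le> \<eta>"
proof -
  interpret reg: bernoulli_regression f g c C by (rule reg)
  let ?m = "n div 3" and ?J = "quad_level i n"
  let ?L = "cube_index W ?J :: ('d \<Rightarrow> widx) set"
  note nm = large_div[OF n]
  have J: "J0 \<le> ?J" by (simp add: quad_level_def)
  interpret q: quad_setting f g c C "{..<n}" ?L "phi_cube W ?J" u "blockA n" "blockB n" ?m
  proof (intro quad_setting.intro quad_setting_axioms.intro reg iid_sample.intro reg.prob_space_P)
    show "l2_onb unit_cube ?L (phi_cube W ?J)" by (rule onb_cube[OF J])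
    show "phi_cube W ?J l \<in> bmf unit_cube" if "l \<in> ?L" for l by (rule phi_cube_bmf[OF J that])
  qed (use nm blocks u large_nonempty[OF n] in auto)
  have fL: "f \<in> L2 unit_cube" and uL: "u \<in> L2 unit_cube" using f u by (auto intro: F_L2)
  have card: "real (card ?L) = 2 ^ (?J * dim)" using card_cube_index[OF J, where 'd='d] by (simp add: dim)
  have rates: "sqrt (2 ^ (?J * dim)) / ?m \<le> 4 * (\<rho> i n)\<^sup>2" "2 powr (- (real ?J * s i)) \<le> 2 powr (s i) * \<rho> i n"
    unfolding quad_level_eq[OF n i] \<rho>_def using quad_level_rates[of n ?m dim "s i"] nm dim_pos s_pos[of i] by auto
  have rr: "sqrt (card ?L) / ?m \<le> 4 * (\<rho> i n)\<^sup>2" unfolding card by (rule rates(1))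
  have L0: "?L \<noteq> {}"
  proof
    assume "?L = {}"
    then have "real (card ?L) = 0" by simp
    then show False unfolding card by simp
  qed
  let ?b = "2 * (\<kappa> * 2 powr s Nl * \<rho> i n)"
  have near: "l2_dist unit_cube h (P_cube W ?J h) \<le> \<kappa> * 2 powr s Nl * \<rho> i n" if h: "h \<in> F i" for h
  proof -
    have "l2_dist unit_cube h (P_cube W ?J h) \<le> \<kappa> * 2 powr (- (real ?J * s i))"
      using h unfolding F_def by (intro bias J s_ge)
    also have "\<dots> \<le> \<kappa> * (2 powr s i * \<rho> i n)" using rates(2) \<kappa>_pos by (intro mult_left_mono) auto
    also have "\<dots> \<le> \<kappa> * (2 powr s Nl * \<rho> i n)"
      using s_mono[OF i] \<kappa>_pos \<rho>_pos[OF n, of i] by (intro mult_left_mono mult_right_mono powr_mono) auto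
    finally show ?thesis by (simp add: mult.assoc)
  qed
  let ?v = "\<lambda>x. P_cube W ?J f x + (-1) * P_cube W ?J u x"
  have v: "?v \<in> l2_span unit_cube ?L (phi_cube W ?J)"
    unfolding V_cube_alt[symmetric]
    using P_cube_V[OF J fL] P_cube_V[OF J uL] unfolding V_cube_alt
    by (intro l2_span_add l2_span_scale finite_cube_index J)
  have vb: "l2_dist unit_cube (\<lambda>x. f x - u x) ?v \<le> ?b"
  proof -
    have "l2_dist unit_cube (\<lambda>x. f x - u x) ?v \<le> l2_dist unit_cube f (P_cube W ?J f) + l2_dist unit_cube (P_cube W ?J u) u"
      using l2_norm_triangle[of "\<lambda>x. f x - P_cube W ?J f x" unit_cube "\<lambda>x. P_cube W ?J u x - u x"]
        fL uL P_cube_L2[OF J fL] P_cube_L2[OF J uL]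
      by (auto simp: l2_dist_def algebra_simps)
    then show ?thesis using near[OF f] near[OF u(1)] by (simp add: l2_dist_commute[of _ u])
  qed
  have K: "12 * C / \<eta> * (4 * (\<rho> i n)\<^sup>2) = KT * (\<rho> i n)\<^sup>2" by (simp add: KT_def)
  have "\<P>(\<omega> in sample_law f g n. \<not> calibrated i n f u \<omega>) \<le>
     \<P>(\<omega> in sample_law f g n. \<not> (T i n u \<omega> \<le> 2 * q.theta_sq + 12 * C / \<eta> * (4 * (\<rho> i n)\<^sup>2) \<and>
       q.theta_sq \<le> 2 * T i n u \<omega> + 12 * C / \<eta> * (4 * (\<rho> i n)\<^sup>2)))"
  proof (rule finite_measure.finite_measure_mono)
    show "finite_measure (sample_law f g n)" unfolding sample_law_def by (rule q.smp.\<Omega>.finite_measure_axioms)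
    have [measurable]: "T i n u \<in> borel_measurable (sample_space n)" by (rule T_measurable[OF u(2)])
    show "{\<omega> \<in> space (sample_law f g n). \<not> (T i n u \<omega> \<le> 2 * q.theta_sq + 12 * C / \<eta> * (4 * (\<rho> i n)\<^sup>2) \<and>
       q.theta_sq \<le> 2 * T i n u \<omega> + 12 * C / \<eta> * (4 * (\<rho> i n)\<^sup>2))} \<in> sets (sample_law f g n)"
      unfolding law_sets_iff by measurable
    have "calibrated i n f u \<omega>" if "T i n u \<omega> \<le> 2 * q.theta_sq + KT * (\<rho> i n)\<^sup>2" "q.theta_sq \<le> 2 * T i n u \<omega> + KT * (\<rho> i n)\<^sup>2" for \<omega>
      unfolding calibrated_def
    proof
      show "T i n u \<omega> \<le> 2 * C\<^sup>2 * (l2_dist unit_cube f u)\<^sup>2 + KT * (\<rho> i n)\<^sup>2"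
        using that(1) q.theta_le by (simp add: power_mult_distrib)
      have "l2_dist unit_cube f u \<le> sqrt q.theta_sq / c + (C / c + 1) * ?b" by (rule q.dist_le_theta[OF v vb])
      also have "sqrt q.theta_sq / c \<le> sqrt (2 * max 0 (T i n u \<omega>) + KT * (\<rho> i n)\<^sup>2) / c"
        using that(2) c by (intro divide_right_mono real_sqrt_le_mono) auto
      also have "(C / c + 1) * ?b = Kb * \<rho> i n" by (simp add: Kb_def)
      finally show "l2_dist unit_cube f u \<le> sqrt (2 * max 0 (T i n u \<omega>) + KT * (\<rho> i n)\<^sup>2) / c + Kb * \<rho> i n" by simp
    qed
    then show "{\<omega> \<in> space (sample_law f g n). \<not> calibrated i n f u \<omega>} \<subseteq> {\<omega> \<in> space (sample_law f g n). \<not> (T i n u \<omega> \<le> 2 * q.theta_sq + 12 * C / \<eta> * (4 * (\<rho> i n)\<^sup>2) \<and>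
       q.theta_sq \<le> 2 * T i n u \<omega> + 12 * C / \<eta> * (4 * (\<rho> i n)\<^sup>2))}"
      unfolding K by blast
  qed
  also have "\<dots> \<le> \<eta>"
    using q.quad_stat_deviation[OF \<eta> rr L0] unfolding sample_law_def T_def .
  finally show ?thesis .
qed

text \<open>For a fixed \<open>u\<close> this is the deviation inequality of the quadratic statistic; for an estimator, condition on its block.\<close>

lemma calibrated_prob:
  assumes n: "large n" and reg: "bernoulli_regression f g c C" and i: "i \<le> j" "i \<le> Nl" and f: "f \<in> F i"
  shows "\<P>(\<omega> in sample_law f g n. \<not> calibrated i n f (estimate j n \<omega>) \<omega>) \<le> \<eta>"
proof -
  interpret reg: bernoulli_regression f g c C by (rule reg)
  interpret smp: iid_sample "pair_law f g" "{..<n}"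
    using large_nonempty[OF n] by (intro iid_sample.intro reg.prob_space_P) simp_all
  let ?AB = "blockA n \<union> blockB n"
  let ?X = "\<lambda>\<theta>. {x\<in>space (PiM ?AB (\<lambda>_. pair_law f g)). \<not> calibrated i n f (U j n \<theta>) x}"
  have sp: "space (PiM S (\<lambda>_. pair_law f g)) = space (PiM S (\<lambda>_. cube_obs))" "sets (PiM S (\<lambda>_. pair_law f g)) = sets (PiM S (\<lambda>_. cube_obs))" for S
    by (auto simp: space_PiM intro!: sets_PiM_cong)
  have rs: "restrict \<omega> ?AB \<in> ?X \<theta> \<longleftrightarrow> \<not> calibrated i n f (U j n \<theta>) \<omega>" if "\<omega> \<in> space smp.\<Omega>" for \<omega> \<theta>
  proof -
    have "calibrated i n f (U j n \<theta>) (restrict \<omega> ?AB) = calibrated i n f (U j n \<theta>) \<omega>" by (simp only: calibrated_def T_restrict)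
    moreover have "restrict \<omega> ?AB \<in> space (PiM ?AB (\<lambda>_. pair_law f g))"
      using measurable_space[OF measurable_restrict_subset that] blocks(1,2)[of n] by simp
    ultimately show ?thesis by blast
  qed
  have "smp.\<Omega>.prob {\<omega>\<in>space smp.\<Omega>. restrict \<omega> ?AB \<in> ?X (net_choice W (F j) K1 a n (blockE n) (restrict \<omega> (blockE n)))} \<le> \<eta>"
  proof (rule smp.random_index_bound[of "blockE n" ?AB "net W (F j) K1 n (n div 3)"])
    show "net_choice W (F j) K1 a n (blockE n) \<in> PiM (blockE n) (\<lambda>_. pair_law f g) \<rightarrow>\<^sub>M count_space UNIV"
      using net_setting.net_choice_measurable[OF net] by (simp add: measurable_cong_sets[OF sp(2) refl])
    show "net_choice W (F j) K1 a n (blockE n) (restrict \<omega> (blockE n)) \<in> net W (F j) K1 n (n div 3)" for \<omega>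
      unfolding net_setting.net_choice_restrict[OF net] using choice_in_net[OF n] by (simp add: choice_def)
    show "?X \<theta> \<in> sets (PiM ?AB (\<lambda>_. pair_law f g))" for \<theta>
      unfolding sp by (intro calibrated_sets_fixed U_props) auto
    fix \<theta> assume \<theta>: "\<theta> \<in> net W (F j) K1 n (n div 3)"
    have "U j n \<theta> \<in> F j" unfolding U_def by (rule net_setting.net_fun_class[OF net \<theta>])
    then have "U j n \<theta> \<in> F i" using F_antimono[OF i(1)] by blast
    then have "\<P>(\<omega> in sample_law f g n. \<not> calibrated i n f (U j n \<theta>) \<omega>) \<le> \<eta>"
      using U_props by (intro calibrated_prob_fixed[OF n reg i(2) f]) auto
    then show "smp.\<Omega>.prob {\<omega>\<in>space smp.\<Omega>. restrict \<omega> ?AB \<in> ?X \<theta>} \<le> \<eta>"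
      using rs unfolding sample_law_def by (simp cong: conj_cong)
  qed (use blocks net_setting.finite_net[OF net] in auto)
  then show ?thesis
    using rs unfolding sample_law_def estimate_def choice_def net_setting.net_choice_restrict[OF net]
    by (simp cong: conj_cong)
qed

text \<open>On the event that all estimates and all quadratic statistics behave, the tests below \<open>j\<close> accept, the test at \<open>j\<close>
  rejects, and the ball at level \<open>j\<close> covers and is small.  Acceptance below \<open>j\<close> uses
  \<open>\<epsilon>\<^sub>n(s\<^bsub>i+1\<^esub>) = \<rho>\<^sub>n(s\<^sub>i)\<close>, which is the reason for doubling the smoothness from level to level.\<close>

definition L0 where "L0 = sqrt (2 * \<tau> + KT) / c + Kb + 1"

lemma sqrt_scale: "0 \<le> r \<Longrightarrow> sqrt (x * r\<^sup>2) = sqrt x * r"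
  by (simp add: real_sqrt_mult)

lemma selected_level_eq:
  assumes n: "large n" and j: "1 \<le> j" "j \<le> Nl"
    and estimate: "\<And>i. 1 \<le> i \<Longrightarrow> i < j \<Longrightarrow> l2_dist unit_cube f (estimate (Suc i) n \<omega>) \<le> Ke * \<rho> i n"
    and dev1: "\<And>i. 1 \<le> i \<Longrightarrow> i < j \<Longrightarrow> calibrated i n f (estimate (Suc i) n \<omega>) \<omega>"
    and dev2: "j < Nl \<Longrightarrow> calibrated j n f (estimate (Suc j) n \<omega>) \<omega>"
    and sep: "\<And>h. j < Nl \<Longrightarrow> h \<in> F (Suc j) \<Longrightarrow> L0 * \<rho> j n \<le> l2_dist unit_cube f h"
  shows "selected_level n \<omega> = j"
  unfolding selected_level_def
proof (rule Least_equality)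
  show "j = Nl \<or> 1 \<le> j \<and> rejects j n \<omega>"
  proof (cases "j = Nl")
    case False
    then have jN: "j < Nl" using j by simp
    have "rejects j n \<omega>"
    proof (rule ccontr)
      let ?u = "estimate (Suc j) n \<omega>"
      assume "\<not> rejects j n \<omega>"
      then have "T j n ?u \<omega> \<le> \<tau> * (\<rho> j n)\<^sup>2" by (simp add: rejects_def)
      then have T: "2 * max 0 (T j n ?u \<omega>) + KT * (\<rho> j n)\<^sup>2 \<le> (2 * \<tau> + KT) * (\<rho> j n)\<^sup>2"
        using \<tau>_nonneg by (auto simp: max_def distrib_right)
      have r: "0 < \<rho> j n" by (rule \<rho>_pos[OF n])
      have "L0 * \<rho> j n \<le> l2_dist unit_cube f ?u" by (intro sep jN estimate_in_F n)
      also have "\<dots> \<le> sqrt (2 * max 0 (T j n ?u \<omega>) + KT * (\<rho> j n)\<^sup>2) / c + Kb * \<rho> j n"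
        using dev2[OF jN] by (simp add: calibrated_def)
      also have "\<dots> \<le> sqrt ((2 * \<tau> + KT) * (\<rho> j n)\<^sup>2) / c + Kb * \<rho> j n"
        using T c by (intro add_right_mono divide_right_mono real_sqrt_le_mono) auto
      also have "\<dots> = (sqrt (2 * \<tau> + KT) / c + Kb) * \<rho> j n"
        unfolding sqrt_scale[OF less_imp_le[OF r]] by (simp add: distrib_right)
      also have "\<dots> < L0 * \<rho> j n" using r by (simp add: L0_def distrib_right)
      finally show False by simp
    qed
    then show ?thesis using j by simp
  qed simp
next
  fix i assume i: "i = Nl \<or> 1 \<le> i \<and> rejects i n \<omega>"
  show "j \<le> i"
  proof (rule ccontr)
    let ?u = "estimate (Suc i) n \<omega>"
    assume "\<not> j \<le> i"
    then have ij: "i < j" by simp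
    then have i1: "1 \<le> i" and ri: "rejects i n \<omega>" using i j by auto
    have "T i n ?u \<omega> \<le> 2 * C\<^sup>2 * (l2_dist unit_cube f ?u)\<^sup>2 + KT * (\<rho> i n)\<^sup>2"
      using dev1[OF i1 ij] by (simp add: calibrated_def)
    also have "\<dots> \<le> 2 * C\<^sup>2 * (Ke * \<rho> i n)\<^sup>2 + KT * (\<rho> i n)\<^sup>2"
      using estimate[OF i1 ij] by (intro add_right_mono mult_left_mono power_mono) auto
    also have "\<dots> = \<tau> * (\<rho> i n)\<^sup>2" by (simp add: \<tau>_def power_mult_distrib distrib_right)
    finally show False using ri by (simp add: rejects_def)
  qed
qed

lemma T_le_scaled_stat:
  assumes "large n" shows "max 0 (T j n u \<omega>) \<le> scaled_stat j n u \<omega> * (\<rho> j n)\<^sup>2"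
    "scaled_stat j n u \<omega> * (\<rho> j n)\<^sup>2 \<le> max 0 (T j n u \<omega>) + (\<rho> j n)\<^sup>2"
proof -
  let ?r = "(\<rho> j n)\<^sup>2" and ?T = "T j n u \<omega>"
  have r: "0 < ?r" using \<rho>_pos[OF assms, of j] by simp
  have "?T / ?r \<le> scaled_stat j n u \<omega>" unfolding scaled_stat_def by linarith
  then have "?T \<le> scaled_stat j n u \<omega> * ?r" using r by (simp add: divide_le_eq)
  then show "max 0 ?T \<le> scaled_stat j n u \<omega> * ?r" using r by simp
  have "real (scaled_stat j n u \<omega>) \<le> max 0 (?T / ?r) + 1" unfolding scaled_stat_def by linarith
  then have "scaled_stat j n u \<omega> * ?r \<le> (max 0 (?T / ?r) + 1) * ?r" using r by (intro mult_right_mono) auto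
  also have "\<dots> = max 0 ?T + ?r" using r by (simp add: distrib_right max_def divide_le_0_iff zero_le_divide_iff)
  finally show "scaled_stat j n u \<omega> * ?r \<le> max 0 ?T + ?r" .
qed

lemma in_Cn:
  assumes n: "large n" and f: "f \<in> L2 unit_cube" and selected_level: "selected_level n \<omega> = j" and d: "calibrated j n f (estimate j n \<omega>) \<omega>"
  shows "f \<in> Cn n \<omega>"
proof -
  let ?u = "estimate j n \<omega>" and ?r = "\<rho> j n"
  have r: "0 < ?r" by (rule \<rho>_pos[OF n])
  have "l2_dist unit_cube f ?u \<le> sqrt (2 * max 0 (T j n ?u \<omega>) + KT * ?r\<^sup>2) / c + Kb * ?r"
    using d by (simp add: calibrated_def)
  also have "\<dots> \<le> sqrt ((2 * scaled_stat j n ?u \<omega> + KT) * ?r\<^sup>2) / c + Kb * ?r"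
    using T_le_scaled_stat(1)[OF n, of j ?u \<omega>] c
    by (intro add_right_mono divide_right_mono real_sqrt_le_mono) (auto simp: distrib_right)
  also have "\<dots> = ?r * radius (scaled_stat j n ?u \<omega>)"
    unfolding sqrt_scale[OF less_imp_le[OF r]] by (simp add: radius_def distrib_left mult.commute)
  finally have "l2_dist unit_cube ?u f \<le> ?r * radius (scaled_stat j n ?u \<omega>)"
    by (subst l2_dist_commute)
  then show ?thesis using f by (simp add: Cn_def selected_level Let_def)
qed

definition K where "K = 2 * (sqrt (4 * C\<^sup>2 * Ke\<^sup>2 + 3 * KT + 2) / c + Kb)"

text \<open>If \<open>\<beta> \<le> 2 s\<^sub>j\<close> then \<open>\<rho>\<^sub>n(s\<^sub>j) = \<epsilon>\<^sub>n(2 s\<^sub>j) \<le> \<epsilon>\<^sub>n(\<beta>)\<close>: the accuracy of the quadratic statistic is no obstacle to the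
  radius, and the distance of the estimator, of order \<open>\<epsilon>\<^sub>n(\<beta>)\<close>, prevails.\<close>

lemma diam_Cn:
  assumes n: "large n" and selected_level: "selected_level n \<omega> = j" and d: "calibrated j n f (estimate j n \<omega>) \<omega>"
    and e: "l2_dist unit_cube f (estimate j n \<omega>) \<le> Ke * eps_rate dim n \<beta>"
    and \<beta>: "0 < \<beta>" "\<beta> \<le> 2 * s j"
  shows "l2_diam unit_cube (Cn n \<omega>) \<le> ennreal (K * eps_rate dim n \<beta>)"
proof -
  let ?u = "estimate j n \<omega>" and ?r = "\<rho> j n" and ?e = "eps_rate dim n \<beta>"
  have r: "0 < ?r" by (rule \<rho>_pos[OF n])
  have re: "?r \<le> ?e" unfolding \<rho>_def rho_rate_eq
    using large_div[OF n] \<beta> dim_pos by (intro eps_rate_antimono) auto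
  have e0: "0 < ?e" using r re by linarith
  have "2 * scaled_stat j n ?u \<omega> * ?r\<^sup>2 + KT * ?r\<^sup>2 \<le> 2 * (max 0 (T j n ?u \<omega>) + ?r\<^sup>2) + KT * ?r\<^sup>2"
    using T_le_scaled_stat(2)[OF n, of j ?u \<omega>] by simp
  also have "max 0 (T j n ?u \<omega>) \<le> 2 * C\<^sup>2 * (Ke * ?e)\<^sup>2 + KT * ?r\<^sup>2"
  proof -
    have "T j n ?u \<omega> \<le> 2 * C\<^sup>2 * (l2_dist unit_cube f ?u)\<^sup>2 + KT * ?r\<^sup>2" using d by (simp add: calibrated_def)
    also have "\<dots> \<le> 2 * C\<^sup>2 * (Ke * ?e)\<^sup>2 + KT * ?r\<^sup>2"
      using e by (intro add_right_mono mult_left_mono power_mono) auto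
    finally show ?thesis using KT_pos by simp
  qed
  also have "2 * (2 * C\<^sup>2 * (Ke * ?e)\<^sup>2 + KT * ?r\<^sup>2 + ?r\<^sup>2) + KT * ?r\<^sup>2 = 4 * C\<^sup>2 * Ke\<^sup>2 * ?e\<^sup>2 + (3 * KT + 2) * ?r\<^sup>2"
    by (simp add: power_mult_distrib algebra_simps)
  also have "\<dots> \<le> 4 * C\<^sup>2 * Ke\<^sup>2 * ?e\<^sup>2 + (3 * KT + 2) * ?e\<^sup>2"
    using re r KT_pos by (intro add_left_mono mult_left_mono power_mono) auto
  also have "\<dots> = (4 * C\<^sup>2 * Ke\<^sup>2 + 3 * KT + 2) * ?e\<^sup>2" by (simp add: algebra_simps)
  finally have bound: "(2 * scaled_stat j n ?u \<omega> + KT) * ?r\<^sup>2 \<le> (4 * C\<^sup>2 * Ke\<^sup>2 + 3 * KT + 2) * ?e\<^sup>2"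
    by (simp add: distrib_right)
  have "?r * radius (scaled_stat j n ?u \<omega>) = sqrt ((2 * scaled_stat j n ?u \<omega> + KT) * ?r\<^sup>2) / c + Kb * ?r"
    unfolding sqrt_scale[OF less_imp_le[OF r]] by (simp add: radius_def distrib_left mult.commute)
  also have "\<dots> \<le> sqrt ((4 * C\<^sup>2 * Ke\<^sup>2 + 3 * KT + 2) * ?e\<^sup>2) / c + Kb * ?e"
    using bound c re Kb_nonneg by (intro add_mono divide_right_mono real_sqrt_le_mono mult_left_mono) auto
  also have "\<dots> = K / 2 * ?e" unfolding sqrt_scale[OF less_imp_le[OF e0]] by (simp add: K_def distrib_right)
  finally have radius: "2 * (?r * radius (scaled_stat j n ?u \<omega>)) \<le> K * ?e" by simp
  have rad0: "0 \<le> ?r * radius (scaled_stat j n ?u \<omega>)"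
    using r c KT_pos Kb_nonneg by (simp add: radius_def)
  have "Cn n \<omega> = {v \<in> L2 unit_cube. l2_dist unit_cube ?u v \<le> ?r * radius (scaled_stat j n ?u \<omega>)}"
    by (simp add: Cn_def selected_level Let_def)
  then have "l2_diam unit_cube (Cn n \<omega>) \<le> ennreal (2 * (?r * radius (scaled_stat j n ?u \<omega>)))"
    using l2_diam_cball[OF U_props(3) rad0] by (simp add: estimate_def)
  also have "\<dots> \<le> ennreal (K * ?e)" using radius by (rule ennreal_leI)
  finally show ?thesis .
qed

text \<open>The bad events are a bad estimate or a bad statistic at a level below \<open>j\<close>, a bad statistic in the test at \<open>j\<close> or in the
  radius, and, for the diameter, a bad final estimate: at most \<open>2 Nl + 3\<close> events of probability \<open>\<eta>\<close>.\<close>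

lemma failure_probability:
  assumes n: "large n" and reg: "bernoulli_regression f g c C" and j: "1 \<le> j" "j \<le> Nl" and f: "f \<in> F j"
    and sep: "\<And>h. j < Nl \<Longrightarrow> h \<in> F (Suc j) \<Longrightarrow> L0 * \<rho> j n \<le> l2_dist unit_cube f h"
  shows "\<P>(\<omega> in sample_law f g n. \<not> f \<in> Cn n \<omega>) \<le> (2 * Nl + 3) * \<eta>"
    and "f \<in> regression_class W \<beta> M \<Longrightarrow> \<beta>m \<le> \<beta> \<Longrightarrow> \<beta> \<le> 2 * s j \<Longrightarrow>
      \<P>(\<omega> in sample_law f g n. ennreal (K * eps_rate dim n \<beta>) < l2_diam unit_cube (Cn n \<omega>)) \<le> (2 * Nl + 3) * \<eta>"
proof -
  interpret reg: bernoulli_regression f g c C by (rule reg)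
  interpret smp: iid_sample "pair_law f g" "{..<n}"
    using large_nonempty[OF n] by (intro iid_sample.intro reg.prob_space_P) simp_all
  let ?\<Omega> = "sample_law f g n"
  interpret \<Omega>: prob_space ?\<Omega> unfolding sample_law_def by (rule smp.\<Omega>.prob_space_axioms)
  define B1 where "B1 i = {\<omega>\<in>space ?\<Omega>. \<not> l2_dist unit_cube f (estimate (Suc i) n \<omega>) \<le> Ke * \<rho> i n}" for i
  define B2 where "B2 i = {\<omega>\<in>space ?\<Omega>. \<not> calibrated i n f (estimate (Suc i) n \<omega>) \<omega>}" for i
  define B3 where "B3 = {\<omega>\<in>space ?\<Omega>. \<not> calibrated j n f (estimate j n \<omega>) \<omega>}"
  define B4 where "B4 \<beta> = {\<omega>\<in>space ?\<Omega>. \<not> l2_dist unit_cube f (estimate j n \<omega>) \<le> Ke * eps_rate dim n \<beta>}" for \<beta>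
  define Bad where "Bad = (\<Union>i\<in>{1..<j}. B1 i) \<union> (\<Union>i\<in>{1..<j}. B2 i) \<union> B2 j \<union> B3"
  have ms: "B1 i \<in> sets ?\<Omega>" "B2 i \<in> sets ?\<Omega>" "B3 \<in> sets ?\<Omega>" "B4 \<beta> \<in> sets ?\<Omega>" for i \<beta>
    unfolding B1_def B2_def B3_def B4_def law_sets_iff by (rule estimate_sets calibrated_sets)+
  have Bad_sets: "Bad \<in> sets ?\<Omega>" unfolding Bad_def using ms by auto
  have p1: "\<Omega>.prob (B1 i) \<le> \<eta>" if i: "i \<in> {1..<j}" for i
  proof -
    have "f \<in> F (Suc i)" using f F_antimono[of "Suc i" j] i by auto
    moreover have "s (Suc i) \<le> 2 * s Nl"
      using s_mono[of "Suc i" Nl] s_pos[of Nl] i j by simp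
    ultimately have "\<Omega>.prob {\<omega>\<in>space ?\<Omega>. \<not> l2_dist unit_cube f (estimate (Suc i) n \<omega>) \<le> Ke * eps_rate dim n (s (Suc i))} \<le> \<eta>"
      using s_ge[of "Suc i"] by (intro estimate_prob[OF n reg]) (auto simp: F_def)
    then show ?thesis using s_Suc[of i] i by (simp add: B1_def \<rho>_def rho_rate_eq)
  qed
  have p2: "\<Omega>.prob (B2 i) \<le> \<eta>" if i: "i \<le> j" for i
    unfolding B2_def using i j f F_antimono[of i j] by (intro calibrated_prob[OF n reg]) auto
  have p3: "\<Omega>.prob B3 \<le> \<eta>"
    unfolding B3_def using j f by (intro calibrated_prob[OF n reg]) auto
  have jN: "card {1..<j} \<le> Nl" using j by simp
  have un: "\<Omega>.prob (\<Union>i\<in>{1..<j}. B i) \<le> Nl * \<eta>" if B: "\<And>i. i \<in> {1..<j} \<Longrightarrow> \<Omega>.prob (B i) \<le> \<eta>" "\<And>i. B i \<in> sets ?\<Omega>" for B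
  proof -
    have "\<Omega>.prob (\<Union>i\<in>{1..<j}. B i) \<le> (\<Sum>i\<in>{1..<j}. \<Omega>.prob (B i))"
      using B by (intro \<Omega>.finite_measure_subadditive_finite) auto
    also have "\<dots> \<le> (\<Sum>i\<in>{1..<j}. \<eta>)" by (intro sum_mono B)
    also have "\<dots> \<le> Nl * \<eta>" using jN \<eta> by (simp add: mult_right_mono)
    finally show ?thesis .
  qed
  have u1: "\<Omega>.prob (\<Union>i\<in>{1..<j}. B1 i) \<le> Nl * \<eta>" by (rule un[OF p1 ms(1)])
  have u2: "\<Omega>.prob (\<Union>i\<in>{1..<j}. B2 i) \<le> Nl * \<eta>" by (rule un[OF p2 ms(2)]) auto
  have Bad_prob: "\<Omega>.prob Bad \<le> (2 * Nl + 2) * \<eta>"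
  proof -
    have us: "(\<Union>i\<in>{1..<j}. B1 i) \<in> sets ?\<Omega>" "(\<Union>i\<in>{1..<j}. B2 i) \<in> sets ?\<Omega>" using ms by auto
    have "\<Omega>.prob Bad \<le> \<Omega>.prob (\<Union>i\<in>{1..<j}. B1 i) + \<Omega>.prob (\<Union>i\<in>{1..<j}. B2 i) + \<Omega>.prob (B2 j) + \<Omega>.prob B3"
    proof -
      have "\<Omega>.prob Bad \<le> \<Omega>.prob ((\<Union>i\<in>{1..<j}. B1 i) \<union> (\<Union>i\<in>{1..<j}. B2 i) \<union> B2 j) + \<Omega>.prob B3"
        unfolding Bad_def using ms us by (intro measure_Un_le sets.Un)
      also have "\<Omega>.prob ((\<Union>i\<in>{1..<j}. B1 i) \<union> (\<Union>i\<in>{1..<j}. B2 i) \<union> B2 j) \<le>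
          \<Omega>.prob ((\<Union>i\<in>{1..<j}. B1 i) \<union> (\<Union>i\<in>{1..<j}. B2 i)) + \<Omega>.prob (B2 j)"
        using ms us by (intro measure_Un_le sets.Un)
      also have "\<Omega>.prob ((\<Union>i\<in>{1..<j}. B1 i) \<union> (\<Union>i\<in>{1..<j}. B2 i)) \<le>
          \<Omega>.prob (\<Union>i\<in>{1..<j}. B1 i) + \<Omega>.prob (\<Union>i\<in>{1..<j}. B2 i)"
        using us by (intro measure_Un_le)
      finally show ?thesis by simp
    qed
    also have "\<dots> \<le> Nl * \<eta> + Nl * \<eta> + \<eta> + \<eta>" using u1 u2 p2[OF order_refl] p3 by linarith
    finally show ?thesis by (simp add: algebra_simps)
  qed
  have good: "selected_level n \<omega> = j \<and> calibrated j n f (estimate j n \<omega>) \<omega>" if "\<omega> \<in> space ?\<Omega>" "\<omega> \<notin> Bad" for \<omega>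
  proof
    show "calibrated j n f (estimate j n \<omega>) \<omega>" using that by (auto simp: Bad_def B3_def)
    show "selected_level n \<omega> = j"
      by (rule selected_level_eq[OF n j, of f]) (use that sep in \<open>auto simp: Bad_def B1_def B2_def\<close>)
  qed
  have "\<Omega>.prob {\<omega>\<in>space ?\<Omega>. \<not> f \<in> Cn n \<omega>} \<le> \<Omega>.prob Bad"
    using good in_Cn[OF n F_L2[OF f]] by (intro \<Omega>.finite_measure_mono Bad_sets) blast
  moreover have "(2 * Nl + 2) * \<eta> \<le> (2 * Nl + 3) * \<eta>" using \<eta> by (intro mult_right_mono) auto
  ultimately show "\<P>(\<omega> in ?\<Omega>. \<not> f \<in> Cn n \<omega>) \<le> (2 * Nl + 3) * \<eta>" using Bad_prob by linarith
  assume f\<beta>: "f \<in> regression_class W \<beta> M" and \<beta>: "\<beta>m \<le> \<beta>" "\<beta> \<le> 2 * s j"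
  have p4: "\<Omega>.prob (B4 \<beta>) \<le> \<eta>"
    unfolding B4_def using \<beta> s_mono[OF j(2)] by (intro estimate_prob[OF n reg f f\<beta>]) auto
  have "{\<omega>\<in>space ?\<Omega>. ennreal (K * eps_rate dim n \<beta>) < l2_diam unit_cube (Cn n \<omega>)} \<subseteq> Bad \<union> B4 \<beta>"
  proof
    fix \<omega> assume \<omega>: "\<omega> \<in> {\<omega>\<in>space ?\<Omega>. ennreal (K * eps_rate dim n \<beta>) < l2_diam unit_cube (Cn n \<omega>)}"
    show "\<omega> \<in> Bad \<union> B4 \<beta>"
    proof (rule ccontr)
      assume nb: "\<omega> \<notin> Bad \<union> B4 \<beta>"
      then have "l2_dist unit_cube f (estimate j n \<omega>) \<le> Ke * eps_rate dim n \<beta>" using \<omega> by (auto simp: B4_def)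
      moreover have "selected_level n \<omega> = j" "calibrated j n f (estimate j n \<omega>) \<omega>" using good \<omega> nb by auto
      ultimately have "l2_diam unit_cube (Cn n \<omega>) \<le> ennreal (K * eps_rate dim n \<beta>)"
        using \<beta> \<beta>m by (intro diam_Cn[OF n]) auto
      then show False using \<omega> by auto
    qed
  qed
  then have "\<Omega>.prob {\<omega>\<in>space ?\<Omega>. ennreal (K * eps_rate dim n \<beta>) < l2_diam unit_cube (Cn n \<omega>)} \<le> \<Omega>.prob (Bad \<union> B4 \<beta>)"
    using Bad_sets ms by (intro \<Omega>.finite_measure_mono) auto
  also have "\<dots> \<le> \<Omega>.prob Bad + \<Omega>.prob (B4 \<beta>)" using Bad_sets ms by (intro measure_Un_le)
  also have "\<dots> \<le> (2 * Nl + 2) * \<eta> + \<eta>" using Bad_prob p4 by simp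
  also have "\<dots> = (2 * Nl + 3) * \<eta>" by (simp add: distrib_right)
  finally show "\<P>(\<omega> in ?\<Omega>. ennreal (K * eps_rate dim n \<beta>) < l2_diam unit_cube (Cn n \<omega>)) \<le> (2 * Nl + 3) * \<eta>" .
qed

end


context confidence
begin

text \<open>With one level this is a single smoothness class, with several levels it is the union of the separated classes; the two
  regimes of the theorem are thus the same statement.\<close>

definition level_class :: "real \<Rightarrow> nat \<Rightarrow> (real ^ 'd \<Rightarrow> real) set" where
  "level_class L n = {f. \<exists>j\<in>{1..Nl}. f \<in> F j \<and> (j < Nl \<longrightarrow> ennreal (L * \<rho> j n) \<le> l2_setdist unit_cube f (F (Suc j)))}"

text \<open>Two points remain beyond the pointwise bounded case.  The confidence set is a ball in \<open>L\<^sup>2\<close>, so it contains \<open>f\<close> exactly if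
  it contains a modification of \<open>f\<close> on a null set.  And a function that is separated from the next class cannot have a
  smoothness \<open>\<beta> \<ge> 2 s\<^sub>j\<close>, for it would then belong to that class and have distance \<open>0\<close> from it; hence
  \<open>\<beta> \<le> 2 s\<^sub>j\<close>, as the diameter bound demands.\<close>

lemma level_class_failure:
  assumes n: "large n" and L: "L0 \<le> L" and f: "f \<in> level_class L n" and g: "g \<in> design_class c C"
  shows "\<P>(\<omega> in sample_law f g n. \<not> f \<in> Cn n \<omega>) \<le> (2 * Nl + 3) * \<eta>"
    and "f \<in> regression_class W \<beta> M \<Longrightarrow> \<beta>m \<le> \<beta> \<Longrightarrow> \<beta> \<le> 2 * s Nl \<Longrightarrow>
      \<P>(\<omega> in sample_law f g n. ennreal (K * eps_rate dim n \<beta>) < l2_diam unit_cube (Cn n \<omega>)) \<le> (2 * Nl + 3) * \<eta>"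
proof -
  obtain j where j: "1 \<le> j" "j \<le> Nl" and fj: "f \<in> F j"
    and sep: "j < Nl \<Longrightarrow> ennreal (L * \<rho> j n) \<le> l2_setdist unit_cube f (F (Suc j))"
    using f by (auto simp: level_class_def)
  have r: "0 < \<rho> j n" by (rule \<rho>_pos[OF n])
  have L00: "0 < L0" using \<tau>_nonneg KT_pos Kb_nonneg c by (simp add: L0_def add_nonneg_pos)
  have sep': "L * \<rho> j n \<le> l2_dist unit_cube f h" if "j < Nl" "h \<in> F (Suc j)" for h
  proof -
    have "l2_setdist unit_cube f (F (Suc j)) \<le> ennreal (l2_dist unit_cube f h)"
      unfolding l2_setdist_def by (rule INF_lower[OF that(2)])
    then have "ennreal (L * \<rho> j n) \<le> ennreal (l2_dist unit_cube f h)" using sep[OF that(1)] by (rule order_trans[rotated])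
    then show ?thesis by (simp add: ennreal_le_iff)
  qed
  have sep0: "L0 * \<rho> j n \<le> l2_dist unit_cube (clip01 f) h" if "j < Nl" "h \<in> F (Suc j)" for h
  proof -
    have "L0 * \<rho> j n \<le> L * \<rho> j n" using L r by (intro mult_right_mono) auto
    also have "\<dots> \<le> l2_dist unit_cube f h" by (rule sep'[OF that])
    also have "\<dots> = l2_dist unit_cube (clip01 f) h"
      using fj F_L2[OF that(2)] unfolding F_def by (intro l2_dist_clip01[symmetric] L2_D)
    finally show ?thesis .
  qed
  have cf: "clip01 f \<in> F j" using fj unfolding F_def by (rule regression_class_clip01)
  have mem: "f \<in> Cn n \<omega> \<longleftrightarrow> clip01 f \<in> Cn n \<omega>" for \<omega>
  proof -
    have "l2_dist unit_cube u (clip01 f) = l2_dist unit_cube u f" if "u \<in> borel_measurable unit_cube" for u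
      using l2_dist_clip01[of f W "s j" M u] fj that unfolding F_def by (metis l2_dist_commute)
    then show ?thesis using F_L2[OF fj] F_L2[OF cf] U_props by (simp add: Cn_def Let_def estimate_def)
  qed
  obtain g' where reg: "bernoulli_regression (clip01 f) g' c C" and law: "\<And>n. sample_law f g n = sample_law (clip01 f) g' n"
    using clip_to_pointwise[of f W "s j" M g c C] fj g c unfolding F_def by blast
  show "\<P>(\<omega> in sample_law f g n. \<not> f \<in> Cn n \<omega>) \<le> (2 * Nl + 3) * \<eta>"
    unfolding mem law by (rule failure_probability(1)[OF n reg j cf sep0])
  assume f\<beta>: "f \<in> regression_class W \<beta> M" and \<beta>: "\<beta>m \<le> \<beta>" "\<beta> \<le> 2 * s Nl"
  have "\<beta> \<le> 2 * s j"
  proof (cases "j = Nl")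
    case False
    then have jN: "j < Nl" using j by simp
    show ?thesis
    proof (rule ccontr)
      assume "\<not> \<beta> \<le> 2 * s j"
      then have "s (Suc j) \<le> \<beta>" using s_Suc[OF j(1)] by simp
      then have "f \<in> F (Suc j)" using f\<beta> regression_class_antimono[of "s (Suc j)" \<beta>] unfolding F_def by blast
      from sep'[OF jN this] have "L * \<rho> j n \<le> 0" by (simp add: l2_dist_def l2_norm_def)
      then show False using mult_pos_pos[of L "\<rho> j n"] L L00 r by linarith
    qed
  qed (use \<beta> in simp)
  then show "\<P>(\<omega> in sample_law f g n. ennreal (K * eps_rate dim n \<beta>) < l2_diam unit_cube (Cn n \<omega>)) \<le> (2 * Nl + 3) * \<eta>"
    unfolding law using f\<beta> \<beta>(1)
    by (intro failure_probability(2)[OF n reg j cf sep0] regression_class_clip01) auto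
qed

lemma level_class_coverage:
  assumes n: "large n" and L: "L0 \<le> L" and f: "f \<in> level_class L n" and g: "g \<in> design_class c C"
  shows "1 - (2 * Nl + 3) * \<eta> \<le> \<P>(\<omega> in sample_law f g n. f \<in> Cn n \<omega>)"
proof -
  obtain j where fj: "f \<in> F j" using f by (auto simp: level_class_def)
  obtain g' where reg: "bernoulli_regression (clip01 f) g' c C" and law: "\<And>n. sample_law f g n = sample_law (clip01 f) g' n"
    using clip_to_pointwise[of f W "s j" M g c C] fj g c unfolding F_def by blast
  interpret reg: bernoulli_regression "clip01 f" g' c C by (rule reg)
  interpret smp: iid_sample "pair_law (clip01 f) g'" "{..<n}"
    using large_nonempty[OF n] by (intro iid_sample.intro reg.prob_space_P) simp_all
  have "sample_law f g n = smp.\<Omega>" unfolding law by (simp only: sample_law_def)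
  then interpret \<Omega>: prob_space "sample_law f g n" using smp.\<Omega>.prob_space_axioms by simp
  have m: "{\<omega>\<in>space (sample_law f g n). f \<in> Cn n \<omega>} \<in> sets (sample_law f g n)"
    unfolding law_sets_iff by (rule Cn_sets)
  have "\<Omega>.prob {\<omega>\<in>space (sample_law f g n). \<not> f \<in> Cn n \<omega>} = 1 - \<P>(\<omega> in sample_law f g n. f \<in> Cn n \<omega>)"
    by (rule \<Omega>.prob_neg[OF m])
  then show ?thesis using level_class_failure(1)[OF assms] by simp
qed

end

theorem adaptive_confidence_sets:
  fixes W :: boundary_wavelets and R \<beta>m M c C \<alpha> \<alpha>' :: real and N Nl :: nat
  assumes W: "cdv_wavelets W R N" and \<beta>m: "0 < \<beta>m" and Nl: "1 \<le> Nl" and M: "0 < M" and c: "0 < c" "c \<le> C"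
    and \<alpha>: "0 < \<alpha>" "0 < \<alpha>'"
  defines "\<F> \<equiv> \<lambda>L n. {f :: real ^ 'd \<Rightarrow> real. \<exists>j\<in>{1..Nl}. f \<in> regression_class W (smooth_level \<beta>m j) M \<and>
    (j < Nl \<longrightarrow> ennreal (L * rho_rate CARD('d) n (smooth_level \<beta>m j))
      \<le> l2_setdist unit_cube f (regression_class W (smooth_level \<beta>m (Suc j)) M))}"
  shows "\<exists>Cn L0 K. random_closed_sets Cn \<and> 0 < L0 \<and>
    (\<forall>L\<ge>L0. \<forall>\<^sub>F n in sequentially. \<forall>f\<in>\<F> L n. \<forall>g\<in>design_class c C.
       1 - \<alpha> \<le> \<P>(\<omega> in sample_law f g n. f \<in> Cn n \<omega>) \<and>
       (\<forall>\<beta>\<in>{\<beta>m..2 * smooth_level \<beta>m Nl}. f \<in> regression_class W \<beta> M \<longrightarrow>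
         \<P>(\<omega> in sample_law f g n. l2_diam unit_cube (Cn n \<omega>) > ennreal (K * eps_rate CARD('d) n \<beta>)) \<le> \<alpha>'))"
proof -
  \<comment> \<open>at most \<open>2 Nl + 3\<close> events of probability \<open>\<eta>\<close> have to be excluded\<close>
  define \<eta> where "\<eta> = min 1 (min \<alpha> \<alpha>') / (2 * Nl + 3)"
  have \<eta>_le: "0 < \<eta>" "\<eta> \<le> 1" "(2 * Nl + 3) * \<eta> \<le> \<alpha>" "(2 * Nl + 3) * \<eta> \<le> \<alpha>'"
  proof -
    have p: "0 < 2 * real Nl + 3" by linarith
    show "0 < \<eta>" using \<alpha> p by (simp add: \<eta>_def)
    have e: "(2 * Nl + 3) * \<eta> = min 1 (min \<alpha> \<alpha>')" using p by (simp add: \<eta>_def)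
    then show "(2 * Nl + 3) * \<eta> \<le> \<alpha>" "(2 * Nl + 3) * \<eta> \<le> \<alpha>'" by linarith+
    show "\<eta> \<le> 1" unfolding \<eta>_def using p by (simp add: divide_le_eq)
  qed
  obtain A where A: "1 \<le> A" "\<forall>\<alpha>. \<forall>Z :: int set. finite Z \<longrightarrow> (\<Sum>z\<in>Z. exp (- (c / 256) * (of_int z - \<alpha>)\<^sup>2)) \<le> A"
    using lattice_gaussian_sum[of "c / 256"] c by auto
  interpret confidence W R N "TYPE('d)" "CARD('d)" Nl \<beta>m M c C \<eta> A
    using W \<beta>m Nl M c \<eta>_le A by unfold_locales auto
  have L0: "0 < L0" using \<tau>_nonneg KT_pos Kb_nonneg c by (simp add: L0_def add_nonneg_pos)
  have cls: "\<F> L n = level_class L n" for L n by (simp add: \<F>_def level_class_def F_def \<rho>_def)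
  have "\<forall>L\<ge>L0. \<forall>\<^sub>F n in sequentially. \<forall>f\<in>\<F> L n. \<forall>g\<in>design_class c C.
       1 - \<alpha> \<le> \<P>(\<omega> in sample_law f g n. f \<in> Cn n \<omega>) \<and>
       (\<forall>\<beta>\<in>{\<beta>m..2 * s Nl}. f \<in> regression_class W \<beta> M \<longrightarrow>
         \<P>(\<omega> in sample_law f g n. l2_diam unit_cube (Cn n \<omega>) > ennreal (K * eps_rate CARD('d) n \<beta>)) \<le> \<alpha>')"
  proof (intro allI impI eventually_mono[OF eventually_large] ballI conjI)
    fix L n and f g :: "real ^ 'd \<Rightarrow> real" assume *: "L0 \<le> L" "large n" "f \<in> \<F> L n" "g \<in> design_class c C"
    show "1 - \<alpha> \<le> \<P>(\<omega> in sample_law f g n. f \<in> Cn n \<omega>)"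
      using level_class_coverage[of n L f g] * \<eta>_le(3) unfolding cls by linarith
    fix \<beta> assume "\<beta> \<in> {\<beta>m..2 * s Nl}" "f \<in> regression_class W \<beta> M"
    then show "\<P>(\<omega> in sample_law f g n. l2_diam unit_cube (Cn n \<omega>) > ennreal (K * eps_rate CARD('d) n \<beta>)) \<le> \<alpha>'"
      using level_class_failure(2)[of n L f g \<beta>] * \<eta>_le(4) unfolding cls by auto
  qed
  then show ?thesis using random_closed_Cn L0 by blast
qed

section \<open>Adaptive confidence sets with unknown rough design\<close>

lemma separated_class_eq:
  fixes W :: boundary_wavelets
  assumes N: "1 \<le> num_levels \<beta>m \<beta>p"
  shows "separated_class W M \<beta>m \<beta>p L n = {f :: real ^ 'd \<Rightarrow> real. \<exists>j\<in>{1..num_levels \<beta>m \<beta>p}.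
    f \<in> regression_class W (smooth_level \<beta>m j) M \<and>
    (j < num_levels \<beta>m \<beta>p \<longrightarrow> ennreal (L * rho_rate CARD('d) n (smooth_level \<beta>m j))
      \<le> l2_setdist unit_cube f (regression_class W (smooth_level \<beta>m (Suc j)) M))}" (is "_ = ?R")
proof -
  let ?N = "num_levels \<beta>m \<beta>p"
  have i: "{1..?N} = insert ?N {1..<?N}" using N by auto
  show ?thesis unfolding separated_class_def i by auto
qed

text \<open>The smoothest class has at least half of the largest smoothness, so one more doubling covers the whole range.\<close>

lemma num_levels_bounds:
  assumes "0 < \<beta>m" "2 * \<beta>m < \<beta>p"
  shows "1 \<le> num_levels \<beta>m \<beta>p" "\<beta>p \<le> 2 * smooth_level \<beta>m (num_levels \<beta>m \<beta>p)"
proof -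
  let ?x = "log 2 (\<beta>p / \<beta>m)" and ?N = "num_levels \<beta>m \<beta>p"
  have x: "0 < ?x" using assms by (subst zero_less_log_cancel_iff) (auto simp: less_divide_eq)
  then show N: "1 \<le> ?N" unfolding num_levels_def by linarith
  have "\<beta>p / \<beta>m = 2 powr ?x" using assms by simp
  also have "\<dots> \<le> 2 powr ?N" unfolding num_levels_def by (intro powr_mono) linarith+
  also have "\<dots> = 2 * 2 ^ (?N - 1)" using N by (simp add: powr_realpow power_Suc[symmetric])
  finally show "\<beta>p \<le> 2 * smooth_level \<beta>m ?N" using assms by (simp add: smooth_level_def divide_le_eq mult.assoc)
qed

theorem corollary1p4:
  fixes W :: boundary_wavelets
    and S R\<^sub>w \<beta>m \<beta>p M c C \<alpha> \<alpha>' :: real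
    and N\<^sub>w :: nat
  assumes "cdv_wavelets W R\<^sub>w N\<^sub>w" and "S < R\<^sub>w" and "S < real N\<^sub>w"
    and "0 < \<beta>m" and "\<beta>m \<le> \<beta>p" and "\<beta>p < S"
    and "0 < M"
    and "0 < c" and "c \<le> 1" and "1 \<le> C"
    and "0 < \<alpha>" and "\<alpha> < 1" and "0 < \<alpha>'" and "\<alpha>' < 1"
  shows
    "(\<beta>p \<le> 2 * \<beta>m \<longrightarrow>
       (\<exists>(Cn :: nat \<Rightarrow> (nat \<Rightarrow> (real ^ 'd) \<times> bool) \<Rightarrow> (real ^ 'd \<Rightarrow> real) set) (K :: real).
          random_closed_sets Cn \<and>
          liminf (\<lambda>n. INF \<beta>\<in>{\<beta>m..\<beta>p}. INF f\<in>regression_class W \<beta> M. INF g\<in>design_class c C.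
              ereal (\<P>(\<omega> in sample_law f g n. f \<in> Cn n \<omega>))) \<ge> ereal (1 - \<alpha>) \<and>
          (\<forall>\<beta>\<in>{\<beta>m..\<beta>p}.
             limsup (\<lambda>n. SUP f\<in>regression_class W \<beta> M. SUP g\<in>design_class c C.
               ereal (\<P>(\<omega> in sample_law f g n.
                 l2_diam unit_cube (Cn n \<omega>) > ennreal (K * eps_rate CARD('d) n \<beta>)))) \<le> ereal \<alpha>')))
   \<and>
     (\<beta>p > 2 * \<beta>m \<longrightarrow>
       (\<exists>(Cn :: nat \<Rightarrow> (nat \<Rightarrow> (real ^ 'd) \<times> bool) \<Rightarrow> (real ^ 'd \<Rightarrow> real) set) (L\<^sub>0 :: real) (K :: real).
          random_closed_sets Cn \<and> L\<^sub>0 > 0 \<and>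
          (\<forall>L\<ge>L\<^sub>0.
             liminf (\<lambda>n. INF f\<in>separated_class W M \<beta>m \<beta>p L n. INF g\<in>design_class c C.
               ereal (\<P>(\<omega> in sample_law f g n. f \<in> Cn n \<omega>))) \<ge> ereal (1 - \<alpha>) \<and>
             (\<forall>\<beta>\<in>{\<beta>m..\<beta>p}.
                limsup (\<lambda>n. SUP f\<in>separated_class W M \<beta>m \<beta>p L n \<inter> regression_class W \<beta> M.
                  SUP g\<in>design_class c C.
                  ereal (\<P>(\<omega> in sample_law f g n.
                    l2_diam unit_cube (Cn n \<omega>) > ennreal (K * eps_rate CARD('d) n \<beta>)))) \<le> ereal \<alpha>'))))
   \<and>
     (c < 1 \<and> 1 < C \<longrightarrow>
       (\<exists>g \<in> (design_class c C :: (real ^ 'd \<Rightarrow> real) set). \<forall>\<gamma>>0. g \<notin> besov_space \<gamma>))"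
proof (intro conjI impI)
  have cC: "c \<le> C" using assms by linarith
  note sets_exist = adaptive_confidence_sets[where 'd='d, OF assms(1,4) _ assms(7,8) cC assms(11,13)]
  {
    assume \<beta>p: "\<beta>p \<le> 2 * \<beta>m"
    obtain Cn :: "nat \<Rightarrow> (nat \<Rightarrow> (real ^ 'd) \<times> bool) \<Rightarrow> (real ^ 'd \<Rightarrow> real) set" and K L
      where Cn: "random_closed_sets Cn"
      and ev: "\<forall>\<^sub>F n in sequentially. \<forall>f\<in>regression_class W \<beta>m M. \<forall>g\<in>design_class c C.
         1 - \<alpha> \<le> \<P>(\<omega> in sample_law f g n. f \<in> Cn n \<omega>) \<and>
         (\<forall>\<beta>\<in>{\<beta>m..2 * \<beta>m}. f \<in> regression_class W \<beta> M \<longrightarrow>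
           \<P>(\<omega> in sample_law f g n. l2_diam unit_cube (Cn n \<omega>) > ennreal (K * eps_rate CARD('d) n \<beta>)) \<le> \<alpha>')"
      using sets_exist[of 1] by (auto simp: smooth_level_def)
    have sub: "f \<in> regression_class W \<beta>m M" if "f \<in> regression_class W \<beta> M" "\<beta> \<in> {\<beta>m..\<beta>p}" for f :: "real ^ 'd \<Rightarrow> real" and \<beta>
      using cdv.regression_class_antimono[of W R\<^sub>w N\<^sub>w \<beta>m \<beta> M] assms(1) that by (auto simp: cdv_def)
    show "\<exists>(Cn :: nat \<Rightarrow> (nat \<Rightarrow> (real ^ 'd) \<times> bool) \<Rightarrow> (real ^ 'd \<Rightarrow> real) set) (K :: real).
          random_closed_sets Cn \<and>
          liminf (\<lambda>n. INF \<beta>\<in>{\<beta>m..\<beta>p}. INF f\<in>regression_class W \<beta> M. INF g\<in>design_class c C.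
              ereal (\<P>(\<omega> in sample_law f g n. f \<in> Cn n \<omega>))) \<ge> ereal (1 - \<alpha>) \<and>
          (\<forall>\<beta>\<in>{\<beta>m..\<beta>p}.
             limsup (\<lambda>n. SUP f\<in>regression_class W \<beta> M. SUP g\<in>design_class c C.
               ereal (\<P>(\<omega> in sample_law f g n.
                 l2_diam unit_cube (Cn n \<omega>) > ennreal (K * eps_rate CARD('d) n \<beta>)))) \<le> ereal \<alpha>')"
    proof (intro exI[of _ Cn] exI[of _ K] conjI ballI Cn Liminf_bounded Limsup_bounded)
      show "\<forall>\<^sub>F n in sequentially. ereal (1 - \<alpha>) \<le> (INF \<beta>\<in>{\<beta>m..\<beta>p}. INF f\<in>regression_class W \<beta> M. INF g\<in>design_class c C.
              ereal (\<P>(\<omega> in sample_law f g n. f \<in> Cn n \<omega>)))"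
        using ev by eventually_elim (auto intro!: INF_greatest dest: sub)
      fix \<beta> assume \<beta>: "\<beta> \<in> {\<beta>m..\<beta>p}"
      show "\<forall>\<^sub>F n in sequentially. (SUP f\<in>regression_class W \<beta> M. SUP g\<in>design_class c C.
               ereal (\<P>(\<omega> in sample_law f g n. l2_diam unit_cube (Cn n \<omega>) > ennreal (K * eps_rate CARD('d) n \<beta>)))) \<le> ereal \<alpha>'"
        using ev by eventually_elim (use \<beta> \<beta>p sub[OF _ \<beta>] in \<open>auto intro!: SUP_least\<close>)
    qed
  }
  {
    assume \<beta>p: "2 * \<beta>m < \<beta>p"
    let ?N = "num_levels \<beta>m \<beta>p"
    note N = num_levels_bounds[OF assms(4) \<beta>p]
    obtain Cn :: "nat \<Rightarrow> (nat \<Rightarrow> (real ^ 'd) \<times> bool) \<Rightarrow> (real ^ 'd \<Rightarrow> real) set" and K L\<^sub>0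
      where Cn: "random_closed_sets Cn" "0 < L\<^sub>0"
      and ev: "\<And>L. L\<^sub>0 \<le> L \<Longrightarrow> \<forall>\<^sub>F n in sequentially. \<forall>f\<in>separated_class W M \<beta>m \<beta>p L n. \<forall>g\<in>design_class c C.
         1 - \<alpha> \<le> \<P>(\<omega> in sample_law f g n. f \<in> Cn n \<omega>) \<and>
         (\<forall>\<beta>\<in>{\<beta>m..2 * smooth_level \<beta>m ?N}. f \<in> regression_class W \<beta> M \<longrightarrow>
           \<P>(\<omega> in sample_law f g n. l2_diam unit_cube (Cn n \<omega>) > ennreal (K * eps_rate CARD('d) n \<beta>)) \<le> \<alpha>')"
      using sets_exist[OF N(1)] unfolding separated_class_eq[OF N(1), symmetric] by blast
    show "\<exists>(Cn :: nat \<Rightarrow> (nat \<Rightarrow> (real ^ 'd) \<times> bool) \<Rightarrow> (real ^ 'd \<Rightarrow> real) set) (L\<^sub>0 :: real) (K :: real).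
          random_closed_sets Cn \<and> L\<^sub>0 > 0 \<and>
          (\<forall>L\<ge>L\<^sub>0.
             liminf (\<lambda>n. INF f\<in>separated_class W M \<beta>m \<beta>p L n. INF g\<in>design_class c C.
               ereal (\<P>(\<omega> in sample_law f g n. f \<in> Cn n \<omega>))) \<ge> ereal (1 - \<alpha>) \<and>
             (\<forall>\<beta>\<in>{\<beta>m..\<beta>p}.
                limsup (\<lambda>n. SUP f\<in>separated_class W M \<beta>m \<beta>p L n \<inter> regression_class W \<beta> M.
                  SUP g\<in>design_class c C.
                  ereal (\<P>(\<omega> in sample_law f g n.
                    l2_diam unit_cube (Cn n \<omega>) > ennreal (K * eps_rate CARD('d) n \<beta>)))) \<le> ereal \<alpha>'))"
    proof (rule exI[of _ Cn], rule exI[of _ L\<^sub>0], rule exI[of _ K], intro conjI allI impI ballI Cn Liminf_bounded Limsup_bounded)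
      fix L assume L: "L\<^sub>0 \<le> L"
      show "\<forall>\<^sub>F n in sequentially. ereal (1 - \<alpha>) \<le> (INF f\<in>separated_class W M \<beta>m \<beta>p L n. INF g\<in>design_class c C.
               ereal (\<P>(\<omega> in sample_law f g n. f \<in> Cn n \<omega>)))"
        using ev[OF L] by eventually_elim (auto intro!: INF_greatest)
      fix \<beta> assume "\<beta> \<in> {\<beta>m..\<beta>p}"
      then have \<beta>: "\<beta> \<in> {\<beta>m..2 * smooth_level \<beta>m ?N}" using N(2) by auto
      show "\<forall>\<^sub>F n in sequentially. (SUP f\<in>separated_class W M \<beta>m \<beta>p L n \<inter> regression_class W \<beta> M. SUP g\<in>design_class c C.
               ereal (\<P>(\<omega> in sample_law f g n. l2_diam unit_cube (Cn n \<omega>) > ennreal (K * eps_rate CARD('d) n \<beta>)))) \<le> ereal \<alpha>'"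
        using ev[OF L] by eventually_elim (use \<beta> in \<open>auto intro!: SUP_least\<close>)
    qed
  }
  assume "c < 1 \<and> 1 < C"
  then show "\<exists>g \<in> (design_class c C :: (real ^ 'd \<Rightarrow> real) set). \<forall>\<gamma>>0. g \<notin> besov_space \<gamma>"
    using exists_rough_density by blast
qed

end
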